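(* Let $R,P>0$, $S=\{|y|\le R\}\subset\mathbb{R}^2$, $\alpha\in(0,1)$, and suppose $\phi^\pm_{a,b}\in C^{3,\alpha}(\mathbb{R})$ are given for all $a,b\in\mathbb{R}$ such that: (i) $\phi^\pm_{a,b}$ depend continuously in $C^{3,\alpha}(\mathbb{R})$ on $(a,b)$; (ii) $\phi^\pm_{a,b}(x+P)=\phi^\pm_{a,b}(x)$; (iii) $\int_0^P\phi^+_{a,b}dx=\int_0^P\phi^-_{a,b}dx$; (iv) if $b<b'$ then $\phi^\pm_{a,b}(x)<\phi^\pm_{a,b'}(x)$ for all $a,x$; (v) for all $a,x$, $\phi^\pm_{a,b}(x)\to\pm\infty$ as $b\to\pm\infty$ (i.e. both $\phi^+_{a,b}(x)$ and $\phi^-_{a,b}(x)$ tend to $+\infty$ as $b\to+\infty$ and to $-\infty$ as $b\to-\infty$). Let $(u_{a,b},v_{a,b})$ be the solution associated to $\phi^\pm_{a,b}$, let $\mathbb{Z}$ act on $\mathbb{C}^3$ by $n:(z_1,z_2,z_3)\mapsto(z_1,z_2,z_3+nP)$, and define $$N_{a,b,c}=\bigl\{(z_1,z_2,z_3)\in\mathbb{C}^3:|z_1|^2-|z_2|^2=2a,\ x\in\mathbb{R},\ y\in(-R,R),\ z_1z_2=v_{a,b}(x,y)+iy,\ z_3=x+iu_{a,b}(x,y)+ic\bigr\}/\mathbb{Z}.$$ Then distinct $N_{a,b,c}$ are disjoint, and with $V=\{(z_1,z_2,z_3)\in\mathbb{C}^3:|\operatorname{Im}z_1z_2|<R\}/\mathbb{Z}$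 there exists a continuous surjective $F:V\to\mathbb{R}^3$ with $F^{-1}(a,b,c)=N_{a,b,c}$ for all $(a,b,c)\in\mathbb{R}^3$; thus $F$ is a special Lagrangian fibration of $V$.
   Context: For $a\in\mathbb{R}$ let $(\dagger_a)$ denote $\frac{\partial u}{\partial x}=\frac{\partial v}{\partial y}$, $\frac{\partial v}{\partial x}=-2(v^2+y^2+a^2)^{1/2}\frac{\partial u}{\partial y}$. Given $P$-periodic $\phi^\pm\in C^{3,\alpha}(\mathbb{R})$ with equal integrals over $[0,P]$, the associated solution $(u,v)$ is the unique pair on $S$, $P$-periodic in $x$, with $u(0,0)=0$, $v(x,\pm R)=\phi^\pm(x)$, which is a $C^{3,\alpha}$ solution of $(\dagger_a)$ if $a\ne0$ and a singular solution of $(\dagger_0)$ if $a=0$ (existence and uniqueness hold). Singular solution of $(\dagger_0)$: continuous, weakly differentiable $u,v$ whose weak derivatives satisfy $(\dagger_0)$, with $v$ a weak solution of $\partial_x[(v^2+y^2)^{-1/2}\partial_xv]+2\partial_y^2v=0$, classical and real analytic away from points $(x,0)$ with $v(x,0)=0$, and a $C^0$ limit of $C^2$ solutions of $(\dagger_b)$ as $b\to0_+$. The sets $N_{a,b,c}$ are special Lagrangian 3-folds (possibly singular when $a=0$) in $\mathbb{C}^3/\mathbb{Z}$ with respect to $\omega'=\frac i2\sum dz_j\wedge d\bar z_j$, $\Omega'=dz_1\wedge dz_2\wedge dz_3$. *)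

theory Defs
  imports "HOL-Analysis.Analysis"
begin

definition C3a :: "real \<Rightarrow> (real \<Rightarrow> real) \<Rightarrow> bool" where
  "C3a \<alpha> f \<longleftrightarrow>
     (\<forall>k<3. \<forall>x. ((deriv ^^ k) f has_real_derivative (deriv ^^ Suc k) f x) (at x)) \<and>
     continuous_on UNIV ((deriv ^^ 3) f) \<and>
     (\<forall>k\<le>3. bounded (range ((deriv ^^ k) f))) \<and>
     (\<exists>C. \<forall>x y. \<bar>(deriv ^^ 3) f x - (deriv ^^ 3) f y\<bar> \<le> C * \<bar>x - y\<bar> powr \<alpha>)"

definition c3a_norm :: "real \<Rightarrow> (real \<Rightarrow> real) \<Rightarrow> real" where
  "c3a_norm \<alpha> f =
     (\<Sum>k\<le>3. (SUP x. \<bar>(deriv ^^ k) f x\<bar>)) +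
     (SUP xy \<in> {xy::real\<times>real. fst xy \<noteq> snd xy}.
        \<bar>(deriv ^^ 3) f (fst xy) - (deriv ^^ 3) f (snd xy)\<bar> / \<bar>fst xy - snd xy\<bar> powr \<alpha>)"

definition strip :: "real \<Rightarrow> (real \<times> real) set" where
  "strip R = {p. \<bar>snd p\<bar> \<le> R}"

definition open_strip :: "real \<Rightarrow> (real \<times> real) set" where
  "open_strip R = {p. \<bar>snd p\<bar> < R}"

text \<open>Classical partial derivatives. The x-derivative is taken along the whole horizontal
  line; on the closed strip the y-derivative is taken within [-R,R] (one-sided at the boundary).\<close>
definition px :: "(real \<times> real \<Rightarrow> real) \<Rightarrow> real \<times> real \<Rightarrow> real" where
  "px f p = deriv (\<lambda>t. f (t, snd p)) (fst p)"

definition py :: "(real \<times> real \<Rightarrow> real) \<Rightarrow> real \<times> real \<Rightarrow> real" where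
  "py f p = deriv (\<lambda>t. f (fst p, t)) (snd p)"

definition pyS :: "real \<Rightarrow> (real \<times> real \<Rightarrow> real) \<Rightarrow> real \<times> real \<Rightarrow> real" where
  "pyS R f p = vector_derivative (\<lambda>t. f (fst p, t)) (at (snd p) within {-R..R})"

fun pdS :: "real \<Rightarrow> bool list \<Rightarrow> (real \<times> real \<Rightarrow> real) \<Rightarrow> real \<times> real \<Rightarrow> real" where
  "pdS R [] f = f"
| "pdS R (d # ds) f = (if d then pyS R (pdS R ds f) else px (pdS R ds f))"

fun pd :: "bool list \<Rightarrow> (real \<times> real \<Rightarrow> real) \<Rightarrow> real \<times> real \<Rightarrow> real" where
  "pd [] f = f"
| "pd (d # ds) f = (if d then py (pd ds f) else px (pd ds f))"

definition Ck_strip :: "real \<Rightarrow> nat \<Rightarrow> (real \<times> real \<Rightarrow> real) \<Rightarrow> bool" where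
  "Ck_strip R k f \<longleftrightarrow>
     (\<forall>ds. length ds < k \<longrightarrow> (\<forall>p\<in>strip R.
        (\<lambda>t. pdS R ds f (t, snd p)) differentiable (at (fst p)) \<and>
        (\<lambda>t. pdS R ds f (fst p, t)) differentiable (at (snd p) within {-R..R}))) \<and>
     (\<forall>ds. length ds \<le> k \<longrightarrow> continuous_on (strip R) (pdS R ds f))"

definition Cka_strip :: "real \<Rightarrow> nat \<Rightarrow> real \<Rightarrow> (real \<times> real \<Rightarrow> real) \<Rightarrow> bool" where
  "Cka_strip R k \<alpha> f \<longleftrightarrow> Ck_strip R k f \<and>
     (\<forall>ds. length ds \<le> k \<longrightarrow> bounded (pdS R ds f ` strip R)) \<and>
     (\<forall>ds. length ds = k \<longrightarrow> (\<exists>C. \<forall>p\<in>strip R. \<forall>q\<in>strip R.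
        \<bar>pdS R ds f p - pdS R ds f q\<bar> \<le> C * dist p q powr \<alpha>))"

definition dagger_on_strip :: "real \<Rightarrow> real \<Rightarrow> (real \<times> real \<Rightarrow> real) \<Rightarrow> (real \<times> real \<Rightarrow> real) \<Rightarrow> bool" where
  "dagger_on_strip R a u v \<longleftrightarrow> (\<forall>p\<in>strip R.
     px u p = pyS R v p \<and>
     px v p = - 2 * sqrt ((v p)\<^sup>2 + (snd p)\<^sup>2 + a\<^sup>2) * pyS R u p)"

definition smooth_plane :: "(real \<times> real \<Rightarrow> real) \<Rightarrow> bool" where
  "smooth_plane \<psi> \<longleftrightarrow> (\<forall>ds. (\<forall>p.
      (\<lambda>t. pd ds \<psi> (t, snd p)) differentiable (at (fst p)) \<and>
      (\<lambda>t. pd ds \<psi> (fst p, t)) differentiable (at (snd p))) \<and>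
      continuous_on UNIV (pd ds \<psi>))"

definition test_fn :: "(real \<times> real) set \<Rightarrow> (real \<times> real \<Rightarrow> real) \<Rightarrow> bool" where
  "test_fn U \<psi> \<longleftrightarrow> smooth_plane \<psi> \<and>
     compact (closure {p. \<psi> p \<noteq> 0}) \<and> closure {p. \<psi> p \<noteq> 0} \<subseteq> U"

definition loc_int :: "(real \<times> real) set \<Rightarrow> (real \<times> real \<Rightarrow> real) \<Rightarrow> bool" where
  "loc_int U f \<longleftrightarrow> f \<in> borel_measurable lborel \<and>
     (\<forall>K. compact K \<and> K \<subseteq> U \<longrightarrow> set_integrable lborel K f)"

definition weak_dx :: "(real \<times> real) set \<Rightarrow> (real \<times> real \<Rightarrow> real) \<Rightarrow> (real \<times> real \<Rightarrow> real) \<Rightarrow> bool" where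
  "weak_dx U f g \<longleftrightarrow> loc_int U f \<and> loc_int U g \<and>
     (\<forall>\<psi>. test_fn U \<psi> \<longrightarrow>
        integral\<^sup>L lborel (\<lambda>p. f p * px \<psi> p) = - integral\<^sup>L lborel (\<lambda>p. g p * \<psi> p))"

definition weak_dy :: "(real \<times> real) set \<Rightarrow> (real \<times> real \<Rightarrow> real) \<Rightarrow> (real \<times> real \<Rightarrow> real) \<Rightarrow> bool" where
  "weak_dy U f g \<longleftrightarrow> loc_int U f \<and> loc_int U g \<and>
     (\<forall>\<psi>. test_fn U \<psi> \<longrightarrow>
        integral\<^sup>L lborel (\<lambda>p. f p * py \<psi> p) = - integral\<^sup>L lborel (\<lambda>p. g p * \<psi> p))"

definition real_analytic_at :: "(real \<times> real \<Rightarrow> real) \<Rightarrow> real \<times> real \<Rightarrow> bool" where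
  "real_analytic_at f p \<longleftrightarrow> (\<exists>c :: nat \<Rightarrow> nat \<Rightarrow> real. \<exists>r>0. \<forall>q. dist q p < r \<longrightarrow>
     ((\<lambda>ij. c (fst ij) (snd ij) * (fst q - fst p) ^ fst ij * (snd q - snd p) ^ snd ij)
        has_sum f q) UNIV)"

definition singular_sol :: "real \<Rightarrow> (real \<times> real \<Rightarrow> real) \<Rightarrow> (real \<times> real \<Rightarrow> real) \<Rightarrow> bool" where
  "singular_sol R u v \<longleftrightarrow>
     continuous_on (strip R) u \<and> continuous_on (strip R) v \<and>
     (\<exists>ux uy vx vy.
        weak_dx (open_strip R) u ux \<and> weak_dy (open_strip R) u uy \<and>
        weak_dx (open_strip R) v vx \<and> weak_dy (open_strip R) v vy \<and>
        (AE p in lborel. p \<in> open_strip R \<longrightarrow>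
           ux p = vy p \<and> vx p = - 2 * sqrt ((v p)\<^sup>2 + (snd p)\<^sup>2) * uy p) \<and>
        loc_int (open_strip R) (\<lambda>p. vx p / sqrt ((v p)\<^sup>2 + (snd p)\<^sup>2)) \<and>
        (\<forall>\<psi>. test_fn (open_strip R) \<psi> \<longrightarrow>
           integral\<^sup>L lborel (\<lambda>p. vx p / sqrt ((v p)\<^sup>2 + (snd p)\<^sup>2) * px \<psi> p
                                  + 2 * vy p * py \<psi> p) = 0)) \<and>
     (\<forall>p \<in> open_strip R - {(x, 0) | x. v (x, 0) = 0}.
        real_analytic_at u p \<and> real_analytic_at v p \<and>
        px u p = py v p \<and> px v p = - 2 * sqrt ((v p)\<^sup>2 + (snd p)\<^sup>2) * py u p) \<and>
     (\<exists>U V :: real \<Rightarrow> real \<times> real \<Rightarrow> real.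
        (\<forall>b>0. Ck_strip R 2 (U b) \<and> Ck_strip R 2 (V b) \<and> dagger_on_strip R b (U b) (V b)) \<and>
        uniform_limit (strip R) U u (at_right 0) \<and>
        uniform_limit (strip R) V v (at_right 0))"

definition assoc_sol :: "real \<Rightarrow> real \<Rightarrow> real \<Rightarrow> real \<Rightarrow> (real \<Rightarrow> real) \<Rightarrow> (real \<Rightarrow> real)
    \<Rightarrow> (real \<times> real \<Rightarrow> real) \<Rightarrow> (real \<times> real \<Rightarrow> real) \<Rightarrow> bool" where
  "assoc_sol R P \<alpha> a \<phi>p \<phi>m u v \<longleftrightarrow>
     (\<forall>p\<in>strip R. u (fst p + P, snd p) = u p \<and> v (fst p + P, snd p) = v p) \<and>
     u (0, 0) = 0 \<and>
     (\<forall>x. v (x, R) = \<phi>p x \<and> v (x, -R) = \<phi>m x) \<and>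
     (if a \<noteq> 0
      then Cka_strip R 3 \<alpha> u \<and> Cka_strip R 3 \<alpha> v \<and> dagger_on_strip R a u v
      else singular_sol R u v)"

text \<open>Lift to C^3 of N_{a,b,c}; this set is invariant under the Z-action
  (z1,z2,z3) -> (z1,z2,z3+nP) because u is P-periodic in x.\<close>
definition N_lift :: "real \<Rightarrow> (real \<times> real \<Rightarrow> real) \<Rightarrow> (real \<times> real \<Rightarrow> real) \<Rightarrow> real \<Rightarrow> real
    \<Rightarrow> (complex \<times> complex \<times> complex) set" where
  "N_lift R u v a c = {(z1, z2, z3). (cmod z1)\<^sup>2 - (cmod z2)\<^sup>2 = 2 * a \<and>
     (\<exists>x y. -R < y \<and> y < R \<and>
        z1 * z2 = complex_of_real (v (x, y)) + \<i> * complex_of_real y \<and>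
        z3 = complex_of_real x + \<i> * complex_of_real (u (x, y)) + \<i> * complex_of_real c)}"

definition V_lift :: "real \<Rightarrow> (complex \<times> complex \<times> complex) set" where
  "V_lift R = {(z1, z2, z3). \<bar>Im (z1 * z2)\<bar> < R}"

definition Zshift :: "real \<Rightarrow> int \<Rightarrow> complex \<times> complex \<times> complex \<Rightarrow> complex \<times> complex \<times> complex" where
  "Zshift P n z = (fst z, fst (snd z), snd (snd z) + of_int n * complex_of_real P)"

end

theory Submission
  imports Defs
begin

text \<open>
  The map is \<open>F(z) = (a, b, Im z\<^sub>3 - u\<^bsub>a,b\<^esub>(x, y))\<close> with \<open>a = (|z\<^sub>1|\<^sup>2 - |z\<^sub>2|\<^sup>2)/2\<close>, \<open>x = Re z\<^sub>3\<close>,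
  \<open>y = Im z\<^sub>1z\<^sub>2\<close> and \<open>b\<close> the unique solution of \<open>v\<^bsub>a,b\<^esub>(x, y) = Re z\<^sub>1z\<^sub>2\<close>. So one needs that
  \<open>v\<^bsub>a,b\<^esub>(x, y)\<close> is a strictly increasing bijection in \<open>b\<close> and that \<open>u\<close>, \<open>v\<close> are jointly continuous in
  \<open>(a, b, x, y)\<close>, both also at \<open>a = 0\<close> and at the singular points.

  Continuity. Two solutions with the same \<open>a \<noteq> 0\<close> differ by the gradient of a potential \<open>h\<close> that solves a
  linear divergence form equation; the function \<open>y \<mapsto> \<integral> \<rho> h\<^sup>2 dx\<close> is almost convex uniformly in \<open>a\<close>, so \<open>h\<close> is
  small if the boundary values of \<open>v\<close> are close. Hence line averages of \<open>u\<close> and \<open>v\<close> are close, and the maximum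
  principle together with energy bounds uniform in \<open>a\<close> turns this into pointwise closeness. At \<open>a = 0\<close> one
  compares with the regular solutions that approximate the singular one.

  Strict monotonicity. Weak monotonicity follows from an \<open>L\<^sup>1\<close> comparison principle, which applies to
  translates in \<open>x\<close> as well. Therefore equality at one point for two values of \<open>b\<close> forces equality on
  a horizontal segment for the values in between. There the weighted average \<open>M\<close> of the
  difference vanishes together with its \<open>y\<close>-derivative, and \<open>M'' \<le> c M / |y|\<close> forces \<open>M = 0\<close> up
  to the boundary, where the data differ.
\<close>

section \<open>Calculus on rectangles and strips\<close>

text \<open>The obstacle is that \<open>sg a v y\<close> degenerates at \<open>v = y = 0\<close> as
  \<open>a\<close> tends to 0, and that the singular solution is usable only as a uniform limit of
  regular ones. The estimates behind continuity therefore have constants uniform for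
  \<open>|a| \<le> A\<close>, and facts at \<open>a = 0\<close> are obtained by letting
  \<open>a\<close> tend to 0. Weak inequalities and integral identities survive this limit, strict
  inequalities do not. This is why strict monotonicity rests on an integrated inequality for
  averages, and why each passage to the limit starts from a positive gap.

  The approximating solutions are not assumed to be periodic or to have prescribed boundary values.
  The comparison by a potential is therefore local: it uses a cut-off on a long interval
  \<open>[-L, L]\<close>, whose error decays like \<open>1 / sqrt L\<close>.

  The weight \<open>(y\<^sup>2 + a\<^sup>2) powr (-1/4)\<close> recurs because it is bounded by
  \<open>|y|\<close> to the power -1/2, which is integrable, independently of \<open>a\<close>.

  A potential controls \<open>u\<close> only up to an additive constant; the normalisation at the
  origin removes it.\<close>

lemma integral_real_derivative:
  fixes f f' :: "real \<Rightarrow> real"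
  assumes "a \<le> b" "\<And>x. x \<in> {a..b} \<Longrightarrow> (f has_real_derivative f' x) (at x)"
  shows "integral {a..b} f' = f b - f a"
  by (rule integral_unique, rule fundamental_theorem_of_calculus)
    (use assms in \<open>auto simp: has_real_derivative_iff_has_vector_derivative[symmetric]
      intro: has_field_derivative_at_within\<close>)

lemma integral_by_parts_vanishing:
  fixes f g f' g' :: "real \<Rightarrow> real"
  assumes "a \<le> b" "\<And>x. x \<in> {a..b} \<Longrightarrow> (f has_real_derivative f' x) (at x)"
    "\<And>x. x \<in> {a..b} \<Longrightarrow> (g has_real_derivative g' x) (at x)"
    "continuous_on {a..b} f'" "continuous_on {a..b} g'" "f a * g a = f b * g b"
  shows "integral {a..b} (\<lambda>x. f x * g' x) = - integral {a..b} (\<lambda>x. f' x * g x)"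
proof -
  have cf: "continuous_on {a..b} f" "continuous_on {a..b} g"
    using assms(2,3) by (meson DERIV_isCont continuous_at_imp_continuous_on)+
  have "integral {a..b} (\<lambda>x. f' x * g x + f x * g' x) = f b * g b - f a * g a"
    by (rule integral_real_derivative[where f = "\<lambda>x. f x * g x"])
      (use assms in \<open>auto intro!: derivative_eq_intros\<close>)
  moreover have "integral {a..b} (\<lambda>x. f' x * g x + f x * g' x)
      = integral {a..b} (\<lambda>x. f' x * g x) + integral {a..b} (\<lambda>x. f x * g' x)"
    by (rule Henstock_Kurzweil_Integration.integral_add)
      (auto intro!: integrable_continuous_real continuous_intros assms cf)
  ultimately show ?thesis using assms(6) by linarith
qed

lemma continuous_on_Pair_compose:
  assumes "continuous_on T f" "continuous_on S X" "continuous_on S Y" "\<And>z. z \<in> S \<Longrightarrow> (X z, Y z) \<in> T"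
  shows "continuous_on S (\<lambda>z. f (X z, Y z))"
  by (rule continuous_on_compose2[OF assms(1)]) (use assms in \<open>auto intro!: continuous_intros\<close>)

lemma continuous_on_integral_snd:
  fixes f :: "real \<times> real \<Rightarrow> real"
  assumes "continuous_on (U \<times> {c..d}) f"
  shows "continuous_on U (\<lambda>x. integral {c..d} (\<lambda>y. f (x, y)))"
  using integral_continuous_on_param[of U c d "\<lambda>x y. f (x, y)"] assms
  by (simp add: case_prod_unfold)

lemma continuous_on_integral_fst:
  fixes f :: "real \<times> real \<Rightarrow> real"
  assumes "continuous_on ({c..d} \<times> U) f"
  shows "continuous_on U (\<lambda>y. integral {c..d} (\<lambda>x. f (x, y)))"
proof -
  have "continuous_on (U \<times> {c..d}) (\<lambda>z. f (snd z, fst z))"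
    by (rule continuous_on_Pair_compose[OF assms]) (auto intro!: continuous_intros)
  then show ?thesis using continuous_on_integral_snd[of U c d "\<lambda>z. f (snd z, fst z)"] by simp
qed

lemma has_real_derivative_integral_snd:
  fixes f fx :: "real \<times> real \<Rightarrow> real"
  assumes "\<And>x y. x \<in> {c<..<d} \<Longrightarrow> y \<in> {y1..y2} \<Longrightarrow> ((\<lambda>t. f (t, y)) has_real_derivative fx (x, y)) (at x)"
    and "\<And>x. x \<in> {c<..<d} \<Longrightarrow> continuous_on {y1..y2} (\<lambda>y. f (x, y))"
    and "continuous_on ({c<..<d} \<times> {y1..y2}) fx" and "x0 \<in> {c<..<d}"
  shows "((\<lambda>x. integral {y1..y2} (\<lambda>y. f (x, y))) has_real_derivative
           integral {y1..y2} (\<lambda>y. fx (x0, y))) (at x0)"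
proof -
  have "((\<lambda>x. integral (cbox y1 y2) (\<lambda>y. f (x, y))) has_real_derivative
           integral (cbox y1 y2) (\<lambda>y. fx (x0, y))) (at x0 within {c<..<d})"
  proof (rule leibniz_rule_field_derivative)
    show "((\<lambda>x. f (x, y)) has_real_derivative fx (x, y)) (at x within {c<..<d})"
      if "x \<in> {c<..<d}" "y \<in> cbox y1 y2" for x y
      using assms(1) that by (simp add: has_field_derivative_at_within)
    show "(\<lambda>y. f (x, y)) integrable_on cbox y1 y2" if "x \<in> {c<..<d}" for x
      using assms(2)[OF that] by (simp add: integrable_continuous_real)
    show "continuous_on ({c<..<d} \<times> cbox y1 y2) (\<lambda>(x, t). fx (x, t))"
      using assms(3) by (simp add: case_prod_unfold)
  qed (use assms in simp_all)
  then show ?thesis using at_within_open[OF assms(4)] by simp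
qed

lemma has_real_derivative_integral_fst:
  fixes f fy :: "real \<times> real \<Rightarrow> real"
  assumes "\<And>x y. y \<in> {c<..<d} \<Longrightarrow> x \<in> {x1..x2} \<Longrightarrow> ((\<lambda>t. f (x, t)) has_real_derivative fy (x, y)) (at y)"
    and "\<And>y. y \<in> {c<..<d} \<Longrightarrow> continuous_on {x1..x2} (\<lambda>x. f (x, y))"
    and "continuous_on ({x1..x2} \<times> {c<..<d}) fy" and "y0 \<in> {c<..<d}"
  shows "((\<lambda>y. integral {x1..x2} (\<lambda>x. f (x, y))) has_real_derivative
           integral {x1..x2} (\<lambda>x. fy (x, y0))) (at y0)"
proof -
  have "continuous_on ({c<..<d} \<times> {x1..x2}) (\<lambda>z. fy (snd z, fst z))"
    by (rule continuous_on_Pair_compose[OF assms(3)]) (auto intro!: continuous_intros)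
  then show ?thesis
    using has_real_derivative_integral_snd[of c d x1 x2 "\<lambda>z. f (snd z, fst z)" "\<lambda>z. fy (snd z, fst z)" y0]
      assms by simp
qed

lemma integral_swap_rectangle:
  fixes f :: "real \<times> real \<Rightarrow> real"
  assumes "continuous_on ({x1..x2} \<times> {y1..y2}) f"
  shows "integral {x1..x2} (\<lambda>x. integral {y1..y2} (\<lambda>y. f (x, y)))
       = integral {y1..y2} (\<lambda>y. integral {x1..x2} (\<lambda>x. f (x, y)))"
proof -
  have "cbox (x1, y1) (x2, y2) = {x1..x2} \<times> {y1..y2}" by (auto simp: cbox_Pair_eq)
  then show ?thesis
    using integral_swap_continuous[of x1 y1 x2 y2 "\<lambda>x y. f (x, y)"] assms
    by (simp add: case_prod_unfold)
qed

lemma continuous_on_rectangle_lines: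
  fixes f :: "real \<times> real \<Rightarrow> real"
  assumes "continuous_on (X \<times> Y) f"
  shows "x \<in> X \<Longrightarrow> continuous_on Y (\<lambda>y. f (x, y))" "y \<in> Y \<Longrightarrow> continuous_on X (\<lambda>x. f (x, y))"
  by (auto intro!: continuous_on_Pair_compose[OF assms] continuous_intros)

text \<open>Requiring only that opposite sides carry equal flux covers both uses: fluxes that vanish
  on the boundary, and fluxes that are periodic in \<open>x\<close>.\<close>

lemma green_rectangle_zero:
  fixes A B Ax By :: "real \<times> real \<Rightarrow> real"
  assumes le: "x1 \<le> x2" "y1 \<le> y2"
    and cA: "continuous_on ({x1..x2} \<times> {y1..y2}) Ax" and cB: "continuous_on ({x1..x2} \<times> {y1..y2}) By"
    and dA: "\<And>x y. x \<in> {x1..x2} \<Longrightarrow> y \<in> {y1..y2} \<Longrightarrow> ((\<lambda>t. A (t, y)) has_real_derivative Ax (x, y)) (at x)"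
    and dB: "\<And>x y. x \<in> {x1..x2} \<Longrightarrow> y \<in> {y1..y2} \<Longrightarrow> ((\<lambda>t. B (x, t)) has_real_derivative By (x, y)) (at y)"
    and bA: "\<And>y. y \<in> {y1..y2} \<Longrightarrow> A (x1, y) = A (x2, y)"
    and bB: "\<And>x. x \<in> {x1..x2} \<Longrightarrow> B (x, y1) = B (x, y2)"
  shows "integral {x1..x2} (\<lambda>x. integral {y1..y2} (\<lambda>y. Ax (x, y) + By (x, y))) = 0"
proof -
  have "integral {x1..x2} (\<lambda>x. integral {y1..y2} (\<lambda>y. Ax (x, y) + By (x, y)))
     = integral {x1..x2} (\<lambda>x. integral {y1..y2} (\<lambda>y. Ax (x, y)) + integral {y1..y2} (\<lambda>y. By (x, y)))"
    by (intro integral_cong Henstock_Kurzweil_Integration.integral_add integrable_continuous_real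
        continuous_on_rectangle_lines[OF cA] continuous_on_rectangle_lines[OF cB])
  also have "\<dots> = integral {x1..x2} (\<lambda>x. integral {y1..y2} (\<lambda>y. Ax (x, y)))
                + integral {x1..x2} (\<lambda>x. integral {y1..y2} (\<lambda>y. By (x, y)))"
    by (intro Henstock_Kurzweil_Integration.integral_add integrable_continuous_real
        continuous_on_integral_snd cA cB)
  also have "integral {x1..x2} (\<lambda>x. integral {y1..y2} (\<lambda>y. By (x, y))) = integral {x1..x2} (\<lambda>x. 0)"
    by (rule integral_cong) (use integral_real_derivative[OF le(2) dB] bB in auto)
  also have "integral {x1..x2} (\<lambda>x. integral {y1..y2} (\<lambda>y. Ax (x, y)))
           = integral {y1..y2} (\<lambda>y. integral {x1..x2} (\<lambda>x. Ax (x, y)))"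
    by (rule integral_swap_rectangle[OF cA])
  also have "\<dots> = integral {y1..y2} (\<lambda>y. 0)"
    by (rule integral_cong) (use integral_real_derivative[OF le(1) dA] bA in auto)
  finally show ?thesis by simp
qed

lemma integral2_mono:
  fixes f g :: "real \<times> real \<Rightarrow> real"
  assumes "continuous_on ({x1..x2} \<times> {y1..y2}) f" "continuous_on ({x1..x2} \<times> {y1..y2}) g"
    and "\<And>x y. x \<in> {x1..x2} \<Longrightarrow> y \<in> {y1..y2} \<Longrightarrow> f (x, y) \<le> g (x, y)"
  shows "integral {x1..x2} (\<lambda>x. integral {y1..y2} (\<lambda>y. f (x, y)))
       \<le> integral {x1..x2} (\<lambda>x. integral {y1..y2} (\<lambda>y. g (x, y)))"
  by (intro integral_le integrable_continuous_real continuous_on_integral_snd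
      continuous_on_rectangle_lines[OF assms(1)] continuous_on_rectangle_lines[OF assms(2)])
    (use assms in auto)

lemma integral2_nonneg_eq_0:
  fixes f :: "real \<times> real \<Rightarrow> real"
  assumes c: "continuous_on ({x1..x2} \<times> {y1..y2}) f" and lt: "x1 < x2" "y1 < y2"
    and nn: "\<And>x y. x \<in> {x1..x2} \<Longrightarrow> y \<in> {y1..y2} \<Longrightarrow> 0 \<le> f (x, y)"
    and z: "integral {x1..x2} (\<lambda>x. integral {y1..y2} (\<lambda>y. f (x, y))) \<le> 0"
    and xy: "x \<in> {x1..x2}" "y \<in> {y1..y2}"
  shows "f (x, y) = 0"
proof -
  note lines = continuous_on_rectangle_lines[OF c]
  have nn': "0 \<le> integral {y1..y2} (\<lambda>y. f (x, y))" if "x \<in> {x1..x2}" for x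
    by (rule Henstock_Kurzweil_Integration.integral_nonneg)
      (use nn that lines in \<open>auto intro!: integrable_continuous_real\<close>)
  have "0 \<le> integral {x1..x2} (\<lambda>x. integral {y1..y2} (\<lambda>y. f (x, y)))"
    by (rule Henstock_Kurzweil_Integration.integral_nonneg)
      (use nn' c in \<open>auto intro!: integrable_continuous_real continuous_on_integral_snd\<close>)
  with z have "integral {x1..x2} (\<lambda>x. integral {y1..y2} (\<lambda>y. f (x, y))) = 0" by simp
  then have "integral {y1..y2} (\<lambda>y. f (x, y)) = 0"
    using integral_eq_0_iff[OF continuous_on_integral_snd[OF c] lt(1)] nn' xy by simp
  then show ?thesis
    using integral_eq_0_iff[OF lines(1)[OF xy(1)] lt(2)] nn xy by simp
qed

text \<open>Schwarz's theorem by integration: \<open>f (z, y) - f (x - 1, y)\<close> is the integral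
  of \<open>fx\<close>. Differentiating it in \<open>y\<close> under the integral, and then in the
  end point \<open>z\<close>, compares \<open>fxy\<close> with \<open>fyx\<close>.\<close>

lemma mixed_partials_eq:
  fixes f fx fy fxy fyx :: "real \<times> real \<Rightarrow> real"
  assumes dx: "\<And>x y. \<bar>y\<bar> < R \<Longrightarrow> ((\<lambda>t. f (t, y)) has_real_derivative fx (x, y)) (at x)"
    and dy: "\<And>x y. \<bar>y\<bar> < R \<Longrightarrow> ((\<lambda>t. f (x, t)) has_real_derivative fy (x, y)) (at y)"
    and dxy: "\<And>x y. \<bar>y\<bar> < R \<Longrightarrow> ((\<lambda>t. fx (x, t)) has_real_derivative fxy (x, y)) (at y)"
    and dyx: "\<And>x y. \<bar>y\<bar> < R \<Longrightarrow> ((\<lambda>t. fy (t, y)) has_real_derivative fyx (x, y)) (at x)"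
    and cont: "continuous_on (open_strip R) fx" "continuous_on (open_strip R) fxy"
    and y: "\<bar>y\<bar> < R"
  shows "fxy (x, y) = fyx (x, y)"
proof -
  have sub: "(A \<times> {-R<..<R}) \<subseteq> open_strip R" for A :: "real set" by (auto simp: open_strip_def)
  have c: "continuous_on A (\<lambda>t. fx (t, y))" "continuous_on A (\<lambda>t. fxy (t, y))"
    if "\<bar>y\<bar> < R" for A and y :: real
    by (rule continuous_on_Pair_compose[OF cont(1)] continuous_on_Pair_compose[OF cont(2)];
        use that in \<open>auto intro!: continuous_intros simp: open_strip_def\<close>)+
  have key: "integral {x-1..z} (\<lambda>t. fxy (t, y)) = fy (z, y) - fy (x - 1, y)" if z: "x - 1 \<le> z" for z
  proof -
    have 1: "((\<lambda>y. integral {x-1..z} (\<lambda>t. fx (t, y))) has_real_derivative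
          integral {x-1..z} (\<lambda>t. fxy (t, y))) (at y)"
      by (rule has_real_derivative_integral_fst[where c = "-R" and d = R])
        (use dxy y c in \<open>auto intro: continuous_on_subset[OF cont(2) sub]\<close>)
    have 2: "((\<lambda>y. f (z, y) - f (x - 1, y)) has_real_derivative fy (z, y) - fy (x - 1, y)) (at y)"
      by (intro derivative_intros dy y)
    have 3: "((\<lambda>y. integral {x-1..z} (\<lambda>t. fx (t, y))) has_real_derivative fy (z, y) - fy (x - 1, y)) (at y)"
    proof (rule has_field_derivative_transform_within_open[OF 2, of "{-R<..<R}"])
      show "f (z, t) - f (x - 1, t) = integral {x-1..z} (\<lambda>s. fx (s, t))" if "t \<in> {-R<..<R}" for t
        using integral_real_derivative[OF z, of "\<lambda>s. f (s, t)" "\<lambda>s. fx (s, t)"] dx that by auto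
    qed (use y in auto)
    show ?thesis by (rule DERIV_unique[OF 1 3])
  qed
  have "((\<lambda>z. integral {x-1..z} (\<lambda>t. fxy (t, y))) has_real_derivative fxy (x, y)) (at x within {x-1..x+1})"
    by (rule integral_has_real_derivative) (use c y in auto)
  then have "((\<lambda>z. integral {x-1..z} (\<lambda>t. fxy (t, y))) has_real_derivative fxy (x, y)) (at x)"
    by (simp add: at_within_Icc_at)
  moreover have "((\<lambda>z. integral {x-1..z} (\<lambda>t. fxy (t, y))) has_real_derivative fyx (x, y)) (at x)"
  proof (rule has_field_derivative_transform_within_open[where f = "\<lambda>z. fy (z, y) - fy (x - 1, y)" and S = "{x-1<..}"])
    show "((\<lambda>z. fy (z, y) - fy (x - 1, y)) has_real_derivative fyx (x, y)) (at x)"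
      by (auto intro!: derivative_eq_intros dyx y)
  qed (use key in auto)
  ultimately show ?thesis by (rule DERIV_unique)
qed

section \<open>The system with explicit derivatives\<close>

definition sg :: "real \<Rightarrow> real \<Rightarrow> real \<Rightarrow> real" where
  "sg a v y = sqrt (v\<^sup>2 + y\<^sup>2 + a\<^sup>2)"

text \<open>\<open>p\<close> is the common value of the \<open>x\<close>-derivative of
  \<open>u\<close> and the \<open>y\<close>-derivative of \<open>v\<close>, and \<open>q\<close> is
  the \<open>y\<close>-derivative of \<open>u\<close>. Carrying the derivatives as functions builds
  in the first equation and leaves behind the one-sided derivatives of the closed strip.\<close>

definition sol1 :: "real \<Rightarrow> real \<Rightarrow> (real \<times> real \<Rightarrow> real) \<Rightarrow> (real \<times> real \<Rightarrow> real)
    \<Rightarrow> (real \<times> real \<Rightarrow> real) \<Rightarrow> (real \<times> real \<Rightarrow> real) \<Rightarrow> bool" where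
  "sol1 R a u v p q \<longleftrightarrow>
     continuous_on (open_strip R) u \<and> continuous_on (open_strip R) v \<and>
     continuous_on (open_strip R) p \<and> continuous_on (open_strip R) q \<and>
     (\<forall>x y. \<bar>y\<bar> < R \<longrightarrow>
        ((\<lambda>t. u (t, y)) has_real_derivative p (x, y)) (at x) \<and>
        ((\<lambda>t. u (x, t)) has_real_derivative q (x, y)) (at y) \<and>
        ((\<lambda>t. v (t, y)) has_real_derivative - 2 * sg a (v (x, y)) y * q (x, y)) (at x) \<and>
        ((\<lambda>t. v (x, t)) has_real_derivative p (x, y)) (at y))"

text \<open>That the \<open>y\<close>-derivative of \<open>p\<close> and the
  \<open>x\<close>-derivative of \<open>q\<close> share the value \<open>r\<close> is the divergence
  form equation for \<open>v\<close>. That the \<open>x\<close>-derivative of \<open>p\<close> and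
  the \<open>y\<close>-derivative of \<open>-2 sg q\<close> share the value \<open>s\<close> is the
  one for \<open>u\<close>. In this form one can integrate by parts without ever differentiating
  \<open>sg\<close>.\<close>

definition sol2 :: "real \<Rightarrow> real \<Rightarrow> (real \<times> real \<Rightarrow> real) \<Rightarrow> (real \<times> real \<Rightarrow> real)
    \<Rightarrow> (real \<times> real \<Rightarrow> real) \<Rightarrow> (real \<times> real \<Rightarrow> real) \<Rightarrow> (real \<times> real \<Rightarrow> real) \<Rightarrow> (real \<times> real \<Rightarrow> real) \<Rightarrow> bool" where
  "sol2 R a u v p q r s \<longleftrightarrow> sol1 R a u v p q \<and>
     continuous_on (open_strip R) r \<and> continuous_on (open_strip R) s \<and>
     (\<forall>x y. \<bar>y\<bar> < R \<longrightarrow>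
        ((\<lambda>t. p (t, y)) has_real_derivative s (x, y)) (at x) \<and>
        ((\<lambda>t. p (x, t)) has_real_derivative r (x, y)) (at y) \<and>
        ((\<lambda>t. q (t, y)) has_real_derivative r (x, y)) (at x) \<and>
        ((\<lambda>t. - 2 * sg a (v (x, t)) t * q (x, t)) has_real_derivative s (x, y)) (at y))"

text \<open>Equality of the mixed derivatives of \<open>u\<close> gives the clause with
  \<open>r\<close>, that of \<open>v\<close> the clause with \<open>s\<close>.\<close>

lemma dagger_imp_sol2:
  assumes u: "Ck_strip R 2 u" and v: "Ck_strip R 2 v" and dag: "dagger_on_strip R a u v"
  shows "\<exists>r s. sol2 R a u v (px u) (pyS R u) r s"
proof -
  have os: "open_strip R \<subseteq> strip R" by (auto simp: open_strip_def strip_def)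
  have C: "continuous_on (open_strip R) (pdS R ds f)" if "length ds \<le> 2" "Ck_strip R 2 f" for ds f
    using that continuous_on_subset[OF _ os] by (auto simp: Ck_strip_def)
  have DX: "((\<lambda>t. pdS R ds f (t, y)) has_real_derivative pdS R (False # ds) f (x, y)) (at x)"
    if "length ds < 2" "Ck_strip R 2 f" "\<bar>y\<bar> < R" for ds f x y
  proof -
    have "(x, y) \<in> strip R" using that by (simp add: strip_def)
    then have "(\<lambda>t. pdS R ds f (t, y)) differentiable (at x)"
      using that(1,2) unfolding Ck_strip_def by fastforce
    then show ?thesis by (simp add: px_def DERIV_deriv_iff_real_differentiable)
  qed
  have DY: "((\<lambda>t. pdS R ds f (x, t)) has_real_derivative pdS R (True # ds) f (x, y)) (at y)"
    if "length ds < 2" "Ck_strip R 2 f" "\<bar>y\<bar> < R" for ds f x y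
  proof -
    have "(x, y) \<in> strip R" using that by (simp add: strip_def)
    then have "(\<lambda>t. pdS R ds f (x, t)) differentiable (at y within {-R..R})"
      using that(1,2) unfolding Ck_strip_def by fastforce
    moreover have "at y within {-R..R} = at y" using that by (intro at_within_Icc_at) auto
    ultimately show ?thesis
      by (simp add: pyS_def vector_derivative_works has_real_derivative_iff_has_vector_derivative)
  qed
  have eq1: "px u (x, y) = pyS R v (x, y)" "px v (x, y) = - 2 * sg a (v (x, y)) y * pyS R u (x, y)"
    if "\<bar>y\<bar> < R" for x y
    using dag that by (auto simp: dagger_on_strip_def strip_def sg_def)
  have mix: "pdS R [True, False] f (x, y) = pdS R [False, True] f (x, y)"
    if "Ck_strip R 2 f" "\<bar>y\<bar> < R" for f x y
    by (rule mixed_partials_eq[of R f "pdS R [False] f" "pdS R [True] f"])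
      (use DX[of "[]" f] DY[of "[]" f] DX[of "[True]" f] DY[of "[False]" f] C[of "[False]" f] C[of "[True, False]" f] that in simp_all)
  define r where "r = pdS R [True, False] u"
  define s where "s = pdS R [False, True] v"
  have s1: "sol1 R a u v (px u) (pyS R u)"
    unfolding sol1_def
  proof (intro conjI allI impI)
    fix x y assume y: "\<bar>y\<bar> < R"
    show "((\<lambda>t. u (t, y)) has_real_derivative px u (x, y)) (at x)"
      "((\<lambda>t. u (x, t)) has_real_derivative pyS R u (x, y)) (at y)"
      using DX[of "[]" u y x] DY[of "[]" u y x] u y by simp_all
    show "((\<lambda>t. v (t, y)) has_real_derivative - 2 * sg a (v (x, y)) y * pyS R u (x, y)) (at x)"
      using DX[of "[]" v y x] v y eq1(2)[OF y, of x] by simp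
    show "((\<lambda>t. v (x, t)) has_real_derivative px u (x, y)) (at y)"
      using DY[of "[]" v y x] v y eq1(1)[OF y, of x] by simp
  qed (use C[of "[]" u] C[of "[]" v] C[of "[False]" u] C[of "[True]" u] u v in simp_all)
  have "((\<lambda>t. px u (t, y)) has_real_derivative s (x, y)) (at x)" if "\<bar>y\<bar> < R" for x y
    using DX[of "[True]" v y x] v that eq1(1)[OF that] by (simp add: s_def)
  moreover have "((\<lambda>t. px u (x, t)) has_real_derivative r (x, y)) (at y)" if "\<bar>y\<bar> < R" for x y
    using DY[of "[False]" u y x] u that by (simp add: r_def)
  moreover have "((\<lambda>t. pyS R u (t, y)) has_real_derivative r (x, y)) (at x)" if "\<bar>y\<bar> < R" for x y
    using DX[of "[True]" u y x] u that mix[OF u that] by (simp add: r_def)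
  moreover have "((\<lambda>t. - 2 * sg a (v (x, t)) t * pyS R u (x, t)) has_real_derivative s (x, y)) (at y)"
    if "\<bar>y\<bar> < R" for x y
  proof (rule has_field_derivative_transform_within_open[of "\<lambda>t. px v (x, t)" _ _ "{-R<..<R}"])
    show "((\<lambda>t. px v (x, t)) has_real_derivative s (x, y)) (at y)"
      using DY[of "[False]" v y x] v that mix[OF v that] by (simp add: s_def)
  qed (use that eq1(2) in auto)
  moreover have "continuous_on (open_strip R) r" "continuous_on (open_strip R) s"
    unfolding r_def s_def by (intro C u v; simp)+
  ultimately show ?thesis using s1 unfolding sol2_def by blast
qed

section \<open>Classical solutions and the maximum principle\<close>

lemma sg_nonneg: "0 \<le> sg a v y" by (simp add: sg_def)

lemma sg_ge_abs_a: "\<bar>a\<bar> \<le> sg a v y"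
  unfolding sg_def by (rule real_le_rsqrt) (simp add: power2_eq_square[symmetric])

lemma sg_pos: "a \<noteq> 0 \<Longrightarrow> 0 < sg a v y"
  using sg_ge_abs_a[of a v y] by linarith

text \<open>The reverse triangle inequality, with \<open>sg\<close> read as the norm of the vector
  with components \<open>v\<close> and \<open>sqrt (y\<^sup>2 + a\<^sup>2)\<close>.\<close>

lemma sg_lipschitz: "\<bar>sg a v y - sg a v' y\<bar> \<le> \<bar>v - v'\<bar>"
proof -
  have "\<bar>norm (v, sqrt (y\<^sup>2 + a\<^sup>2)) - norm (v', sqrt (y\<^sup>2 + a\<^sup>2))\<bar>
      \<le> norm ((v, sqrt (y\<^sup>2 + a\<^sup>2)) - (v', sqrt (y\<^sup>2 + a\<^sup>2)))"
    by (rule norm_triangle_ineq3)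
  then show ?thesis by (simp add: norm_Pair sg_def add.assoc)
qed

lemma continuous_on_sg [continuous_intros]:
  "continuous_on S f \<Longrightarrow> continuous_on S g \<Longrightarrow> continuous_on S (\<lambda>z. sg a (f z) (g z))"
  unfolding sg_def by (intro continuous_intros)

lemma rectangle_subset_open_strip:
  "\<bar>y1\<bar> < R \<Longrightarrow> \<bar>y2\<bar> < R \<Longrightarrow> X \<times> {y1..y2} \<subseteq> open_strip R"
  by (auto simp: open_strip_def)

lemma continuous_on_line_x:
  fixes f :: "real \<times> real \<Rightarrow> real"
  assumes "continuous_on (open_strip R) f" "\<bar>y\<bar> < R"
  shows "continuous_on Z (\<lambda>x. f (x, y))"
  by (rule continuous_on_Pair_compose[OF assms(1)])
    (use assms in \<open>auto simp: open_strip_def intro!: continuous_intros\<close>)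

lemma sol1_derivs:
  assumes "sol1 R a u v p q" "\<bar>y\<bar> < R"
  shows "((\<lambda>t. u (t, y)) has_real_derivative p (x, y)) (at x)"
    "((\<lambda>t. u (x, t)) has_real_derivative q (x, y)) (at y)"
    "((\<lambda>t. v (t, y)) has_real_derivative - 2 * sg a (v (x, y)) y * q (x, y)) (at x)"
    "((\<lambda>t. v (x, t)) has_real_derivative p (x, y)) (at y)"
  using assms by (auto simp: sol1_def)

lemma sol1_cont:
  assumes "sol1 R a u v p q" "S \<subseteq> open_strip R"
  shows "continuous_on S u" "continuous_on S v" "continuous_on S p" "continuous_on S q"
  using assms by (auto simp: sol1_def intro: continuous_on_subset)

lemma sol2_derivs:
  assumes "sol2 R a u v p q r s" "\<bar>y\<bar> < R"
  shows "((\<lambda>t. p (t, y)) has_real_derivative s (x, y)) (at x)"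
    "((\<lambda>t. p (x, t)) has_real_derivative r (x, y)) (at y)"
    "((\<lambda>t. q (t, y)) has_real_derivative r (x, y)) (at x)"
    "((\<lambda>t. - 2 * sg a (v (x, t)) t * q (x, t)) has_real_derivative s (x, y)) (at y)"
  using assms by (auto simp: sol2_def)

lemma sol2_cont:
  assumes "sol2 R a u v p q r s" "S \<subseteq> open_strip R"
  shows "continuous_on S r" "continuous_on S s"
  using assms by (auto simp: sol2_def intro: continuous_on_subset)

lemma sol2_sol1: "sol2 R a u v p q r s \<Longrightarrow> sol1 R a u v p q"
  by (simp add: sol2_def)

text \<open>The system is odd because \<open>sg\<close> is even in \<open>v\<close>. This symmetry
  turns every upper bound into a lower bound.\<close>

lemma sol1_neg:
  assumes "sol1 R a u v p q"
  shows "sol1 R a (\<lambda>z. - u z) (\<lambda>z. - v z) (\<lambda>z. - p z) (\<lambda>z. - q z)"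
  using assms unfolding sol1_def
  by (auto intro!: continuous_intros derivative_eq_intros simp: sg_def)

lemma sol2_neg:
  assumes "sol2 R a u v p q r s"
  shows "sol2 R a (\<lambda>z. - u z) (\<lambda>z. - v z) (\<lambda>z. - p z) (\<lambda>z. - q z) (\<lambda>z. - r z) (\<lambda>z. - s z)"
proof -
  have "((\<lambda>t. - 2 * sg a (- v (x, t)) t * - q (x, t)) has_real_derivative - s (x, y)) (at y)"
    if "\<bar>y\<bar> < R" for x y
    using DERIV_minus[OF sol2_derivs(4)[OF assms that, of x]] by (simp add: sg_def)
  then show ?thesis
    using assms sol1_neg unfolding sol2_def
    by (auto intro!: continuous_intros DERIV_minus)
qed

text \<open>The vanishing of \<open>g'\<close> at 0 is what makes the truncated function
  differentiable there. The lemma produces the continuously differentiable test functions, vanishing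
  on a half line, of both comparison arguments below.\<close>

lemma has_real_derivative_max0:
  fixes g g' :: "real \<Rightarrow> real"
  assumes d: "\<And>t. (g has_real_derivative g' t) (at t)" and 0: "g' 0 = 0"
  shows "((\<lambda>t. g (max 0 t)) has_real_derivative g' (max 0 t)) (at t)"
proof -
  consider "t < 0" | "t > 0" | "t = 0" by linarith
  then show ?thesis
  proof cases
    case 1
    have "((\<lambda>t. g 0) has_real_derivative g' (max 0 t)) (at t)" using 0 1 by (simp add: max_def)
    then show ?thesis
      by (rule has_field_derivative_transform_within_open[of _ _ _ "{..<0}"]) (use 1 in auto)
  next
    case 2
    have "(g has_real_derivative g' (max 0 t)) (at t)" using d[of t] 2 by (simp add: max_def)
    then show ?thesis
      by (rule has_field_derivative_transform_within_open[of _ _ _ "{0<..}"]) (use 2 in auto)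
  next
    case 3
    have "((\<lambda>h. (g h - g 0) / h) \<longlongrightarrow> 0) (at 0)"
      using d[of 0] 0 by (simp add: has_field_derivative_iff)
    then have n: "((\<lambda>h. norm ((g h - g 0) / h)) \<longlongrightarrow> 0) (at 0)" by (rule tendsto_norm_zero)
    have "((\<lambda>h. (g (max 0 h) - g 0) / h) \<longlongrightarrow> 0) (at 0)"
      by (rule Lim_null_comparison[OF _ n]) (auto simp: max_def divide_nonneg_neg intro!: always_eventually)
    then show ?thesis using 0 3 by (simp add: has_field_derivative_iff)
  qed
qed

lemma has_real_derivative_max0_square:
  "((\<lambda>t. (max 0 (t - c))\<^sup>2) has_real_derivative 2 * max 0 (t - c)) (at (t::real))"
proof -
  have "((\<lambda>t. (max 0 t)\<^sup>2) has_real_derivative 2 * max 0 (t - c)) (at (t - c))"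
    by (rule has_real_derivative_max0[of "\<lambda>t. t\<^sup>2" "\<lambda>t. 2 * t"]) (auto intro!: derivative_eq_intros)
  then have "((\<lambda>t. (max 0 (t - c))\<^sup>2) has_real_derivative 2 * max 0 (t - c) * 1) (at t)"
    by (rule DERIV_chain2) (auto intro!: derivative_eq_intros)
  then show ?thesis by simp
qed

text \<open>Green's theorem for the flux \<open>(- F(v) q, F(v) p)\<close> with \<open>F t\<close>
  the squared positive part of \<open>t - c\<close>: the terms with \<open>r\<close> cancel, the
  flux vanishes on the boundary, and the integral of \<open>F'(v) (2 sg q^2 + p^2)\<close> is left.
  The factor of \<open>q^2\<close> may degenerate, so only \<open>F'(v) p = 0\<close> is used. It is
  integrated along a vertical line, where \<open>p\<close> is the derivative of
  \<open>v\<close>.\<close>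

lemma max_principle_v:
  assumes sol: "sol2 R a u v p q r s" and x: "x1 < x2" and y: "y1 < y2" "\<bar>y1\<bar> < R" "\<bar>y2\<bar> < R"
    and bd1: "\<And>x. x \<in> {x1..x2} \<Longrightarrow> v (x, y1) \<le> c \<and> v (x, y2) \<le> c"
    and bd2: "\<And>y. y \<in> {y1..y2} \<Longrightarrow> v (x1, y) \<le> c \<and> v (x2, y) \<le> c"
    and xy: "x0 \<in> {x1..x2}" "y0 \<in> {y1..y2}"
  shows "v (x0, y0) \<le> c"
proof -
  define F where "F t = (max 0 (t - c))\<^sup>2" for t
  define F' where "F' t = 2 * max 0 (t - c)" for t
  have dF: "(F has_real_derivative F' t) (at t)" for t
    unfolding F_def F'_def by (rule has_real_derivative_max0_square)
  have cF: "continuous_on UNIV F" "continuous_on UNIV F'"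
    unfolding F_def F'_def by (intro continuous_intros)+
  have F'0: "0 \<le> F' t" for t by (simp add: F'_def)
  have ins: "\<bar>y\<bar> < R" if "y \<in> {y1..y2}" for y using that y by auto
  define Q where "Q = {x1..x2} \<times> {y1..y2}"
  have Q: "Q \<subseteq> open_strip R" unfolding Q_def by (rule rectangle_subset_open_strip[OF y(2,3)])
  note s1 = sol2_sol1[OF sol]
  note cont = sol1_cont[OF s1 Q] sol2_cont[OF sol Q]
  have cFv: "continuous_on Q (\<lambda>z. F (v z))" "continuous_on Q (\<lambda>z. F' (v z))"
    by (rule continuous_on_compose2[OF cF(1) cont(2)] continuous_on_compose2[OF cF(2) cont(2)]; simp)+
  have cs: "continuous_on Q (\<lambda>z. sg a (v z) (snd z))" by (intro continuous_intros cont)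
  define Ax where "Ax z = - (F' (v z) * (- 2 * sg a (v z) (snd z) * q z) * q z + F (v z) * r z)" for z
  define By where "By z = F' (v z) * p z * p z + F (v z) * r z" for z
  have cA: "continuous_on Q Ax" "continuous_on Q By"
    unfolding Ax_def By_def by (intro continuous_intros cont cFv cs)+
  have zero: "integral {x1..x2} (\<lambda>x. integral {y1..y2} (\<lambda>y. Ax (x, y) + By (x, y))) = 0"
  proof (rule green_rectangle_zero[where A = "\<lambda>z. - (F (v z) * q z)" and B = "\<lambda>z. F (v z) * p z"])
    fix x y assume xy: "x \<in> {x1..x2}" "y \<in> {y1..y2}"
    note D = sol1_derivs[OF s1 ins[OF xy(2)], of x] sol2_derivs[OF sol ins[OF xy(2)], of x]
    show "((\<lambda>t. - (F (v (t, y)) * q (t, y))) has_real_derivative Ax (x, y)) (at x)"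
      unfolding Ax_def by (auto intro!: derivative_eq_intros DERIV_chain2[OF dF] D)
    show "((\<lambda>t. F (v (x, t)) * p (x, t)) has_real_derivative By (x, y)) (at y)"
      unfolding By_def by (auto intro!: derivative_eq_intros DERIV_chain2[OF dF] D)
  qed (use x y cA bd1 bd2 in \<open>auto simp: Q_def F_def\<close>)
  have eq: "Ax (x, y) + By (x, y) = F' (v (x, y)) * (2 * sg a (v (x, y)) y * (q (x, y))\<^sup>2 + (p (x, y))\<^sup>2)" for x y
    by (simp add: Ax_def By_def algebra_simps power2_eq_square)
  have Z: "F' (v (x, y)) * (2 * sg a (v (x, y)) y * (q (x, y))\<^sup>2 + (p (x, y))\<^sup>2) = 0"
    if "x \<in> {x1..x2}" "y \<in> {y1..y2}" for x y
  proof -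
    have "(\<lambda>z. Ax z + By z) (x, y) = 0"
      by (rule integral2_nonneg_eq_0[of x1 x2 y1 y2])
        (use x y that zero cA eq F'0 sg_nonneg in \<open>auto simp: Q_def intro!: continuous_intros\<close>)
    then show ?thesis using eq by simp
  qed
  have Z': "F' (v (x0, y)) * p (x0, y) = 0" if "y \<in> {y1..y2}" for y
  proof -
    have "0 \<le> 2 * sg a (v (x0, y)) y * (q (x0, y))\<^sup>2" by (simp add: sg_nonneg)
    then show ?thesis
      using Z[OF xy(1) that] add_nonneg_eq_0_iff[of "2 * sg a (v (x0, y)) y * (q (x0, y))\<^sup>2" "(p (x0, y))\<^sup>2"] by auto
  qed
  have "integral {y1..y0} (\<lambda>y. F' (v (x0, y)) * p (x0, y)) = F (v (x0, y0)) - F (v (x0, y1))"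
  proof (rule integral_real_derivative)
    fix t assume "t \<in> {y1..y0}"
    then have "\<bar>t\<bar> < R" using xy ins by auto
    then show "((\<lambda>y. F (v (x0, y))) has_real_derivative F' (v (x0, t)) * p (x0, t)) (at t)"
      by (intro DERIV_chain2[OF dF] sol1_derivs(4)[OF s1])
  qed (use xy in auto)
  moreover have "integral {y1..y0} (\<lambda>y. F' (v (x0, y)) * p (x0, y)) = integral {y1..y0} (\<lambda>y. 0)"
    by (rule integral_cong) (use Z' xy in auto)
  ultimately have "F (v (x0, y0)) = 0" using bd1[OF xy(1)] by (simp add: F_def)
  then show ?thesis by (simp add: F_def max_def split: if_splits)
qed

text \<open>As for \<open>v\<close>, with the flux \<open>(F(u) p, 2 F(u) sg q)\<close>. For
  \<open>u\<close> the unweighted derivative \<open>p\<close> is the horizontal one, so the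
  conclusion is drawn along horizontal lines.\<close>

lemma max_principle_u:
  assumes sol: "sol2 R a u v p q r s" and x: "x1 < x2" and y: "y1 < y2" "\<bar>y1\<bar> < R" "\<bar>y2\<bar> < R"
    and bd1: "\<And>x. x \<in> {x1..x2} \<Longrightarrow> u (x, y1) \<le> c \<and> u (x, y2) \<le> c"
    and bd2: "\<And>y. y \<in> {y1..y2} \<Longrightarrow> u (x1, y) \<le> c \<and> u (x2, y) \<le> c"
    and xy: "x0 \<in> {x1..x2}" "y0 \<in> {y1..y2}"
  shows "u (x0, y0) \<le> c"
proof -
  define F where "F t = (max 0 (t - c))\<^sup>2" for t
  define F' where "F' t = 2 * max 0 (t - c)" for t
  have dF: "(F has_real_derivative F' t) (at t)" for t
    unfolding F_def F'_def by (rule has_real_derivative_max0_square)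
  have cF: "continuous_on UNIV F" "continuous_on UNIV F'"
    unfolding F_def F'_def by (intro continuous_intros)+
  have F'0: "0 \<le> F' t" for t by (simp add: F'_def)
  have ins: "\<bar>y\<bar> < R" if "y \<in> {y1..y2}" for y using that y by auto
  define Q where "Q = {x1..x2} \<times> {y1..y2}"
  have Q: "Q \<subseteq> open_strip R" unfolding Q_def by (rule rectangle_subset_open_strip[OF y(2,3)])
  note s1 = sol2_sol1[OF sol]
  note cont = sol1_cont[OF s1 Q] sol2_cont[OF sol Q]
  have cFu: "continuous_on Q (\<lambda>z. F (u z))" "continuous_on Q (\<lambda>z. F' (u z))"
    by (rule continuous_on_compose2[OF cF(1) cont(1)] continuous_on_compose2[OF cF(2) cont(1)]; simp)+
  have cs: "continuous_on Q (\<lambda>z. sg a (v z) (snd z))" by (intro continuous_intros cont)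
  define g where "g z = - 2 * sg a (v z) (snd z) * q z" for z
  have cg: "continuous_on Q g" unfolding g_def by (intro continuous_intros cs cont)
  define Ax where "Ax z = F' (u z) * p z * p z + F (u z) * s z" for z
  define By where "By z = - (F' (u z) * q z * g z + F (u z) * s z)" for z
  have cA: "continuous_on Q Ax" "continuous_on Q By"
    unfolding Ax_def By_def by (intro continuous_intros cont cFu cg)+
  have zero: "integral {x1..x2} (\<lambda>x. integral {y1..y2} (\<lambda>y. Ax (x, y) + By (x, y))) = 0"
  proof (rule green_rectangle_zero[where A = "\<lambda>z. F (u z) * p z" and B = "\<lambda>z. - (F (u z) * g z)"])
    fix x y assume xy: "x \<in> {x1..x2}" "y \<in> {y1..y2}"
    note D = sol1_derivs[OF s1 ins[OF xy(2)], of x] sol2_derivs[OF sol ins[OF xy(2)], of x]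
    have dg: "((\<lambda>t. g (x, t)) has_real_derivative s (x, y)) (at y)"
      using D(8) by (simp add: g_def)
    show "((\<lambda>t. F (u (t, y)) * p (t, y)) has_real_derivative Ax (x, y)) (at x)"
      unfolding Ax_def by (auto intro!: derivative_eq_intros DERIV_chain2[OF dF] D)
    show "((\<lambda>t. - (F (u (x, t)) * g (x, t))) has_real_derivative By (x, y)) (at y)"
      unfolding By_def by (auto intro!: derivative_eq_intros DERIV_chain2[OF dF] D dg)
  qed (use x y cA bd1 bd2 in \<open>auto simp: Q_def F_def\<close>)
  have eq: "Ax (x, y) + By (x, y) = F' (u (x, y)) * (2 * sg a (v (x, y)) y * (q (x, y))\<^sup>2 + (p (x, y))\<^sup>2)" for x y
    by (simp add: Ax_def By_def g_def algebra_simps power2_eq_square)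
  have Z: "F' (u (x, y)) * (2 * sg a (v (x, y)) y * (q (x, y))\<^sup>2 + (p (x, y))\<^sup>2) = 0"
    if "x \<in> {x1..x2}" "y \<in> {y1..y2}" for x y
  proof -
    have "(\<lambda>z. Ax z + By z) (x, y) = 0"
      by (rule integral2_nonneg_eq_0[of x1 x2 y1 y2])
        (use x y that zero cA eq F'0 sg_nonneg in \<open>auto simp: Q_def intro!: continuous_intros\<close>)
    then show ?thesis using eq by simp
  qed
  have Z': "F' (u (x, y0)) * p (x, y0) = 0" if "x \<in> {x1..x2}" for x
  proof -
    have "0 \<le> 2 * sg a (v (x, y0)) y0 * (q (x, y0))\<^sup>2" by (simp add: sg_nonneg)
    then show ?thesis
      using Z[OF that xy(2)] add_nonneg_eq_0_iff[of "2 * sg a (v (x, y0)) y0 * (q (x, y0))\<^sup>2" "(p (x, y0))\<^sup>2"] by auto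
  qed
  have "integral {x1..x0} (\<lambda>x. F' (u (x, y0)) * p (x, y0)) = F (u (x0, y0)) - F (u (x1, y0))"
    by (rule integral_real_derivative)
      (use xy ins in \<open>auto intro!: DERIV_chain2[OF dF] sol1_derivs(1)[OF s1]\<close>)
  moreover have "integral {x1..x0} (\<lambda>x. F' (u (x, y0)) * p (x, y0)) = integral {x1..x0} (\<lambda>y. 0)"
    by (rule integral_cong) (use Z' xy in auto)
  ultimately have "F (u (x0, y0)) = 0" using bd2[OF xy(2)] by (simp add: F_def)
  then show ?thesis by (simp add: F_def max_def split: if_splits)
qed

lemma sol1_periodic_q:
  assumes s1: "sol1 R a u v p q" and per: "\<And>x y. \<bar>y\<bar> < R \<Longrightarrow> u (x + P, y) = u (x, y)" and y: "\<bar>y\<bar> < R"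
  shows "q (x + P, y) = q (x, y)"
proof -
  have "((\<lambda>t. u (x + P, t)) has_real_derivative q (x, y)) (at y)"
    by (rule has_field_derivative_transform_within_open[OF sol1_derivs(2)[OF s1 y], of "{-R<..<R}"])
      (use per y in auto)
  then show ?thesis by (rule DERIV_unique[OF sol1_derivs(2)[OF s1 y]])
qed

section \<open>Comparison principle\<close>

text \<open>With \<open>d = v\<^sub>1 - v\<^sub>2\<close> and \<open>S\<close> a smooth approximation of the Heaviside function, the equation for \<open>d\<close> is
  multiplied by \<open>(R'\<^sup>2 - y\<^sup>2) S(d)\<close>: the terms with \<open>S'\<close> are nonnegative up to an error that vanishes
  with the smoothing, and what remains is the integral of the positive part of \<open>d\<close>.\<close>

lemma order_principle:
  assumes sol1: "sol2 R a u1 v1 p1 q1 r1 s1" and sol2: "sol2 R a u2 v2 p2 q2 r2 s2"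
    and a: "a \<noteq> 0" and P: "P > 0" and R': "0 < R'" "R' < R"
    and per1: "\<And>x y. \<bar>y\<bar> < R \<Longrightarrow> u1 (x + P, y) = u1 (x, y) \<and> v1 (x + P, y) = v1 (x, y)"
    and per2: "\<And>x y. \<bar>y\<bar> < R \<Longrightarrow> u2 (x + P, y) = u2 (x, y) \<and> v2 (x + P, y) = v2 (x, y)"
    and bd: "\<And>x. v1 (x, R') \<le> v2 (x, R') \<and> v1 (x, -R') \<le> v2 (x, -R')"
    and y: "\<bar>y0\<bar> \<le> R'"
  shows "v1 (x0, y0) \<le> v2 (x0, y0)"
proof -
  define Q where "Q = {x0..x0+P} \<times> {-R'..R'}"
  have Q: "Q \<subseteq> open_strip R" unfolding Q_def by (rule rectangle_subset_open_strip) (use R' in auto)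
  have ins: "\<bar>y\<bar> < R" if "y \<in> {-R'..R'}" for y using that R' by auto
  note S1 = sol2_sol1[OF sol1] and S2 = sol2_sol1[OF sol2]
  note cont = sol1_cont[OF S1 Q] sol2_cont[OF sol1 Q] sol1_cont[OF S2 Q] sol2_cont[OF sol2 Q]
  define d where "d z = v1 z - v2 z" for z
  define k where "k z = q1 z - q2 z" for z
  define p where "p z = p1 z - p2 z" for z
  define r where "r z = r1 z - r2 z" for z
  define dx where "dx z = - 2 * sg a (v1 z) (snd z) * q1 z + 2 * sg a (v2 z) (snd z) * q2 z" for z
  have cd: "continuous_on Q d" "continuous_on Q k" "continuous_on Q p" "continuous_on Q r" "continuous_on Q dx"
    unfolding d_def k_def p_def r_def dx_def by (intro continuous_intros cont)+
  have "compact Q" by (simp add: Q_def compact_Times)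
  then have "bounded (q2 ` Q)" using cont by (intro compact_imp_bounded compact_continuous_image) auto
  then obtain K where K: "\<And>z. z \<in> Q \<Longrightarrow> \<bar>q2 z\<bar> \<le> K" by (auto simp: bounded_iff)
  \<comment> \<open>The 8 is the price of replacing \<open>4 J(d)\<close> by four times the positive
    part of \<open>d\<close>. The rest bounds the cross term caused by the two different
    coefficients.\<close>
  define C where "C = 8 + 2 * R'\<^sup>2 * (K\<^sup>2 / \<bar>a\<bar>)"
  have main: "integral {x0..x0+P} (\<lambda>x. integral {-R'..R'} (\<lambda>y. 4 * max 0 (d (x, y)) - C * e)) \<le> 0"
    if e: "e > 0" for e :: real
  proof -
    \<comment> \<open>Two properties decide the choice. The primitive \<open>J\<close> differs from
      the positive part by at most \<open>2 e\<close>, because \<open>arctan\<close> is bounded, and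
      \<open>S' t * t\<^sup>2 \<le> 2 * e\<close>, so that an error quadratic in \<open>d\<close>
      vanishes with \<open>e\<close>.\<close>
    define S where "S t = (max 0 t)\<^sup>2 / ((max 0 t)\<^sup>2 + e\<^sup>2)" for t
    define S' where "S' t = 2 * (max 0 t) * e\<^sup>2 / ((max 0 t)\<^sup>2 + e\<^sup>2)\<^sup>2" for t
    define J where "J t = max 0 t - e * arctan (max 0 t / e)" for t
    have nz: "t\<^sup>2 + e\<^sup>2 \<noteq> 0" "t\<^sup>2 + e\<^sup>2 > 0" for t using e by (auto simp: add_nonneg_eq_0_iff add_nonneg_pos)
    have dS: "(S has_real_derivative S' t) (at t)" for t
      unfolding S_def S'_def
      by (rule has_real_derivative_max0[of "\<lambda>t. t\<^sup>2 / (t\<^sup>2 + e\<^sup>2)" "\<lambda>t. 2 * t * e\<^sup>2 / (t\<^sup>2 + e\<^sup>2)\<^sup>2"])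
        (use nz in \<open>auto intro!: derivative_eq_intros simp: field_simps power2_eq_square\<close>)
    have dJ: "(J has_real_derivative S t) (at t)" for t
      unfolding S_def J_def
    proof (rule has_real_derivative_max0[of "\<lambda>t. t - e * arctan (t / e)" "\<lambda>t. t\<^sup>2 / (t\<^sup>2 + e\<^sup>2)"])
      fix t :: real
      have 1: "1 + (t / e)\<^sup>2 = (t\<^sup>2 + e\<^sup>2) / e\<^sup>2" using e by (simp add: field_simps)
      have "1 - e\<^sup>2 / (t\<^sup>2 + e\<^sup>2) = t\<^sup>2 / (t\<^sup>2 + e\<^sup>2)" using nz[of t] by (simp add: field_simps)
      then have 2: "1 - e * (inverse (1 + (t / e)\<^sup>2) * (1 / e)) = t\<^sup>2 / (t\<^sup>2 + e\<^sup>2)"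
        using e unfolding 1 by simp
      have "((\<lambda>t. arctan (t / e)) has_real_derivative inverse (1 + (t / e)\<^sup>2) * (1 / e)) (at t)"
        by (rule DERIV_chain2[OF DERIV_arctan]) (use e in \<open>auto intro!: derivative_eq_intros\<close>)
      from DERIV_diff[OF DERIV_ident DERIV_cmult[OF this, of e]]
      show "((\<lambda>t. t - e * arctan (t / e)) has_real_derivative t\<^sup>2 / (t\<^sup>2 + e\<^sup>2)) (at t)"
        unfolding 2 .
    qed auto
    have cS: "continuous_on UNIV S" "continuous_on UNIV S'" "continuous_on UNIV J"
      unfolding S_def S'_def J_def using nz e by (auto intro!: continuous_intros)
    have cSd: "continuous_on Q (\<lambda>z. S (d z))" "continuous_on Q (\<lambda>z. S' (d z))" "continuous_on Q (\<lambda>z. J (d z))"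
      by (rule continuous_on_compose2[OF cS(1) cd(1)] continuous_on_compose2[OF cS(2) cd(1)]
          continuous_on_compose2[OF cS(3) cd(1)]; simp)+
    have S0: "S t = 0" "J t = 0" if "t \<le> 0" for t using that by (auto simp: S_def J_def max_def)
    have S'd: "0 \<le> S' t" "S' t * t\<^sup>2 \<le> 2 * e" for t
    proof -
      show "0 \<le> S' t" by (auto simp: S'_def)
      define m where "m = max 0 t"
      have m: "0 \<le> m" by (simp add: m_def)
      have sq: "2 * (m * e) \<le> m\<^sup>2 + e\<^sup>2" using sum_squares_bound[of m e] by (simp add: mult.assoc)
      have "m * e \<le> m\<^sup>2 + e\<^sup>2" using sq zero_le_power2[of m] zero_le_power2[of e] by linarith
      moreover have "m\<^sup>2 \<le> m\<^sup>2 + e\<^sup>2" by simp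
      ultimately have "(m * e) * m\<^sup>2 \<le> (m\<^sup>2 + e\<^sup>2) * (m\<^sup>2 + e\<^sup>2)" by (intro mult_mono) auto
      then have "2 * e * ((m * e) * m\<^sup>2) \<le> 2 * e * ((m\<^sup>2 + e\<^sup>2) * (m\<^sup>2 + e\<^sup>2))"
        using e by (intro mult_left_mono) auto
      moreover have "2 * e * ((m * e) * m\<^sup>2) = 2 * m * e\<^sup>2 * m\<^sup>2" by (simp add: power2_eq_square)
      ultimately have "2 * m * e\<^sup>2 * m\<^sup>2 \<le> 2 * e * (m\<^sup>2 + e\<^sup>2)\<^sup>2"
        by (simp only: power2_eq_square[of "m\<^sup>2 + e\<^sup>2"])
      then have "S' t * m\<^sup>2 \<le> 2 * e" using nz[of m] unfolding S'_def m_def[symmetric]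
        by (simp add: divide_le_eq)
      moreover have "S' t * t\<^sup>2 = S' t * m\<^sup>2" by (auto simp: S'_def m_def max_def)
      ultimately show "S' t * t\<^sup>2 \<le> 2 * e" by linarith
    qed
    have Jge: "max 0 t - 2 * e \<le> J t" for t
    proof -
      have "arctan (max 0 t / e) \<le> 2" using arctan_ubound[of "max 0 t / e"] pi_less_4 by linarith
      then show ?thesis using e by (simp add: J_def)
    qed
    define Y where "Y z = R'\<^sup>2 - (snd z)\<^sup>2" for z :: "real \<times> real"
    have cY: "continuous_on Q Y" unfolding Y_def by (intro continuous_intros)
    have Y: "0 \<le> Y (x, y)" "Y (x, y) \<le> R'\<^sup>2" if "y \<in> {-R'..R'}" for x y
      using that R' abs_le_square_iff[of y R'] by (auto simp: Y_def)
    define Ax where "Ax z = - 2 * Y z * (S' (d z) * dx z * k z + S (d z) * r z)" for z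
    define By where "By z = 2 * (Y z * (S' (d z) * (p z)\<^sup>2 + S (d z) * r z) + 2 * J (d z))" for z
    have cA: "continuous_on Q Ax" "continuous_on Q By"
      unfolding Ax_def By_def by (intro continuous_intros cd cSd cY)+
    have perq: "k (x0 + P, y) = k (x0, y)" "d (x0 + P, y) = d (x0, y)" if "\<bar>y\<bar> < R" for y
      using sol1_periodic_q[OF S1 _ that, of P x0] sol1_periodic_q[OF S2 _ that, of P x0] per1 per2 that
      by (simp_all add: k_def d_def)
    \<comment> \<open>The extra flux \<open>2 y J(d)\<close> cancels the term created by
      differentiating the weight \<open>Y\<close>, since \<open>J\<close> is a primitive of
      \<open>S\<close>. What it leaves behind is \<open>4 J(d)\<close>, the quantity to be
      bounded.\<close>
    have zero: "integral {x0..x0+P} (\<lambda>x. integral {-R'..R'} (\<lambda>y. Ax (x, y) + By (x, y))) = 0"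
    proof (rule green_rectangle_zero[where A = "\<lambda>z. - 2 * Y z * (S (d z) * k z)"
            and B = "\<lambda>z. 2 * (Y z * (S (d z) * p z) + 2 * snd z * J (d z))"])
      fix x y assume xy: "x \<in> {x0..x0+P}" "y \<in> {-R'..R'}"
      note D = sol1_derivs[OF S1 ins[OF xy(2)], of x] sol2_derivs[OF sol1 ins[OF xy(2)], of x]
        sol1_derivs[OF S2 ins[OF xy(2)], of x] sol2_derivs[OF sol2 ins[OF xy(2)], of x]
      have Dd: "((\<lambda>t. d (t, y)) has_real_derivative dx (x, y)) (at x)"
        "((\<lambda>t. d (x, t)) has_real_derivative p (x, y)) (at y)"
        "((\<lambda>t. k (t, y)) has_real_derivative r (x, y)) (at x)"
        "((\<lambda>t. p (x, t)) has_real_derivative r (x, y)) (at y)"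
        unfolding d_def dx_def p_def k_def r_def by (auto intro!: derivative_eq_intros D)
      show "((\<lambda>t. - 2 * Y (t, y) * (S (d (t, y)) * k (t, y))) has_real_derivative Ax (x, y)) (at x)"
        unfolding Ax_def Y_def by (auto intro!: derivative_eq_intros DERIV_chain2[OF dS] Dd simp: algebra_simps)
      show "((\<lambda>t. 2 * (Y (x, t) * (S (d (x, t)) * p (x, t)) + 2 * snd (x, t) * J (d (x, t)))) has_real_derivative By (x, y)) (at y)"
        unfolding By_def Y_def
        by (auto intro!: derivative_eq_intros DERIV_chain2[OF dS] DERIV_chain2[OF dJ] Dd simp: algebra_simps power2_eq_square)
    next
      fix x assume "x \<in> {x0..x0+P}"
      have "d (x, -R') \<le> 0" "d (x, R') \<le> 0" using bd[of x] by (simp_all add: d_def)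
      then show "2 * (Y (x, -R') * (S (d (x, -R')) * p (x, -R')) + 2 * snd (x, -R') * J (d (x, -R')))
          = 2 * (Y (x, R') * (S (d (x, R')) * p (x, R')) + 2 * snd (x, R') * J (d (x, R')))"
        by (simp add: S0)
    qed (use P R' cA perq ins in \<open>auto simp: Q_def Y_def\<close>)
    have "integral {x0..x0+P} (\<lambda>x. integral {-R'..R'} (\<lambda>y. (\<lambda>z. 4 * max 0 (d z) - C * e) (x, y)))
       \<le> integral {x0..x0+P} (\<lambda>x. integral {-R'..R'} (\<lambda>y. (\<lambda>z. Ax z + By z) (x, y)))"
    proof (rule integral2_mono)
      fix x y assume xy: "x \<in> {x0..x0+P}" "y \<in> {-R'..R'}"
      define z where "z = (x, y)"
      have zQ: "z \<in> Q" using xy by (simp add: z_def Q_def)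
      define s1 where "s1 = sg a (v1 z) y"
      define s2 where "s2 = sg a (v2 z) y"
      have s: "0 < s1" "\<bar>a\<bar> \<le> s1" "\<bar>s1 - s2\<bar> \<le> \<bar>d z\<bar>"
        unfolding s1_def s2_def d_def by (auto intro: sg_pos[OF a] sg_ge_abs_a sg_lipschitz)
      have dxz: "dx z = - 2 * (s1 * q1 z - s2 * q2 z)" by (simp add: dx_def s1_def s2_def z_def)
      \<comment> \<open>The flux difference is \<open>s1 k + (s1 - s2) q2\<close>. Completing the
        square absorbs the mixed term into \<open>s1 k^2\<close>. The remainder is at most
        \<open>d^2 K^2 / |a|\<close>, as \<open>sg\<close> is Lipschitz in \<open>v\<close> and at
        least \<open>|a|\<close>.\<close>
      have "- 2 * dx z * k z = 4 * (s1 * (k z)\<^sup>2 + (s1 - s2) * q2 z * k z)"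
        unfolding dxz k_def by (simp add: algebra_simps power2_eq_square)
      moreover have "4 * (s1 * (k z)\<^sup>2 + (s1 - s2) * q2 z * k z) + (s1 - s2)\<^sup>2 * (q2 z)\<^sup>2 / s1
          = (2 * s1 * k z + (s1 - s2) * q2 z)\<^sup>2 / s1"
        using s by (simp add: field_simps power2_eq_square)
      moreover have "0 \<le> (2 * s1 * k z + (s1 - s2) * q2 z)\<^sup>2 / s1" using s by simp
      ultimately have 1: "- ((s1 - s2)\<^sup>2 * (q2 z)\<^sup>2 / s1) \<le> - 2 * dx z * k z" by linarith
      have "(s1 - s2)\<^sup>2 * (q2 z)\<^sup>2 / s1 \<le> (d z)\<^sup>2 * K\<^sup>2 / \<bar>a\<bar>"
      proof (rule frac_le)
        have "(s1 - s2)\<^sup>2 \<le> (d z)\<^sup>2" using s(3) by (simp add: abs_le_square_iff)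
        moreover have "(q2 z)\<^sup>2 \<le> K\<^sup>2" using K[OF zQ] by (metis abs_le_square_iff abs_ge_self order_trans)
        ultimately show "(s1 - s2)\<^sup>2 * (q2 z)\<^sup>2 \<le> (d z)\<^sup>2 * K\<^sup>2" by (intro mult_mono) auto
      qed (use s a in auto)
      with 1 have 2: "- ((d z)\<^sup>2 * K\<^sup>2 / \<bar>a\<bar>) \<le> - 2 * dx z * k z + 2 * (p z)\<^sup>2"
        using zero_le_power2[of "p z"] by linarith
      have "S' (d z) * (- ((d z)\<^sup>2 * K\<^sup>2 / \<bar>a\<bar>)) \<le> S' (d z) * (- 2 * dx z * k z + 2 * (p z)\<^sup>2)"
        by (rule mult_left_mono[OF 2 S'd(1)])
      moreover have "S' (d z) * (d z)\<^sup>2 * (K\<^sup>2 / \<bar>a\<bar>) \<le> 2 * e * (K\<^sup>2 / \<bar>a\<bar>)"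
        by (rule mult_right_mono[OF S'd(2)]) simp
      ultimately have 3: "- (2 * e * (K\<^sup>2 / \<bar>a\<bar>)) \<le> S' (d z) * (- 2 * dx z * k z + 2 * (p z)\<^sup>2)"
        by (simp add: algebra_simps)
      have Yz: "0 \<le> Y z" "Y z \<le> R'\<^sup>2" using Y[OF xy(2)] by (auto simp: z_def)
      have ke: "0 \<le> 2 * e * (K\<^sup>2 / \<bar>a\<bar>)" using e by simp
      have "Y z * - (2 * e * (K\<^sup>2 / \<bar>a\<bar>)) \<le> Y z * (S' (d z) * (- 2 * dx z * k z + 2 * (p z)\<^sup>2))"
        by (rule mult_left_mono[OF 3 Yz(1)])
      moreover have "Y z * (2 * e * (K\<^sup>2 / \<bar>a\<bar>)) \<le> R'\<^sup>2 * (2 * e * (K\<^sup>2 / \<bar>a\<bar>))"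
        by (rule mult_right_mono[OF Yz(2) ke])
      ultimately have 4: "- (R'\<^sup>2 * (2 * e * (K\<^sup>2 / \<bar>a\<bar>))) \<le> Y z * (S' (d z) * (- 2 * dx z * k z + 2 * (p z)\<^sup>2))"
        by linarith
      have "Ax z + By z = Y z * (S' (d z) * (- 2 * dx z * k z + 2 * (p z)\<^sup>2)) + 4 * J (d z)"
        by (simp add: Ax_def By_def algebra_simps)
      moreover have "C * e = 8 * e + R'\<^sup>2 * (2 * e * (K\<^sup>2 / \<bar>a\<bar>))" by (simp add: C_def algebra_simps)
      ultimately show "4 * max 0 (d (x, y)) - C * e \<le> Ax (x, y) + By (x, y)"
        using 4 Jge[of "d z"] unfolding z_def by linarith
    qed (use cA cd in \<open>auto simp: Q_def intro!: continuous_intros\<close>)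
    then show ?thesis using zero by simp
  qed
  define I where "I = integral {x0..x0+P} (\<lambda>x. integral {-R'..R'} (\<lambda>y. 4 * max 0 (d (x, y))))"
  have cm: "continuous_on ({x0..x0+P} \<times> {-R'..R'}) (\<lambda>z. 4 * max 0 (d z))"
    using cd(1) by (auto simp: Q_def intro!: continuous_intros)
  have lin: "I - C * e * (2 * R' * P) \<le> 0" if e: "e > 0" for e
  proof -
    have "integral {x0..x0+P} (\<lambda>x. integral {-R'..R'} (\<lambda>y. 4 * max 0 (d (x, y)) - C * e))
        = integral {x0..x0+P} (\<lambda>x. integral {-R'..R'} (\<lambda>y. 4 * max 0 (d (x, y))) - integral {-R'..R'} (\<lambda>y. C * e))"
      by (intro integral_cong Henstock_Kurzweil_Integration.integral_diff integrable_continuous_real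
          continuous_on_rectangle_lines(1)[OF cm]) auto
    also have "\<dots> = I - integral {x0..x0+P} (\<lambda>x. integral {-R'..R'} (\<lambda>y. C * e))"
      unfolding I_def
      by (intro Henstock_Kurzweil_Integration.integral_diff integrable_continuous_real
          continuous_on_integral_snd[OF cm]) auto
    finally show ?thesis using main[OF e] R' P by (simp add: algebra_simps)
  qed
  have "I \<le> 0"
  proof (rule ccontr)
    assume "\<not> I \<le> 0"
    then have I: "I > 0" by simp
    have C: "C > 0" unfolding C_def by (intro add_pos_nonneg) auto
    define e where "e = I / (2 * (C * (2 * R' * P)))"
    have "C * (2 * R' * P) > 0" using C R' P by simp
    then have "e > 0" "C * e * (2 * R' * P) = I / 2" using I R' P C by (auto simp: e_def field_simps)
    with lin[of e] I show False by simp
  qed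
  then have "(\<lambda>z. 4 * max 0 (d z)) (x0, y0) = 0"
    by (intro integral2_nonneg_eq_0[OF cm]) (use P R' y in \<open>auto simp: I_def\<close>)
  then show ?thesis by (simp add: d_def)
qed

section \<open>Energy bound\<close>

lemma has_real_derivative_quartic_weight:
  fixes a t :: real
  assumes "a \<noteq> 0"
  shows "((\<lambda>t. (t\<^sup>2 + a\<^sup>2) powr (-1/4)) has_real_derivative
      - (1/2) * t * (t\<^sup>2 + a\<^sup>2) powr (-1/4) / (t\<^sup>2 + a\<^sup>2)) (at t)"
proof -
  have tp: "0 < t\<^sup>2 + a\<^sup>2" using assms by (simp add: add_nonneg_pos)
  have "((\<lambda>t. (t\<^sup>2 + a\<^sup>2) powr (-1/4)) has_real_derivative (-1/4) * (t\<^sup>2 + a\<^sup>2) powr (-1/4 - 1) * (2 * t)) (at t)"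
    by (rule DERIV_chain2[where g = "\<lambda>t. t\<^sup>2 + a\<^sup>2", OF has_real_derivative_powr])
      (use tp in \<open>auto intro!: derivative_eq_intros\<close>)
  moreover have "(t\<^sup>2 + a\<^sup>2) powr (-1/4 - 1) = (t\<^sup>2 + a\<^sup>2) powr (-1/4) / (t\<^sup>2 + a\<^sup>2)"
    using tp by (subst powr_diff) simp
  moreover have "(-1/4) * (z / D) * (2 * t) = - (1/2) * t * z / D" for z D :: real
    by (simp add: field_simps)
  ultimately show ?thesis by (simp only:)
qed

text \<open>Multiplying the equation for \<open>v\<close> by \<open>\<eta>\<^sup>2 \<Phi>(v)\<close> with \<open>\<Phi>(v) = v (v\<^sup>2 + a\<^sup>2)\<^bsup>-1/4\<^esup>\<close> instead of \<open>\<eta>\<^sup>2 v\<close> gains a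
  power of the degenerate weight: \<open>|y|\<^bsup>1/2\<^esup>\<close> in place of \<open>|y|\<close> in front of \<open>(\<partial>u/\<partial>y)\<^sup>2\<close>, and only
  the former has an inverse integrable at \<open>y = 0\<close>.\<close>

lemma energy_bound:
  fixes A M P R R' :: real
  assumes R': "0 < R'" "R' < R" and P: "P > 0"
  shows "\<exists>C>0. \<forall>a u v p q r s c. a \<noteq> 0 \<longrightarrow> \<bar>a\<bar> \<le> A \<longrightarrow> sol2 R a u v p q r s \<longrightarrow>
     (\<forall>x y. \<bar>y\<bar> < R \<longrightarrow> u (x + P, y) = u (x, y) \<and> v (x + P, y) = v (x, y)) \<longrightarrow>
     (\<forall>x y. \<bar>y\<bar> < R \<longrightarrow> \<bar>v (x, y)\<bar> \<le> M) \<longrightarrow>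
     integral {c..c+P} (\<lambda>x. integral {-R'..R'} (\<lambda>y. (p (x, y))\<^sup>2 + sqrt (sg a (v (x, y)) y) * (q (x, y))\<^sup>2)) \<le> C"
proof -
  \<comment> \<open>The cut-off will be the square of \<open>R2^2 - y^2\<close>. It vanishes at
    \<open>|y| = R2\<close> and is at least \<open>h0\<^sup>2\<close> for
    \<open>|y| \<le> R'\<close>.\<close>
  define R2 where "R2 = (R' + R) / 2"
  have R2: "0 < R2" "R2 < R" "R' < R2" using R' by (auto simp: R2_def field_simps)
  define T where "T = M\<^sup>2 + A\<^sup>2 + 1"
  have T: "1 \<le> T" by (simp add: T_def)
  define h0 where "h0 = R2\<^sup>2 - R'\<^sup>2"
  have h0: "0 < h0" using R2 R' by (simp add: h0_def power_strict_mono)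
  \<comment> \<open>\<open>64 * T\<^sup>2 * R\<^sup>2\<close> is the pointwise loss in
    \<open>pw\<close>, \<open>2 * R2 * P\<close> the area of the rectangle,
    \<open>h0\<^sup>2\<close> the lower bound of the cut-off; the 1 ensures positivity.\<close>
  define C where "C = 64 * T\<^sup>2 * R\<^sup>2 * (2 * R2 * P) / h0\<^sup>2 + 1"
  have C: "C > 0" unfolding C_def using R2 P by (intro add_nonneg_pos) auto
  have main: "integral {c..c+P} (\<lambda>x. integral {-R'..R'} (\<lambda>y. (p (x, y))\<^sup>2 + sqrt (sg a (v (x, y)) y) * (q (x, y))\<^sup>2)) \<le> C"
    if a: "a \<noteq> 0" "\<bar>a\<bar> \<le> A" and sol: "sol2 R a u v p q r s"
      and per: "\<forall>x y. \<bar>y\<bar> < R \<longrightarrow> u (x + P, y) = u (x, y) \<and> v (x + P, y) = v (x, y)"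
      and M: "\<forall>x y. \<bar>y\<bar> < R \<longrightarrow> \<bar>v (x, y)\<bar> \<le> M" for a u v p q r s c
  proof -
    define Q where "Q = {c..c+P} \<times> {-R2..R2}"
    have Q: "Q \<subseteq> open_strip R" unfolding Q_def by (rule rectangle_subset_open_strip) (use R2 in auto)
    have ins: "\<bar>y\<bar> < R" if "y \<in> {-R2..R2}" for y using that R2 by auto
    note s1 = sol2_sol1[OF sol]
    note cont = sol1_cont[OF s1 Q] sol2_cont[OF sol Q]
    define w where "w t = (t\<^sup>2 + a\<^sup>2) powr (-1/4)" for t
    define F where "F t = t * w t" for t
    define F' where "F' t = w t * (1 - t\<^sup>2 / (2 * (t\<^sup>2 + a\<^sup>2)))" for t
    have ta: "0 < t\<^sup>2 + a\<^sup>2" for t using a by (simp add: add_nonneg_pos)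
    have wpos: "0 < w t" for t using a by (simp add: w_def)
    have dF: "(F has_real_derivative F' t) (at t)" for t
    proof -
      have dw: "(w has_real_derivative - (1/2) * t * w t / (t\<^sup>2 + a\<^sup>2)) (at t)"
        unfolding w_def by (rule has_real_derivative_quartic_weight[OF a(1)])
      have "((\<lambda>t. t * w t) has_real_derivative 1 * w t + (- (1/2) * t * w t / (t\<^sup>2 + a\<^sup>2)) * t) (at t)"
        by (rule DERIV_mult[OF DERIV_ident dw])
      moreover have "1 * w t + (- (1/2) * t * w t / (t\<^sup>2 + a\<^sup>2)) * t = F' t"
        using ta[of t] by (simp add: F'_def field_simps power2_eq_square)
      ultimately show ?thesis unfolding F_def by (simp only:)
    qed
    have cw: "continuous_on UNIV w" unfolding w_def using a by (auto intro!: continuous_intros)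
    have cF: "continuous_on UNIV F" "continuous_on UNIV F'"
      unfolding F_def F'_def using less_imp_neq[OF ta, symmetric] by (auto intro!: continuous_intros cw simp del: distrib_left_numeral)
    have F'ge: "w t / 2 \<le> F' t" for t
    proof -
      have "t\<^sup>2 / (2 * (t\<^sup>2 + a\<^sup>2)) \<le> 1 / 2" using ta[of t] by (simp add: field_simps)
      then have "w t * (1 / 2) \<le> w t * (1 - t\<^sup>2 / (2 * (t\<^sup>2 + a\<^sup>2)))"
        using wpos[of t] by (intro mult_left_mono) auto
      then show ?thesis by (simp add: F'_def)
    qed
    have cFv: "continuous_on Q (\<lambda>z. F (v z))" "continuous_on Q (\<lambda>z. F' (v z))"
      by (rule continuous_on_compose2[OF cF(1) cont(2)] continuous_on_compose2[OF cF(2) cont(2)]; simp)+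
    have cs: "continuous_on Q (\<lambda>z. sg a (v z) (snd z))" by (intro continuous_intros cont)
    define Y where "Y z = R2\<^sup>2 - (snd z)\<^sup>2" for z :: "real \<times> real"
    have cY: "continuous_on Q Y" unfolding Y_def by (intro continuous_intros)
    define Ax where "Ax z = - ((Y z)\<^sup>2 * (F' (v z) * (- 2 * sg a (v z) (snd z) * q z) * q z + F (v z) * r z))" for z
    define By where "By z = - 4 * snd z * Y z * (F (v z) * p z) + (Y z)\<^sup>2 * (F' (v z) * p z * p z + F (v z) * r z)" for z
    have cA: "continuous_on Q Ax" "continuous_on Q By"
      unfolding Ax_def By_def by (intro continuous_intros cont cFv cs cY)+
    define D where "D z = (p z)\<^sup>2 + sqrt (sg a (v z) (snd z)) * (q z)\<^sup>2" for z
    have cD: "continuous_on Q D" unfolding D_def by (intro continuous_intros cont cs)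
    have perq: "q (c + P, y) = q (c, y)" "v (c + P, y) = v (c, y)" if "\<bar>y\<bar> < R" for y
      using sol1_periodic_q[OF s1 _ that, of P c] per that by auto
    have zero: "integral {c..c+P} (\<lambda>x. integral {-R2..R2} (\<lambda>y. Ax (x, y) + By (x, y))) = 0"
    proof (rule green_rectangle_zero[where A = "\<lambda>z. - ((Y z)\<^sup>2 * (F (v z) * q z))" and B = "\<lambda>z. (Y z)\<^sup>2 * (F (v z) * p z)"])
      fix x y assume xy: "x \<in> {c..c+P}" "y \<in> {-R2..R2}"
      note DD = sol1_derivs[OF s1 ins[OF xy(2)], of x] sol2_derivs[OF sol ins[OF xy(2)], of x]
      show "((\<lambda>t. - ((Y (t, y))\<^sup>2 * (F (v (t, y)) * q (t, y)))) has_real_derivative Ax (x, y)) (at x)"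
        unfolding Ax_def Y_def by (auto intro!: derivative_eq_intros DERIV_chain2[OF dF] DD simp: algebra_simps)
      show "((\<lambda>t. (Y (x, t))\<^sup>2 * (F (v (x, t)) * p (x, t))) has_real_derivative By (x, y)) (at y)"
        unfolding By_def Y_def by (auto intro!: derivative_eq_intros DERIV_chain2[OF dF] DD simp: algebra_simps)
    qed (use P R2 cA perq ins in \<open>auto simp: Q_def Y_def\<close>)
    have pw: "(Y (x, y))\<^sup>2 * D (x, y) - 64 * T\<^sup>2 * R\<^sup>2 \<le> 4 * T * (Ax (x, y) + By (x, y))"
      if xy: "x \<in> {c..c+P}" "y \<in> {-R2..R2}" for x y
    proof -
      define t where "t = v (x, y)"
      define \<sigma> where "\<sigma> = sg a t y"
      define \<eta> where "\<eta> = Y (x, y)"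
      define p' where "p' = p (x, y)"
      define q' where "q' = q (x, y)"
      have \<sigma>: "0 < \<sigma>" unfolding \<sigma>_def by (rule sg_pos[OF a(1)])
      have yR: "y\<^sup>2 \<le> R\<^sup>2" using ins[OF xy(2)] R2 by (simp add: abs_le_square_iff[symmetric])
      have tM: "\<bar>t\<bar> \<le> M" using M ins[OF xy(2)] by (auto simp: t_def)
      then have "t\<^sup>2 \<le> M\<^sup>2" using abs_le_square_iff[of t M] by simp
      moreover have "a\<^sup>2 \<le> A\<^sup>2" using a(2) abs_le_square_iff[of a A] by simp
      ultimately have tT: "t\<^sup>2 + a\<^sup>2 \<le> T" by (simp add: T_def)
      have F'p: "0 < F' t" using F'ge[of t] wpos[of t] by linarith
      have t2w: "t\<^sup>2 * w t \<le> T"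
      proof -
        have "t\<^sup>2 * w t \<le> (t\<^sup>2 + a\<^sup>2) * w t" using wpos[of t] by (intro mult_right_mono) auto
        also have "\<dots> = (t\<^sup>2 + a\<^sup>2) powr (1 + -1/4)"
          using ta[of t] unfolding w_def by (subst powr_add) simp
        also have "\<dots> \<le> T powr (3/4)" using ta[of t] tT by (simp add: powr_mono2)
        also have "\<dots> \<le> T powr 1" using T by (intro powr_mono) auto
        finally show ?thesis using T by simp
      qed
      have FF: "(F t)\<^sup>2 / F' t \<le> 2 * T"
      proof -
        have "(F t)\<^sup>2 / F' t \<le> (F t)\<^sup>2 / (w t / 2)"
          using F'ge[of t] wpos[of t] by (intro divide_left_mono) (auto intro: mult_pos_pos F'p)
        also have "\<dots> = 2 * (t\<^sup>2 * w t)" using wpos[of t] by (simp add: F_def field_simps power2_eq_square)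
        finally show ?thesis using t2w by simp
      qed
      have wT: "1 / T \<le> w t"
      proof -
        have "1 / T = T powr (-1)" using T by (simp add: powr_minus_divide)
        also have "\<dots> \<le> T powr (-1/4)" using T by (intro powr_mono) auto
        also have "\<dots> \<le> w t" unfolding w_def using ta[of t] tT by (intro powr_mono2') auto
        finally show ?thesis .
      qed
      \<comment> \<open>Here the half power is gained: \<open>\<sigma>\<^sup>2\<close> exceeds
        \<open>t\<^sup>2 + a\<^sup>2\<close> by \<open>y\<^sup>2\<close>, so \<open>w t\<close> is
        at least \<open>\<sigma>\<close> to the power -1/2, and \<open>F'\<close> is at least
        \<open>w / 2\<close>.\<close>
      have ws: "sqrt \<sigma> \<le> w t * \<sigma>"
      proof -
        have s4: "\<sigma> powr (-1/2) = (\<sigma>\<^sup>2) powr (-1/4)"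
          using \<sigma> by (simp add: powr_powr flip: powr_numeral)
        have "\<sigma> powr (-1/2) \<le> w t"
          unfolding w_def s4 using ta[of t] by (intro powr_mono2') (auto simp: \<sigma>_def sg_def)
        then have "\<sigma> powr (-1/2) * \<sigma> \<le> w t * \<sigma>" using \<sigma> by (intro mult_right_mono) auto
        moreover have "\<sigma> powr (-1/2) * \<sigma> = \<sigma> powr (-1/2 + 1)" using \<sigma> by (subst powr_add) simp
        moreover have "\<sigma> powr (-1/2 + 1) = sqrt \<sigma>" using \<sigma> by (simp add: powr_half_sqrt)
        ultimately show ?thesis by linarith
      qed
      have sum: "Ax (x, y) + By (x, y) = \<eta>\<^sup>2 * F' t * (2 * \<sigma> * q'\<^sup>2 + p'\<^sup>2) - 4 * y * \<eta> * F t * p'"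
        by (simp add: Ax_def By_def t_def \<sigma>_def \<eta>_def p'_def q'_def algebra_simps power2_eq_square)
      \<comment> \<open>The term from differentiating the cut-off is absorbed into half of the
        \<open>p'\<close> term. The remainder involves only \<open>F^2 / F'\<close>, which is
        bounded by \<open>FF\<close>.\<close>
      have "0 \<le> (\<eta> * F' t * p' - 4 * y * F t)\<^sup>2 / (2 * F' t)" using F'p by simp
      also have "\<dots> = \<eta>\<^sup>2 * F' t * p'\<^sup>2 / 2 - 4 * y * \<eta> * F t * p' + 8 * y\<^sup>2 * ((F t)\<^sup>2 / F' t)"
        using F'p by (simp add: field_simps power2_eq_square)
      finally have 1: "- (8 * y\<^sup>2 * ((F t)\<^sup>2 / F' t)) \<le> \<eta>\<^sup>2 * F' t * p'\<^sup>2 / 2 - 4 * y * \<eta> * F t * p'" by linarith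
      have "y\<^sup>2 * ((F t)\<^sup>2 / F' t) \<le> R\<^sup>2 * (2 * T)" using yR FF F'p by (intro mult_mono) auto
      with 1 have 2: "- (16 * R\<^sup>2 * T) \<le> \<eta>\<^sup>2 * F' t * p'\<^sup>2 / 2 - 4 * y * \<eta> * F t * p'" by linarith
      have "p'\<^sup>2 / (2 * T) + sqrt \<sigma> * q'\<^sup>2 \<le> F' t * (2 * \<sigma> * q'\<^sup>2 + p'\<^sup>2)"
      proof -
        have "sqrt \<sigma> * q'\<^sup>2 \<le> w t * \<sigma> * q'\<^sup>2" by (intro mult_right_mono ws) auto
        moreover have "1 / T * p'\<^sup>2 \<le> w t * p'\<^sup>2" by (intro mult_right_mono wT) auto
        then have "p'\<^sup>2 / (2 * T) \<le> w t * p'\<^sup>2 / 2" by simp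
        ultimately have "p'\<^sup>2 / (2 * T) + sqrt \<sigma> * q'\<^sup>2 \<le> w t * p'\<^sup>2 / 2 + w t * \<sigma> * q'\<^sup>2"
          by (rule add_mono[rotated])
        also have "\<dots> = w t / 2 * (2 * \<sigma> * q'\<^sup>2 + p'\<^sup>2)" by (simp add: field_simps)
        also have "\<dots> \<le> F' t * (2 * \<sigma> * q'\<^sup>2 + p'\<^sup>2)"
          using \<sigma> by (intro mult_right_mono F'ge) auto
        finally show ?thesis .
      qed
      moreover have "D (x, y) / (2 * T) \<le> p'\<^sup>2 / (2 * T) + sqrt \<sigma> * q'\<^sup>2"
      proof -
        have "sqrt \<sigma> * q'\<^sup>2 / (2 * T) \<le> sqrt \<sigma> * q'\<^sup>2 / 1" using T \<sigma> by (intro divide_left_mono) auto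
        then show ?thesis by (simp add: D_def p'_def q'_def \<sigma>_def t_def add_divide_distrib)
      qed
      ultimately have 3: "D (x, y) / (2 * T) \<le> F' t * (2 * \<sigma> * q'\<^sup>2 + p'\<^sup>2)" by linarith
      have "F' t * p'\<^sup>2 / 2 + F' t * (2 * \<sigma> * q'\<^sup>2 + p'\<^sup>2) / 2 \<le> F' t * (2 * \<sigma> * q'\<^sup>2 + p'\<^sup>2)"
        using F'p \<sigma> by (simp add: field_simps)
      then have "\<eta>\<^sup>2 * (F' t * p'\<^sup>2 / 2 + F' t * (2 * \<sigma> * q'\<^sup>2 + p'\<^sup>2) / 2) \<le> \<eta>\<^sup>2 * (F' t * (2 * \<sigma> * q'\<^sup>2 + p'\<^sup>2))"
        by (rule mult_left_mono) simp
      moreover have "\<eta>\<^sup>2 * (D (x, y) / (2 * T)) \<le> \<eta>\<^sup>2 * (F' t * (2 * \<sigma> * q'\<^sup>2 + p'\<^sup>2))"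
        by (rule mult_left_mono[OF 3]) simp
      moreover have "\<eta>\<^sup>2 * (F' t * p'\<^sup>2 / 2 + F' t * (2 * \<sigma> * q'\<^sup>2 + p'\<^sup>2) / 2)
          = \<eta>\<^sup>2 * F' t * p'\<^sup>2 / 2 + \<eta>\<^sup>2 * (F' t * (2 * \<sigma> * q'\<^sup>2 + p'\<^sup>2)) / 2" by (simp add: algebra_simps)
      ultimately have 4: "\<eta>\<^sup>2 * (D (x, y) / (2 * T)) / 2 - 16 * R\<^sup>2 * T \<le> Ax (x, y) + By (x, y)"
        unfolding sum using 2 by (simp add: mult.assoc)
      have "4 * T * (\<eta>\<^sup>2 * (D (x, y) / (2 * T)) / 2 - 16 * R\<^sup>2 * T) \<le> 4 * T * (Ax (x, y) + By (x, y))"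
        using T by (intro mult_left_mono[OF 4]) auto
      moreover have "4 * T * (\<eta>\<^sup>2 * (D (x, y) / (2 * T)) / 2 - 16 * R\<^sup>2 * T) = \<eta>\<^sup>2 * D (x, y) - 64 * T\<^sup>2 * R\<^sup>2"
        using T by (simp add: field_simps power2_eq_square)
      ultimately show ?thesis by (simp add: \<eta>_def)
    qed
    have Dnn: "0 \<le> D z" for z by (simp add: D_def sg_nonneg)
    have "integral {c..c+P} (\<lambda>x. integral {-R2..R2} (\<lambda>y. (\<lambda>z. (Y z)\<^sup>2 * D z - 64 * T\<^sup>2 * R\<^sup>2) (x, y)))
        \<le> integral {c..c+P} (\<lambda>x. integral {-R2..R2} (\<lambda>y. (\<lambda>z. 4 * T * (Ax z + By z)) (x, y)))"
      by (rule integral2_mono) (use pw cA cD cY in \<open>auto simp: Q_def intro!: continuous_intros\<close>)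
    also have "\<dots> = 0" using zero by simp
    finally have le0: "integral {c..c+P} (\<lambda>x. integral {-R2..R2} (\<lambda>y. (Y (x, y))\<^sup>2 * D (x, y) - 64 * T\<^sup>2 * R\<^sup>2)) \<le> 0" by simp
    have cYD: "continuous_on ({c..c+P} \<times> {-R2..R2}) (\<lambda>z. (Y z)\<^sup>2 * D z)"
      using cY cD by (auto simp: Q_def intro!: continuous_intros)
    have "integral {c..c+P} (\<lambda>x. integral {-R2..R2} (\<lambda>y. (Y (x, y))\<^sup>2 * D (x, y) - 64 * T\<^sup>2 * R\<^sup>2))
      = integral {c..c+P} (\<lambda>x. integral {-R2..R2} (\<lambda>y. (Y (x, y))\<^sup>2 * D (x, y)) - integral {-R2..R2} (\<lambda>y. 64 * T\<^sup>2 * R\<^sup>2))"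
      by (intro integral_cong Henstock_Kurzweil_Integration.integral_diff integrable_continuous_real
          continuous_on_rectangle_lines(1)[OF cYD]) auto
    also have "\<dots> = integral {c..c+P} (\<lambda>x. integral {-R2..R2} (\<lambda>y. (Y (x, y))\<^sup>2 * D (x, y)))
        - integral {c..c+P} (\<lambda>x. integral {-R2..R2} (\<lambda>y. 64 * T\<^sup>2 * R\<^sup>2))"
      by (intro Henstock_Kurzweil_Integration.integral_diff integrable_continuous_real
          continuous_on_integral_snd[OF cYD]) auto
    finally have E: "integral {c..c+P} (\<lambda>x. integral {-R2..R2} (\<lambda>y. (Y (x, y))\<^sup>2 * D (x, y))) \<le> 64 * T\<^sup>2 * R\<^sup>2 * (2 * R2 * P)"
      using le0 P R2 by (simp add: algebra_simps)
    have cD': "continuous_on ({c..c+P} \<times> {-R'..R'}) D"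
      by (rule continuous_on_subset[OF cD]) (use R2 in \<open>auto simp: Q_def\<close>)
    have "integral {c..c+P} (\<lambda>x. integral {-R'..R'} (\<lambda>y. D (x, y)))
       \<le> integral {c..c+P} (\<lambda>x. integral {-R2..R2} (\<lambda>y. (Y (x, y))\<^sup>2 * D (x, y)) / h0\<^sup>2)"
    proof (rule integral_le)
      fix x assume x: "x \<in> {c..c+P}"
      have "integral {-R'..R'} (\<lambda>y. D (x, y)) \<le> integral {-R'..R'} (\<lambda>y. (Y (x, y))\<^sup>2 * D (x, y) / h0\<^sup>2)"
      proof (rule integral_le)
        fix y assume y: "y \<in> {-R'..R'}"
        have "y\<^sup>2 \<le> R'\<^sup>2" using y R' by (simp add: abs_le_square_iff[symmetric] abs_le_iff)
        then have "h0 \<le> Y (x, y)" by (simp add: h0_def Y_def)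
        then have "h0\<^sup>2 \<le> (Y (x, y))\<^sup>2" using h0 by (intro power_mono) auto
        then have "h0\<^sup>2 * D (x, y) \<le> (Y (x, y))\<^sup>2 * D (x, y)" by (intro mult_right_mono Dnn)
        then show "D (x, y) \<le> (Y (x, y))\<^sup>2 * D (x, y) / h0\<^sup>2" using h0 by (simp add: field_simps)
      next
        show "(\<lambda>y. D (x, y)) integrable_on {-R'..R'}"
          by (intro integrable_continuous_real continuous_on_rectangle_lines(1)[OF cD' x])
        show "(\<lambda>y. (Y (x, y))\<^sup>2 * D (x, y) / h0\<^sup>2) integrable_on {-R'..R'}"
          using h0 continuous_on_rectangle_lines(1)[OF cD' x]
          by (intro integrable_continuous_real continuous_intros) (auto simp: Y_def intro!: continuous_intros)
      qed
      also have "\<dots> \<le> integral {-R2..R2} (\<lambda>y. (Y (x, y))\<^sup>2 * D (x, y) / h0\<^sup>2)"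
      proof (rule integral_subset_le)
        show "(\<lambda>y. (Y (x, y))\<^sup>2 * D (x, y) / h0\<^sup>2) integrable_on {-R2..R2}"
          using h0 continuous_on_rectangle_lines(1)[OF cYD x]
          by (intro integrable_continuous_real continuous_on_divide continuous_on_const) auto
        show "(\<lambda>y. (Y (x, y))\<^sup>2 * D (x, y) / h0\<^sup>2) integrable_on {-R'..R'}"
          using h0 continuous_on_rectangle_lines(1)[OF cD' x]
          by (intro integrable_continuous_real continuous_intros) (auto simp: Y_def intro!: continuous_intros)
      qed (use R2 Dnn in auto)
      finally show "integral {-R'..R'} (\<lambda>y. D (x, y)) \<le> integral {-R2..R2} (\<lambda>y. (Y (x, y))\<^sup>2 * D (x, y)) / h0\<^sup>2"
        by simp
    qed (use h0 in \<open>auto intro!: integrable_continuous_real continuous_intros continuous_on_integral_snd[OF cD'] continuous_on_integral_snd[OF cYD]\<close>)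
    also have "\<dots> = integral {c..c+P} (\<lambda>x. integral {-R2..R2} (\<lambda>y. (Y (x, y))\<^sup>2 * D (x, y))) / h0\<^sup>2" by simp
    also have "\<dots> \<le> 64 * T\<^sup>2 * R\<^sup>2 * (2 * R2 * P) / h0\<^sup>2" by (intro divide_right_mono E) simp
    also have "\<dots> \<le> C" by (simp add: C_def)
    finally show ?thesis by (simp add: D_def)
  qed
  show ?thesis by (rule exI[of _ C]) (use C main in blast)
qed

section \<open>From averages to pointwise bounds\<close>

text \<open>Chebyshev's inequality. The factor 2 leaves room for a strict contradiction
  \<open>2 * C \<le> C\<close>.\<close>

lemma exists_small_value:
  fixes E :: "real \<Rightarrow> real"
  assumes c: "continuous_on {a..b} E" and nn: "\<And>t. t \<in> {a..b} \<Longrightarrow> 0 \<le> E t"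
    and sub: "a \<le> c" "c + r \<le> b" and r: "r > 0" and C: "integral {a..b} E \<le> C" "C > 0"
  shows "\<exists>t\<in>{c..c+r}. E t \<le> 2 * C / r"
proof (rule ccontr)
  assume "\<not> ?thesis"
  then have big: "2 * C / r \<le> E t" if "t \<in> {c..c+r}" for t using that by force
  have sub': "{c..c+r} \<subseteq> {a..b}" using sub by auto
  have i: "E integrable_on {c..c+r}" "E integrable_on {a..b}"
    using c continuous_on_subset[OF c sub'] by (auto intro: integrable_continuous_real)
  have "2 * C = integral {c..c+r} (\<lambda>t. 2 * C / r)" using r by simp
  also have "\<dots> \<le> integral {c..c+r} E" by (rule integral_le) (use i big in auto)
  also have "\<dots> \<le> integral {a..b} E" by (rule integral_subset_le) (use i sub' nn in auto)
  finally show False using C by simp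
qed

text \<open>If \<open>g\<close> exceeded the bound at a point, the maximum principle would force a curve of large
  values to run from that point to a far away vertical side, while \<open>g\<close> is small on two good
  horizontal lines close to it; crossing from the curve to these lines costs too much energy.\<close>

lemma pointwise_bound_from_averages:
  fixes g :: "real \<Rightarrow> real \<Rightarrow> real" and E E2 :: "real \<Rightarrow> real"
  assumes pos: "\<rho> > 0" "r > 0" "2 * r \<le> \<rho>" "\<delta> > 0" "4 * \<delta> \<le> \<rho>" "\<gamma> > 0" "C > 0" "\<kappa> \<ge> 0"
    and max: "\<And>s1 s2 t1 t2 c s t. \<lbrakk>s0 - \<rho> \<le> s1; s1 < s2; s2 \<le> s0 + \<rho>; t0 - \<rho> \<le> t1; t1 < t2; t2 \<le> t0 + \<rho>;
        \<forall>s\<in>{s1..s2}. g s t1 \<le> c \<and> g s t2 \<le> c; \<forall>t\<in>{t1..t2}. g s1 t \<le> c \<and> g s2 t \<le> c;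
        s \<in> {s1..s2}; t \<in> {t1..t2}\<rbrakk> \<Longrightarrow> g s t \<le> c"
    and E: "continuous_on {t0-\<rho>..t0+\<rho>} E" "\<And>t. t \<in> {t0-\<rho>..t0+\<rho>} \<Longrightarrow> 0 \<le> E t" "integral {t0-\<rho>..t0+\<rho>} E \<le> C"
    and E2: "continuous_on {s0-\<rho>..s0+\<rho>} E2" "\<And>t. t \<in> {s0-\<rho>..s0+\<rho>} \<Longrightarrow> 0 \<le> E2 t" "integral {s0-\<rho>..s0+\<rho>} E2 \<le> C"
    and line: "\<And>s s' t. \<lbrakk>s \<in> {s0-\<rho>..s0+\<rho>}; s' \<in> {s0-\<rho>..s0+\<rho>}; t \<in> {t0-\<rho>..t0+\<rho>}; s \<le> s'; s' - s \<le> \<delta>\<rbrakk>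
        \<Longrightarrow> (g s' t - g s t)\<^sup>2 \<le> \<kappa> * E t"
    and cross: "\<And>s t t'. \<lbrakk>s \<in> {s0-\<rho>..s0+\<rho>}; t \<in> {t0-\<rho>..t0+\<rho>}; t' \<in> {t0-\<rho>..t0+\<rho>}; t \<le> t'\<rbrakk>
        \<Longrightarrow> (g s t' - g s t)\<^sup>2 \<le> (t' - t) * E2 s"
    and avg: "\<And>s t. \<lbrakk>s0 - \<rho> \<le> s; s + \<delta> \<le> s0 + \<rho>; t \<in> {t0-\<rho>..t0+\<rho>}\<rbrakk> \<Longrightarrow> \<exists>s'\<in>{s..s+\<delta>}. g s' t \<le> A"
    and small: "\<kappa> * (2 * C) \<le> \<gamma>\<^sup>2 * r" "32 * r * C \<le> \<rho> * \<gamma>\<^sup>2"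
    and st: "\<bar>s - s0\<bar> \<le> \<rho> / 4" "\<bar>t - t0\<bar> \<le> r"
  shows "g s t \<le> A + 2 * \<gamma>"
proof -
  \<comment> \<open>The rectangle for the maximum principle is thin in the second variable. On the
    lines \<open>t1\<close>, \<open>t2\<close>, where \<open>E\<close> is small, a point with value
    at most \<open>A\<close> lies within distance \<open>\<delta>\<close>, and moving from it costs
    at most \<open>\<gamma>\<close>. On the sides \<open>s1\<close>, \<open>s2\<close>, where
    \<open>E2\<close> is small, crossing the height of at most \<open>4 * r\<close> from such a line
    costs a second \<open>\<gamma>\<close>.\<close>
  obtain t1 where t1: "t1 \<in> {t0-2*r..t0-2*r+r}" "E t1 \<le> 2 * C / r"
    using exists_small_value[OF E(1,2) _ _ pos(2) E(3) pos(7), of "t0-2*r"] pos by auto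
  obtain t2 where t2: "t2 \<in> {t0+r..t0+r+r}" "E t2 \<le> 2 * C / r"
    using exists_small_value[OF E(1,2) _ _ pos(2) E(3) pos(7), of "t0+r"] pos by auto
  have \<rho>4: "0 < \<rho> / 4" using pos by simp
  obtain s1 where s1: "s1 \<in> {s-\<rho>/4..s-\<rho>/4+\<rho>/4}" "E2 s1 \<le> 2 * C / (\<rho> / 4)"
    using exists_small_value[OF E2(1,2) _ _ \<rho>4 E2(3) pos(7), of "s-\<rho>/4"] pos st unfolding abs_le_iff by auto
  obtain s2 where s2: "s2 \<in> {s..s+\<rho>/4}" "E2 s2 \<le> 2 * C / (\<rho> / 4)"
    using exists_small_value[OF E2(1,2) _ _ \<rho>4 E2(3) pos(7), of "s"] pos st unfolding abs_le_iff by auto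
  have rng: "t1 \<in> {t0-\<rho>..t0+\<rho>}" "t2 \<in> {t0-\<rho>..t0+\<rho>}" "s1 \<in> {s0-\<rho>/2..s0+\<rho>/2}" "s2 \<in> {s0-\<rho>/2..s0+\<rho>/2}"
      "t1 < t2" "t \<in> {t1..t2}" "s \<in> {s1..s2}" "t2 - t1 \<le> 4 * r"
    using t1(1) t2(1) s1(1) s2(1) st pos unfolding abs_le_iff by auto
  have good: "g x \<tau> \<le> A + \<gamma>" if x: "x \<in> {s0-\<rho>/2..s0+\<rho>/2}" and \<tau>: "\<tau> \<in> {t0-\<rho>..t0+\<rho>}" "E \<tau> \<le> 2 * C / r" for x \<tau>
  proof -
    obtain x' where x': "x' \<in> {x..x+\<delta>}" "g x' \<tau> \<le> A" using avg[of x \<tau>] x \<tau> pos by auto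
    have "(g x' \<tau> - g x \<tau>)\<^sup>2 \<le> \<kappa> * E \<tau>" by (rule line) (use x x' \<tau> pos in auto)
    also have "\<dots> \<le> \<kappa> * (2 * C / r)" using \<tau> pos by (intro mult_left_mono) auto
    also have "\<dots> \<le> \<gamma>\<^sup>2" using small(1) pos by (simp add: field_simps)
    finally have "\<bar>g x' \<tau> - g x \<tau>\<bar> \<le> \<gamma>" using pos by (simp add: abs_le_square_iff[symmetric])
    then show ?thesis using x' by linarith
  qed
  have side: "g x \<tau> \<le> A + 2 * \<gamma>" if x: "x \<in> {s0-\<rho>/2..s0+\<rho>/2}" "E2 x \<le> 2 * C / (\<rho> / 4)" and \<tau>: "\<tau> \<in> {t1..t2}" for x \<tau>
  proof -
    have xx: "x \<in> {s0-\<rho>..s0+\<rho>}" using x pos by auto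
    have "(g x \<tau> - g x t1)\<^sup>2 \<le> (\<tau> - t1) * E2 x" by (rule cross) (use xx rng \<tau> in auto)
    also have "\<dots> \<le> (4 * r) * (2 * C / (\<rho> / 4))" using \<tau> rng x E2(2)[OF xx] pos by (intro mult_mono) auto
    also have "\<dots> \<le> \<gamma>\<^sup>2" using small(2) pos by (simp add: field_simps)
    finally have "\<bar>g x \<tau> - g x t1\<bar> \<le> \<gamma>" using pos by (simp add: abs_le_square_iff[symmetric])
    then show ?thesis using good[OF x(1) rng(1) t1(2)] by linarith
  qed
  show ?thesis
  proof (cases "s1 < s2")
    case True
    show ?thesis
    proof (rule max[of s1 s2 t1 t2])
      show "\<forall>s\<in>{s1..s2}. g s t1 \<le> A + 2 * \<gamma> \<and> g s t2 \<le> A + 2 * \<gamma>"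
      proof
        fix x assume x: "x \<in> {s1..s2}"
        then have "x \<in> {s0-\<rho>/2..s0+\<rho>/2}" using rng by auto
        then show "g x t1 \<le> A + 2 * \<gamma> \<and> g x t2 \<le> A + 2 * \<gamma>"
          using good[of x t1] good[of x t2] rng t1 t2 pos by force
      qed
    qed (use True rng side[OF rng(3) s1(2)] side[OF rng(4) s2(2)] pos in auto)
  next
    \<comment> \<open>Since \<open>s1 \<le> s \<le> s2\<close>, the rectangle degenerates only if
      \<open>s\<close> itself lies on a good side.\<close>
    case False
    then have "s = s1" using rng by auto
    then show ?thesis using side[OF rng(3) s1(2) rng(6)] by simp
  qed
qed

section \<open>The potential of the difference of two solutions\<close>

text \<open>In terms of \<open>W\<close> the second equation of the system reads \<open>\<partial>W/\<partial>x = -2 \<partial>u/\<partial>y\<close>.\<close>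

definition W :: "real \<Rightarrow> real \<Rightarrow> real \<Rightarrow> real" where
  "W a v y = arsinh (v / sqrt (y\<^sup>2 + a\<^sup>2))"

lemma tau_pos: "a \<noteq> 0 \<Longrightarrow> 0 < y\<^sup>2 + (a::real)\<^sup>2" by (simp add: add_nonneg_pos)

lemma sg_factor:
  assumes "a \<noteq> 0"
  shows "sqrt (y\<^sup>2 + a\<^sup>2) * sqrt ((v / sqrt (y\<^sup>2 + a\<^sup>2))\<^sup>2 + 1) = sg a v y"
proof -
  have "(y\<^sup>2 + a\<^sup>2) * ((v / sqrt (y\<^sup>2 + a\<^sup>2))\<^sup>2 + 1) = v\<^sup>2 + y\<^sup>2 + a\<^sup>2"
    using tau_pos[OF assms, of y] assms by (simp add: power_divide distrib_left)
  then show ?thesis by (simp add: sg_def real_sqrt_mult[symmetric])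
qed

lemma W_has_derivative:
  assumes a: "a \<noteq> 0" and g: "(f has_real_derivative g) (at x)"
  shows "((\<lambda>t. W a (f t) y) has_real_derivative g / sg a (f x) y) (at x)"
proof -
  define \<tau> where "\<tau> = sqrt (y\<^sup>2 + a\<^sup>2)"
  have \<tau>: "\<tau> > 0" using tau_pos[OF a, of y] by (simp add: \<tau>_def)
  have "((\<lambda>t. arsinh (f t / \<tau>)) has_real_derivative 1 / sqrt ((f x / \<tau>)\<^sup>2 + 1) * (g / \<tau>)) (at x)"
    by (rule DERIV_chain2[OF arsinh_real_has_field_derivative]) (use \<tau> g in \<open>auto intro!: derivative_eq_intros\<close>)
  moreover have "1 / sqrt ((f x / \<tau>)\<^sup>2 + 1) * (g / \<tau>) = g / sg a (f x) y"
    using sg_factor[OF a, of y "f x"] by (simp add: \<tau>_def mult.commute)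
  ultimately show ?thesis unfolding W_def \<tau>_def by (simp only:)
qed

lemma continuous_on_W [continuous_intros]:
  assumes "a \<noteq> 0" "continuous_on S f" "continuous_on S g"
  shows "continuous_on S (\<lambda>z. W a (f z) (g z))"
  unfolding W_def using assms(1) 
  by (intro continuous_on_compose2[OF continuous_on_arsinh[of UNIV]] continuous_on_divide continuous_on_real_sqrt continuous_on_add continuous_on_power
      continuous_on_const assms(2,3)) auto

lemma W_monotone:
  assumes "a \<noteq> 0" shows "0 \<le> (v1 - v2) * (W a v1 y - W a v2 y)"
proof -
  have t: "0 < sqrt (y\<^sup>2 + a\<^sup>2)" using tau_pos[OF assms, of y] by simp
  consider "v1 < v2" | "v1 = v2" | "v1 > v2" by linarith
  then show ?thesis
  proof cases
    case 1
    then have "W a v1 y < W a v2 y" using t by (simp add: W_def divide_strict_right_mono)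
    with 1 show ?thesis by (intro mult_nonpos_nonpos) auto
  next
    case 3
    then have "W a v2 y < W a v1 y" using t by (simp add: W_def divide_strict_right_mono)
    with 3 show ?thesis by (intro mult_nonneg_nonneg) auto
  qed simp
qed

lemma arsinh_lipschitz: "\<bar>arsinh x - arsinh y\<bar> \<le> \<bar>x - (y::real)\<bar>"
proof -
  have *: "arsinh y - arsinh x \<le> y - x" if "x < y" for x y :: real
  proof -
    have "\<exists>z>x. z < y \<and> arsinh y - arsinh x = (y - x) * (1 / sqrt (z\<^sup>2 + 1))"
      by (rule MVT2[OF that]) (auto intro!: derivative_eq_intros)
    then obtain z where z: "arsinh y - arsinh x = (y - x) * (1 / sqrt (z\<^sup>2 + 1))" by blast
    have "1 \<le> sqrt (z\<^sup>2 + 1)" by simp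
    then have "1 / sqrt (z\<^sup>2 + 1) \<le> 1" by (subst divide_le_eq_1_pos) linarith+
    then have "(y - x) * (1 / sqrt (z\<^sup>2 + 1)) \<le> (y - x) * 1" using that by (intro mult_left_mono) auto
    then show ?thesis using z by simp
  qed
  consider "x < y" | "x = y" | "y < x" by linarith
  then show ?thesis
  proof cases
    case 1 with *[OF 1] arsinh_real_strict_mono[OF 1] show ?thesis by linarith
  next
    case 3 with *[OF 3] arsinh_real_strict_mono[OF 3] show ?thesis by linarith
  qed simp
qed

lemma W_lipschitz:
  assumes "a \<noteq> 0" shows "\<bar>W a v1 y - W a v2 y\<bar> \<le> \<bar>v1 - v2\<bar> / sqrt (y\<^sup>2 + a\<^sup>2)"
proof -
  have t: "0 < sqrt (y\<^sup>2 + a\<^sup>2)" using tau_pos[OF assms, of y] by simp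
  have "\<bar>v1 / sqrt (y\<^sup>2 + a\<^sup>2) - v2 / sqrt (y\<^sup>2 + a\<^sup>2)\<bar> = \<bar>v1 - v2\<bar> / sqrt (y\<^sup>2 + a\<^sup>2)"
    using t by (simp add: diff_divide_distrib[symmetric] abs_divide)
  then show ?thesis unfolding W_def using arsinh_lipschitz by metis
qed

text \<open>The growth is really logarithmic. The square root is taken because in
  \<open>W_bound\<close> it yields the weight with exponent -1/4, whose second primitive is bounded
  uniformly in \<open>a\<close>.\<close>

lemma arsinh_le_sqrt: "0 \<le> x \<Longrightarrow> arsinh x \<le> 2 * sqrt (2 * (x::real))"
proof -
  assume x: "0 \<le> x"
  have "sqrt (x\<^sup>2 + 1) \<le> x + 1" by (rule real_le_lsqrt) (use x in \<open>auto simp: power2_eq_square algebra_simps\<close>)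
  then have "arsinh x \<le> ln (1 + 2 * x)"
    unfolding arsinh_real_def using arsinh_real_aux[of x] x by (subst ln_le_cancel_iff) auto
  also have "\<dots> = 2 * ln (sqrt (1 + 2 * x))" using x by (simp add: ln_sqrt)
  also have "\<dots> \<le> 2 * (sqrt (1 + 2 * x) - 1)" using x ln_le_minus_one[of "sqrt (1 + 2 * x)"] by simp
  also have "\<dots> \<le> 2 * sqrt (2 * x)" using sqrt_add_le_add_sqrt[of 1 "2 * x"] x by simp
  finally show ?thesis .
qed

lemma W_bound:
  assumes a: "a \<noteq> 0" and v: "\<bar>v\<bar> \<le> M"
  shows "\<bar>W a v y\<bar> \<le> 2 * sqrt (2 * M) * (y\<^sup>2 + a\<^sup>2) powr (-1/4)"
proof -
  define \<tau> where "\<tau> = sqrt (y\<^sup>2 + a\<^sup>2)"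
  have \<tau>: "\<tau> > 0" using tau_pos[OF a, of y] by (simp add: \<tau>_def)
  have "\<bar>W a v y\<bar> = arsinh (\<bar>v\<bar> / \<tau>)"
  proof (cases "0 \<le> v")
    case True
    then have "0 \<le> v / \<tau>" using \<tau> by simp
    then have "0 \<le> arsinh (v / \<tau>)" using arsinh_real_neg_iff[of "v / \<tau>"] by linarith
    then show ?thesis using True by (simp add: W_def \<tau>_def)
  next
    case False
    then have "v / \<tau> < 0" using \<tau> by (simp add: divide_neg_pos)
    then have "arsinh (v / \<tau>) < 0" by simp
    then have "\<bar>arsinh (v / \<tau>)\<bar> = - arsinh (v / \<tau>)" by (rule abs_of_neg)
    moreover have "arsinh (\<bar>v\<bar> / \<tau>) = - arsinh (v / \<tau>)" using False by simp
    ultimately show ?thesis by (simp only: W_def \<tau>_def)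
  qed
  also have "\<dots> \<le> 2 * sqrt (2 * (\<bar>v\<bar> / \<tau>))" by (rule arsinh_le_sqrt) (use \<tau> in simp)
  also have "\<dots> \<le> 2 * sqrt (2 * (M / \<tau>))" using v \<tau> by (simp add: divide_right_mono)
  also have "\<dots> = 2 * sqrt (2 * M) * (1 / sqrt \<tau>)" by (simp add: real_sqrt_mult real_sqrt_divide)
  also have "1 / sqrt \<tau> = (y\<^sup>2 + a\<^sup>2) powr (-1/4)"
  proof -
    have "sqrt \<tau> = (y\<^sup>2 + a\<^sup>2) powr (1/4)"
      using tau_pos[OF a, of y] by (simp add: \<tau>_def powr_half_sqrt[symmetric] powr_powr)
    then show ?thesis using powr_minus_divide[of "y\<^sup>2 + a\<^sup>2" "1/4"] by simp
  qed
  finally show ?thesis .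
qed

section \<open>Existence and size of the potential\<close>

lemma continuous_on_Times_lipschitz:
  fixes h :: "real \<times> real \<Rightarrow> real"
  assumes lip: "\<And>x y y'. x \<in> A \<Longrightarrow> y \<in> B \<Longrightarrow> y' \<in> B \<Longrightarrow> \<bar>h (x, y) - h (x, y')\<bar> \<le> K * \<bar>y - y'\<bar>"
    and c: "\<And>y. y \<in> B \<Longrightarrow> continuous_on A (\<lambda>x. h (x, y))"
  shows "continuous_on (A \<times> B) h"
  unfolding continuous_on_def
proof
  fix z0 assume z0: "z0 \<in> A \<times> B"
  obtain x0 y0 where z0e: "z0 = (x0, y0)" by (cases z0)
  have "continuous_on (A \<times> B) (\<lambda>z. h (fst z, y0))"
    by (rule continuous_on_compose2[OF c]) (use z0 z0e in \<open>auto intro!: continuous_intros\<close>)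
  then have t1: "((\<lambda>z. h (fst z, y0)) \<longlongrightarrow> h (x0, y0)) (at z0 within A \<times> B)"
    using z0 z0e unfolding continuous_on_def by fastforce
  have "((\<lambda>z. K * \<bar>snd z - y0\<bar>) \<longlongrightarrow> K * \<bar>snd z0 - y0\<bar>) (at z0 within A \<times> B)"
    by (intro tendsto_intros)
  then have t3: "((\<lambda>z. K * \<bar>snd z - y0\<bar>) \<longlongrightarrow> 0) (at z0 within A \<times> B)" using z0e by simp
  have t2: "((\<lambda>z. h z - h (fst z, y0)) \<longlongrightarrow> 0) (at z0 within A \<times> B)"
    by (rule Lim_null_comparison[OF _ t3])
      (use z0 z0e lip in \<open>auto simp: eventually_at_filter intro!: always_eventually\<close>)
  show "(h \<longlongrightarrow> h z0) (at z0 within A \<times> B)"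
    using tendsto_add[OF t1 t2] z0e by simp
qed

text \<open>Poincare's lemma for the form \<open>d dx + k dy\<close>, integrated along a horizontal
  and then a vertical segment. For \<open>d = v1 - v2\<close> and \<open>k = u1 - u2\<close>
  closedness is the first equation of the system.\<close>

lemma potential_exists:
  assumes ck: "continuous_on (open_strip R) k" and cd: "continuous_on (open_strip R) d"
    and cm: "continuous_on (open_strip R) m"
    and dk: "\<And>x y. \<bar>y\<bar> < R \<Longrightarrow> ((\<lambda>t. k (t, y)) has_real_derivative m (x, y)) (at x)"
    and dd: "\<And>x y. \<bar>y\<bar> < R \<Longrightarrow> ((\<lambda>t. d (x, t)) has_real_derivative m (x, y)) (at y)"
    and R1: "0 < R1" "R1 < R" and L1: "0 < L1"
  shows "\<exists>h. (\<forall>x y. \<bar>x\<bar> < L1 \<longrightarrow> \<bar>y\<bar> < R1 \<longrightarrow>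
      ((\<lambda>t. h (t, y)) has_real_derivative d (x, y)) (at x) \<and>
      ((\<lambda>t. h (x, t)) has_real_derivative k (x, y)) (at y)) \<and>
      continuous_on ({-L1<..<L1} \<times> {-R1<..<R1}) h"
proof -
  define h where "h z = integral {-R1..snd z} (\<lambda>t. k (fst z, t)) + integral {-L1..fst z} (\<lambda>t. d (t, -R1))"
    for z :: "real \<times> real"
  have sub: "X \<times> {-R1..R1} \<subseteq> open_strip R" for X
    by (rule rectangle_subset_open_strip) (use R1 in auto)
  note c = continuous_on_subset[OF ck sub] continuous_on_subset[OF cd sub] continuous_on_subset[OF cm sub]
  have cX: "continuous_on X (\<lambda>x. d (x, y))" "continuous_on X (\<lambda>x. k (x, y))" if "\<bar>y\<bar> \<le> R1" for X y
    using continuous_on_rectangle_lines(2)[OF c(2)] continuous_on_rectangle_lines(2)[OF c(1)] that by (auto simp: abs_le_iff)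
  have cY: "continuous_on {-R1..R1} (\<lambda>y. k (x, y))" for x
    by (rule continuous_on_rectangle_lines(1)[OF c(1), of x UNIV]) simp
  have hx: "((\<lambda>t. h (t, y)) has_real_derivative d (x, y)) (at x)" if x: "\<bar>x\<bar> < L1" and y: "\<bar>y\<bar> < R1" for x y
  proof -
    have sy: "{-R1..y} \<subseteq> {-R1..R1}" using y by auto
    have 1: "((\<lambda>x. integral {-R1..y} (\<lambda>t. k (x, t))) has_real_derivative integral {-R1..y} (\<lambda>t. m (x, t))) (at x)"
    proof (rule has_real_derivative_integral_snd[where c = "-L1" and d = L1])
      show "continuous_on ({-L1<..<L1} \<times> {-R1..y}) m"
        by (rule continuous_on_subset[OF c(3)]) (use sy in auto)
    qed (use x y R1 dk in \<open>auto intro!: continuous_on_subset[OF cY sy]\<close>)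
    have 2: "integral {-R1..y} (\<lambda>t. m (x, t)) = d (x, y) - d (x, -R1)"
      by (rule integral_real_derivative) (use y R1 dd in auto)
    have "((\<lambda>x. integral {-L1..x} (\<lambda>t. d (t, -R1))) has_real_derivative d (x, -R1)) (at x within {-L1..L1})"
      by (rule integral_has_real_derivative) (use x R1 cX in auto)
    then have 3: "((\<lambda>x. integral {-L1..x} (\<lambda>t. d (t, -R1))) has_real_derivative d (x, -R1)) (at x)"
      using x by (simp add: at_within_Icc_at abs_less_iff)
    show ?thesis unfolding h_def using DERIV_add[OF 1 3] 2 by simp
  qed
  have hy: "((\<lambda>t. h (x, t)) has_real_derivative k (x, y)) (at y)" if y: "\<bar>y\<bar> < R1" for x y
  proof -
    have "((\<lambda>y. integral {-R1..y} (\<lambda>t. k (x, t))) has_real_derivative k (x, y)) (at y within {-R1..R1})"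
      by (rule integral_has_real_derivative) (use y cY in auto)
    then have 3: "((\<lambda>y. integral {-R1..y} (\<lambda>t. k (x, t))) has_real_derivative k (x, y)) (at y)"
      using y by (simp add: at_within_Icc_at abs_less_iff)
    show ?thesis unfolding h_def by (auto intro!: derivative_eq_intros 3)
  qed
  have "compact ({-L1..L1} \<times> {-R1..R1})" by (simp add: compact_Times)
  then have "bounded (k ` ({-L1..L1} \<times> {-R1..R1}))"
    by (intro compact_imp_bounded compact_continuous_image c)
  then obtain K where K: "\<And>z. z \<in> {-L1..L1} \<times> {-R1..R1} \<Longrightarrow> \<bar>k z\<bar> \<le> K" by (auto simp: bounded_iff)
  have "continuous_on ({-L1<..<L1} \<times> {-R1<..<R1}) h"
  proof (rule continuous_on_Times_lipschitz)
    fix x y y' assume xy: "x \<in> {-L1<..<L1}" "y \<in> {-R1<..<R1}" "y' \<in> {-R1<..<R1}"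
    have "norm (h (x, y) - h (x, y')) \<le> K * norm (y - y')"
    proof (rule field_differentiable_bound[of "{-R1<..<R1}" "\<lambda>t. h (x, t)" "\<lambda>t. k (x, t)"])
      show "((\<lambda>t. h (x, t)) has_real_derivative k (x, z)) (at z within {-R1<..<R1})" if "z \<in> {-R1<..<R1}" for z
        using hy[of z x] that by (auto intro: has_field_derivative_at_within)
    qed (use xy K in auto)
    then show "\<bar>h (x, y) - h (x, y')\<bar> \<le> K * \<bar>y - y'\<bar>" by simp
  next
    fix y assume "y \<in> {-R1<..<R1}"
    then show "continuous_on {-L1<..<L1} (\<lambda>x. h (x, y))"
      by (intro DERIV_continuous_on[OF has_field_derivative_at_within[OF hx]]) auto
  qed
  then show ?thesis using hx hy by blast
qed

text \<open>Let \<open>e\<close> be the difference of the values of \<open>W\<close>. In the second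
  \<open>y\<close>-derivative of the weighted square of \<open>h\<close>, integration by parts in
  \<open>x\<close> produces \<open>d e\<close>, which has a sign by \<open>W_monotone\<close>, and a
  cut-off term of order \<open>1/L\<close> times \<open>e\<close>. Neither solution is assumed
  periodic, hence the long interval. The parameters \<open>a\<close> and \<open>b\<close> may
  differ; the resulting defect is what \<open>err\<close> bounds.\<close>

lemma potential_L2_estimate:
  fixes A M L R R' \<epsilon> :: real
  defines "\<Lambda> \<equiv> 4 * sqrt (2 * M)" and "T \<equiv> R\<^sup>2 + A\<^sup>2 + 1"
  assumes S1: "sol1 R a u1 v1 p1 q1" and S2: "sol1 R b u2 v2 p2 q2"
    and a: "a \<noteq> 0" "\<bar>a\<bar> \<le> A" and L: "0 < L" and R': "0 < R'" "R' < R" and \<epsilon>: "0 \<le> \<epsilon>"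
    and M: "\<And>x y. \<bar>y\<bar> < R \<Longrightarrow> \<bar>v1 (x, y)\<bar> \<le> M \<and> \<bar>v2 (x, y)\<bar> \<le> M"
    and bd: "\<And>x. \<bar>x\<bar> \<le> L \<Longrightarrow> \<bar>v1 (x, R') - v2 (x, R')\<bar> \<le> \<epsilon> \<and> \<bar>v1 (x, -R') - v2 (x, -R')\<bar> \<le> \<epsilon>"
    and err: "\<And>x y. \<bar>x\<bar> \<le> L \<Longrightarrow> \<bar>y\<bar> \<le> R' \<Longrightarrow>
        \<bar>q2 (x, y) * (1 - sg b (v2 (x, y)) y / sg a (v2 (x, y)) y)\<bar> \<le> \<epsilon>"
    and \<theta>: "\<theta> = 8 / 3 * \<Lambda> * T / sqrt L + \<epsilon> * sqrt L * R\<^sup>2 / 2" "\<theta> \<le> 1 / 2"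
  shows "\<exists>h \<gamma>. (\<forall>x y. \<bar>x\<bar> \<le> L \<longrightarrow> \<bar>y\<bar> \<le> R' \<longrightarrow>
      ((\<lambda>t. h (t, y)) has_real_derivative v1 (x, y) - v2 (x, y)) (at x) \<and>
      ((\<lambda>t. h (x, t)) has_real_derivative u1 (x, y) - u2 (x, y) - \<gamma>) (at y)) \<and>
      (\<forall>y. \<bar>y\<bar> \<le> R' \<longrightarrow> integral {-L..L} (\<lambda>x. (1 - x\<^sup>2 / L\<^sup>2)\<^sup>2 * (h (x, y))\<^sup>2) \<le> 4 * \<epsilon>\<^sup>2 * L^3 + 4 * \<theta>)"
proof -
  define R2 where "R2 = (R' + R) / 2"
  have R2: "0 < R2" "R2 < R" "R' < R2" using R' by (auto simp: R2_def field_simps)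
  have os: "open_strip R \<subseteq> open_strip R" by simp
  note c1 = sol1_cont[OF S1 os] and c2 = sol1_cont[OF S2 os]
  have "\<exists>h. (\<forall>x y. \<bar>x\<bar> < L + 1 \<longrightarrow> \<bar>y\<bar> < R2 \<longrightarrow>
      ((\<lambda>t. h (t, y)) has_real_derivative v1 (x, y) - v2 (x, y)) (at x) \<and>
      ((\<lambda>t. h (x, t)) has_real_derivative u1 (x, y) - u2 (x, y)) (at y)) \<and>
      continuous_on ({-(L+1)<..<L+1} \<times> {-R2<..<R2}) h"
    by (rule potential_exists[of R "\<lambda>z. u1 z - u2 z" "\<lambda>z. v1 z - v2 z" "\<lambda>z. p1 z - p2 z"])
      (use L R2 in \<open>auto intro!: continuous_intros c1 c2 derivative_intros sol1_derivs[OF S1] sol1_derivs[OF S2]\<close>)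
  then obtain h0 where
    h0x: "\<And>x y. \<bar>x\<bar> < L + 1 \<Longrightarrow> \<bar>y\<bar> < R2 \<Longrightarrow> ((\<lambda>t. h0 (t, y)) has_real_derivative v1 (x, y) - v2 (x, y)) (at x)"
    and h0y: "\<And>x y. \<bar>x\<bar> < L + 1 \<Longrightarrow> \<bar>y\<bar> < R2 \<Longrightarrow> ((\<lambda>t. h0 (x, t)) has_real_derivative u1 (x, y) - u2 (x, y)) (at y)"
    and ch0: "continuous_on ({-(L+1)<..<L+1} \<times> {-R2<..<R2}) h0" by blast
  \<comment> \<open>\<open>h0\<close> may be changed by a constant and by a multiple of
    \<open>y\<close>, the latter shifting \<open>u1 - u2\<close> by a constant. These two freedoms
    make \<open>h\<close> vanish at both points \<open>(0, R')\<close> and \<open>(0, -R')\<close>,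
    so that closeness of the boundary values bounds \<open>h\<close> on the two edges.\<close>
  define \<gamma> where "\<gamma> = (h0 (0, R') - h0 (0, -R')) / (2 * R')"
  define h where "h z = h0 z - h0 (0, R') + \<gamma> * R' - \<gamma> * snd z" for z
  define d where "d z = v1 z - v2 z" for z
  define k where "k z = u1 z - u2 z - \<gamma>" for z
  define dq where "dq z = q1 z - q2 z" for z
  have hx: "((\<lambda>t. h (t, y)) has_real_derivative d (x, y)) (at x)" if "\<bar>x\<bar> < L + 1" "\<bar>y\<bar> < R2" for x y
    unfolding h_def d_def by (auto intro!: derivative_eq_intros h0x that)
  have hy: "((\<lambda>t. h (x, t)) has_real_derivative k (x, y)) (at y)" if "\<bar>x\<bar> < L + 1" "\<bar>y\<bar> < R2" for x y
    unfolding h_def k_def by (auto intro!: derivative_eq_intros h0y that)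
  have ky: "((\<lambda>t. k (x, t)) has_real_derivative dq (x, y)) (at y)" if "\<bar>y\<bar> < R2" for x y
    unfolding k_def dq_def using that R2
    by (auto intro!: derivative_eq_intros sol1_derivs[OF S1] sol1_derivs[OF S2])
  have hbd: "h (0, R') = 0" "h (0, -R') = 0"
    using R' by (auto simp: h_def \<gamma>_def field_simps)
  define Q where "Q = {-L..L} \<times> {-R2<..<R2}"
  have QO: "Q \<subseteq> open_strip R" using R2 by (auto simp: Q_def open_strip_def)
  have ch: "continuous_on Q h"
    unfolding h_def by (intro continuous_intros continuous_on_subset[OF ch0]) (use L in \<open>auto simp: Q_def\<close>)
  note cc1 = sol1_cont[OF S1 QO] and cc2 = sol1_cont[OF S2 QO]
  have cQ: "continuous_on Q d" "continuous_on Q k" "continuous_on Q dq"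
    unfolding d_def k_def dq_def by (intro continuous_intros cc1 cc2)+
  have cL: "continuous_on {-L..L} (\<lambda>x. f (x, y))" if "continuous_on Q f" "\<bar>y\<bar> < R2" for f :: "real \<times> real \<Rightarrow> real" and y
    using continuous_on_rectangle_lines(2)[of "{-L..L}" "{-R2<..<R2}" f y] that by (auto simp: Q_def abs_less_iff)
  define \<kappa> where "\<kappa> x = 1 - x\<^sup>2 / L\<^sup>2" for x
  have \<kappa>: "0 \<le> \<kappa> x" "\<kappa> x \<le> 1" if "x \<in> {-L..L}" for x
  proof -
    have "x\<^sup>2 \<le> L\<^sup>2" using that L by (simp add: abs_le_square_iff[symmetric] abs_le_iff)
    then show "0 \<le> \<kappa> x" "\<kappa> x \<le> 1" using L by (auto simp: \<kappa>_def)
  qed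
  have ck: "continuous_on X \<kappa>" for X unfolding \<kappa>_def using L by (intro continuous_intros) auto
  have d\<kappa>: "(\<kappa> has_real_derivative - 2 * x / L\<^sup>2) (at x)" for x
    unfolding \<kappa>_def divide_inverse by (auto intro!: derivative_eq_intros)
  define m where "m y = integral {-L..L} (\<lambda>x. (\<kappa> x)\<^sup>2 * (h (x, y))\<^sup>2)" for y
  define m1 where "m1 y = integral {-L..L} (\<lambda>x. (\<kappa> x)\<^sup>2 * (2 * h (x, y) * k (x, y)))" for y
  define m2 where "m2 y = integral {-L..L} (\<lambda>x. (\<kappa> x)\<^sup>2 * (2 * (k (x, y))\<^sup>2 + 2 * h (x, y) * dq (x, y)))" for y
  have ckQ: "continuous_on Q (\<lambda>z. \<kappa> (fst z))"
    by (rule continuous_on_compose2[OF ck[of UNIV]]) (auto intro!: continuous_intros)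
  have dm: "(m has_real_derivative m1 y) (at y)" if y: "\<bar>y\<bar> < R2" for y
  proof -
    have "((\<lambda>y. integral {-L..L} (\<lambda>x. (\<lambda>z. (\<kappa> (fst z))\<^sup>2 * (h z)\<^sup>2) (x, y))) has_real_derivative
        integral {-L..L} (\<lambda>x. (\<lambda>z. (\<kappa> (fst z))\<^sup>2 * (2 * h z * k z)) (x, y))) (at y)"
    proof (rule has_real_derivative_integral_fst[where c = "-R2" and d = R2])
      fix x y assume xy: "y \<in> {-R2<..<R2}" "x \<in> {-L..L}"
      show "((\<lambda>t. (\<lambda>z. (\<kappa> (fst z))\<^sup>2 * (h z)\<^sup>2) (x, t)) has_real_derivative
          (\<lambda>z. (\<kappa> (fst z))\<^sup>2 * (2 * h z * k z)) (x, y)) (at y)"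
        using hy[of x y] xy by (auto intro!: derivative_eq_intros simp: abs_less_iff algebra_simps)
    next
      fix y assume "y \<in> {-R2<..<R2}"
      then show "continuous_on {-L..L} (\<lambda>x. (\<lambda>z. (\<kappa> (fst z))\<^sup>2 * (h z)\<^sup>2) (x, y))"
        using cL[OF ch, of y] by (auto intro!: continuous_intros ck)
    next
      show "continuous_on ({-L..L} \<times> {-R2<..<R2}) (\<lambda>z. (\<kappa> (fst z))\<^sup>2 * (2 * h z * k z))"
        using ch cQ ckQ unfolding Q_def by (intro continuous_intros) auto
    qed (use y in auto)
    then show ?thesis by (simp add: m_def[abs_def] m1_def)
  qed
  have dm1: "(m1 has_real_derivative m2 y) (at y)" if y: "\<bar>y\<bar> < R2" for y
  proof -
    have "((\<lambda>y. integral {-L..L} (\<lambda>x. (\<lambda>z. (\<kappa> (fst z))\<^sup>2 * (2 * h z * k z)) (x, y))) has_real_derivative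
        integral {-L..L} (\<lambda>x. (\<lambda>z. (\<kappa> (fst z))\<^sup>2 * (2 * (k z)\<^sup>2 + 2 * h z * dq z)) (x, y))) (at y)"
    proof (rule has_real_derivative_integral_fst[where c = "-R2" and d = R2])
      fix x y assume xy: "y \<in> {-R2<..<R2}" "x \<in> {-L..L}"
      show "((\<lambda>t. (\<lambda>z. (\<kappa> (fst z))\<^sup>2 * (2 * h z * k z)) (x, t)) has_real_derivative
          (\<lambda>z. (\<kappa> (fst z))\<^sup>2 * (2 * (k z)\<^sup>2 + 2 * h z * dq z)) (x, y)) (at y)"
        using hy[of x y] ky[of y x] xy
        by (auto intro!: derivative_eq_intros simp: abs_less_iff algebra_simps power2_eq_square)
    next
      fix y assume "y \<in> {-R2<..<R2}"
      then show "continuous_on {-L..L} (\<lambda>x. (\<lambda>z. (\<kappa> (fst z))\<^sup>2 * (2 * h z * k z)) (x, y))"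
        using cL[OF ch, of y] cL[OF cQ(2), of y] by (auto intro!: continuous_intros ck)
    next
      show "continuous_on ({-L..L} \<times> {-R2<..<R2}) (\<lambda>z. (\<kappa> (fst z))\<^sup>2 * (2 * (k z)\<^sup>2 + 2 * h z * dq z))"
        using ch cQ ckQ unfolding Q_def by (intro continuous_intros) auto
    qed (use y in auto)
    then show ?thesis by (simp add: m1_def[abs_def] m2_def)
  qed
  have M0: "0 \<le> M" using M[of 0 0] R' by force
  define l where "l = sqrt L"
  have l: "0 < l" "l * l = L" using L by (auto simp: l_def)
  define w where "w y = (y\<^sup>2 + a\<^sup>2) powr (-1/4)" for y
  have w0: "0 \<le> w y" for y by (simp add: w_def)
  have \<Lambda>0: "0 \<le> \<Lambda>" using M0 by (simp add: \<Lambda>_def)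
  have m2_ge: "- (2 * \<Lambda> * w y / l + \<epsilon> * l) * (m y + 2) \<le> m2 y" if y: "\<bar>y\<bar> \<le> R'" for y
  proof -
    have yR: "\<bar>y\<bar> < R" "\<bar>y\<bar> < R2" using y R' R2 by auto
    define e where "e x = W a (v1 (x, y)) y - W a (v2 (x, y)) y" for x
    \<comment> \<open>The defect: the second solution carries the coefficient \<open>sg b\<close>,
      while differentiating \<open>W a\<close> divides by \<open>sg a\<close>.\<close>
    define Er where "Er x = q2 (x, y) * (1 - sg b (v2 (x, y)) y / sg a (v2 (x, y)) y)" for x
    define ex where "ex x = - 2 * dq (x, y) - 2 * Er x" for x
    have sga: "0 < sg a t y" for t by (rule sg_pos[OF a(1)])
    have de: "(e has_real_derivative ex x) (at x)" for x
    proof -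
      have "(e has_real_derivative - 2 * sg a (v1 (x, y)) y * q1 (x, y) / sg a (v1 (x, y)) y
          - - 2 * sg b (v2 (x, y)) y * q2 (x, y) / sg a (v2 (x, y)) y) (at x)"
        unfolding e_def by (intro derivative_intros W_has_derivative a sol1_derivs(3)[OF S1 yR(1)] sol1_derivs(3)[OF S2 yR(1)])
      moreover have "- 2 * sg a (v1 (x, y)) y * q1 (x, y) / sg a (v1 (x, y)) y
          - - 2 * sg b (v2 (x, y)) y * q2 (x, y) / sg a (v2 (x, y)) y = ex x"
        using sga[of "v1 (x, y)"] sga[of "v2 (x, y)"] unfolding ex_def Er_def dq_def
        by (simp add: field_simps)
      ultimately show ?thesis by (simp only:)
    qed
    have cl: "continuous_on {-L..L} (\<lambda>x. h (x, y))" "continuous_on {-L..L} (\<lambda>x. d (x, y))"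
      "continuous_on {-L..L} (\<lambda>x. k (x, y))" "continuous_on {-L..L} (\<lambda>x. dq (x, y))"
      "continuous_on {-L..L} (\<lambda>x. q2 (x, y))" "continuous_on {-L..L} (\<lambda>x. v2 (x, y))"
      using cL[OF ch yR(2)] cL[OF cQ(1) yR(2)] cL[OF cQ(2) yR(2)] cL[OF cQ(3) yR(2)]
        cL[OF cc2(4) yR(2)] cL[OF cc2(2) yR(2)] by auto
    have cEr: "continuous_on {-L..L} Er"
      unfolding Er_def using sga by (intro continuous_intros cl) (auto simp: less_imp_neq[symmetric])
    have cex: "continuous_on {-L..L} ex" unfolding ex_def by (intro continuous_intros cl cEr)
    have ce: "continuous_on {-L..L} e" by (rule DERIV_continuous_on[OF has_field_derivative_at_within[OF de]])
    have ibp: "integral {-L..L} (\<lambda>x. ((\<kappa> x)\<^sup>2 * h (x, y)) * ex x)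
        = - integral {-L..L} (\<lambda>x. (2 * \<kappa> x * (- 2 * x / L\<^sup>2) * h (x, y) + (\<kappa> x)\<^sup>2 * d (x, y)) * e x)"
    proof (rule integral_by_parts_vanishing)
      fix x assume "x \<in> {-L..L}"
      then show "((\<lambda>x. (\<kappa> x)\<^sup>2 * h (x, y)) has_real_derivative
          2 * \<kappa> x * (- 2 * x / L\<^sup>2) * h (x, y) + (\<kappa> x)\<^sup>2 * d (x, y)) (at x)"
        using hx[of x y] yR by (auto intro!: derivative_eq_intros d\<kappa> simp: abs_less_iff algebra_simps)
    qed (use L cl ce cex de ck in \<open>auto intro!: continuous_intros simp: \<kappa>_def\<close>)
    define G where "G x = (\<kappa> x)\<^sup>2 * (2 * (k (x, y))\<^sup>2) - 2 * (\<kappa> x)\<^sup>2 * h (x, y) * Er x" for x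
    define H where "H x = (2 * \<kappa> x * (- 2 * x / L\<^sup>2) * h (x, y) + (\<kappa> x)\<^sup>2 * d (x, y)) * e x" for x
    have cG: "continuous_on {-L..L} G" unfolding G_def by (intro continuous_intros cl cEr ck)
    have cH: "continuous_on {-L..L} H" unfolding H_def using L by (intro continuous_intros cl ce ck) auto
    have "m2 y = integral {-L..L} (\<lambda>x. G x - ((\<kappa> x)\<^sup>2 * h (x, y)) * ex x)"
      unfolding m2_def G_def ex_def by (intro integral_cong) (simp add: algebra_simps)
    also have "\<dots> = integral {-L..L} G - integral {-L..L} (\<lambda>x. ((\<kappa> x)\<^sup>2 * h (x, y)) * ex x)"
      by (intro Henstock_Kurzweil_Integration.integral_diff integrable_continuous_real cG continuous_intros cl cex ck)
    also have "\<dots> = integral {-L..L} G + integral {-L..L} H" unfolding ibp H_def by simp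
    also have "\<dots> = integral {-L..L} (\<lambda>x. G x + H x)"
      by (intro Henstock_Kurzweil_Integration.integral_add[symmetric] integrable_continuous_real cG cH)
    finally have m2: "m2 y = integral {-L..L} (\<lambda>x. G x + H x)" .
    define c where "c = 4 * \<Lambda> * w y / L + 2 * \<epsilon>"
    have c0: "0 \<le> c" using \<Lambda>0 w0[of y] L \<epsilon> by (simp add: c_def)
    have eb: "\<bar>e x\<bar> \<le> \<Lambda> * w y" for x
      using W_bound[OF a(1), of "v1 (x, y)" M y] W_bound[OF a(1), of "v2 (x, y)" M y] M[OF yR(1), of x]
      unfolding e_def \<Lambda>_def w_def by linarith
    have "integral {-L..L} (\<lambda>x. - (c / 2) * (l * ((\<kappa> x)\<^sup>2 * (h (x, y))\<^sup>2) + 1 / l)) \<le> integral {-L..L} (\<lambda>x. G x + H x)"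
    proof (rule integral_le)
      fix x assume x: "x \<in> {-L..L}"
      note kx = \<kappa>[OF x]
      have xL: "\<bar>x\<bar> \<le> L" using x by auto
      define X where "X = \<kappa> x * \<bar>h (x, y)\<bar>"
      have X0: "0 \<le> X" using kx by (simp add: X_def)
      have "\<bar>2 * \<kappa> x * (- 2 * x / L\<^sup>2) * h (x, y) * e x\<bar> = 4 * (\<bar>x\<bar> / L\<^sup>2) * X * \<bar>e x\<bar>"
        using kx by (simp add: X_def abs_mult)
      also have "\<dots> \<le> 4 * (1 / L) * X * (\<Lambda> * w y)"
      proof (intro mult_mono)
        show "\<bar>x\<bar> / L\<^sup>2 \<le> 1 / L" using xL L by (simp add: field_simps power2_eq_square)
      qed (use X0 eb L in auto)
      finally have "- (4 * (1 / L) * X * (\<Lambda> * w y)) \<le> 2 * \<kappa> x * (- 2 * x / L\<^sup>2) * h (x, y) * e x"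
        by (simp only: abs_le_iff) linarith
      moreover have "4 * (1 / L) * X * (\<Lambda> * w y) = 4 * \<Lambda> * w y / L * X" by simp
      ultimately have 1: "- (4 * \<Lambda> * w y / L * X) \<le> 2 * \<kappa> x * (- 2 * x / L\<^sup>2) * h (x, y) * e x"
        by (simp only:)
      have "0 \<le> d (x, y) * e x"
        unfolding d_def e_def by (rule W_monotone[OF a(1)])
      then have "0 \<le> (\<kappa> x)\<^sup>2 * (d (x, y) * e x)" by (rule mult_nonneg_nonneg[OF zero_le_power2])
      then have 2: "0 \<le> (\<kappa> x)\<^sup>2 * d (x, y) * e x" by (simp add: mult.assoc)
      have "(\<kappa> x)\<^sup>2 \<le> \<kappa> x" using kx by (simp add: power2_eq_square mult_left_le)
      then have "(\<kappa> x)\<^sup>2 * \<bar>h (x, y)\<bar> \<le> X" unfolding X_def by (intro mult_right_mono) auto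
      then have "((\<kappa> x)\<^sup>2 * \<bar>h (x, y)\<bar>) * \<bar>Er x\<bar> \<le> X * \<epsilon>"
        using err[OF xL y] X0 by (intro mult_mono) (auto simp: Er_def)
      moreover have "\<bar>(\<kappa> x)\<^sup>2 * h (x, y) * Er x\<bar> = ((\<kappa> x)\<^sup>2 * \<bar>h (x, y)\<bar>) * \<bar>Er x\<bar>" by (simp add: abs_mult)
      ultimately have 3: "- (2 * \<epsilon> * X) \<le> - (2 * (\<kappa> x)\<^sup>2 * h (x, y) * Er x)" by (simp add: abs_le_iff mult.commute)
      \<comment> \<open>Young's inequality with the parameter \<open>l = sqrt L\<close>. Integrated
        over an interval of length \<open>2 * L\<close>, the square and the constant both acquire
        the factor \<open>l\<close>, so the result is a multiple of \<open>m y + 2\<close>.\<close>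
      have "0 \<le> (l * X - 1)\<^sup>2 / (2 * l)" using l by simp
      also have "\<dots> = (l * X\<^sup>2 + 1 / l) / 2 - X" using l by (simp add: field_simps power2_eq_square)
      finally have "X \<le> (l * X\<^sup>2 + 1 / l) / 2" by simp
      then have "c * X \<le> c * ((l * X\<^sup>2 + 1 / l) / 2)" using c0 by (rule mult_left_mono)
      moreover have "X\<^sup>2 = (\<kappa> x)\<^sup>2 * (h (x, y))\<^sup>2" by (simp add: X_def power_mult_distrib)
      ultimately have 4: "- (c / 2) * (l * ((\<kappa> x)\<^sup>2 * (h (x, y))\<^sup>2) + 1 / l) \<le> - (c * X)" by simp
      have 5: "c * X = 4 * \<Lambda> * w y / L * X + 2 * \<epsilon> * X" by (simp add: c_def distrib_right)
      have 6: "G x + H x = (\<kappa> x)\<^sup>2 * (2 * (k (x, y))\<^sup>2) - (2 * (\<kappa> x)\<^sup>2 * h (x, y) * Er x)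
          + 2 * \<kappa> x * (- 2 * x / L\<^sup>2) * h (x, y) * e x + (\<kappa> x)\<^sup>2 * d (x, y) * e x"
        by (simp only: G_def H_def distrib_right add.assoc)
      have 7: "0 \<le> (\<kappa> x)\<^sup>2 * (2 * (k (x, y))\<^sup>2)" by simp
      show "- (c / 2) * (l * ((\<kappa> x)\<^sup>2 * (h (x, y))\<^sup>2) + 1 / l) \<le> G x + H x"
        unfolding 6 using 1 2 3 4 5 7 by linarith
    qed (use L in \<open>auto intro!: integrable_continuous_real continuous_intros cl cG cH ck\<close>)
    moreover have "integral {-L..L} (\<lambda>x. - (c / 2) * (l * ((\<kappa> x)\<^sup>2 * (h (x, y))\<^sup>2) + 1 / l)) = - (c / 2) * (l * m y + 2 * L / l)"
    proof -
      have "integral {-L..L} (\<lambda>x. l * ((\<kappa> x)\<^sup>2 * (h (x, y))\<^sup>2) + 1 / l)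
          = integral {-L..L} (\<lambda>x. l * ((\<kappa> x)\<^sup>2 * (h (x, y))\<^sup>2)) + integral {-L..L} (\<lambda>x. 1 / l)"
        by (intro Henstock_Kurzweil_Integration.integral_add integrable_continuous_real continuous_intros cl ck)
      then show ?thesis using L by (simp add: m_def)
    qed
    moreover have "- (c / 2) * (l * m y + 2 * L / l) = - (2 * \<Lambda> * w y / l + \<epsilon> * l) * (m y + 2)"
    proof -
      have "L / l = l" using l by (simp add: field_simps)
      moreover have "c / 2 * l = 2 * \<Lambda> * w y / l + \<epsilon> * l" using l(1) by (simp add: c_def l(2)[symmetric] field_simps)
      ultimately show ?thesis
        by (metis (no_types, opaque_lifting) distrib_left minus_mult_left mult.assoc mult.commute times_divide_eq_right)
    qed
    ultimately show ?thesis using m2 by (simp only:)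
  qed
  have cm: "continuous_on {-R'..R'} m"
    by (rule DERIV_continuous_on[OF has_field_derivative_at_within[OF dm]]) (use R2 in auto)
  obtain y0 where y0: "y0 \<in> {-R'..R'}" "\<And>y. y \<in> {-R'..R'} \<Longrightarrow> m y \<le> m y0"
    using continuous_attains_sup[of "{-R'..R'}" m] cm R' by auto
  define \<mu> where "\<mu> = m y0"
  have m0: "0 \<le> m y" if "\<bar>y\<bar> < R2" for y unfolding m_def
    by (rule Henstock_Kurzweil_Integration.integral_nonneg)
      (use cL[OF ch that] in \<open>auto intro!: integrable_continuous_real continuous_intros ck\<close>)
  have \<mu>0: "0 \<le> \<mu>" unfolding \<mu>_def by (rule m0) (use y0 R2 in auto)
  \<comment> \<open>A function whose second derivative dominates \<open>3/4 * w\<close>. It stays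
    bounded as \<open>a\<close> tends to 0, although \<open>w\<close> does not; this makes the
    correction of \<open>m\<close> to a convex function uniform in \<open>a\<close>.\<close>
  define N where "N y = (y\<^sup>2 + a\<^sup>2) powr (3/4)" for y
  have tp: "0 < y\<^sup>2 + a\<^sup>2" for y by (rule tau_pos[OF a(1)])
  have dN: "(N has_real_derivative 3/2 * (y * w y)) (at y)" for y
  proof -
    have "(N has_real_derivative 3/4 * (y\<^sup>2 + a\<^sup>2) powr (3/4 - 1) * (2 * y)) (at y)"
      unfolding N_def
      by (rule DERIV_chain2[where g = "\<lambda>y. y\<^sup>2 + a\<^sup>2", OF has_real_derivative_powr])
        (use tp[of y] in \<open>auto intro!: derivative_eq_intros\<close>)
    then show ?thesis by (simp add: w_def mult.commute mult.left_commute)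
  qed
  have dw: "(w has_real_derivative - (1/2) * y * w y / (y\<^sup>2 + a\<^sup>2)) (at y)" for y
    unfolding w_def by (rule has_real_derivative_quartic_weight[OF a(1)])
  define n2 where "n2 y = 3/2 * (w y + y * (- (1/2) * y * w y / (y\<^sup>2 + a\<^sup>2)))" for y
  have dN2: "((\<lambda>y. 3/2 * (y * w y)) has_real_derivative n2 y) (at y)" for y
    unfolding n2_def by (auto intro!: derivative_eq_intros dw)
  have n2: "3/4 * w y \<le> n2 y" for y
  proof -
    have "y\<^sup>2 / (y\<^sup>2 + a\<^sup>2) \<le> 1" using tp[of y] by (simp add: divide_le_eq_1)
    then have "w y * (y\<^sup>2 / (y\<^sup>2 + a\<^sup>2)) \<le> w y * 1" using w0 by (intro mult_left_mono) auto
    moreover have "n2 y = 3/2 * w y - 3/4 * (w y * (y\<^sup>2 / (y\<^sup>2 + a\<^sup>2)))"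
      by (simp add: n2_def algebra_simps power2_eq_square)
    ultimately show ?thesis by linarith
  qed
  \<comment> \<open>Chosen so that \<open>c1 * (3/4 * w y) + c2\<close> is the loss in
    \<open>m2_ge\<close> with \<open>m y\<close> replaced by its maximum \<open>\<mu>\<close>; the
    factor \<open>8 / 3\<close> compensates for the \<open>3/4\<close>.\<close>
  define c1 where "c1 = (\<mu> + 2) * (8 / 3 * \<Lambda> / l)"
  define c2 where "c2 = (\<mu> + 2) * (\<epsilon> * l)"
  have c12: "0 \<le> c1" "0 \<le> c2" using \<mu>0 \<Lambda>0 l \<epsilon> by (auto simp: c1_def c2_def)
  define B where "B y = m y + c1 * N y + c2 * (y\<^sup>2 / 2)" for y
  have conv: "convex_on {-R'..R'} B"
  proof (rule f''_ge0_imp_convex)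
    show "(B has_real_derivative m1 y + c1 * (3/2 * (y * w y)) + c2 * y) (at y)" if "y \<in> {-R'..R'}" for y
      unfolding B_def using that R2 by (auto intro!: derivative_eq_intros dm dN)
    show "((\<lambda>y. m1 y + c1 * (3/2 * (y * w y)) + c2 * y) has_real_derivative m2 y + c1 * n2 y + c2) (at y)"
      if "y \<in> {-R'..R'}" for y
    proof -
      have "\<bar>y\<bar> < R2" using that R2 by auto
      from DERIV_add[OF DERIV_add[OF dm1[OF this] DERIV_cmult[OF dN2[of y], of c1]] DERIV_cmult_Id[of c2]]
      show ?thesis by simp
    qed
    show "0 \<le> m2 y + c1 * n2 y + c2" if y: "y \<in> {-R'..R'}" for y
    proof -
      have "(2 * \<Lambda> * w y / l + \<epsilon> * l) * (m y + 2) \<le> (2 * \<Lambda> * w y / l + \<epsilon> * l) * (\<mu> + 2)"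
        using y0(2)[OF y] \<Lambda>0 w0[of y] l \<epsilon> by (intro mult_left_mono) (auto simp: \<mu>_def)
      also have "\<dots> = c1 * (3/4 * w y) + c2" using l(1) by (simp add: c1_def c2_def field_simps)
      also have "\<dots> \<le> c1 * n2 y + c2" using n2[of y] c12 by (intro add_right_mono mult_left_mono) auto
      finally show ?thesis using m2_ge[of y] y by (simp add: abs_le_iff algebra_simps)
    qed
  qed simp
  have Bmax: "B y0 \<le> max (B R') (B (-R'))"
  proof -
    define t where "t = (y0 + R') / (2 * R')"
    have t: "0 \<le> t" "t \<le> 1" "y0 = (1 - t) *\<^sub>R (-R') + t *\<^sub>R R'"
      using y0(1) R' by (auto simp: t_def field_simps)
    have "B y0 \<le> (1 - t) * B (-R') + t * B R'"
      unfolding t(3) by (rule convex_onD[OF conv]) (use t R' in auto)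
    also have "\<dots> \<le> (1 - t) * max (B R') (B (-R')) + t * max (B R') (B (-R'))"
      using t by (intro add_mono mult_left_mono) auto
    finally show ?thesis by (simp add: algebra_simps)
  qed
  have NT: "0 \<le> N y" "N R' \<le> T" for y
  proof -
    show "0 \<le> N y" by (simp add: N_def)
    have "R'\<^sup>2 \<le> R\<^sup>2" using R' by (intro power_mono) auto
    moreover have "a\<^sup>2 \<le> A\<^sup>2" using a(2) abs_le_square_iff[of a A] by simp
    ultimately have "N R' \<le> T powr (3/4)" unfolding N_def T_def using tp[of R'] by (intro powr_mono2) auto
    also have "\<dots> \<le> T powr 1" by (intro powr_mono) (auto simp: T_def)
    also have "\<dots> = T" by (simp add: T_def add_nonneg_pos)
    finally show "N R' \<le> T" .
  qed
  have mb: "m R' \<le> 2 * \<epsilon>\<^sup>2 * L^3" "m (-R') \<le> 2 * \<epsilon>\<^sup>2 * L^3"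
  proof -
    have key: "m y \<le> 2 * \<epsilon>\<^sup>2 * L^3" if y: "\<bar>y\<bar> < R2" and h0': "h (0, y) = 0" and db: "\<And>x. \<bar>x\<bar> \<le> L \<Longrightarrow> \<bar>d (x, y)\<bar> \<le> \<epsilon>" for y
    proof -
      have "m y \<le> integral {-L..L} (\<lambda>x. \<epsilon>\<^sup>2 * L\<^sup>2)"
        unfolding m_def
      proof (rule integral_le)
        fix x assume x: "x \<in> {-L..L}"
        have "norm (h (x, y) - h (0, y)) \<le> \<epsilon> * norm (x - 0)"
        proof (rule field_differentiable_bound[of "{-L..L}" "\<lambda>t. h (t, y)" "\<lambda>t. d (t, y)"])
          show "((\<lambda>t. h (t, y)) has_real_derivative d (z, y)) (at z within {-L..L})" if "z \<in> {-L..L}" for z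
            using hx[of z y] that y L by (auto intro: has_field_derivative_at_within)
        qed (use x L db in \<open>auto simp: abs_le_iff\<close>)
        also have "\<dots> \<le> \<epsilon> * L" using x \<epsilon> by (intro mult_left_mono) auto
        finally have "\<bar>h (x, y)\<bar> \<le> \<epsilon> * L" using h0' by simp
        then have "(h (x, y))\<^sup>2 \<le> (\<epsilon> * L)\<^sup>2" using abs_le_square_iff[of "h (x, y)" "\<epsilon> * L"] \<epsilon> L by simp
        moreover have "(\<kappa> x)\<^sup>2 \<le> 1" using \<kappa>[OF x] by (simp add: power_le_one)
        ultimately have "(\<kappa> x)\<^sup>2 * (h (x, y))\<^sup>2 \<le> 1 * (\<epsilon> * L)\<^sup>2" by (intro mult_mono) auto
        then show "(\<kappa> x)\<^sup>2 * (h (x, y))\<^sup>2 \<le> \<epsilon>\<^sup>2 * L\<^sup>2" by (simp add: power_mult_distrib)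
      qed (use cL[OF ch y] in \<open>auto intro!: integrable_continuous_real continuous_intros ck\<close>)
      also have "\<dots> = 2 * \<epsilon>\<^sup>2 * L^3" using L by (simp add: power2_eq_square power3_eq_cube)
      finally show ?thesis .
    qed
    show "m R' \<le> 2 * \<epsilon>\<^sup>2 * L^3" "m (-R') \<le> 2 * \<epsilon>\<^sup>2 * L^3"
      by (rule key; use R2 R' hbd bd in \<open>auto simp: d_def\<close>)+
  qed
  have BR: "max (B R') (B (-R')) \<le> 2 * \<epsilon>\<^sup>2 * L^3 + c1 * T + c2 * (R\<^sup>2 / 2)"
  proof -
    have "c1 * N R' \<le> c1 * T" using NT c12 by (intro mult_left_mono) auto
    moreover have "c2 * (R'\<^sup>2 / 2) \<le> c2 * (R\<^sup>2 / 2)" using R' c12 by (intro mult_left_mono divide_right_mono power_mono) auto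
    moreover have "N (-R') = N R'" by (simp add: N_def)
    ultimately show ?thesis using mb by (simp add: B_def)
  qed
  have "\<mu> \<le> B y0" unfolding \<mu>_def B_def using c12 NT by simp
  then have "\<mu> \<le> 2 * \<epsilon>\<^sup>2 * L^3 + c1 * T + c2 * (R\<^sup>2 / 2)" using Bmax BR by linarith
  also have "\<dots> = 2 * \<epsilon>\<^sup>2 * L^3 + (\<mu> + 2) * \<theta>"
    using \<theta>(1) unfolding c1_def c2_def l_def by (simp add: algebra_simps)
  \<comment> \<open>The unknown maximum stands on both sides because the correction was scaled by
    it; \<open>\<theta> \<le> 1/2\<close> allows half of it to be absorbed.\<close>
  finally have "\<mu> \<le> 2 * \<epsilon>\<^sup>2 * L^3 + \<mu> * \<theta> + 2 * \<theta>" by (simp add: algebra_simps)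
  moreover have "\<mu> * \<theta> \<le> \<mu> * (1 / 2)" using \<theta>(2) \<mu>0 by (intro mult_left_mono) auto
  ultimately have \<mu>: "\<mu> \<le> 4 * \<epsilon>\<^sup>2 * L^3 + 4 * \<theta>" by linarith
  show ?thesis
  proof (intro exI[of _ h] exI[of _ \<gamma>] conjI allI impI)
    fix x y :: real assume "\<bar>x\<bar> \<le> L" "\<bar>y\<bar> \<le> R'"
    then show "((\<lambda>t. h (t, y)) has_real_derivative v1 (x, y) - v2 (x, y)) (at x)"
      "((\<lambda>t. h (x, t)) has_real_derivative u1 (x, y) - u2 (x, y) - \<gamma>) (at y)"
      using hx[of x y] hy[of x y] R2 by (auto simp: d_def k_def)
  next
    fix y :: real assume "\<bar>y\<bar> \<le> R'"
    then have "m y \<le> \<mu>" using y0(2)[of y] by (auto simp: \<mu>_def abs_le_iff)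
    then show "integral {-L..L} (\<lambda>x. (1 - x\<^sup>2 / L\<^sup>2)\<^sup>2 * (h (x, y))\<^sup>2) \<le> 4 * \<epsilon>\<^sup>2 * L^3 + 4 * \<theta>"
      using \<mu> by (simp add: m_def \<kappa>_def)
  qed
qed

text \<open>The order of the choices matters: \<open>L\<close> first, to make the cut-off error
  small, and only then \<open>\<epsilon>\<close>, which has to beat \<open>L^3\<close>. Neither
  depends on the solutions, on \<open>R'\<close>, or on \<open>a\<close> within
  \<open>|a| \<le> A\<close>. A mean square bound on \<open>h\<close> becomes pointwise because the
  \<open>x\<close>-derivative of \<open>h\<close> is at most \<open>2 * M\<close>.\<close>

lemma potential_uniform_estimate:
  fixes A M K \<eta> R :: real
  assumes R: "0 < R" and M0: "0 \<le> M" and \<eta>: "0 < \<eta>" and K: "0 \<le> K"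
  shows "\<exists>L \<epsilon>. K + 1 \<le> L \<and> 0 < \<epsilon> \<and> (\<forall>a b u1 v1 p1 q1 u2 v2 p2 q2 R'.
     a \<noteq> 0 \<longrightarrow> \<bar>a\<bar> \<le> A \<longrightarrow> 0 < R' \<longrightarrow> R' < R \<longrightarrow> sol1 R a u1 v1 p1 q1 \<longrightarrow> sol1 R b u2 v2 p2 q2 \<longrightarrow>
     (\<forall>x y. \<bar>y\<bar> < R \<longrightarrow> \<bar>v1 (x, y)\<bar> \<le> M \<and> \<bar>v2 (x, y)\<bar> \<le> M) \<longrightarrow>
     (\<forall>x. \<bar>x\<bar> \<le> L \<longrightarrow> \<bar>v1 (x, R') - v2 (x, R')\<bar> \<le> \<epsilon> \<and> \<bar>v1 (x, -R') - v2 (x, -R')\<bar> \<le> \<epsilon>) \<longrightarrow>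
     (\<forall>x y. \<bar>x\<bar> \<le> L \<longrightarrow> \<bar>y\<bar> \<le> R' \<longrightarrow> \<bar>q2 (x, y) * (1 - sg b (v2 (x, y)) y / sg a (v2 (x, y)) y)\<bar> \<le> \<epsilon>) \<longrightarrow>
     (\<exists>\<gamma>. (\<forall>x x' y. -K \<le> x \<longrightarrow> x \<le> x' \<longrightarrow> x' \<le> K \<longrightarrow> \<bar>y\<bar> \<le> R' \<longrightarrow>
              \<bar>integral {x..x'} (\<lambda>t. v1 (t, y) - v2 (t, y))\<bar> \<le> 2 * \<eta>) \<and>
          (\<forall>x y y'. \<bar>x\<bar> \<le> K \<longrightarrow> -R' \<le> y \<longrightarrow> y \<le> y' \<longrightarrow> y' \<le> R' \<longrightarrow>
              \<bar>integral {y..y'} (\<lambda>t. u1 (x, t) - u2 (x, t) - \<gamma>)\<bar> \<le> 2 * \<eta>)))"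
proof -
  \<comment> \<open>Over a length \<open>s\<close> the potential varies by at most
    \<open>\<eta> / 2\<close>. A single value above \<open>\<eta>\<close> therefore contributes at
    least \<open>\<eta>\<^sup>2 * s / 8\<close> to the integral, where the weight is at least
    \<open>1 / 2\<close>.\<close>
  define s where "s = min 1 (\<eta> / (4 * M + 4))"
  have s: "0 < s" "s \<le> 1" "2 * M * s \<le> \<eta> / 2"
  proof -
    show "0 < s" using \<eta> M0 by (simp add: s_def)
    show "s \<le> 1" by (simp add: s_def)
    have "2 * M * s \<le> 2 * M * (\<eta> / (4 * M + 4))" using M0 by (intro mult_left_mono) (auto simp: s_def)
    also have "\<dots> \<le> \<eta> / 2" using M0 \<eta> by (simp add: field_simps)
    finally show "2 * M * s \<le> \<eta> / 2" .
  qed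
  \<comment> \<open>The total error will be at most \<open>9 * \<zeta>\<close>, one part from the
    boundary values and eight from \<open>4 * \<theta>\<close>; it has to stay below
    \<open>\<eta>\<^sup>2 * s / 8\<close>.\<close>
  define \<zeta> where "\<zeta> = min (1/4) (\<eta>\<^sup>2 * s / 100)"
  have \<zeta>: "0 < \<zeta>" "\<zeta> \<le> 1/4" "\<zeta> \<le> \<eta>\<^sup>2 * s / 100" using \<eta> s by (auto simp: \<zeta>_def)
  define \<Lambda> where "\<Lambda> = 4 * sqrt (2 * M)"
  define T where "T = R\<^sup>2 + A\<^sup>2 + 1"
  have LT: "0 \<le> 8 / 3 * \<Lambda> * T" using M0 by (simp add: \<Lambda>_def T_def)
  \<comment> \<open>The summand \<open>2 * K + 2\<close> keeps all points in use within
    \<open>|x| \<le> L / 2\<close>, where the cut-off is not small. The square makes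
    \<open>sqrt L\<close> dominate the cut-off error.\<close>
  define L where "L = 2 * K + 2 + (8 / 3 * \<Lambda> * T / \<zeta>)\<^sup>2"
  have L: "2 * K + 2 \<le> L" "0 < L" "1 \<le> L" using K by (auto simp: L_def intro: add_pos_nonneg)
  have L1: "8 / 3 * \<Lambda> * T / sqrt L \<le> \<zeta>"
  proof -
    have "8 / 3 * \<Lambda> * T / \<zeta> \<le> sqrt L" by (rule real_le_rsqrt) (use K in \<open>simp add: L_def\<close>)
    then show ?thesis using L \<zeta> by (simp add: field_simps)
  qed
  define \<epsilon> where "\<epsilon> = min (min 1 (\<zeta> / (4 * L^3))) (\<zeta> / (sqrt L * (R\<^sup>2 + 1)))"
  have L3: "0 < L^3" using L by simp
  have \<epsilon>: "0 < \<epsilon>" "\<epsilon> \<le> 1" "\<epsilon> \<le> \<zeta> / (4 * L^3)" "\<epsilon> \<le> \<zeta> / (sqrt L * (R\<^sup>2 + 1))"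
    using \<zeta> L L3 by (auto simp: \<epsilon>_def add_nonneg_pos)
  define \<theta> where "\<theta> = 8 / 3 * \<Lambda> * T / sqrt L + \<epsilon> * sqrt L * R\<^sup>2 / 2"
  have "0 < sqrt L * (R\<^sup>2 + 1)" using L by (intro mult_pos_pos add_nonneg_pos) auto
  then have "\<epsilon> * (sqrt L * (R\<^sup>2 + 1)) \<le> \<zeta>" using \<epsilon>(4) pos_le_divide_eq by blast
  moreover have "\<epsilon> * (sqrt L * (R\<^sup>2 / 2)) \<le> \<epsilon> * (sqrt L * (R\<^sup>2 + 1))"
    using \<epsilon> L by (intro mult_left_mono) auto
  ultimately have \<theta>: "\<theta> \<le> 2 * \<zeta>" using L1 by (simp add: \<theta>_def)
  have tot: "4 * \<epsilon>\<^sup>2 * L^3 + 4 * \<theta> < \<eta>\<^sup>2 * s / 8"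
  proof -
    have "\<epsilon>\<^sup>2 \<le> \<epsilon>" using \<epsilon> by (simp add: power2_eq_square mult_left_le)
    then have "4 * \<epsilon>\<^sup>2 * L^3 \<le> 4 * \<epsilon> * L^3" using L3 by simp
    also have "\<dots> \<le> \<zeta>" using \<epsilon>(3) L3 by (simp add: field_simps)
    finally have "4 * \<epsilon>\<^sup>2 * L^3 + 4 * \<theta> \<le> 9 * \<zeta>" using \<theta> by linarith
    also have "\<dots> < \<eta>\<^sup>2 * s / 8" using \<zeta> by linarith
    finally show ?thesis .
  qed
  show ?thesis
  proof (rule exI[of _ L], rule exI[of _ \<epsilon>], intro conjI allI impI)
    show "K + 1 \<le> L" using L K by linarith
    show "0 < \<epsilon>" by (rule \<epsilon>)
    fix a b u1 v1 p1 q1 u2 v2 p2 q2 R'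
    assume a: "a \<noteq> 0" "\<bar>a\<bar> \<le> A" and R': "0 < R'" "R' < R"
      and S1: "sol1 R a u1 v1 p1 q1" and S2: "sol1 R b u2 v2 p2 q2"
      and M: "\<forall>x y. \<bar>y\<bar> < R \<longrightarrow> \<bar>v1 (x, y)\<bar> \<le> M \<and> \<bar>v2 (x, y)\<bar> \<le> M"
      and bd: "\<forall>x. \<bar>x\<bar> \<le> L \<longrightarrow> \<bar>v1 (x, R') - v2 (x, R')\<bar> \<le> \<epsilon> \<and> \<bar>v1 (x, -R') - v2 (x, -R')\<bar> \<le> \<epsilon>"
      and err: "\<forall>x y. \<bar>x\<bar> \<le> L \<longrightarrow> \<bar>y\<bar> \<le> R' \<longrightarrow> \<bar>q2 (x, y) * (1 - sg b (v2 (x, y)) y / sg a (v2 (x, y)) y)\<bar> \<le> \<epsilon>"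
    have "\<exists>h \<gamma>. (\<forall>x y. \<bar>x\<bar> \<le> L \<longrightarrow> \<bar>y\<bar> \<le> R' \<longrightarrow>
      ((\<lambda>t. h (t, y)) has_real_derivative v1 (x, y) - v2 (x, y)) (at x) \<and>
      ((\<lambda>t. h (x, t)) has_real_derivative u1 (x, y) - u2 (x, y) - \<gamma>) (at y)) \<and>
      (\<forall>y. \<bar>y\<bar> \<le> R' \<longrightarrow> integral {-L..L} (\<lambda>x. (1 - x\<^sup>2 / L\<^sup>2)\<^sup>2 * (h (x, y))\<^sup>2) \<le> 4 * \<epsilon>\<^sup>2 * L^3 + 4 * \<theta>)"
      by (rule potential_L2_estimate[OF S1 S2 a L(2) R' less_imp_le[OF \<epsilon>(1)]])
        (use M bd err \<theta> \<zeta> in \<open>auto simp: \<theta>_def \<Lambda>_def T_def\<close>)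
    then obtain h \<gamma> where
      hx: "\<And>x y. \<bar>x\<bar> \<le> L \<Longrightarrow> \<bar>y\<bar> \<le> R' \<Longrightarrow> ((\<lambda>t. h (t, y)) has_real_derivative v1 (x, y) - v2 (x, y)) (at x)"
      and hy: "\<And>x y. \<bar>x\<bar> \<le> L \<Longrightarrow> \<bar>y\<bar> \<le> R' \<Longrightarrow> ((\<lambda>t. h (x, t)) has_real_derivative u1 (x, y) - u2 (x, y) - \<gamma>) (at y)"
      and I: "\<And>y. \<bar>y\<bar> \<le> R' \<Longrightarrow> integral {-L..L} (\<lambda>x. (1 - x\<^sup>2 / L\<^sup>2)\<^sup>2 * (h (x, y))\<^sup>2) \<le> 4 * \<epsilon>\<^sup>2 * L^3 + 4 * \<theta>"
      by blast
    have small: "\<bar>h (x0, y)\<bar> \<le> \<eta>" if x0: "\<bar>x0\<bar> \<le> K" and y: "\<bar>y\<bar> \<le> R'" for x0 y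
    proof (rule ccontr)
      assume "\<not> \<bar>h (x0, y)\<bar> \<le> \<eta>"
      then have big: "\<eta> < \<bar>h (x0, y)\<bar>" by simp
      have sub: "{x0..x0+s} \<subseteq> {-L..L}" using x0 s L K by (auto simp: abs_le_iff)
      have chL: "continuous_on {-L..L} (\<lambda>x. h (x, y))"
        by (rule DERIV_continuous_on[OF has_field_derivative_at_within[OF hx]]) (use y in \<open>auto simp: abs_le_iff\<close>)
      define f where "f x = (1 - x\<^sup>2 / L\<^sup>2)\<^sup>2 * (h (x, y))\<^sup>2" for x
      have cf: "continuous_on {-L..L} f" unfolding f_def using L by (intro continuous_intros chL) auto
      have "\<eta>\<^sup>2 * s / 8 = integral {x0..x0+s} (\<lambda>x. \<eta>\<^sup>2 / 8)" using s by simp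
      also have "\<dots> \<le> integral {x0..x0+s} f"
      proof (rule integral_le)
        fix x assume x: "x \<in> {x0..x0+s}"
        have "norm (h (x, y) - h (x0, y)) \<le> (2 * M) * norm (x - x0)"
        proof (rule field_differentiable_bound[of "{x0..x0+s}" "\<lambda>t. h (t, y)" "\<lambda>t. v1 (t, y) - v2 (t, y)"])
          fix z assume z: "z \<in> {x0..x0+s}"
          then have zL: "\<bar>z\<bar> \<le> L" using sub by (auto simp: abs_le_iff)
          show "((\<lambda>t. h (t, y)) has_real_derivative v1 (z, y) - v2 (z, y)) (at z within {x0..x0+s})"
            using hx[OF zL y] by (rule has_field_derivative_at_within)
          have "\<bar>v1 (z, y)\<bar> \<le> M \<and> \<bar>v2 (z, y)\<bar> \<le> M" using M y R' by auto
          then show "norm (v1 (z, y) - v2 (z, y)) \<le> 2 * M" by auto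
        qed (use x s in auto)
        also have "\<dots> \<le> 2 * M * s" using x M0 by (intro mult_left_mono) auto
        finally have "\<eta> / 2 \<le> \<bar>h (x, y)\<bar>" using big s(3) by auto
        then have h2: "\<eta>\<^sup>2 / 4 \<le> (h (x, y))\<^sup>2" using \<eta> abs_le_square_iff[of "\<eta> / 2" "h (x, y)"] by (simp add: power_divide)
        have "\<bar>x\<bar> \<le> L / 2" using x x0 s L by (auto simp: abs_le_iff)
        then have "x\<^sup>2 \<le> (L / 2)\<^sup>2" using abs_le_square_iff[of x "L / 2"] L by simp
        then have "x\<^sup>2 / L\<^sup>2 \<le> 1 / 4" using L by (simp add: field_simps power2_eq_square)
        then have "(3/4)\<^sup>2 \<le> (1 - x\<^sup>2 / L\<^sup>2)\<^sup>2" by (intro power_mono) auto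
        moreover have "1 / 2 \<le> (3/4 :: real)\<^sup>2" by (simp add: power2_eq_square)
        ultimately have "1 / 2 \<le> (1 - x\<^sup>2 / L\<^sup>2)\<^sup>2" by linarith
        then have "1 / 2 * (\<eta>\<^sup>2 / 4) \<le> (1 - x\<^sup>2 / L\<^sup>2)\<^sup>2 * (h (x, y))\<^sup>2" using h2 by (intro mult_mono) auto
        then show "\<eta>\<^sup>2 / 8 \<le> f x" by (simp add: f_def)
      qed (use continuous_on_subset[OF cf sub] in \<open>auto intro: integrable_continuous_real\<close>)
      also have "\<dots> \<le> integral {-L..L} f"
        by (rule integral_subset_le[OF sub])
          (use continuous_on_subset[OF cf sub] cf in \<open>auto intro: integrable_continuous_real simp: f_def\<close>)
      finally show False using I[OF y] tot by (simp add: f_def[abs_def])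
    qed
    show "\<exists>\<gamma>. (\<forall>x x' y. -K \<le> x \<longrightarrow> x \<le> x' \<longrightarrow> x' \<le> K \<longrightarrow> \<bar>y\<bar> \<le> R' \<longrightarrow>
              \<bar>integral {x..x'} (\<lambda>t. v1 (t, y) - v2 (t, y))\<bar> \<le> 2 * \<eta>) \<and>
          (\<forall>x y y'. \<bar>x\<bar> \<le> K \<longrightarrow> -R' \<le> y \<longrightarrow> y \<le> y' \<longrightarrow> y' \<le> R' \<longrightarrow>
              \<bar>integral {y..y'} (\<lambda>t. u1 (x, t) - u2 (x, t) - \<gamma>)\<bar> \<le> 2 * \<eta>)"
    proof (intro exI[of _ \<gamma>] conjI allI impI)
      fix x x' y assume x: "-K \<le> x" "x \<le> x'" "x' \<le> K" and y: "\<bar>y\<bar> \<le> R'"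
      have "integral {x..x'} (\<lambda>t. v1 (t, y) - v2 (t, y)) = h (x', y) - h (x, y)"
        by (rule integral_real_derivative) (use x y L K hx in \<open>auto simp: abs_le_iff\<close>)
      moreover have "\<bar>h (x', y)\<bar> \<le> \<eta>" "\<bar>h (x, y)\<bar> \<le> \<eta>" using small x y by (auto simp: abs_le_iff)
      ultimately show "\<bar>integral {x..x'} (\<lambda>t. v1 (t, y) - v2 (t, y))\<bar> \<le> 2 * \<eta>" by linarith
    next
      fix x y y' assume x: "\<bar>x\<bar> \<le> K" and y: "-R' \<le> y" "y \<le> y'" "y' \<le> R'"
      have "integral {y..y'} (\<lambda>t. u1 (x, t) - u2 (x, t) - \<gamma>) = h (x, y') - h (x, y)"
        by (rule integral_real_derivative) (use x y L K hy in \<open>auto simp: abs_le_iff\<close>)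
      moreover have "\<bar>h (x, y')\<bar> \<le> \<eta>" "\<bar>h (x, y)\<bar> \<le> \<eta>" using small x y by (auto simp: abs_le_iff)
      ultimately show "\<bar>integral {y..y'} (\<lambda>t. u1 (x, t) - u2 (x, t) - \<gamma>)\<bar> \<le> 2 * \<eta>" by linarith
    qed
  qed
qed

section \<open>Uniform closeness of solutions\<close>

lemma cauchy_schwarz_weighted:
  fixes f w :: "real \<Rightarrow> real"
  assumes ab: "a \<le> b" and cf: "continuous_on {a..b} f" and cw: "continuous_on {a..b} w"
    and w: "\<And>x. x \<in> {a..b} \<Longrightarrow> 0 < w x"
  shows "(integral {a..b} f)\<^sup>2 \<le> integral {a..b} (\<lambda>x. 1 / w x) * integral {a..b} (\<lambda>x. w x * (f x)\<^sup>2)"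
proof (cases "a = b")
  case True then show ?thesis by simp
next
  case False
  then have ab': "a < b" using ab by simp
  have cw': "continuous_on {a..b} (\<lambda>x. 1 / w x)" using w by (intro continuous_intros cw) (auto simp: less_imp_neq[symmetric])
  define F where "F = integral {a..b} f"
  define G where "G = integral {a..b} (\<lambda>x. 1 / w x)"
  define H where "H = integral {a..b} (\<lambda>x. w x * (f x)\<^sup>2)"
  have nn: "0 \<le> 1 / w x" if "x \<in> {a..b}" for x using w[OF that] by simp
  have G0: "0 \<le> G" unfolding G_def
    by (rule Henstock_Kurzweil_Integration.integral_nonneg) (use nn cw' in \<open>auto intro: integrable_continuous_real\<close>)
  have "G \<noteq> 0" unfolding G_def using integral_eq_0_iff[OF cw' ab' nn] ab' w by force
  then have G: "0 < G" using G0 by simp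
  define c where "c = F / G"
  have "0 \<le> integral {a..b} (\<lambda>x. (w x * (f x)\<^sup>2 - 2 * c * f x) + c\<^sup>2 * (1 / w x))"
  proof (rule Henstock_Kurzweil_Integration.integral_nonneg)
    show "(\<lambda>x. (w x * (f x)\<^sup>2 - 2 * c * f x) + c\<^sup>2 * (1 / w x)) integrable_on {a..b}"
      by (intro integrable_continuous_real continuous_on_add continuous_on_diff continuous_on_mult continuous_on_power continuous_on_const cf cw cw')
    fix x assume x: "x \<in> {a..b}"
    have "(w x * (f x)\<^sup>2 - 2 * c * f x) + c\<^sup>2 * (1 / w x) = (w x * f x - c)\<^sup>2 / w x"
      using w[OF x] by (simp add: field_simps power2_eq_square)
    then show "0 \<le> (w x * (f x)\<^sup>2 - 2 * c * f x) + c\<^sup>2 * (1 / w x)" using w[OF x] by simp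
  qed
  also have "\<dots> = integral {a..b} (\<lambda>x. w x * (f x)\<^sup>2 - 2 * c * f x) + integral {a..b} (\<lambda>x. c\<^sup>2 * (1 / w x))"
    by (intro Henstock_Kurzweil_Integration.integral_add integrable_continuous_real continuous_on_diff continuous_on_mult continuous_on_power continuous_on_const cf cw cw')
  also have "integral {a..b} (\<lambda>x. w x * (f x)\<^sup>2 - 2 * c * f x) = H - integral {a..b} (\<lambda>x. 2 * c * f x)"
    unfolding H_def
    by (intro Henstock_Kurzweil_Integration.integral_diff integrable_continuous_real continuous_on_mult continuous_on_power continuous_on_const cf cw)
  also have "integral {a..b} (\<lambda>x. 2 * c * f x) = 2 * c * F" unfolding F_def by simp
  also have "integral {a..b} (\<lambda>x. c\<^sup>2 * (1 / w x)) = c\<^sup>2 * G" unfolding G_def by (rule integral_mult_right)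
  finally have "0 \<le> H - 2 * c * F + c\<^sup>2 * G" .
  also have "\<dots> = H - F\<^sup>2 / G" using G by (simp add: c_def field_simps power2_eq_square)
  finally have "F\<^sup>2 \<le> G * H" using G by (simp add: field_simps)
  then show ?thesis by (simp add: F_def G_def H_def)
qed

lemma cauchy_schwarz_interval:
  fixes f :: "real \<Rightarrow> real"
  assumes ab: "a \<le> b" and cf: "continuous_on {a..b} f"
  shows "(integral {a..b} f)\<^sup>2 \<le> (b - a) * integral {a..b} (\<lambda>x. (f x)\<^sup>2)"
  using cauchy_schwarz_weighted[OF ab cf, of "\<lambda>_. 1"] ab by simp

lemma integral2_subset_le:
  fixes f :: "real \<times> real \<Rightarrow> real"
  assumes c: "continuous_on ({x1..x2} \<times> {y1..y2}) f" and nn: "\<And>x y. x \<in> {x1..x2} \<Longrightarrow> y \<in> {y1..y2} \<Longrightarrow> 0 \<le> f (x, y)"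
    and sub: "{a1..a2} \<subseteq> {x1..x2}" "{b1..b2} \<subseteq> {y1..y2}"
  shows "integral {a1..a2} (\<lambda>x. integral {b1..b2} (\<lambda>y. f (x, y))) \<le> integral {x1..x2} (\<lambda>x. integral {y1..y2} (\<lambda>y. f (x, y)))"
proof -
  have c': "continuous_on ({x1..x2} \<times> {b1..b2}) f" by (rule continuous_on_subset[OF c]) (use sub in auto)
  have nn': "0 \<le> integral {b1..b2} (\<lambda>y. f (x, y))" if "x \<in> {x1..x2}" for x
    by (rule Henstock_Kurzweil_Integration.integral_nonneg)
      (use continuous_on_rectangle_lines(1)[OF c' that] nn that sub in \<open>auto intro!: integrable_continuous_real\<close>)
  have "integral {a1..a2} (\<lambda>x. integral {b1..b2} (\<lambda>y. f (x, y))) \<le> integral {x1..x2} (\<lambda>x. integral {b1..b2} (\<lambda>y. f (x, y)))"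
    by (rule integral_subset_le[OF sub(1)])
      (use nn' continuous_on_integral_snd[OF c'] continuous_on_subset[OF continuous_on_integral_snd[OF c'] sub(1)]
        in \<open>auto intro!: integrable_continuous_real\<close>)
  also have "\<dots> \<le> integral {x1..x2} (\<lambda>x. integral {y1..y2} (\<lambda>y. f (x, y)))"
  proof (rule integral_le)
    fix x assume x: "x \<in> {x1..x2}"
    show "integral {b1..b2} (\<lambda>y. f (x, y)) \<le> integral {y1..y2} (\<lambda>y. f (x, y))"
      by (rule integral_subset_le[OF sub(2)])
        (use continuous_on_rectangle_lines(1)[OF c' x] continuous_on_rectangle_lines(1)[OF c x] nn x
          in \<open>auto intro!: integrable_continuous_real\<close>)
  qed (use continuous_on_integral_snd[OF c'] continuous_on_integral_snd[OF c] in \<open>auto intro!: integrable_continuous_real\<close>)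
  finally show ?thesis .
qed

lemma exists_le_of_integral_le:
  fixes f g :: "real \<Rightarrow> real"
  assumes cf: "continuous_on {s..s+\<delta>} f" and cg: "continuous_on {s..s+\<delta>} g" and \<delta>: "\<delta> > 0" and \<gamma>: "\<gamma> > 0"
    and I: "\<bar>integral {s..s+\<delta>} (\<lambda>t. f t - g t)\<bar> \<le> \<gamma> * \<delta>"
  shows "\<exists>t\<in>{s..s+\<delta>}. f t \<le> g t + 2 * \<gamma>"
proof (rule ccontr)
  assume "\<not> ?thesis"
  then have "2 * \<gamma> \<le> f t - g t" if "t \<in> {s..s+\<delta>}" for t using that by force
  then have "integral {s..s+\<delta>} (\<lambda>t. 2 * \<gamma>) \<le> integral {s..s+\<delta>} (\<lambda>t. f t - g t)"
    by (intro integral_le integrable_continuous_real continuous_intros cf cg) auto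
  moreover have "integral {s..s+\<delta>} (\<lambda>t. 2 * \<gamma>) = 2 * (\<gamma> * \<delta>)" using \<delta> by simp
  moreover have "0 < \<gamma> * \<delta>" using \<gamma> \<delta> by simp
  ultimately show False using I by linarith
qed

text \<open>The case of \<open>pointwise_bound_from_averages\<close> with \<open>x\<close> as the
  first variable. Both derivatives of \<open>v\<close> have square integrals at most
  \<open>C'\<close>, since for bounded \<open>v\<close> the square of \<open>sg\<close> is at most a
  constant times its root. Of the final \<open>5 * \<gamma>\<close>, one part is the oscillation of
  \<open>v0\<close>, two are lost in the averages and two in the crossing argument.\<close>

lemma v_upper_bound:
  fixes v0 :: "real \<times> real \<Rightarrow> real"
  assumes sol: "sol2 R a u v p q r s" and a: "a \<noteq> 0" "\<bar>a\<bar> \<le> A"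
    and M: "\<And>x y. \<bar>y\<bar> < R \<Longrightarrow> \<bar>v (x, y)\<bar> \<le> M"
    and En: "integral {x0-D..x0+D} (\<lambda>x. integral {-R'..R'} (\<lambda>y. (p (x, y))\<^sup>2 + sqrt (sg a (v (x, y)) y) * (q (x, y))\<^sup>2)) \<le> C"
    and R': "0 < R'" "R' < R" and \<rho>: "0 < \<rho>" "\<rho> \<le> D" "\<bar>y0\<bar> + \<rho> \<le> R'"
    and C': "C' = 4 * (2 + M\<^sup>2 + R\<^sup>2 + A\<^sup>2) * C" "0 < C"
    and pos: "r' > 0" "2 * r' \<le> \<rho>" "\<delta> > 0" "4 * \<delta> \<le> \<rho>" "\<gamma> > 0"
    and small: "\<delta> * (2 * C') \<le> \<gamma>\<^sup>2 * r'" "32 * r' * C' \<le> \<rho> * \<gamma>\<^sup>2"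
    and c0: "continuous_on (open_strip R) v0"
    and osc: "\<And>x y. \<bar>x - x0\<bar> \<le> \<rho> \<Longrightarrow> \<bar>y - y0\<bar> \<le> \<rho> \<Longrightarrow> v0 (x, y) \<le> v0 (x0, y0) + \<gamma>"
    and avg: "\<And>x y. x0 - \<rho> \<le> x \<Longrightarrow> x + \<delta> \<le> x0 + \<rho> \<Longrightarrow> \<bar>y - y0\<bar> \<le> \<rho> \<Longrightarrow>
        \<bar>integral {x..x+\<delta>} (\<lambda>t. v (t, y) - v0 (t, y))\<bar> \<le> \<gamma> * \<delta>"
    and xy: "\<bar>x - x0\<bar> \<le> \<rho> / 4" "\<bar>y - y0\<bar> \<le> r'"
  shows "v (x, y) \<le> v0 (x0, y0) + 5 * \<gamma>"
proof -
  note s1 = sol2_sol1[OF sol]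
  define X where "X = {x0-\<rho>..x0+\<rho>}"
  define Y where "Y = {y0-\<rho>..y0+\<rho>}"
  have Yin: "\<bar>y\<bar> < R" if "y \<in> Y" for y using that R' \<rho> unfolding Y_def by (auto simp: abs_less_iff)
  have XY: "X \<times> Y \<subseteq> open_strip R" using Yin by (auto simp: open_strip_def)
  define Q where "Q = {x0-D..x0+D} \<times> {-R'..R'}"
  have QO: "Q \<subseteq> open_strip R" unfolding Q_def by (rule rectangle_subset_open_strip) (use R' in auto)
  have XYQ: "X \<subseteq> {x0-D..x0+D}" "Y \<subseteq> {-R'..R'}" using \<rho> R' by (auto simp: X_def Y_def abs_le_iff)
  note cO = sol1_cont[OF s1 order_refl]
  define g where "g z = - 2 * sg a (v z) (snd z) * q z" for z
  have cg: "continuous_on (open_strip R) g" unfolding g_def by (intro continuous_intros cO)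
  define De where "De z = (p z)\<^sup>2 + sqrt (sg a (v z) (snd z)) * (q z)\<^sup>2" for z
  have cD: "continuous_on (open_strip R) De" unfolding De_def by (intro continuous_intros cO)
  have De0: "0 \<le> De z" for z by (simp add: De_def sg_nonneg)
  define B where "B = 4 * (2 + M\<^sup>2 + R\<^sup>2 + A\<^sup>2)"
  have B: "1 \<le> B" by (simp add: B_def)
  have gD: "(g (x, y))\<^sup>2 \<le> B * De (x, y)" "(p (x, y))\<^sup>2 \<le> B * De (x, y)" if y: "\<bar>y\<bar> < R" for x y
  proof -
    define \<sigma> where "\<sigma> = sg a (v (x, y)) y"
    have \<sigma>: "0 < \<sigma>" unfolding \<sigma>_def by (rule sg_pos[OF a(1)])
    have "\<sigma>\<^sup>2 = (v (x, y))\<^sup>2 + y\<^sup>2 + a\<^sup>2" by (simp add: \<sigma>_def sg_def)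
    moreover have "(v (x, y))\<^sup>2 \<le> M\<^sup>2" using M[OF y, of x] abs_le_square_iff[of "v (x, y)" M] by simp
    moreover have "y\<^sup>2 \<le> R\<^sup>2" using y abs_le_square_iff[of y R] by simp
    moreover have "a\<^sup>2 \<le> A\<^sup>2" using a(2) abs_le_square_iff[of a A] by simp
    ultimately have \<sigma>2: "\<sigma>\<^sup>2 \<le> M\<^sup>2 + R\<^sup>2 + A\<^sup>2" by linarith
    have ss: "sqrt \<sigma> * sqrt \<sigma> = \<sigma>" using \<sigma> by simp
    have "\<sigma> * sqrt \<sigma> \<le> 1 + \<sigma>\<^sup>2"
    proof (cases "\<sigma> \<le> 1")
      case True
      then have "\<sigma> * sqrt \<sigma> \<le> 1 * 1" using \<sigma> by (intro mult_mono) auto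
      then show ?thesis by (smt (verit) zero_le_power2)
    next
      case False
      then have "sqrt \<sigma> \<le> \<sigma>" by (intro real_le_lsqrt) (auto simp: power2_eq_square)
      then have "\<sigma> * sqrt \<sigma> \<le> \<sigma> * \<sigma>" using \<sigma> by (intro mult_left_mono) auto
      then show ?thesis by (simp add: power2_eq_square)
    qed
    then have 1: "\<sigma> * sqrt \<sigma> \<le> 2 + M\<^sup>2 + R\<^sup>2 + A\<^sup>2" using \<sigma>2 by linarith
    have "(g (x, y))\<^sup>2 = 4 * (\<sigma> * sqrt \<sigma>) * (sqrt \<sigma> * (q (x, y))\<^sup>2)"
    proof -
      have "\<sigma>\<^sup>2 = (\<sigma> * sqrt \<sigma>) * sqrt \<sigma>" using ss by (simp add: power2_eq_square mult.assoc)
      then show ?thesis by (simp add: g_def \<sigma>_def[symmetric] power_mult_distrib)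
    qed
    also have "\<dots> \<le> 4 * (2 + M\<^sup>2 + R\<^sup>2 + A\<^sup>2) * (sqrt \<sigma> * (q (x, y))\<^sup>2)"
      using 1 \<sigma> by (intro mult_right_mono mult_left_mono) auto
    also have "\<dots> \<le> B * De (x, y)" unfolding B_def De_def \<sigma>_def by (intro mult_left_mono) auto
    finally show "(g (x, y))\<^sup>2 \<le> B * De (x, y)" .
    have "(p (x, y))\<^sup>2 \<le> De (x, y)" by (simp add: De_def sg_nonneg)
    also have "\<dots> \<le> B * De (x, y)" using B De0[of "(x, y)"] by (simp add: mult_le_cancel_right1)
    finally show "(p (x, y))\<^sup>2 \<le> B * De (x, y)" .
  qed
  have EnB: "integral X (\<lambda>x. integral Y (\<lambda>y. f (x, y))) \<le> C'"
    if cf: "continuous_on (open_strip R) f" and le: "\<And>x y. \<bar>y\<bar> < R \<Longrightarrow> f (x, y) \<le> B * De (x, y)" for f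
  proof -
    have "integral X (\<lambda>x. integral Y (\<lambda>y. f (x, y))) \<le> integral X (\<lambda>x. integral Y (\<lambda>y. (\<lambda>z. B * De z) (x, y)))"
      unfolding X_def Y_def
      by (rule integral2_mono) (use le Yin XY cf cD in \<open>auto simp: X_def Y_def intro!: continuous_intros intro: continuous_on_subset\<close>)
    also have "\<dots> \<le> integral {x0-D..x0+D} (\<lambda>x. integral {-R'..R'} (\<lambda>y. (\<lambda>z. B * De z) (x, y)))"
      unfolding X_def Y_def
      by (rule integral2_subset_le) (use XYQ B De0 continuous_on_subset[OF cD QO] in \<open>auto simp: X_def Y_def Q_def intro!: continuous_intros\<close>)
    also have "\<dots> = B * integral {x0-D..x0+D} (\<lambda>x. integral {-R'..R'} (\<lambda>y. De (x, y)))" by simp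
    also have "\<dots> \<le> B * C" using En B by (intro mult_left_mono) (auto simp: De_def)
    finally show ?thesis by (simp add: C'(1) B_def)
  qed
  define E where "E y = integral X (\<lambda>x. (g (x, y))\<^sup>2)" for y
  define E2 where "E2 x = integral Y (\<lambda>y. (p (x, y))\<^sup>2)" for x
  have cg2: "continuous_on (X \<times> Y) (\<lambda>z. (g z)\<^sup>2)" "continuous_on (X \<times> Y) (\<lambda>z. (p z)\<^sup>2)"
    using continuous_on_subset[OF cg XY] continuous_on_subset[OF cO(3) XY] by (auto intro!: continuous_intros)
  have lineY: "continuous_on Z (\<lambda>y. f (x, y))" if "continuous_on (open_strip R) f" "Z \<subseteq> Y" for f :: "real \<times> real \<Rightarrow> real" and x Z
    by (rule continuous_on_Pair_compose[OF that(1)]) (use that Yin in \<open>auto simp: open_strip_def intro!: continuous_intros\<close>)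
  have "C' = B * C" by (simp add: C'(1) B_def)
  then have C'0: "0 < C'" using B C'(2) by simp
  have "v (x, y) \<le> (v0 (x0, y0) + 3 * \<gamma>) + 2 * \<gamma>"
  proof (rule pointwise_bound_from_averages[where g = "\<lambda>s t. v (s, t)" and E = E and ?E2.0 = E2 and C = C'
        and \<kappa> = \<delta> and \<rho> = \<rho> and r = r' and \<delta> = \<delta> and ?s0.0 = x0 and ?t0.0 = y0])
    show "0 < \<rho>" "0 < r'" "2 * r' \<le> \<rho>" "0 < \<delta>" "4 * \<delta> \<le> \<rho>" "0 < \<gamma>" "0 < C'" "0 \<le> \<delta>"
      "\<delta> * (2 * C') \<le> \<gamma>\<^sup>2 * r'" "32 * r' * C' \<le> \<rho> * \<gamma>\<^sup>2" "\<bar>x - x0\<bar> \<le> \<rho> / 4" "\<bar>y - y0\<bar> \<le> r'"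
      using \<rho> pos C'0 small xy by auto
  next
    fix s1 s2 t1 t2 c s t
    assume A: "x0 - \<rho> \<le> s1" "s1 < s2" "s2 \<le> x0 + \<rho>" "y0 - \<rho> \<le> t1" "t1 < t2" "t2 \<le> y0 + \<rho>"
      "\<forall>s\<in>{s1..s2}. v (s, t1) \<le> c \<and> v (s, t2) \<le> c" "\<forall>t\<in>{t1..t2}. v (s1, t) \<le> c \<and> v (s2, t) \<le> c"
      "s \<in> {s1..s2}" "t \<in> {t1..t2}"
    show "v (s, t) \<le> c"
      by (rule max_principle_v[OF sol A(2,5)]) (use A Yin in \<open>auto simp: Y_def\<close>)
  next
    show "continuous_on {y0-\<rho>..y0+\<rho>} E" unfolding E_def Y_def[symmetric] X_def
      by (rule continuous_on_integral_fst) (use cg2(1) in \<open>simp add: X_def\<close>)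
    show "continuous_on {x0-\<rho>..x0+\<rho>} E2" unfolding E2_def X_def[symmetric] Y_def
      by (rule continuous_on_integral_snd) (use cg2(2) in \<open>simp add: Y_def\<close>)
    show "0 \<le> E t" if "t \<in> {y0-\<rho>..y0+\<rho>}" for t unfolding E_def
      by (rule Henstock_Kurzweil_Integration.integral_nonneg)
        (use that Yin in \<open>auto simp: X_def Y_def intro!: integrable_continuous_real continuous_intros continuous_on_line_x[OF cg]\<close>)
    show "0 \<le> E2 t" for t unfolding E2_def
      by (rule Henstock_Kurzweil_Integration.integral_nonneg)
        (auto simp: Y_def intro!: integrable_continuous_real continuous_intros lineY[OF cO(3), unfolded Y_def])
    have "integral Y E = integral X (\<lambda>x. integral Y (\<lambda>y. (g (x, y))\<^sup>2))"
      unfolding E_def X_def Y_def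
      by (rule integral_swap_rectangle[symmetric]) (use cg2(1) in \<open>simp add: X_def Y_def\<close>)
    also have "\<dots> \<le> C'" by (rule EnB[of "\<lambda>z. (g z)\<^sup>2"]) (use gD in \<open>auto intro!: continuous_intros cg\<close>)
    finally show "integral {y0-\<rho>..y0+\<rho>} E \<le> C'" by (simp add: Y_def)
    have "integral X E2 \<le> C'" unfolding E2_def
      by (rule EnB[of "\<lambda>z. (p z)\<^sup>2"]) (use gD in \<open>auto intro!: continuous_intros cO\<close>)
    then show "integral {x0-\<rho>..x0+\<rho>} E2 \<le> C'" by (simp add: X_def)
  next
    fix s s' t assume s: "s \<in> {x0-\<rho>..x0+\<rho>}" "s' \<in> {x0-\<rho>..x0+\<rho>}" and t: "t \<in> {y0-\<rho>..y0+\<rho>}" and ss: "s \<le> s'" "s' - s \<le> \<delta>"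
    have tR: "\<bar>t\<bar> < R" using Yin t by (simp add: Y_def)
    have sub: "{s..s'} \<subseteq> X" using s by (auto simp: X_def)
    have "integral {s..s'} (\<lambda>x. g (x, t)) = v (s', t) - v (s, t)"
      by (rule integral_real_derivative[OF ss(1)]) (use sol1_derivs(3)[OF s1 tR] in \<open>simp add: g_def\<close>)
    then have "(v (s', t) - v (s, t))\<^sup>2 \<le> (s' - s) * integral {s..s'} (\<lambda>x. (g (x, t))\<^sup>2)"
      using cauchy_schwarz_interval[OF ss(1) continuous_on_line_x[OF cg tR]] by simp
    also have "\<dots> \<le> \<delta> * E t"
      unfolding E_def
    proof (intro mult_mono integral_subset_le)
      show "0 \<le> integral {s..s'} (\<lambda>x. (g (x, t))\<^sup>2)"
        by (rule Henstock_Kurzweil_Integration.integral_nonneg)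
          (auto intro!: integrable_continuous_real continuous_intros continuous_on_line_x[OF cg tR])
    qed (use ss sub pos tR in \<open>auto simp: X_def intro!: integrable_continuous_real continuous_intros continuous_on_line_x[OF cg tR]\<close>)
    finally show "(v (s', t) - v (s, t))\<^sup>2 \<le> \<delta> * E t" .
  next
    fix s t t' assume s: "s \<in> {x0-\<rho>..x0+\<rho>}" and t: "t \<in> {y0-\<rho>..y0+\<rho>}" "t' \<in> {y0-\<rho>..y0+\<rho>}" "t \<le> t'"
    have sub: "{t..t'} \<subseteq> Y" using t by (auto simp: Y_def)
    have "integral {t..t'} (\<lambda>y. p (s, y)) = v (s, t') - v (s, t)"
      by (rule integral_real_derivative[OF t(3)]) (use sol1_derivs(4)[OF s1] sub Yin in auto)
    then have "(v (s, t') - v (s, t))\<^sup>2 \<le> (t' - t) * integral {t..t'} (\<lambda>x. (p (s, x))\<^sup>2)"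
      using cauchy_schwarz_interval[OF t(3) lineY[OF cO(3) sub, of s]] by simp
    also have "\<dots> \<le> (t' - t) * E2 s"
      unfolding E2_def
      by (intro mult_left_mono integral_subset_le)
        (use t sub in \<open>auto intro!: integrable_continuous_real continuous_intros lineY[OF cO(3) sub] simp: Y_def lineY[OF cO(3), unfolded Y_def]\<close>)
    finally show "(v (s, t') - v (s, t))\<^sup>2 \<le> (t' - t) * E2 s" .
  next
    fix s t assume s: "x0 - \<rho> \<le> s" "s + \<delta> \<le> x0 + \<rho>" and t: "t \<in> {y0-\<rho>..y0+\<rho>}"
    have tR: "\<bar>t\<bar> < R" using Yin t by (simp add: Y_def)
    have ty: "\<bar>t - y0\<bar> \<le> \<rho>" using t by (auto simp: abs_le_iff)
    obtain s' where s': "s' \<in> {s..s+\<delta>}" "v (s', t) \<le> v0 (s', t) + 2 * \<gamma>"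
      using exists_le_of_integral_le[OF continuous_on_line_x[OF cO(2) tR] continuous_on_line_x[OF c0 tR] pos(3,5) avg[OF s ty]] by blast
    moreover have "v0 (s', t) \<le> v0 (x0, y0) + \<gamma>" using osc[of s' t] s' s ty by (auto simp: abs_le_iff)
    ultimately show "\<exists>s'\<in>{s..s+\<delta>}. v (s', t) \<le> v0 (x0, y0) + 3 * \<gamma>" by (intro bexI[of _ s']) auto
  qed
  then show ?thesis by simp
qed

text \<open>Uniformity in \<open>a\<close> is the point. If both end points are within
  \<open>2 * \<delta>\<close> of 0, the function \<open>2 t w\<close> has derivative at least
  \<open>w\<close> and is bounded by \<open>3 * sqrt \<delta>\<close>. Otherwise the whole interval
  stays at distance at least \<open>\<delta>\<close> from 0, and \<open>w\<close> is at most
  \<open>1 / sqrt \<delta>\<close> on it.\<close>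

lemma integral_weight_bound:
  fixes a y y' \<delta> :: real
  assumes a: "a \<noteq> 0" and y: "y \<le> y'" "y' - y \<le> \<delta>" "0 < \<delta>"
  shows "integral {y..y'} (\<lambda>t. (t\<^sup>2 + a\<^sup>2) powr (-1/4)) \<le> 6 * sqrt \<delta>"
proof -
  define w where "w t = (t\<^sup>2 + a\<^sup>2) powr (-1/4)" for t
  have tp: "0 < t\<^sup>2 + a\<^sup>2" for t by (rule tau_pos[OF a])
  have cw: "continuous_on Z w" for Z unfolding w_def using a by (intro continuous_intros) auto
  have w0: "0 \<le> w t" for t by (simp add: w_def)
  have wle: "w t \<le> 1 / sqrt c" if "0 < c" "c \<le> \<bar>t\<bar>" for t c
  proof -
    have "c\<^sup>2 \<le> t\<^sup>2" using that abs_le_square_iff[of c t] by simp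
    then have "w t \<le> (c\<^sup>2) powr (-1/4)" unfolding w_def using that by (intro powr_mono2') (auto simp: add_increasing2)
    also have "\<dots> = c powr (-1/2)" using that by (simp add: powr_powr flip: powr_numeral)
    also have "\<dots> = 1 / sqrt c" using that by (simp add: powr_minus_divide powr_half_sqrt)
    finally show ?thesis .
  qed
  show ?thesis
  proof (cases "\<bar>y\<bar> \<le> 2 * \<delta> \<and> \<bar>y'\<bar> \<le> 2 * \<delta>")
    case True
    define f where "f t = 2 * (t * w t)" for t
    define f' where "f' t = 2 * (w t + t * (- (1/2) * t * w t / (t\<^sup>2 + a\<^sup>2)))" for t
    have dw: "(w has_real_derivative - (1/2) * t * w t / (t\<^sup>2 + a\<^sup>2)) (at t)" for t
      unfolding w_def by (rule has_real_derivative_quartic_weight[OF a])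
    have df: "(f has_real_derivative f' t) (at t)" for t
      unfolding f_def f'_def by (auto intro!: derivative_eq_intros dw)
    have cf': "continuous_on Z f'" for Z
      unfolding f'_def using tp by (intro continuous_intros cw) (auto simp: less_imp_neq[symmetric])
    have ge: "w t \<le> f' t" for t
    proof -
      have "t\<^sup>2 / (t\<^sup>2 + a\<^sup>2) \<le> 1" using tp[of t] by (simp add: divide_le_eq_1)
      then have "w t * (t\<^sup>2 / (t\<^sup>2 + a\<^sup>2)) \<le> w t * 1" using w0 by (intro mult_left_mono) auto
      moreover have "2 * (w t + t * (- (1/2) * t * w t / D)) = 2 * w t - w t * (t\<^sup>2 / D)" for D
        by (simp add: algebra_simps power2_eq_square)
      then have "f' t = 2 * w t - w t * (t\<^sup>2 / (t\<^sup>2 + a\<^sup>2))" unfolding f'_def .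
      ultimately show ?thesis by linarith
    qed
    have fb: "\<bar>f t\<bar> \<le> 3 * sqrt \<delta>" if "\<bar>t\<bar> \<le> 2 * \<delta>" for t
    proof (cases "t = 0")
      case False
      have "\<bar>t\<bar> * w t \<le> \<bar>t\<bar> * (1 / sqrt \<bar>t\<bar>)" using False by (intro mult_left_mono wle) auto
      also have "\<dots> = sqrt \<bar>t\<bar>" using False by (simp add: real_div_sqrt)
      also have "\<dots> \<le> sqrt (2 * \<delta>)" using that by simp
      also have "\<dots> = sqrt 2 * sqrt \<delta>" by (simp add: real_sqrt_mult)
      also have "\<dots> \<le> 3/2 * sqrt \<delta>" using y by (intro mult_right_mono real_le_lsqrt) (auto simp: power2_eq_square)
      finally show ?thesis using w0[of t] by (simp add: f_def abs_mult)
    qed (use y in \<open>simp add: f_def\<close>)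
    have "integral {y..y'} w \<le> integral {y..y'} f'"
      by (rule integral_le) (use ge cw cf' in \<open>auto intro: integrable_continuous_real\<close>)
    also have "\<dots> = f y' - f y" by (rule integral_real_derivative[OF y(1) df])
    also have "\<dots> \<le> 6 * sqrt \<delta>" using fb[of y] fb[of y'] True by linarith
    finally show ?thesis by (simp only: w_def[abs_def])
  next
    case False
    have "\<delta> \<le> \<bar>t\<bar>" if "t \<in> {y..y'}" for t using that False y by auto
    then have "integral {y..y'} w \<le> integral {y..y'} (\<lambda>t. 1 / sqrt \<delta>)"
      by (intro integral_le) (use wle y cw in \<open>auto intro: integrable_continuous_real\<close>)
    also have "\<dots> = (y' - y) / sqrt \<delta>" using y by simp
    also have "\<dots> \<le> \<delta> / sqrt \<delta>" using y by (intro divide_right_mono) auto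
    also have "\<dots> = sqrt \<delta>" using y by (simp add: real_div_sqrt)
    also have "\<dots> \<le> 6 * sqrt \<delta>" using y by simp
    finally show ?thesis by (simp only: w_def[abs_def])
  qed
qed

lemma inverse_sqrt_sg_le:
  assumes "a \<noteq> 0" shows "1 / sqrt (sg a v y) \<le> (y\<^sup>2 + a\<^sup>2) powr (-1/4)"
proof -
  have t: "0 < y\<^sup>2 + a\<^sup>2" by (rule tau_pos[OF assms])
  have "sqrt (y\<^sup>2 + a\<^sup>2) \<le> sg a v y" by (simp add: sg_def)
  then have "1 / sqrt (sg a v y) \<le> 1 / sqrt (sqrt (y\<^sup>2 + a\<^sup>2))"
    using t by (intro divide_left_mono) (auto intro!: mult_pos_pos simp: sg_pos[OF assms])
  also have "sqrt (sqrt (y\<^sup>2 + a\<^sup>2)) = (y\<^sup>2 + a\<^sup>2) powr (1/4)"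
    using t by (simp add: powr_half_sqrt[symmetric] powr_powr)
  also have "1 / (y\<^sup>2 + a\<^sup>2) powr (1/4) = (y\<^sup>2 + a\<^sup>2) powr (-1/4)"
    using powr_minus_divide[of "y\<^sup>2 + a\<^sup>2" "1/4"] by simp
  finally show ?thesis .
qed

text \<open>Compared with \<open>v\<close> the roles of \<open>x\<close> and \<open>y\<close> are
  exchanged. The horizontal derivative of \<open>u\<close> has an unweighted energy bound and serves
  for the crossing. The vertical one is controlled only with the weight \<open>sqrt sg\<close>; it
  is used over lengths at most \<open>\<delta>\<close>, where the weighted Cauchy-Schwarz inequality
  costs the factor \<open>6 * sqrt \<delta>\<close>. The unknown constant \<open>k\<close> comes
  from the potential.\<close>

lemma u_upper_bound:
  fixes u0 :: "real \<times> real \<Rightarrow> real"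
  assumes sol: "sol2 R a u v p q r s" and a: "a \<noteq> 0"
    and En: "integral {x0-D..x0+D} (\<lambda>x. integral {-R'..R'} (\<lambda>y. (p (x, y))\<^sup>2 + sqrt (sg a (v (x, y)) y) * (q (x, y))\<^sup>2)) \<le> C"
    and R': "0 < R'" "R' < R" and \<rho>: "0 < \<rho>" "\<rho> \<le> D" "\<bar>y0\<bar> + \<rho> \<le> R'" and C: "0 < C"
    and pos: "r' > 0" "2 * r' \<le> \<rho>" "\<delta> > 0" "4 * \<delta> \<le> \<rho>" "\<gamma> > 0"
    and small: "6 * sqrt \<delta> * (2 * C) \<le> \<gamma>\<^sup>2 * r'" "32 * r' * C \<le> \<rho> * \<gamma>\<^sup>2"
    and c0: "continuous_on (open_strip R) u0"
    and osc: "\<And>x y. \<bar>x - x0\<bar> \<le> \<rho> \<Longrightarrow> \<bar>y - y0\<bar> \<le> \<rho> \<Longrightarrow> u0 (x, y) \<le> u0 (x0, y0) + \<gamma>"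
    and avg: "\<And>x y. y0 - \<rho> \<le> y \<Longrightarrow> y + \<delta> \<le> y0 + \<rho> \<Longrightarrow> \<bar>x - x0\<bar> \<le> \<rho> \<Longrightarrow>
        \<bar>integral {y..y+\<delta>} (\<lambda>t. u (x, t) - k - u0 (x, t))\<bar> \<le> \<gamma> * \<delta>"
    and xy: "\<bar>y - y0\<bar> \<le> \<rho> / 4" "\<bar>x - x0\<bar> \<le> r'"
  shows "u (x, y) - k \<le> u0 (x0, y0) + 5 * \<gamma>"
proof -
  note s1 = sol2_sol1[OF sol]
  define X where "X = {x0-\<rho>..x0+\<rho>}"
  define Y where "Y = {y0-\<rho>..y0+\<rho>}"
  have Yin: "\<bar>y\<bar> < R" if "y \<in> Y" for y using that R' \<rho> unfolding Y_def by (auto simp: abs_less_iff)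
  have XY: "X \<times> Y \<subseteq> open_strip R" using Yin by (auto simp: open_strip_def)
  define Q where "Q = {x0-D..x0+D} \<times> {-R'..R'}"
  have QO: "Q \<subseteq> open_strip R" unfolding Q_def by (rule rectangle_subset_open_strip) (use R' in auto)
  have XYQ: "X \<subseteq> {x0-D..x0+D}" "Y \<subseteq> {-R'..R'}" using \<rho> R' by (auto simp: X_def Y_def abs_le_iff)
  note cO = sol1_cont[OF s1 order_refl]
  define w where "w z = sqrt (sg a (v z) (snd z))" for z
  have w0: "0 < w z" for z unfolding w_def using sg_pos[OF a] by simp
  have cw: "continuous_on (open_strip R) w" unfolding w_def by (intro continuous_intros cO)
  define g where "g z = w z * (q z)\<^sup>2" for z
  have cg: "continuous_on (open_strip R) g" unfolding g_def by (intro continuous_intros cO cw)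
  define De where "De z = (p z)\<^sup>2 + g z" for z
  have g0: "0 \<le> g z" for z using w0[of z] by (simp add: g_def)
  have cD: "continuous_on (open_strip R) De" unfolding De_def by (intro continuous_intros cO cg)
  have De0: "0 \<le> De z" for z using g0[of z] by (simp add: De_def)
  have EnB: "integral X (\<lambda>x. integral Y (\<lambda>y. f (x, y))) \<le> C"
    if cf: "continuous_on (open_strip R) f" and le: "\<And>z. f z \<le> De z" for f
  proof -
    have "integral X (\<lambda>x. integral Y (\<lambda>y. f (x, y))) \<le> integral X (\<lambda>x. integral Y (\<lambda>y. De (x, y)))"
      unfolding X_def Y_def
      by (rule integral2_mono) (use le XY cf cD in \<open>auto simp: X_def Y_def intro: continuous_on_subset\<close>)
    also have "\<dots> \<le> integral {x0-D..x0+D} (\<lambda>x. integral {-R'..R'} (\<lambda>y. De (x, y)))"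
      unfolding X_def Y_def
      by (rule integral2_subset_le) (use XYQ De0 continuous_on_subset[OF cD QO] in \<open>auto simp: X_def Y_def Q_def\<close>)
    also have "\<dots> \<le> C" using En by (simp add: De_def g_def w_def)
    finally show ?thesis .
  qed
  define E where "E x = integral Y (\<lambda>y. g (x, y))" for x
  define E2 where "E2 y = integral X (\<lambda>x. (p (x, y))\<^sup>2)" for y
  have cg2: "continuous_on (X \<times> Y) g" "continuous_on (X \<times> Y) (\<lambda>z. (p z)\<^sup>2)"
    using continuous_on_subset[OF cg XY] continuous_on_subset[OF cO(3) XY] by (auto intro!: continuous_intros)
  have lineY: "continuous_on Z (\<lambda>y. f (x, y))" if "continuous_on (open_strip R) f" "Z \<subseteq> Y" for f :: "real \<times> real \<Rightarrow> real" and x Z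
    by (rule continuous_on_Pair_compose[OF that(1)]) (use that Yin in \<open>auto simp: open_strip_def intro!: continuous_intros\<close>)
  have "u (x, y) - k \<le> (u0 (x0, y0) + 3 * \<gamma>) + 2 * \<gamma>"
  proof (rule pointwise_bound_from_averages[where g = "\<lambda>s t. u (t, s) - k" and E = E and ?E2.0 = E2 and C = C
        and \<kappa> = "6 * sqrt \<delta>" and \<rho> = \<rho> and r = r' and \<delta> = \<delta> and ?s0.0 = y0 and ?t0.0 = x0])
    show "0 < \<rho>" "0 < r'" "2 * r' \<le> \<rho>" "0 < \<delta>" "4 * \<delta> \<le> \<rho>" "0 < \<gamma>" "0 < C" "0 \<le> 6 * sqrt \<delta>"
      "6 * sqrt \<delta> * (2 * C) \<le> \<gamma>\<^sup>2 * r'" "32 * r' * C \<le> \<rho> * \<gamma>\<^sup>2" "\<bar>y - y0\<bar> \<le> \<rho> / 4" "\<bar>x - x0\<bar> \<le> r'"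
      using \<rho> pos C small xy by auto
  next
    fix s1 s2 t1 t2 c s t
    assume A: "y0 - \<rho> \<le> s1" "s1 < s2" "s2 \<le> y0 + \<rho>" "x0 - \<rho> \<le> t1" "t1 < t2" "t2 \<le> x0 + \<rho>"
      "\<forall>s\<in>{s1..s2}. u (t1, s) - k \<le> c \<and> u (t2, s) - k \<le> c" "\<forall>t\<in>{t1..t2}. u (t, s1) - k \<le> c \<and> u (t, s2) - k \<le> c"
      "s \<in> {s1..s2}" "t \<in> {t1..t2}"
    have "u (t, s) \<le> c + k"
      by (rule max_principle_u[OF sol A(5,2)]) (use A Yin in \<open>auto simp: Y_def algebra_simps\<close>)
    then show "u (t, s) - k \<le> c" by simp
  next
    show "continuous_on {x0-\<rho>..x0+\<rho>} E" unfolding E_def X_def[symmetric] Y_def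
      by (rule continuous_on_integral_snd) (use cg2(1) in \<open>simp add: Y_def\<close>)
    show "continuous_on {y0-\<rho>..y0+\<rho>} E2" unfolding E2_def Y_def[symmetric] X_def
      by (rule continuous_on_integral_fst) (use cg2(2) in \<open>simp add: X_def\<close>)
    show "0 \<le> E t" for t unfolding E_def
      by (rule Henstock_Kurzweil_Integration.integral_nonneg)
        (use g0 in \<open>auto simp: Y_def intro!: integrable_continuous_real lineY[OF cg, unfolded Y_def]\<close>)
    show "0 \<le> E2 t" if "t \<in> {y0-\<rho>..y0+\<rho>}" for t unfolding E2_def
      by (rule Henstock_Kurzweil_Integration.integral_nonneg)
        (use that Yin in \<open>auto simp: X_def Y_def intro!: integrable_continuous_real continuous_intros continuous_on_line_x[OF cO(3)]\<close>)
    have "integral X E \<le> C" unfolding E_def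
      by (rule EnB[OF cg]) (simp add: De_def)
    then show "integral {x0-\<rho>..x0+\<rho>} E \<le> C" by (simp add: X_def)
    have "integral Y E2 = integral X (\<lambda>x. integral Y (\<lambda>y. (p (x, y))\<^sup>2))"
      unfolding E2_def X_def Y_def
      by (rule integral_swap_rectangle[symmetric]) (use cg2(2) in \<open>simp add: X_def Y_def\<close>)
    also have "\<dots> \<le> C" by (rule EnB[of "\<lambda>z. (p z)\<^sup>2"]) (use g0 in \<open>auto intro!: continuous_intros cO simp: De_def\<close>)
    finally show "integral {y0-\<rho>..y0+\<rho>} E2 \<le> C" by (simp add: Y_def)
  next
    fix s s' t assume s: "s \<in> {y0-\<rho>..y0+\<rho>}" "s' \<in> {y0-\<rho>..y0+\<rho>}" and t: "t \<in> {x0-\<rho>..x0+\<rho>}" and ss: "s \<le> s'" "s' - s \<le> \<delta>"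
    have sub: "{s..s'} \<subseteq> Y" using s by (auto simp: Y_def)
    have "integral {s..s'} (\<lambda>y. q (t, y)) = u (t, s') - u (t, s)"
      by (rule integral_real_derivative[OF ss(1)]) (use sol1_derivs(2)[OF s1] sub Yin in auto)
    then have "(u (t, s') - u (t, s))\<^sup>2 \<le> integral {s..s'} (\<lambda>y. 1 / w (t, y)) * integral {s..s'} (\<lambda>y. g (t, y))"
      using cauchy_schwarz_weighted[OF ss(1) lineY[OF cO(4) sub, of t] lineY[OF cw sub, of t] w0] by (simp add: g_def)
    also have "\<dots> \<le> (6 * sqrt \<delta>) * E t"
    proof (rule mult_mono)
      have "integral {s..s'} (\<lambda>y. 1 / w (t, y)) \<le> integral {s..s'} (\<lambda>y. (y\<^sup>2 + a\<^sup>2) powr (-1/4))"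
      proof (rule integral_le)
        show "(\<lambda>y. 1 / w (t, y)) integrable_on {s..s'}"
          using w0 by (intro integrable_continuous_real continuous_intros lineY[OF cw sub]) (auto simp: less_imp_neq[symmetric])
        show "(\<lambda>y. (y\<^sup>2 + a\<^sup>2) powr (-1/4)) integrable_on {s..s'}"
          using a by (intro integrable_continuous_real continuous_intros) auto
        show "1 / w (t, y) \<le> (y\<^sup>2 + a\<^sup>2) powr (-1/4)" for y
          unfolding w_def snd_conv by (rule inverse_sqrt_sg_le[OF a])
      qed
      also have "\<dots> \<le> 6 * sqrt \<delta>" by (rule integral_weight_bound[OF a ss pos(3)])
      finally show "integral {s..s'} (\<lambda>y. 1 / w (t, y)) \<le> 6 * sqrt \<delta>" .
      show "integral {s..s'} (\<lambda>y. g (t, y)) \<le> E t" unfolding E_def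
        by (rule integral_subset_le[OF sub])
          (use g0 in \<open>auto simp: Y_def intro!: integrable_continuous_real lineY[OF cg sub] lineY[OF cg, unfolded Y_def]\<close>)
      show "0 \<le> integral {s..s'} (\<lambda>y. g (t, y))"
        by (rule Henstock_Kurzweil_Integration.integral_nonneg)
          (use g0 in \<open>auto intro!: integrable_continuous_real lineY[OF cg sub]\<close>)
    qed (use pos in simp)
    finally show "(u (t, s') - k - (u (t, s) - k))\<^sup>2 \<le> 6 * sqrt \<delta> * E t" by simp
  next
    fix s t t' assume s: "s \<in> {y0-\<rho>..y0+\<rho>}" and t: "t \<in> {x0-\<rho>..x0+\<rho>}" "t' \<in> {x0-\<rho>..x0+\<rho>}" "t \<le> t'"
    have sR: "\<bar>s\<bar> < R" using Yin s by (simp add: Y_def)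
    have sub: "{t..t'} \<subseteq> X" using t by (auto simp: X_def)
    have "integral {t..t'} (\<lambda>x. p (x, s)) = u (t', s) - u (t, s)"
      by (rule integral_real_derivative[OF t(3)]) (use sol1_derivs(1)[OF s1 sR] in auto)
    then have "(u (t', s) - u (t, s))\<^sup>2 \<le> (t' - t) * integral {t..t'} (\<lambda>x. (p (x, s))\<^sup>2)"
      using cauchy_schwarz_interval[OF t(3) continuous_on_line_x[OF cO(3) sR]] by simp
    also have "\<dots> \<le> (t' - t) * E2 s"
      unfolding E2_def
      by (intro mult_left_mono integral_subset_le)
        (use t sub in \<open>auto intro!: integrable_continuous_real continuous_intros continuous_on_line_x[OF cO(3) sR] simp: X_def\<close>)
    finally show "(u (t', s) - k - (u (t, s) - k))\<^sup>2 \<le> (t' - t) * E2 s" by simp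
  next
    fix s t assume s: "y0 - \<rho> \<le> s" "s + \<delta> \<le> y0 + \<rho>" and t: "t \<in> {x0-\<rho>..x0+\<rho>}"
    have sub: "{s..s+\<delta>} \<subseteq> Y" using s by (auto simp: Y_def)
    have tx: "\<bar>t - x0\<bar> \<le> \<rho>" using t by (auto simp: abs_le_iff)
    have cu: "continuous_on {s..s+\<delta>} (\<lambda>y. u (t, y) - k)" by (intro continuous_intros lineY[OF cO(1) sub])
    obtain s' where s': "s' \<in> {s..s+\<delta>}" "u (t, s') - k \<le> u0 (t, s') + 2 * \<gamma>"
      using exists_le_of_integral_le[OF cu lineY[OF c0 sub] pos(3,5) avg[OF s tx]] by blast
    moreover have "u0 (t, s') \<le> u0 (x0, y0) + \<gamma>" using osc[of t s'] s' s tx by (auto simp: abs_le_iff)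
    ultimately show "\<exists>s'\<in>{s..s+\<delta>}. u (t, s') - k \<le> u0 (x0, y0) + 3 * \<gamma>" by (intro bexI[of _ s']) auto
  qed
  then show ?thesis by simp
qed

text \<open>The quantifier order is the content: \<open>\<rho>\<close> comes from the continuity of
  \<open>u0\<close> and \<open>v0\<close>, then \<open>r'\<close> is small against
  \<open>\<rho>\<close>, then \<open>\<delta>\<close> small against \<open>r'\<close>, and all three
  precede the solution and its parameter \<open>a\<close>. Lower bounds are the upper bounds for the
  negated solution.\<close>

lemma closeness_at_point:
  fixes u0 v0 :: "real \<times> real \<Rightarrow> real"
  assumes R: "0 < R'" "R' < R" and P: "0 < P" and y0: "\<bar>y0\<bar> < R'" and C: "0 < C" and \<gamma>: "0 < \<gamma>"
    and cu0: "continuous_on (open_strip R) u0" and cv0: "continuous_on (open_strip R) v0"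
  shows "\<exists>\<rho> \<delta> r'. 0 < \<rho> \<and> \<rho> \<le> P / 2 \<and> \<bar>y0\<bar> + \<rho> \<le> R' \<and> 0 < \<delta> \<and> 0 < r' \<and> (\<forall>a u v p q r s k.
    a \<noteq> 0 \<longrightarrow> \<bar>a\<bar> \<le> A \<longrightarrow> sol2 R a u v p q r s \<longrightarrow> (\<forall>x y. \<bar>y\<bar> < R \<longrightarrow> \<bar>v (x, y)\<bar> \<le> M) \<longrightarrow>
    integral {x0-P/2..x0+P/2} (\<lambda>x. integral {-R'..R'} (\<lambda>y. (p (x, y))\<^sup>2 + sqrt (sg a (v (x, y)) y) * (q (x, y))\<^sup>2)) \<le> C \<longrightarrow>
    (\<forall>x y. x0 - \<rho> \<le> x \<longrightarrow> x + \<delta> \<le> x0 + \<rho> \<longrightarrow> \<bar>y - y0\<bar> \<le> \<rho> \<longrightarrow>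
        \<bar>integral {x..x+\<delta>} (\<lambda>t. v (t, y) - v0 (t, y))\<bar> \<le> \<gamma> * \<delta>) \<longrightarrow>
    (\<forall>x y. y0 - \<rho> \<le> y \<longrightarrow> y + \<delta> \<le> y0 + \<rho> \<longrightarrow> \<bar>x - x0\<bar> \<le> \<rho> \<longrightarrow>
        \<bar>integral {y..y+\<delta>} (\<lambda>t. u (x, t) - k - u0 (x, t))\<bar> \<le> \<gamma> * \<delta>) \<longrightarrow>
    (\<forall>x y. \<bar>x - x0\<bar> \<le> r' \<longrightarrow> \<bar>y - y0\<bar> \<le> r' \<longrightarrow>
        \<bar>v (x, y) - v0 (x0, y0)\<bar> \<le> 5 * \<gamma> \<and> \<bar>u (x, y) - k - u0 (x0, y0)\<bar> \<le> 5 * \<gamma>))"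
proof -
  have O: "open (open_strip R)"
  proof -
    have "open_strip R = {p. \<bar>snd p\<bar> < R}" by (simp add: open_strip_def)
    then show ?thesis by (auto intro!: open_Collect_less continuous_intros)
  qed
  have near: "\<exists>\<rho>>0. \<forall>x y. \<bar>x - x0\<bar> \<le> \<rho> \<longrightarrow> \<bar>y - y0\<bar> \<le> \<rho> \<longrightarrow> \<bar>f (x, y) - f (x0, y0)\<bar> \<le> \<gamma>"
    if "continuous_on (open_strip R) f" for f :: "real \<times> real \<Rightarrow> real"
  proof -
    have "isCont f (x0, y0)"
      using that O y0 R by (simp add: continuous_on_eq_continuous_at open_strip_def)
    then obtain d where d: "d > 0" "\<And>z. dist z (x0, y0) < d \<Longrightarrow> dist (f z) (f (x0, y0)) < \<gamma>"
      using \<gamma> unfolding continuous_at_eps_delta by blast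
    show ?thesis
    proof (intro exI[of _ "d / 3"] conjI allI impI)
      fix x y assume "\<bar>x - x0\<bar> \<le> d / 3" "\<bar>y - y0\<bar> \<le> d / 3"
      then have "dist (x, y) (x0, y0) < d"
        using d(1) sqrt_sum_squares_le_sum_abs[of "x - x0" "y - y0"]
        by (simp add: dist_Pair_Pair dist_real_def)
      then show "\<bar>f (x, y) - f (x0, y0)\<bar> \<le> \<gamma>" using d(2) by (force simp: dist_real_def)
    qed (use d in simp)
  qed
  obtain \<rho>1 where \<rho>1: "\<rho>1 > 0" "\<And>x y. \<bar>x - x0\<bar> \<le> \<rho>1 \<Longrightarrow> \<bar>y - y0\<bar> \<le> \<rho>1 \<Longrightarrow> \<bar>u0 (x, y) - u0 (x0, y0)\<bar> \<le> \<gamma>"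
    using near[OF cu0] by blast
  obtain \<rho>2 where \<rho>2: "\<rho>2 > 0" "\<And>x y. \<bar>x - x0\<bar> \<le> \<rho>2 \<Longrightarrow> \<bar>y - y0\<bar> \<le> \<rho>2 \<Longrightarrow> \<bar>v0 (x, y) - v0 (x0, y0)\<bar> \<le> \<gamma>"
    using near[OF cv0] by blast
  define \<rho> where "\<rho> = min (min \<rho>1 \<rho>2) (min (P / 2) (R' - \<bar>y0\<bar>))"
  have \<rho>: "0 < \<rho>" "\<rho> \<le> P / 2" "\<bar>y0\<bar> + \<rho> \<le> R'" "\<rho> \<le> \<rho>1" "\<rho> \<le> \<rho>2"
    unfolding \<rho>_def using \<rho>1(1) \<rho>2(1) P y0 by linarith+
  define C' where "C' = 4 * (2 + M\<^sup>2 + R\<^sup>2 + A\<^sup>2) * C"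
  have CC': "C \<le> C'"
  proof -
    have "1 * C \<le> 4 * (2 + M\<^sup>2 + R\<^sup>2 + A\<^sup>2) * C" using C by (intro mult_right_mono) auto
    then show ?thesis by (simp add: C'_def)
  qed
  then have C': "0 < C'" using C by linarith
  define r' where "r' = min (\<rho> / 4) (\<rho> * \<gamma>\<^sup>2 / (32 * C'))"
  have r': "0 < r'" "r' \<le> \<rho> / 4" "32 * r' * C' \<le> \<rho> * \<gamma>\<^sup>2"
  proof -
    show "0 < r'" "r' \<le> \<rho> / 4" using \<rho> \<gamma> C' by (auto simp: r'_def)
    have "r' \<le> \<rho> * \<gamma>\<^sup>2 / (32 * C')" by (simp add: r'_def)
    then show "32 * r' * C' \<le> \<rho> * \<gamma>\<^sup>2" using C' by (simp add: field_simps)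
  qed
  define \<delta> where "\<delta> = min (\<rho> / 4) (min (\<gamma>\<^sup>2 * r' / (2 * C')) ((\<gamma>\<^sup>2 * r' / (12 * C))\<^sup>2))"
  have \<delta>: "0 < \<delta>" "4 * \<delta> \<le> \<rho>" "\<delta> * (2 * C') \<le> \<gamma>\<^sup>2 * r'" "6 * sqrt \<delta> * (2 * C) \<le> \<gamma>\<^sup>2 * r'"
  proof -
    show "0 < \<delta>" "4 * \<delta> \<le> \<rho>" using \<rho> \<gamma> C C' r' by (auto simp: \<delta>_def)
    have "\<delta> \<le> \<gamma>\<^sup>2 * r' / (2 * C')" by (simp add: \<delta>_def)
    then show "\<delta> * (2 * C') \<le> \<gamma>\<^sup>2 * r'" using C' by (simp add: field_simps)
    have "sqrt \<delta> \<le> \<gamma>\<^sup>2 * r' / (12 * C)"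
      by (rule real_le_lsqrt) (use \<rho> \<gamma> C C' r' in \<open>auto simp: \<delta>_def\<close>)
    then show "6 * sqrt \<delta> * (2 * C) \<le> \<gamma>\<^sup>2 * r'" using C by (simp add: field_simps)
  qed
  have r2: "32 * r' * C \<le> \<rho> * \<gamma>\<^sup>2"
  proof -
    have "32 * r' * C \<le> 32 * r' * C'" using CC' r' by (intro mult_left_mono) auto
    then show ?thesis using r' by linarith
  qed
  show ?thesis
  proof (rule exI[of _ \<rho>], rule exI[of _ \<delta>], rule exI[of _ r'], intro conjI \<rho>(1-3) \<delta>(1) r'(1) allI impI)
    fix a u v p q r s k x y
    assume a: "a \<noteq> 0" "\<bar>a\<bar> \<le> A" and sol: "sol2 R a u v p q r s" and M: "\<forall>x y. \<bar>y\<bar> < R \<longrightarrow> \<bar>v (x, y)\<bar> \<le> M"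
      and En: "integral {x0-P/2..x0+P/2} (\<lambda>x. integral {-R'..R'} (\<lambda>y. (p (x, y))\<^sup>2 + sqrt (sg a (v (x, y)) y) * (q (x, y))\<^sup>2)) \<le> C"
      and av: "\<forall>x y. x0 - \<rho> \<le> x \<longrightarrow> x + \<delta> \<le> x0 + \<rho> \<longrightarrow> \<bar>y - y0\<bar> \<le> \<rho> \<longrightarrow>
        \<bar>integral {x..x+\<delta>} (\<lambda>t. v (t, y) - v0 (t, y))\<bar> \<le> \<gamma> * \<delta>"
      and au: "\<forall>x y. y0 - \<rho> \<le> y \<longrightarrow> y + \<delta> \<le> y0 + \<rho> \<longrightarrow> \<bar>x - x0\<bar> \<le> \<rho> \<longrightarrow>
        \<bar>integral {y..y+\<delta>} (\<lambda>t. u (x, t) - k - u0 (x, t))\<bar> \<le> \<gamma> * \<delta>"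
      and x: "\<bar>x - x0\<bar> \<le> r'" and y: "\<bar>y - y0\<bar> \<le> r'"
    have r22: "2 * r' \<le> \<rho>" using r' \<rho> by linarith
    have xy: "\<bar>x - x0\<bar> \<le> \<rho> / 4" "\<bar>y - y0\<bar> \<le> \<rho> / 4" using x y r' by auto
    have osc: "\<bar>u0 (x, y) - u0 (x0, y0)\<bar> \<le> \<gamma>" "\<bar>v0 (x, y) - v0 (x0, y0)\<bar> \<le> \<gamma>"
      if "\<bar>x - x0\<bar> \<le> \<rho>" "\<bar>y - y0\<bar> \<le> \<rho>" for x y using \<rho>1(2) \<rho>2(2) \<rho> that by auto
    note solm = sol2_neg[OF sol]
    have En': "integral {x0-P/2..x0+P/2} (\<lambda>x. integral {-R'..R'} (\<lambda>y. (- p (x, y))\<^sup>2 + sqrt (sg a (- v (x, y)) y) * (- q (x, y))\<^sup>2)) \<le> C"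
      using En by (simp add: sg_def)
    have Mv: "\<bar>v (x, y)\<bar> \<le> M" "\<bar>- v (x, y)\<bar> \<le> M" if "\<bar>y\<bar> < R" for x y using M that by auto
    have ov: "v0 (x, y) \<le> v0 (x0, y0) + \<gamma>" "- v0 (x, y) \<le> - v0 (x0, y0) + \<gamma>"
      "u0 (x, y) \<le> u0 (x0, y0) + \<gamma>" "- u0 (x, y) \<le> - u0 (x0, y0) + \<gamma>"
      if "\<bar>x - x0\<bar> \<le> \<rho>" "\<bar>y - y0\<bar> \<le> \<rho>" for x y using osc[OF that] by linarith+
    have av1: "\<bar>integral {x..x+\<delta>} (\<lambda>t. v (t, y) - v0 (t, y))\<bar> \<le> \<gamma> * \<delta>"
      "\<bar>integral {x..x+\<delta>} (\<lambda>t. - v (t, y) - - v0 (t, y))\<bar> \<le> \<gamma> * \<delta>"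
      if "x0 - \<rho> \<le> x" "x + \<delta> \<le> x0 + \<rho>" "\<bar>y - y0\<bar> \<le> \<rho>" for x y
    proof -
      show 1: "\<bar>integral {x..x+\<delta>} (\<lambda>t. v (t, y) - v0 (t, y))\<bar> \<le> \<gamma> * \<delta>" using av that by blast
      have "(\<lambda>t. - v (t, y) - - v0 (t, y)) = (\<lambda>t. - (v (t, y) - v0 (t, y)))" by (simp add: fun_eq_iff)
      then show "\<bar>integral {x..x+\<delta>} (\<lambda>t. - v (t, y) - - v0 (t, y))\<bar> \<le> \<gamma> * \<delta>"
        using 1 by (simp only: integral_neg abs_minus_cancel)
    qed
    have au1: "\<bar>integral {y..y+\<delta>} (\<lambda>t. u (x, t) - k - u0 (x, t))\<bar> \<le> \<gamma> * \<delta>"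
      "\<bar>integral {y..y+\<delta>} (\<lambda>t. - u (x, t) - - k - - u0 (x, t))\<bar> \<le> \<gamma> * \<delta>"
      if "y0 - \<rho> \<le> y" "y + \<delta> \<le> y0 + \<rho>" "\<bar>x - x0\<bar> \<le> \<rho>" for x y
    proof -
      show 1: "\<bar>integral {y..y+\<delta>} (\<lambda>t. u (x, t) - k - u0 (x, t))\<bar> \<le> \<gamma> * \<delta>" using au that by blast
      have "(\<lambda>t. - u (x, t) - - k - - u0 (x, t)) = (\<lambda>t. - (u (x, t) - k - u0 (x, t)))" by (simp add: fun_eq_iff)
      then show "\<bar>integral {y..y+\<delta>} (\<lambda>t. - u (x, t) - - k - - u0 (x, t))\<bar> \<le> \<gamma> * \<delta>"
        using 1 by (simp only: integral_neg abs_minus_cancel)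
    qed
    have v1: "v (x, y) \<le> v0 (x0, y0) + 5 * \<gamma>"
      by (rule v_upper_bound[OF sol a Mv(1) En R \<rho>(1-3) C'_def C r'(1) r22 \<delta>(1,2) \<gamma> \<delta>(3) r'(3) cv0 ov(1) av1(1) xy(1) y])
    have v2: "- v (x, y) \<le> - v0 (x0, y0) + 5 * \<gamma>"
      by (rule v_upper_bound[OF solm a Mv(2) En' R \<rho>(1-3) C'_def C r'(1) r22 \<delta>(1,2) \<gamma> \<delta>(3) r'(3)
            continuous_on_minus[OF cv0] ov(2) av1(2) xy(1) y])
    have u1: "u (x, y) - k \<le> u0 (x0, y0) + 5 * \<gamma>"
      by (rule u_upper_bound[OF sol a(1) En R \<rho>(1-3) C r'(1) r22 \<delta>(1,2) \<gamma> \<delta>(4) r2 cu0 ov(3) au1(1) xy(2) x])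
    have u2: "- u (x, y) - - k \<le> - u0 (x0, y0) + 5 * \<gamma>"
      by (rule u_upper_bound[OF solm a(1) En' R \<rho>(1-3) C r'(1) r22 \<delta>(1,2) \<gamma> \<delta>(4) r2 continuous_on_minus[OF cu0]
            ov(4) au1(2) xy(2) x])
    show "\<bar>v (x, y) - v0 (x0, y0)\<bar> \<le> 5 * \<gamma>" "\<bar>u (x, y) - k - u0 (x0, y0)\<bar> \<le> 5 * \<gamma>"
      using v1 v2 u1 u2 by linarith+
  qed
qed

text \<open>\<open>(U, V)\<close> mediates between the solution \<open>(u, v)\<close> and the limit
  \<open>(u0, v0)\<close>: it is regular, so a potential for its difference from
  \<open>(u, v)\<close> exists, and it is uniformly close to the limit, which itself may be
  singular.\<close>

lemma local_convergence:
  fixes u0 v0 :: "real \<times> real \<Rightarrow> real" and R P A M x0 y0 \<eta> :: real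
  assumes R: "0 < R" and P: "0 < P" and M0: "0 \<le> M" and y0: "\<bar>y0\<bar> < R" and \<eta>: "0 < \<eta>"
    and cu0: "continuous_on (open_strip R) u0" and cv0: "continuous_on (open_strip R) v0" and u00: "u0 (0, 0) = 0"
  shows "\<exists>L \<epsilon> R1 d. 0 < \<epsilon> \<and> 0 < R1 \<and> R1 < R \<and> 0 < d \<and> (\<forall>a u v p q r s b U V pU qU R' x y.
    a \<noteq> 0 \<longrightarrow> \<bar>a\<bar> \<le> A \<longrightarrow> sol2 R a u v p q r s \<longrightarrow> sol1 R b U V pU qU \<longrightarrow>
    (\<forall>x y. \<bar>y\<bar> < R \<longrightarrow> u (x + P, y) = u (x, y) \<and> v (x + P, y) = v (x, y)) \<longrightarrow>
    (\<forall>x y. \<bar>y\<bar> < R \<longrightarrow> \<bar>v (x, y)\<bar> \<le> M \<and> \<bar>V (x, y)\<bar> \<le> M) \<longrightarrow> u (0, 0) = 0 \<longrightarrow>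
    R1 < R' \<longrightarrow> R' < R \<longrightarrow>
    (\<forall>x. \<bar>x\<bar> \<le> L \<longrightarrow> \<bar>v (x, R') - V (x, R')\<bar> \<le> \<epsilon> \<and> \<bar>v (x, -R') - V (x, -R')\<bar> \<le> \<epsilon>) \<longrightarrow>
    (\<forall>x y. \<bar>x\<bar> \<le> L \<longrightarrow> \<bar>y\<bar> \<le> R' \<longrightarrow> \<bar>qU (x, y) * (1 - sg b (V (x, y)) y / sg a (V (x, y)) y)\<bar> \<le> \<epsilon>) \<longrightarrow>
    (\<forall>x y. \<bar>x\<bar> \<le> L \<longrightarrow> \<bar>y\<bar> < R \<longrightarrow> \<bar>U (x, y) - u0 (x, y)\<bar> \<le> \<epsilon> \<and> \<bar>V (x, y) - v0 (x, y)\<bar> \<le> \<epsilon>) \<longrightarrow>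
    \<bar>x - x0\<bar> \<le> d \<longrightarrow> \<bar>y - y0\<bar> \<le> d \<longrightarrow>
    \<bar>v (x, y) - v0 (x0, y0)\<bar> < \<eta> \<and> \<bar>u (x, y) - u0 (x0, y0)\<bar> < \<eta>)"
proof -
  define R1 where "R1 = (\<bar>y0\<bar> + R) / 2"
  have R1: "0 < R1" "R1 < R" "\<bar>y0\<bar> < R1" using y0 R by (auto simp: R1_def)
  \<comment> \<open>The closeness estimate is used twice, at \<open>(x0, y0)\<close> and at the
    origin, with a loss of \<open>5 * \<gamma>\<close> each.\<close>
  define \<gamma> where "\<gamma> = \<eta> / 12"
  have \<gamma>: "0 < \<gamma>" using \<eta> by (simp add: \<gamma>_def)
  obtain C where C: "C > 0" and En: "\<And>a u v p q r s c. a \<noteq> 0 \<Longrightarrow> \<bar>a\<bar> \<le> A \<Longrightarrow> sol2 R a u v p q r s \<Longrightarrow>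
     (\<forall>x y. \<bar>y\<bar> < R \<longrightarrow> u (x + P, y) = u (x, y) \<and> v (x + P, y) = v (x, y)) \<Longrightarrow>
     (\<forall>x y. \<bar>y\<bar> < R \<longrightarrow> \<bar>v (x, y)\<bar> \<le> M) \<Longrightarrow>
     integral {c..c+P} (\<lambda>x. integral {-R1..R1} (\<lambda>y. (p (x, y))\<^sup>2 + sqrt (sg a (v (x, y)) y) * (q (x, y))\<^sup>2)) \<le> C"
    using energy_bound[OF R1(1,2) P, of A M] by blast
  define conc where "conc x1 y1 \<rho> \<delta> r' \<longleftrightarrow> 0 < \<rho> \<and> \<rho> \<le> P / 2 \<and> \<bar>y1\<bar> + \<rho> \<le> R1 \<and> 0 < \<delta> \<and> 0 < r' \<and> (\<forall>a u v p q r s k.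
    a \<noteq> 0 \<longrightarrow> \<bar>a\<bar> \<le> A \<longrightarrow> sol2 R a u v p q r s \<longrightarrow> (\<forall>x y. \<bar>y\<bar> < R \<longrightarrow> \<bar>v (x, y)\<bar> \<le> M) \<longrightarrow>
    integral {x1-P/2..x1+P/2} (\<lambda>x. integral {-R1..R1} (\<lambda>y. (p (x, y))\<^sup>2 + sqrt (sg a (v (x, y)) y) * (q (x, y))\<^sup>2)) \<le> C \<longrightarrow>
    (\<forall>x y. x1 - \<rho> \<le> x \<longrightarrow> x + \<delta> \<le> x1 + \<rho> \<longrightarrow> \<bar>y - y1\<bar> \<le> \<rho> \<longrightarrow>
        \<bar>integral {x..x+\<delta>} (\<lambda>t. v (t, y) - v0 (t, y))\<bar> \<le> \<gamma> * \<delta>) \<longrightarrow>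
    (\<forall>x y. y1 - \<rho> \<le> y \<longrightarrow> y + \<delta> \<le> y1 + \<rho> \<longrightarrow> \<bar>x - x1\<bar> \<le> \<rho> \<longrightarrow>
        \<bar>integral {y..y+\<delta>} (\<lambda>t. u (x, t) - k - u0 (x, t))\<bar> \<le> \<gamma> * \<delta>) \<longrightarrow>
    (\<forall>x y. \<bar>x - x1\<bar> \<le> r' \<longrightarrow> \<bar>y - y1\<bar> \<le> r' \<longrightarrow>
        \<bar>v (x, y) - v0 (x1, y1)\<bar> \<le> 5 * \<gamma> \<and> \<bar>u (x, y) - k - u0 (x1, y1)\<bar> \<le> 5 * \<gamma>))" for x1 y1 \<rho> \<delta> r'
  have ex: "\<exists>\<rho> \<delta> r'. conc x1 y1 \<rho> \<delta> r'" if "\<bar>y1\<bar> < R1" for x1 y1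
    unfolding conc_def by (rule closeness_at_point[OF R1(1,2) P that C \<gamma> cu0 cv0])
  obtain \<rho>0 \<delta>0 r0 where c0: "conc x0 y0 \<rho>0 \<delta>0 r0" using ex[OF R1(3)] by blast
  \<comment> \<open>At the origin both \<open>u\<close> and \<open>u0\<close> vanish, so the
    estimate there bounds the unknown additive constant \<open>k\<close>.\<close>
  obtain \<rho>1 \<delta>1 r1 where c1: "conc 0 0 \<rho>1 \<delta>1 r1" using ex[of 0 0] R1 by auto
  have pos: "0 < \<delta>0" "0 < \<delta>1" "0 < r0" "0 < r1" using c0 c1 by (auto simp: conc_def)
  \<comment> \<open>Half of the admissible deviation \<open>\<gamma> * \<delta>\<close> of an
    integral goes to \<open>2 * \<eta>1\<close> from the potential, the other half to the distance
    between \<open>(U, V)\<close> and the limit.\<close>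
  define \<eta>1 where "\<eta>1 = \<gamma> * min \<delta>0 \<delta>1 / 4"
  have \<eta>1: "0 < \<eta>1" using \<gamma> pos by (simp add: \<eta>1_def)
  define K where "K = \<bar>x0\<bar> + P"
  have K: "0 \<le> K" using P by (simp add: K_def)
  obtain L \<epsilon>1 where L: "K + 1 \<le> L" and \<epsilon>1: "0 < \<epsilon>1" and
    pot: "\<And>a b u1 v1 p1 q1 u2 v2 p2 q2 R'.
     a \<noteq> 0 \<Longrightarrow> \<bar>a\<bar> \<le> A \<Longrightarrow> 0 < R' \<Longrightarrow> R' < R \<Longrightarrow> sol1 R a u1 v1 p1 q1 \<Longrightarrow> sol1 R b u2 v2 p2 q2 \<Longrightarrow>
     (\<forall>x y. \<bar>y\<bar> < R \<longrightarrow> \<bar>v1 (x, y)\<bar> \<le> M \<and> \<bar>v2 (x, y)\<bar> \<le> M) \<Longrightarrow>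
     (\<forall>x. \<bar>x\<bar> \<le> L \<longrightarrow> \<bar>v1 (x, R') - v2 (x, R')\<bar> \<le> \<epsilon>1 \<and> \<bar>v1 (x, -R') - v2 (x, -R')\<bar> \<le> \<epsilon>1) \<Longrightarrow>
     (\<forall>x y. \<bar>x\<bar> \<le> L \<longrightarrow> \<bar>y\<bar> \<le> R' \<longrightarrow> \<bar>q2 (x, y) * (1 - sg b (v2 (x, y)) y / sg a (v2 (x, y)) y)\<bar> \<le> \<epsilon>1) \<Longrightarrow>
     (\<exists>\<gamma>. (\<forall>x x' y. -K \<le> x \<longrightarrow> x \<le> x' \<longrightarrow> x' \<le> K \<longrightarrow> \<bar>y\<bar> \<le> R' \<longrightarrow>
              \<bar>integral {x..x'} (\<lambda>t. v1 (t, y) - v2 (t, y))\<bar> \<le> 2 * \<eta>1) \<and>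
          (\<forall>x y y'. \<bar>x\<bar> \<le> K \<longrightarrow> -R' \<le> y \<longrightarrow> y \<le> y' \<longrightarrow> y' \<le> R' \<longrightarrow>
              \<bar>integral {y..y'} (\<lambda>t. u1 (x, t) - u2 (x, t) - \<gamma>)\<bar> \<le> 2 * \<eta>1))"
    using potential_uniform_estimate[OF R M0 \<eta>1 K, of A] by blast
  define \<epsilon> where "\<epsilon> = min \<epsilon>1 (\<gamma> / 2)"
  have \<epsilon>: "0 < \<epsilon>" "\<epsilon> \<le> \<epsilon>1" "\<epsilon> \<le> \<gamma> / 2" using \<epsilon>1 \<gamma> by (simp_all add: \<epsilon>_def)
  show ?thesis
  proof (rule exI[of _ L], rule exI[of _ \<epsilon>], rule exI[of _ R1], rule exI[of _ r0], intro conjI \<epsilon>(1) R1(1,2) pos(3) allI impI)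
    fix a u v p q r s b U V pU qU R' x y
    assume a: "a \<noteq> 0" "\<bar>a\<bar> \<le> A" and sol: "sol2 R a u v p q r s" and SU: "sol1 R b U V pU qU"
      and per: "\<forall>x y. \<bar>y\<bar> < R \<longrightarrow> u (x + P, y) = u (x, y) \<and> v (x + P, y) = v (x, y)"
      and M: "\<forall>x y. \<bar>y\<bar> < R \<longrightarrow> \<bar>v (x, y)\<bar> \<le> M \<and> \<bar>V (x, y)\<bar> \<le> M" and u0': "u (0, 0) = 0"
      and R': "R1 < R'" "R' < R"
      and bd: "\<forall>x. \<bar>x\<bar> \<le> L \<longrightarrow> \<bar>v (x, R') - V (x, R')\<bar> \<le> \<epsilon> \<and> \<bar>v (x, -R') - V (x, -R')\<bar> \<le> \<epsilon>"
      and err: "\<forall>x y. \<bar>x\<bar> \<le> L \<longrightarrow> \<bar>y\<bar> \<le> R' \<longrightarrow> \<bar>qU (x, y) * (1 - sg b (V (x, y)) y / sg a (V (x, y)) y)\<bar> \<le> \<epsilon>"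
      and cl: "\<forall>x y. \<bar>x\<bar> \<le> L \<longrightarrow> \<bar>y\<bar> < R \<longrightarrow> \<bar>U (x, y) - u0 (x, y)\<bar> \<le> \<epsilon> \<and> \<bar>V (x, y) - v0 (x, y)\<bar> \<le> \<epsilon>"
      and x: "\<bar>x - x0\<bar> \<le> r0" and y: "\<bar>y - y0\<bar> \<le> r0"
    note s1 = sol2_sol1[OF sol]
    have R'0: "0 < R'" using R' R1 by simp
    have bd1: "\<forall>x. \<bar>x\<bar> \<le> L \<longrightarrow> \<bar>v (x, R') - V (x, R')\<bar> \<le> \<epsilon>1 \<and> \<bar>v (x, -R') - V (x, -R')\<bar> \<le> \<epsilon>1"
      using bd \<epsilon>(2) by (meson order_trans)
    have err1: "\<forall>x y. \<bar>x\<bar> \<le> L \<longrightarrow> \<bar>y\<bar> \<le> R' \<longrightarrow> \<bar>qU (x, y) * (1 - sg b (V (x, y)) y / sg a (V (x, y)) y)\<bar> \<le> \<epsilon>1"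
      using err \<epsilon>(2) by (meson order_trans)
    obtain k where kv: "\<And>x x' y. -K \<le> x \<Longrightarrow> x \<le> x' \<Longrightarrow> x' \<le> K \<Longrightarrow> \<bar>y\<bar> \<le> R' \<Longrightarrow>
              \<bar>integral {x..x'} (\<lambda>t. v (t, y) - V (t, y))\<bar> \<le> 2 * \<eta>1"
      and ku: "\<And>x y y'. \<bar>x\<bar> \<le> K \<Longrightarrow> -R' \<le> y \<Longrightarrow> y \<le> y' \<Longrightarrow> y' \<le> R' \<Longrightarrow>
              \<bar>integral {y..y'} (\<lambda>t. u (x, t) - U (x, t) - k)\<bar> \<le> 2 * \<eta>1"
      using pot[OF a R'0 R'(2) s1 SU M bd1 err1] by blast
    note cO = sol1_cont[OF s1 order_refl] and cU = sol1_cont[OF SU order_refl]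
    have lineY: "continuous_on Z (\<lambda>y. f (x, y))" if "continuous_on (open_strip R) f" "Z \<subseteq> {-R1..R1}" for f :: "real \<times> real \<Rightarrow> real" and x Z
    proof (rule continuous_on_Pair_compose[OF that(1)])
      show "(x, z) \<in> open_strip R" if "z \<in> Z" for z
        using subsetD[OF \<open>Z \<subseteq> {-R1..R1}\<close> that] R1 by (auto simp: open_strip_def)
    qed (auto intro!: continuous_intros)
    have est: "\<bar>v (x, y) - v0 (x1, y1)\<bar> \<le> 5 * \<gamma> \<and> \<bar>u (x, y) - k - u0 (x1, y1)\<bar> \<le> 5 * \<gamma>"
      if cc: "conc x1 y1 \<rho> \<delta> r'" and x1: "\<bar>x1\<bar> + P \<le> K" and \<delta>\<eta>: "4 * \<eta>1 \<le> \<gamma> * \<delta>"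
        and x: "\<bar>x - x1\<bar> \<le> r'" and y: "\<bar>y - y1\<bar> \<le> r'" for x1 y1 \<rho> \<delta> r' x y
    proof -
      have p: "0 < \<rho>" "\<rho> \<le> P / 2" "\<bar>y1\<bar> + \<rho> \<le> R1" "0 < \<delta>" using cc by (auto simp: conc_def)
      have E: "integral {x1-P/2..x1+P/2} (\<lambda>x. integral {-R1..R1} (\<lambda>y. (p (x, y))\<^sup>2 + sqrt (sg a (v (x, y)) y) * (q (x, y))\<^sup>2)) \<le> C"
      proof -
        have "x1 - P / 2 + P = x1 + P / 2" by simp
        then show ?thesis using En[OF a sol per, of "x1 - P / 2"] M by (simp only:) blast
      qed
      have \<epsilon>\<delta>: "\<epsilon> * \<delta> \<le> \<gamma> / 2 * \<delta>" using \<epsilon> p by (intro mult_right_mono) auto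
      have A1: "\<bar>integral {x..x+\<delta>} (\<lambda>t. v (t, y) - v0 (t, y))\<bar> \<le> \<gamma> * \<delta>"
        if "x1 - \<rho> \<le> x" "x + \<delta> \<le> x1 + \<rho>" "\<bar>y - y1\<bar> \<le> \<rho>" for x y
      proof -
        have yR: "\<bar>y\<bar> \<le> R1" using that p by linarith
        then have yR': "\<bar>y\<bar> \<le> R'" "\<bar>y\<bar> < R" using R' R1 by auto
        have xK: "-K \<le> x" "x \<le> x + \<delta>" "x + \<delta> \<le> K" using that p x1 P by linarith+
        have "integral {x..x+\<delta>} (\<lambda>t. v (t, y) - v0 (t, y))
            = integral {x..x+\<delta>} (\<lambda>t. (v (t, y) - V (t, y)) + (V (t, y) - v0 (t, y)))" by simp
        also have "\<dots> = integral {x..x+\<delta>} (\<lambda>t. v (t, y) - V (t, y)) + integral {x..x+\<delta>} (\<lambda>t. V (t, y) - v0 (t, y))"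
          by (intro Henstock_Kurzweil_Integration.integral_add integrable_continuous_real continuous_intros
              continuous_on_line_x[OF cO(2) yR'(2)] continuous_on_line_x[OF cU(2) yR'(2)] continuous_on_line_x[OF cv0 yR'(2)])
        finally have eq: "integral {x..x+\<delta>} (\<lambda>t. v (t, y) - v0 (t, y)) = \<dots>" .
        have "norm (integral {x..x+\<delta>} (\<lambda>t. V (t, y) - v0 (t, y))) \<le> \<epsilon> * (x + \<delta> - x)"
        proof (rule integral_bound)
          show "continuous_on {x..x+\<delta>} (\<lambda>t. V (t, y) - v0 (t, y))"
            by (intro continuous_intros continuous_on_line_x[OF cU(2) yR'(2)] continuous_on_line_x[OF cv0 yR'(2)])
          fix t assume "t \<in> {x..x+\<delta>}"
          then have "\<bar>t\<bar> \<le> L" using xK L by auto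
          then show "norm (V (t, y) - v0 (t, y)) \<le> \<epsilon>" using cl yR'(2) by auto
        qed (use p in simp)
        then show ?thesis using kv[OF xK yR'(1)] \<delta>\<eta> \<epsilon>\<delta> unfolding eq by simp
      qed
      have A2: "\<bar>integral {y..y+\<delta>} (\<lambda>t. u (x, t) - k - u0 (x, t))\<bar> \<le> \<gamma> * \<delta>"
        if "y1 - \<rho> \<le> y" "y + \<delta> \<le> y1 + \<rho>" "\<bar>x - x1\<bar> \<le> \<rho>" for x y
      proof -
        have sub: "{y..y+\<delta>} \<subseteq> {-R1..R1}" using that p by auto
        have yR: "-R' \<le> y" "y \<le> y + \<delta>" "y + \<delta> \<le> R'" using that p R' by linarith+
        have xK: "\<bar>x\<bar> \<le> K" using that p x1 P by linarith
        then have xL: "\<bar>x\<bar> \<le> L" using L by linarith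
        have "integral {y..y+\<delta>} (\<lambda>t. u (x, t) - k - u0 (x, t))
            = integral {y..y+\<delta>} (\<lambda>t. (u (x, t) - U (x, t) - k) + (U (x, t) - u0 (x, t)))" by (simp add: algebra_simps)
        also have "\<dots> = integral {y..y+\<delta>} (\<lambda>t. u (x, t) - U (x, t) - k) + integral {y..y+\<delta>} (\<lambda>t. U (x, t) - u0 (x, t))"
          by (intro Henstock_Kurzweil_Integration.integral_add integrable_continuous_real continuous_intros
              lineY[OF cO(1) sub] lineY[OF cU(1) sub] lineY[OF cu0 sub])
        finally have eq: "integral {y..y+\<delta>} (\<lambda>t. u (x, t) - k - u0 (x, t)) = \<dots>" .
        have "norm (integral {y..y+\<delta>} (\<lambda>t. U (x, t) - u0 (x, t))) \<le> \<epsilon> * (y + \<delta> - y)"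
        proof (rule integral_bound)
          show "continuous_on {y..y+\<delta>} (\<lambda>t. U (x, t) - u0 (x, t))"
            by (intro continuous_intros lineY[OF cU(1) sub] lineY[OF cu0 sub])
          fix t assume "t \<in> {y..y+\<delta>}"
          then have "\<bar>t\<bar> < R" using sub R1 by auto
          then show "norm (U (x, t) - u0 (x, t)) \<le> \<epsilon>" using cl xL by auto
        qed (use p in simp)
        then show ?thesis using ku[OF xK yR] \<delta>\<eta> \<epsilon>\<delta> unfolding eq by simp
      qed
      have Mv: "\<bar>v (x, y)\<bar> \<le> M" if "\<bar>y\<bar> < R" for x y using M that by blast
      note H = cc[unfolded conc_def, THEN conjunct2, THEN conjunct2, THEN conjunct2, THEN conjunct2, THEN conjunct2, rule_format]
      show ?thesis by (rule H[OF a sol Mv E A1 A2 x y])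
    qed
    have d0: "4 * \<eta>1 \<le> \<gamma> * \<delta>0" "4 * \<eta>1 \<le> \<gamma> * \<delta>1" using \<gamma> by (simp_all add: \<eta>1_def)
    have e1: "\<bar>v (x, y) - v0 (x0, y0)\<bar> \<le> 5 * \<gamma> \<and> \<bar>u (x, y) - k - u0 (x0, y0)\<bar> \<le> 5 * \<gamma>"
      by (rule est[OF c0 _ d0(1) x y]) (simp add: K_def)
    have e2: "\<bar>v (0, 0) - v0 (0, 0)\<bar> \<le> 5 * \<gamma> \<and> \<bar>u (0, 0) - k - u0 (0, 0)\<bar> \<le> 5 * \<gamma>"
      by (rule est[OF c1 _ d0(2)]) (use pos in \<open>auto simp: K_def\<close>)
    then have "\<bar>k\<bar> \<le> 5 * \<gamma>" using u0' u00 by simp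
    then show "\<bar>v (x, y) - v0 (x0, y0)\<bar> < \<eta>" "\<bar>u (x, y) - u0 (x0, y0)\<bar> < \<eta>"
      using e1 \<eta> \<gamma>_def by linarith+
  qed
qed

section \<open>Strict monotonicity: a degenerate Gronwall argument\<close>

text \<open>The coefficient \<open>c / |s|\<close> is not integrable at 0, so the usual Gronwall
  lemma fails. But \<open>M\<close> has a minimum at \<open>y0\<close>, so \<open>M1 y0 = 0\<close>
  and \<open>M\<close> vanishes there to first order: with \<open>b\<close> the maximum of
  \<open>M1\<close>, \<open>M s \<le> b * (s - y0)\<close>. This compensates the singularity and
  bounds the growth of \<open>M1\<close> by \<open>c * \<delta> * b \<le> b / 2\<close>.\<close>

lemma degenerate_gronwall_right:
  fixes M M1 :: "real \<Rightarrow> real"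
  assumes cM: "continuous_on {-R<..<R} M" and cM1: "continuous_on {-R<..<R} M1"
    and nn: "\<And>y. \<bar>y\<bar> < R \<Longrightarrow> 0 \<le> M y"
    and ftc: "\<And>y1 y2. -R < y1 \<Longrightarrow> y1 \<le> y2 \<Longrightarrow> y2 < R \<Longrightarrow> M y2 - M y1 = integral {y1..y2} M1"
    and growth: "\<And>y1 y2. -R < y1 \<Longrightarrow> y1 \<le> y2 \<Longrightarrow> y2 < R \<Longrightarrow> 0 \<notin> {y1..y2} \<Longrightarrow>
        M1 y2 - M1 y1 \<le> integral {y1..y2} (\<lambda>s. c / \<bar>s\<bar> * M s)"
    and c: "0 < c" and y0: "\<bar>y0\<bar> < R" "M y0 = 0"
  shows "\<exists>\<delta>>0. y0 + \<delta> < R \<and> (\<forall>y\<in>{y0..y0+\<delta>}. M y = 0)"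
proof -
  \<comment> \<open>The last entry ensures \<open>s - y0 \<le> |s|\<close> on the interval: for
    \<open>y0 < 0\<close> it stays left of \<open>y0 / 2\<close>, for \<open>y0 \<ge> 0\<close> the
    inequality is automatic. It also keeps 0 out of the half-open interval.\<close>
  define \<delta> where "\<delta> = min (min ((R - y0) / 2) (1 / (2 * c))) (if y0 < 0 then - y0 / 2 else 1)"
  have \<delta>: "0 < \<delta>" "y0 + \<delta> < R" "c * \<delta> \<le> 1 / 2" "y0 < 0 \<Longrightarrow> \<delta> \<le> - y0 / 2"
  proof -
    show "0 < \<delta>" using y0 c by (auto simp: \<delta>_def)
    have "\<delta> \<le> (R - y0) / 2" unfolding \<delta>_def by (intro min.coboundedI1 order_refl)
    then show "y0 + \<delta> < R" using y0 by (simp add: field_simps)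
    have "\<delta> \<le> 1 / (2 * c)" unfolding \<delta>_def by (rule min.coboundedI1, rule min.coboundedI2, simp)
    then show "c * \<delta> \<le> 1 / 2" using c by (simp add: field_simps)
    show "\<delta> \<le> - y0 / 2" if "y0 < 0" unfolding \<delta>_def if_P[OF that] by (rule min.cobounded2)
  qed
  have sub: "{y0..y0+\<delta>} \<subseteq> {-R<..<R}" using y0 \<delta> by auto
  have sgt: "s - y0 \<le> \<bar>s\<bar>" "s \<noteq> 0" if "s \<in> {y0<..y0+\<delta>}" for s
    using that \<delta>(4) by (cases "y0 < 0"; force)+
  have dM: "(M has_real_derivative M1 y0) (at y0)"
  proof -
    define l where "l = (y0 - R) / 2" 
    define l' where "l' = (y0 + R) / 2" 
    have l: "-R < l" "l < y0" "y0 < l'" "l' < R" using y0 by (auto simp: l_def l'_def)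
    have cl: "continuous_on {l..l'} M1" by (rule continuous_on_subset[OF cM1]) (use l in auto)
    have "((\<lambda>y. integral {l..y} M1) has_real_derivative M1 y0) (at y0 within {l..l'})"
      by (rule integral_has_real_derivative[OF cl]) (use l in auto)
    then have "((\<lambda>y. integral {l..y} M1) has_real_derivative M1 y0) (at y0)" using l by (simp add: at_within_Icc_at)
    from DERIV_add[OF this DERIV_const[of "M l"]]
    have d: "((\<lambda>y. integral {l..y} M1 + M l) has_real_derivative M1 y0) (at y0)" by simp
    show ?thesis
    proof (rule has_field_derivative_transform_within_open[OF d, of "{l<..<l'}"])
      fix y assume "y \<in> {l<..<l'}"
      then show "integral {l..y} M1 + M l = M y" using ftc[of l y] l by auto
    qed (use l in auto)
  qed
  have M10: "M1 y0 = 0"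
  proof (rule DERIV_local_min[OF dM, of "R - \<bar>y0\<bar>"])
    show "\<forall>y. \<bar>y0 - y\<bar> < R - \<bar>y0\<bar> \<longrightarrow> M y0 \<le> M y" using nn y0(2) by auto
  qed (use y0 in simp)
  have cI: "continuous_on {y0..y0+\<delta>} M1" by (rule continuous_on_subset[OF cM1 sub])
  obtain yh where yh: "yh \<in> {y0..y0+\<delta>}" "\<And>y. y \<in> {y0..y0+\<delta>} \<Longrightarrow> M1 y \<le> M1 yh"
    using continuous_attains_sup[OF _ _ cI] \<delta> by auto
  define b where "b = M1 yh"
  have b0: "0 \<le> b" using yh(2)[of y0] M10 \<delta> by (simp add: b_def)
  have Mle: "M s \<le> b * (s - y0)" if s: "s \<in> {y0..y0+\<delta>}" for s
  proof -
    have "M s - M y0 = integral {y0..s} M1" by (rule ftc) (use s \<delta> y0 in auto)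
    also have "\<dots> \<le> integral {y0..s} (\<lambda>_. b)"
    proof (rule integral_le)
      show "M1 integrable_on {y0..s}" by (rule integrable_continuous_real[OF continuous_on_subset[OF cI]]) (use s in auto)
    qed (use yh(2) s in \<open>auto simp: b_def\<close>)
    also have "\<dots> = b * (s - y0)" using s by simp
    finally show ?thesis using y0 by simp
  qed
  have "b = 0"
  proof (rule ccontr)
    assume "b \<noteq> 0"
    then have bp: "0 < b" using b0 by simp
    then have yhg: "y0 < yh" using M10 yh(1) by (cases "yh = y0") (auto simp: b_def)
    have "isCont M1 y0" using cM1 y0 by (simp add: continuous_on_eq_continuous_at abs_less_iff)
    then obtain e where e: "e > 0" "\<And>y. dist y y0 < e \<Longrightarrow> dist (M1 y) (M1 y0) < b / 4"
      unfolding continuous_at_eps_delta using bp by (metis divide_pos_pos zero_less_numeral)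
    \<comment> \<open>\<open>growth\<close> excludes intervals containing 0, which \<open>y0\<close>
      may be, so one starts slightly to the right, where continuity keeps \<open>M1\<close> below
      \<open>b / 4\<close>.\<close>
    define y1 where "y1 = y0 + min (e / 2) (yh - y0)"
    have y1: "y0 < y1" "y1 \<le> yh" "dist y1 y0 < e" using e yhg by (auto simp: y1_def dist_real_def)
    have small: "M1 y1 < b / 4" using e(2)[OF y1(3)] M10 by (simp add: dist_real_def)
    have nz: "s \<noteq> 0" if "s \<in> {y1..yh}" for s using sgt(2)[of s] that y1 yh by auto
    have "M1 yh - M1 y1 \<le> integral {y1..yh} (\<lambda>s. c / \<bar>s\<bar> * M s)"
      by (rule growth) (use y1 yh y0 \<delta> nz in auto)
    also have "\<dots> \<le> integral {y1..yh} (\<lambda>s. c * b)"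
    proof (rule integral_le)
      show "(\<lambda>s. c / \<bar>s\<bar> * M s) integrable_on {y1..yh}"
        by (intro integrable_continuous_real continuous_intros continuous_on_subset[OF cM])
          (use nz y1 yh y0 \<delta> in auto)
      fix s assume s: "s \<in> {y1..yh}"
      have ss: "s \<in> {y0<..y0+\<delta>}" using s y1 yh by auto
      have "M s \<le> b * \<bar>s\<bar>" using Mle[of s] ss sgt(1)[OF ss] b0 by (smt (verit) atLeastAtMost_iff greaterThanAtMost_iff mult_left_mono)
      then have "c / \<bar>s\<bar> * M s \<le> c / \<bar>s\<bar> * (b * \<bar>s\<bar>)" using c by (intro mult_left_mono) auto
      also have "\<dots> = c * b" using sgt(2)[OF ss] by simp
      finally show "c / \<bar>s\<bar> * M s \<le> c * b" .
    qed auto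
    also have "\<dots> = (c * (yh - y1)) * b" using y1 by simp
    also have "\<dots> \<le> (c * \<delta>) * b" using y1 yh c b0 by (intro mult_right_mono mult_left_mono) auto
    also have "\<dots> \<le> 1 / 2 * b" using \<delta>(3) b0 by (intro mult_right_mono) auto
    finally show False using small bp by (simp add: b_def)
  qed
  then have "\<forall>y\<in>{y0..y0+\<delta>}. M y = 0" using Mle nn sub by (force simp: abs_less_iff)
  then show ?thesis using \<delta> by blast
qed

text \<open>The zero set of \<open>M\<close> is closed and, by the local statement and its mirror
  image under \<open>y \<mapsto> - y\<close>, open in the interval, which is connected.\<close>

lemma degenerate_gronwall:
  fixes M M1 :: "real \<Rightarrow> real"
  assumes cM: "continuous_on {-R<..<R} M" and cM1: "continuous_on {-R<..<R} M1"
    and nn: "\<And>y. \<bar>y\<bar> < R \<Longrightarrow> 0 \<le> M y"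
    and ftc: "\<And>y1 y2. -R < y1 \<Longrightarrow> y1 \<le> y2 \<Longrightarrow> y2 < R \<Longrightarrow> M y2 - M y1 = integral {y1..y2} M1"
    and growth: "\<And>y1 y2. -R < y1 \<Longrightarrow> y1 \<le> y2 \<Longrightarrow> y2 < R \<Longrightarrow> 0 \<notin> {y1..y2} \<Longrightarrow>
        M1 y2 - M1 y1 \<le> integral {y1..y2} (\<lambda>s. c / \<bar>s\<bar> * M s)"
    and c: "0 < c" and y0: "\<bar>y0\<bar> < R" "M y0 = 0" and y: "\<bar>y\<bar> < R"
  shows "M y = 0"
proof -
  define Z where "Z = {y \<in> {-R<..<R}. M y = 0}"
  have right: "\<exists>\<delta>>0. z + \<delta> < R \<and> (\<forall>y\<in>{z..z+\<delta>}. M y = 0)" if "z \<in> Z" for z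
    by (rule degenerate_gronwall_right[OF cM cM1 nn ftc growth c]) (use that in \<open>auto simp: Z_def abs_less_iff\<close>)
  have left: "\<exists>\<delta>>0. (\<forall>y\<in>{z-\<delta>..z}. M y = 0)" if z: "z \<in> Z" for z
  proof -
    have refl: "integral {y1..y2} (\<lambda>t. f (- t)) = integral {-y2..-y1} f" for f :: "real \<Rightarrow> real" and y1 y2
      using Henstock_Kurzweil_Integration.integral_reflect_real[of "-y1" "-y2" f] by simp
    have cm: "continuous_on {-R<..<R} (\<lambda>t. f (- t))" if "continuous_on {-R<..<R} f" for f :: "real \<Rightarrow> real"
      by (rule continuous_on_compose2[OF that]) (auto intro!: continuous_intros)
    have "\<exists>\<delta>>0. - z + \<delta> < R \<and> (\<forall>y\<in>{- z..- z+\<delta>}. M (- y) = 0)"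
    proof (rule degenerate_gronwall_right[where ?M1.0 = "\<lambda>t. - M1 (- t)" and c = c and R = R])
      show "M (- y2) - M (- y1) = integral {y1..y2} (\<lambda>t. - M1 (- t))" if "-R < y1" "y1 \<le> y2" "y2 < R" for y1 y2
        using ftc[of "-y2" "-y1"] that refl[of y1 y2 M1] by simp
      show "- M1 (- y2) - - M1 (- y1) \<le> integral {y1..y2} (\<lambda>s. c / \<bar>s\<bar> * M (- s))"
        if "-R < y1" "y1 \<le> y2" "y2 < R" "0 \<notin> {y1..y2}" for y1 y2
      proof -
        have "0 \<notin> {-y2..-y1}" using that(4) by auto
        then have "M1 (- y1) - M1 (- y2) \<le> integral {-y2..-y1} (\<lambda>s. c / \<bar>s\<bar> * M s)"
          using growth[of "-y2" "-y1"] that by simp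
        then show ?thesis using refl[of y1 y2 "\<lambda>s. c / \<bar>s\<bar> * M s"] by simp
      qed
    qed (use z c nn cm[OF cM] cm[OF cM1] in \<open>auto simp: Z_def abs_less_iff intro!: continuous_intros\<close>)
    then obtain \<delta> where "\<delta> > 0" and d: "\<And>y. y \<in> {- z..- z+\<delta>} \<Longrightarrow> M (- y) = 0" by blast
    moreover have "M y = 0" if "y \<in> {z-\<delta>..z}" for y using d[of "-y"] that by auto
    ultimately show ?thesis by blast
  qed
  have "openin (top_of_set {-R<..<R}) Z"
    unfolding openin_contains_ball
  proof (intro conjI ballI)
    fix z assume z: "z \<in> Z"
    obtain \<delta>1 where d1: "\<delta>1 > 0" "\<forall>y\<in>{z..z+\<delta>1}. M y = 0" using right[OF z] by blast
    obtain \<delta>2 where d2: "\<delta>2 > 0" "\<forall>y\<in>{z-\<delta>2..z}. M y = 0" using left[OF z] by blast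
    have "M y = 0" if "dist z y < min \<delta>1 \<delta>2" for y
      using that d1(2) d2(2) by (cases "z \<le> y") (auto simp: dist_real_def)
    then show "\<exists>e>0. ball z e \<inter> {-R<..<R} \<subseteq> Z"
      using d1 d2 by (intro exI[of _ "min \<delta>1 \<delta>2"]) (auto simp: Z_def)
  qed (auto simp: Z_def)
  moreover have "closedin (top_of_set {-R<..<R}) Z"
    unfolding Z_def by (rule continuous_closedin_preimage_constant[OF cM])
  ultimately have "Z = {} \<or> Z = {-R<..<R}"
    using connected_clopen[of "{-R<..<R}"] connected_Ioo by blast
  moreover have "y0 \<in> Z" using y0 by (simp add: Z_def abs_less_iff)
  moreover have "y \<in> {-R<..<R}" using y by (simp add: abs_less_iff)
  ultimately have "y \<in> Z" by blast
  then show ?thesis by (simp add: Z_def)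
qed

section \<open>Weighted averages of the difference of two solutions\<close>

definition bump :: "real \<Rightarrow> real \<Rightarrow> real \<Rightarrow> real" where
  "bump x0 t x = (1 + cos (pi * (x - x0) / t)) / 2"

definition bump_deriv :: "real \<Rightarrow> real \<Rightarrow> real \<Rightarrow> real" where
  "bump_deriv x0 t x = - (pi / t) * sin (pi * (x - x0) / t) / 2"

definition bump_deriv2 :: "real \<Rightarrow> real \<Rightarrow> real \<Rightarrow> real" where
  "bump_deriv2 x0 t x = - (pi / t)\<^sup>2 * cos (pi * (x - x0) / t) / 2"

text \<open>A raised cosine on \<open>[x0 - t, x0 + t]\<close>. It vanishes at the ends together
  with its first derivative, so two integrations by parts leave no boundary terms. Its second
  derivative is bounded below by a multiple of the function itself, which closes the differential
  inequality for the average.\<close>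

lemma bump_facts:
  assumes t: "t > 0"
  shows "(bump x0 t has_real_derivative bump_deriv x0 t x) (at x)"
    "(bump_deriv x0 t has_real_derivative bump_deriv2 x0 t x) (at x)"
    "0 \<le> bump x0 t x" "- (pi / t)\<^sup>2 * bump x0 t x \<le> bump_deriv2 x0 t x"
    "bump x0 t (x0 - t) = 0" "bump x0 t (x0 + t) = 0"
    "bump_deriv x0 t (x0 - t) = 0" "bump_deriv x0 t (x0 + t) = 0"
    "continuous_on Z (bump x0 t)" "continuous_on Z (bump_deriv x0 t)" "continuous_on Z (bump_deriv2 x0 t)"
    "bump x0 t x0 = 1"
proof -
  have inner: "((\<lambda>x. pi * (x - x0) / t) has_real_derivative pi / t) (at x)" for x
    using t by (auto intro!: derivative_eq_intros simp: field_simps)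
  show "(bump x0 t has_real_derivative bump_deriv x0 t x) (at x)"
    unfolding bump_def bump_deriv_def
    by (rule derivative_eq_intros inner refl | simp)+
  show "(bump_deriv x0 t has_real_derivative bump_deriv2 x0 t x) (at x)"
    unfolding bump_deriv_def bump_deriv2_def
    by (rule derivative_eq_intros inner refl | simp add: power2_eq_square)+
  have "0 \<le> (1 + cos \<theta>) / 2" for \<theta> :: real
    using divide_right_mono[OF add_left_mono[OF cos_ge_minus_one[of \<theta>], of 1], of 2]
    by (simp only: add.right_inverse div_0 zero_le_numeral simp_thms)
  then show "0 \<le> bump x0 t x" unfolding bump_def .
  have "- K * C / 2 + K * ((1 + C) / 2) = K / 2" for K C :: real by (simp add: field_simps)
  then have "bump_deriv2 x0 t x + (pi / t)\<^sup>2 * bump x0 t x = (pi / t)\<^sup>2 / 2"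
    unfolding bump_def bump_deriv2_def .
  moreover have "0 \<le> (pi / t)\<^sup>2 / 2" by simp
  ultimately show "- (pi / t)\<^sup>2 * bump x0 t x \<le> bump_deriv2 x0 t x" by linarith
  have e: "pi * (x0 - t - x0) / t = - pi" "pi * (x0 + t - x0) / t = pi" using t by (simp_all add: field_simps)
  show "bump x0 t (x0 - t) = 0" "bump x0 t (x0 + t) = 0" "bump_deriv x0 t (x0 - t) = 0" "bump_deriv x0 t (x0 + t) = 0"
    unfolding bump_def bump_deriv_def e by simp_all
  show "continuous_on Z (bump x0 t)" "continuous_on Z (bump_deriv x0 t)" "continuous_on Z (bump_deriv2 x0 t)"
    unfolding bump_def bump_deriv_def bump_deriv2_def using t by (intro continuous_intros; simp)+
  show "bump x0 t x0 = 1" by (simp add: bump_def)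
qed

text \<open>One integration by parts replaces the \<open>y\<close>-derivative of \<open>v\<close> by
  values of \<open>u\<close>; in the second derivative, two of them replace the
  \<open>y\<close>-derivative of \<open>u\<close> by differences of \<open>W\<close>, which are
  nonnegative and at most the difference of \<open>v\<close> divided by \<open>|y|\<close>. The two
  integrated statements contain no derivatives of the solutions, so they can pass to the limit
  \<open>a = 0\<close>.\<close>

lemma difference_average_growth:
  fixes x0 t :: real
  assumes S1: "sol1 R a u1 v1 p1 q1" and S2: "sol1 R a u2 v2 p2 q2" and a: "a \<noteq> 0" and t: "t > 0"
    and le: "\<And>x y. \<bar>y\<bar> < R \<Longrightarrow> v1 (x, y) \<le> v2 (x, y)"
    and y: "-R < y1" "y1 \<le> y2" "y2 < R"
  defines "M \<equiv> \<lambda>y. integral {x0-t..x0+t} (\<lambda>x. (v2 (x, y) - v1 (x, y)) * bump x0 t x)"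
    and "M1 \<equiv> \<lambda>y. - integral {x0-t..x0+t} (\<lambda>x. (u2 (x, y) - u1 (x, y)) * bump_deriv x0 t x)"
  shows "M y2 - M y1 = integral {y1..y2} M1"
    and "0 \<notin> {y1..y2} \<Longrightarrow> M1 y2 - M1 y1 \<le> integral {y1..y2} (\<lambda>s. (pi / t)\<^sup>2 / 2 / \<bar>s\<bar> * M s)"
proof -
  note B = bump_facts[OF t, where ?x0.0 = x0]
  define I where "I = {x0-t..x0+t}"
  note c1 = sol1_cont[OF S1 order_refl] and c2 = sol1_cont[OF S2 order_refl]
  have QO: "I \<times> {-R<..<R} \<subseteq> open_strip R" by (auto simp: open_strip_def)
  define d where "d z = v2 z - v1 z" for z
  define k where "k z = u2 z - u1 z" for z
  define p where "p z = p2 z - p1 z" for z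
  define q where "q z = q2 z - q1 z" for z
  have cc: "continuous_on (open_strip R) d" "continuous_on (open_strip R) k" "continuous_on (open_strip R) p" "continuous_on (open_strip R) q"
    unfolding d_def k_def p_def q_def by (intro continuous_intros c1 c2)+
  have dd: "((\<lambda>t. d (x, t)) has_real_derivative p (x, y)) (at y)" "((\<lambda>t. k (t, y)) has_real_derivative p (x, y)) (at x)"
    "((\<lambda>t. k (x, t)) has_real_derivative q (x, y)) (at y)" if "\<bar>y\<bar> < R" for x y
    unfolding d_def k_def p_def q_def
    by (intro derivative_intros sol1_derivs[OF S1 that] sol1_derivs[OF S2 that])+
  have bf: "continuous_on (I \<times> {-R<..<R}) (\<lambda>z. bump x0 t (fst z))" "continuous_on (I \<times> {-R<..<R}) (\<lambda>z. bump_deriv x0 t (fst z))"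
    by (rule continuous_on_compose2[OF B(9)[of UNIV]] continuous_on_compose2[OF B(10)[of UNIV]]; auto intro!: continuous_intros)+
  have dM: "(M has_real_derivative M1 y) (at y)" if y: "\<bar>y\<bar> < R" for y
  proof -
    have "((\<lambda>y. integral {x0-t..x0+t} (\<lambda>x. (\<lambda>z. d z * bump x0 t (fst z)) (x, y))) has_real_derivative
        integral {x0-t..x0+t} (\<lambda>x. (\<lambda>z. p z * bump x0 t (fst z)) (x, y))) (at y)"
    proof (rule has_real_derivative_integral_fst[where c = "-R" and d = R])
      fix x y :: real assume "y \<in> {-R<..<R}"
      then have "\<bar>y\<bar> < R" by auto
      from DERIV_cmult_right[OF dd(1)[OF this, of x], of "bump x0 t x"]
      show "((\<lambda>s. (\<lambda>z. d z * bump x0 t (fst z)) (x, s)) has_real_derivative (\<lambda>z. p z * bump x0 t (fst z)) (x, y)) (at y)" by simp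
    next
      fix y :: real assume "y \<in> {-R<..<R}"
      then have "\<bar>y\<bar> < R" by auto
      then show "continuous_on {x0-t..x0+t} (\<lambda>x. (\<lambda>z. d z * bump x0 t (fst z)) (x, y))"
        using continuous_on_line_x[OF cc(1)] B(9) by (auto intro!: continuous_intros)
    next
      show "continuous_on ({x0-t..x0+t} \<times> {-R<..<R}) (\<lambda>z. p z * bump x0 t (fst z))"
        using continuous_on_subset[OF cc(3) QO] bf unfolding I_def by (intro continuous_intros)
    qed (use y in auto)
    then have 1: "(M has_real_derivative integral {x0-t..x0+t} (\<lambda>x. bump x0 t x * p (x, y))) (at y)"
      by (simp add: M_def d_def mult.commute)
    have "integral {x0-t..x0+t} (\<lambda>x. bump x0 t x * p (x, y)) = - integral {x0-t..x0+t} (\<lambda>x. bump_deriv x0 t x * k (x, y))"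
      by (rule integral_by_parts_vanishing) (use t B dd(2)[OF y] continuous_on_line_x[OF cc(3) y] in auto)
    then show ?thesis using 1 by (simp add: M1_def k_def mult.commute)
  qed
  show "M y2 - M y1 = integral {y1..y2} M1"
    by (rule integral_real_derivative[symmetric]) (use dM y in auto)
  define m2 where "m2 y = - integral {x0-t..x0+t} (\<lambda>x. q (x, y) * bump_deriv x0 t x)" for y
  have dM1: "(M1 has_real_derivative m2 y) (at y)" if y: "\<bar>y\<bar> < R" for y
  proof -
    have "((\<lambda>y. integral {x0-t..x0+t} (\<lambda>x. (\<lambda>z. k z * bump_deriv x0 t (fst z)) (x, y))) has_real_derivative
        integral {x0-t..x0+t} (\<lambda>x. (\<lambda>z. q z * bump_deriv x0 t (fst z)) (x, y))) (at y)"
    proof (rule has_real_derivative_integral_fst[where c = "-R" and d = R])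
      fix x y :: real assume "y \<in> {-R<..<R}"
      then have "\<bar>y\<bar> < R" by auto
      from DERIV_cmult_right[OF dd(3)[OF this, of x], of "bump_deriv x0 t x"]
      show "((\<lambda>s. (\<lambda>z. k z * bump_deriv x0 t (fst z)) (x, s)) has_real_derivative (\<lambda>z. q z * bump_deriv x0 t (fst z)) (x, y)) (at y)" by simp
    next
      fix y :: real assume "y \<in> {-R<..<R}"
      then have "\<bar>y\<bar> < R" by auto
      then show "continuous_on {x0-t..x0+t} (\<lambda>x. (\<lambda>z. k z * bump_deriv x0 t (fst z)) (x, y))"
        using continuous_on_line_x[OF cc(2)] B(10) by (auto intro!: continuous_intros)
    next
      show "continuous_on ({x0-t..x0+t} \<times> {-R<..<R}) (\<lambda>z. q z * bump_deriv x0 t (fst z))"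
        using continuous_on_subset[OF cc(4) QO] bf unfolding I_def by (intro continuous_intros)
    qed (use y in auto)
    from DERIV_minus[OF this] show ?thesis by (simp add: M1_def k_def m2_def)
  qed
  have m2le: "m2 y \<le> (pi / t)\<^sup>2 / 2 / \<bar>y\<bar> * M y" if y: "\<bar>y\<bar> < R" "y \<noteq> 0" for y
  proof -
    define e where "e x = W a (v2 (x, y)) y - W a (v1 (x, y)) y" for x
    have de: "(e has_real_derivative - 2 * q (x, y)) (at x)" for x
    proof -
      have "(e has_real_derivative - 2 * sg a (v2 (x, y)) y * q2 (x, y) / sg a (v2 (x, y)) y
          - - 2 * sg a (v1 (x, y)) y * q1 (x, y) / sg a (v1 (x, y)) y) (at x)"
        unfolding e_def by (intro derivative_intros W_has_derivative a sol1_derivs(3)[OF S1 y(1)] sol1_derivs(3)[OF S2 y(1)])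
      then show ?thesis using sg_pos[OF a, of "v1 (x, y)" y] sg_pos[OF a, of "v2 (x, y)" y]
        by (simp add: q_def algebra_simps)
    qed
    have ce: "continuous_on Z e" for Z by (rule DERIV_continuous_on[OF has_field_derivative_at_within[OF de]])
    have cq: "continuous_on Z (\<lambda>x. q (x, y))" for Z by (rule continuous_on_line_x[OF cc(4) y(1)])
    have e0: "0 \<le> e x" "e x \<le> d (x, y) / \<bar>y\<bar>" for x
    proof -
      have dn: "0 \<le> d (x, y)" using le[OF y(1), of x] by (simp add: d_def)
      have tp: "0 < sqrt (y\<^sup>2 + a\<^sup>2)" using tau_pos[OF a, of y] by simp
      have "v1 (x, y) / sqrt (y\<^sup>2 + a\<^sup>2) \<le> v2 (x, y) / sqrt (y\<^sup>2 + a\<^sup>2)" using le[OF y(1), of x] tp by (intro divide_right_mono) auto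
      then have "\<not> arsinh (v2 (x, y) / sqrt (y\<^sup>2 + a\<^sup>2)) < arsinh (v1 (x, y) / sqrt (y\<^sup>2 + a\<^sup>2))" by simp
      then show "0 \<le> e x" unfolding e_def W_def by linarith
      have "e x \<le> d (x, y) / sqrt (y\<^sup>2 + a\<^sup>2)"
        using W_lipschitz[OF a, of "v2 (x, y)" y "v1 (x, y)"] dn by (simp add: e_def d_def)
      also have "\<dots> \<le> d (x, y) / \<bar>y\<bar>"
      proof (rule divide_left_mono)
        show "\<bar>y\<bar> \<le> sqrt (y\<^sup>2 + a\<^sup>2)" by (rule real_le_rsqrt) simp
      qed (use dn tp y in auto)
      finally show "e x \<le> d (x, y) / \<bar>y\<bar>" .
    qed
    have "integral {x0-t..x0+t} (\<lambda>x. bump_deriv x0 t x * (- 2 * q (x, y))) = - integral {x0-t..x0+t} (\<lambda>x. bump_deriv2 x0 t x * e x)"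
      by (rule integral_by_parts_vanishing) (use t B de cq in \<open>auto intro!: continuous_intros\<close>)
    moreover have "integral {x0-t..x0+t} (\<lambda>x. bump_deriv x0 t x * (- 2 * q (x, y))) = 2 * m2 y"
      unfolding m2_def by (simp add: mult.commute mult.left_commute flip: integral_mult_right)
    ultimately have "2 * m2 y = integral {x0-t..x0+t} (\<lambda>x. - (bump_deriv2 x0 t x * e x))" by simp
    also have "\<dots> \<le> integral {x0-t..x0+t} (\<lambda>x. ((pi / t)\<^sup>2 / \<bar>y\<bar>) * (d (x, y) * bump x0 t x))"
    proof (rule integral_le)
      show "(\<lambda>x. - (bump_deriv2 x0 t x * e x)) integrable_on {x0-t..x0+t}"
        by (intro integrable_continuous_real continuous_intros ce B)
      show "(\<lambda>x. ((pi / t)\<^sup>2 / \<bar>y\<bar>) * (d (x, y) * bump x0 t x)) integrable_on {x0-t..x0+t}"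
        by (intro integrable_continuous_real continuous_on_mult continuous_on_const continuous_on_line_x[OF cc(1) y(1)] B)
      fix x
      have "- bump_deriv2 x0 t x * e x \<le> (pi / t)\<^sup>2 * bump x0 t x * e x"
        using B(4)[of x] e0(1)[of x] by (intro mult_right_mono) auto
      also have "\<dots> \<le> (pi / t)\<^sup>2 * bump x0 t x * (d (x, y) / \<bar>y\<bar>)"
        using e0(2)[of x] B(3)[of x] by (intro mult_left_mono) auto
      finally show "- (bump_deriv2 x0 t x * e x) \<le> ((pi / t)\<^sup>2 / \<bar>y\<bar>) * (d (x, y) * bump x0 t x)"
        by (simp add: mult.commute mult.left_commute)
    qed
    also have "\<dots> = ((pi / t)\<^sup>2 / \<bar>y\<bar>) * M y" by (simp add: M_def d_def)
    finally show ?thesis by (simp add: mult.commute)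
  qed
  show "M1 y2 - M1 y1 \<le> integral {y1..y2} (\<lambda>s. (pi / t)\<^sup>2 / 2 / \<bar>s\<bar> * M s)" if nz: "0 \<notin> {y1..y2}"
  proof -
    have ab: "\<bar>s\<bar> < R" "s \<noteq> 0" if "s \<in> {y1..y2}" for s using that y nz by auto
    have "M1 y2 - M1 y1 = integral {y1..y2} m2"
      by (rule integral_real_derivative[symmetric]) (use dM1 y ab in auto)
    also have "\<dots> \<le> integral {y1..y2} (\<lambda>s. (pi / t)\<^sup>2 / 2 / \<bar>s\<bar> * M s)"
    proof (rule integral_le)
      have "continuous_on ({x0-t..x0+t} \<times> {-R<..<R}) (\<lambda>z. q z * bump_deriv x0 t (fst z))"
        using continuous_on_subset[OF cc(4) QO] bf unfolding I_def by (intro continuous_intros)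
      then have "continuous_on {-R<..<R} m2" unfolding m2_def
        using continuous_on_integral_fst[of "x0-t" "x0+t" "{-R<..<R}" "\<lambda>z. q z * bump_deriv x0 t (fst z)"]
        by (auto intro!: continuous_intros)
      then show "m2 integrable_on {y1..y2}"
        by (intro integrable_continuous_real) (rule continuous_on_subset, use y in auto)
      have "continuous_on {y1..y2} M"
        by (rule DERIV_continuous_on[OF has_field_derivative_at_within[OF dM]]) (use ab in auto)
      then show "(\<lambda>s. (pi / t)\<^sup>2 / 2 / \<bar>s\<bar> * M s) integrable_on {y1..y2}"
        using ab by (intro integrable_continuous_real continuous_intros) auto
    qed (use m2le ab in auto)
    finally show ?thesis .
  qed
qed

section \<open>Periodic solutions and boundary data\<close>

lemma periodic_int_multiple:
  fixes f :: "real \<Rightarrow> 'a"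
  assumes "\<And>x. f (x + P) = f x"
  shows "f (x + of_int n * P) = f x"
proof -
  have nat: "f (x + of_nat k * P) = f x" for k x
  proof (induction k arbitrary: x)
    case (Suc k)
    have "f (x + of_nat (Suc k) * P) = f ((x + of_nat k * P) + P)" by (simp add: algebra_simps)
    then show ?case using assms Suc by simp
  qed simp
  show ?thesis
  proof (cases "0 \<le> n")
    case True
    then show ?thesis using nat[of x "nat n"] by simp
  next
    case False
    then have "f (x + of_int n * P + of_nat (nat (- n)) * P) = f x" by simp
    then show ?thesis using nat[of "x + of_int n * P" "nat (- n)"] by simp
  qed
qed

lemma period_reduction:
  fixes x P :: real
  assumes "P > 0"
  obtains n :: int where "x + of_int n * P \<in> {0..P}"
proof
  have "0 \<le> x / P - of_int \<lfloor>x / P\<rfloor>" "x / P - of_int \<lfloor>x / P\<rfloor> \<le> 1" by linarith+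
  then have "0 \<le> (x / P - of_int \<lfloor>x / P\<rfloor>) * P" "(x / P - of_int \<lfloor>x / P\<rfloor>) * P \<le> 1 * P"
    using assms by (auto intro: mult_right_mono)
  then show "x + of_int (- \<lfloor>x / P\<rfloor>) * P \<in> {0..P}" using assms by (simp add: algebra_simps)
qed

lemma strip_eq: "strip R = UNIV \<times> {-R..R}"
  by (auto simp: strip_def abs_le_iff)

text \<open>The equations hold in the open strip only, so comparisons are made on lines
  \<open>y = R'\<close> and \<open>y = -R'\<close> inside it. By uniform continuity on a compact
  rectangle a strict inequality on the edges survives as a weak one on such lines.\<close>

lemma near_edge:
  fixes f :: "real \<times> real \<Rightarrow> real"
  assumes c: "continuous_on (strip R) f" and R1: "0 < R1" "R1 < R" and L: "0 \<le> L"
    and edge: "\<And>x. \<bar>x\<bar> \<le> L \<Longrightarrow> f (x, R) < c \<and> f (x, -R) < c"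
  shows "\<exists>R'. R1 < R' \<and> R' < R \<and> (\<forall>x. \<bar>x\<bar> \<le> L \<longrightarrow> f (x, R') \<le> c \<and> f (x, -R') \<le> c)"
proof -
  define Q where "Q = {-L..L} \<times> {-R..R}"
  have cQ: "continuous_on Q f" by (rule continuous_on_subset[OF c]) (auto simp: Q_def strip_eq)
  have "compact Q" by (simp add: Q_def compact_Times)
  then have uc: "uniformly_continuous_on Q f" using cQ by (rule compact_uniformly_continuous[rotated])
  define g where "g x = max (f (x, R)) (f (x, -R))" for x
  have "continuous_on {-L..L} g" unfolding g_def
    by (intro continuous_intros continuous_on_Pair_compose[OF cQ]) (use R1 in \<open>auto simp: Q_def\<close>)
  then obtain xm where xm: "xm \<in> {-L..L}" "\<And>x. x \<in> {-L..L} \<Longrightarrow> g x \<le> g xm"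
    using continuous_attains_sup[of "{-L..L}" g] L by auto
  have gm: "0 < c - g xm" using edge[of xm] xm(1) by (auto simp: g_def abs_le_iff)
  then obtain d where d: "d > 0" "\<And>z z'. z \<in> Q \<Longrightarrow> z' \<in> Q \<Longrightarrow> dist z' z < d \<Longrightarrow> dist (f z') (f z) < c - g xm"
    using uc unfolding uniformly_continuous_on_def by metis
  define R' where "R' = max ((R1 + R) / 2) (R - d / 2)"
  have R': "R1 < R'" "R' < R" "R - R' < d" using R1 d(1) by (auto simp: R'_def max_def field_simps)
  show ?thesis
  proof (intro exI[of _ R'] conjI R'(1,2) allI impI)
    fix x assume x: "\<bar>x\<bar> \<le> L"
    then have x': "x \<in> {-L..L}" by auto
    have "dist (f (x, R')) (f (x, R)) < c - g xm"
      by (rule d(2)) (use x' R' R1 in \<open>auto simp: Q_def dist_Pair_Pair dist_real_def\<close>)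
    moreover have "f (x, R) \<le> g x" "f (x, -R) \<le> g x" by (simp_all add: g_def)
    ultimately show "f (x, R') \<le> c" using xm(2)[OF x'] unfolding dist_real_def by linarith
    have "dist (f (x, -R')) (f (x, -R)) < c - g xm"
      by (rule d(2)) (use x' R' R1 in \<open>auto simp: Q_def dist_Pair_Pair dist_real_def\<close>)
    moreover have "f (x, -R) \<le> g x" by (simp add: g_def)
    ultimately show "f (x, -R') \<le> c" using xm(2)[OF x'] unfolding dist_real_def by linarith
  qed
qed

definition psol :: "real \<Rightarrow> real \<Rightarrow> real \<Rightarrow> (real \<times> real \<Rightarrow> real) \<Rightarrow> (real \<times> real \<Rightarrow> real) \<Rightarrow> bool" where
  "psol R P a u v \<longleftrightarrow> (\<exists>p q r s. sol2 R a u v p q r s) \<and> continuous_on (strip R) v \<and>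
     (\<forall>x y. \<bar>y\<bar> \<le> R \<longrightarrow> u (x + P, y) = u (x, y) \<and> v (x + P, y) = v (x, y))"

text \<open>The constants are the barriers that bound \<open>v\<close> by its boundary values, for
  every \<open>a\<close>.\<close>

lemma psol_const: "psol R P a (\<lambda>_. 0) (\<lambda>_. c)"
  unfolding psol_def
  by (intro conjI exI[of _ "\<lambda>_. 0"]) (auto simp: sol2_def sol1_def)

text \<open>The coefficients do not involve \<open>x\<close>. Comparing a solution with translates
  of another is what later spreads an equality at one point to a segment.\<close>

lemma psol_translate:
  assumes "psol R P a u v"
  shows "psol R P a (\<lambda>z. u (fst z + t, snd z)) (\<lambda>z. v (fst z + t, snd z))"
proof -
  obtain p q r s where sol: "sol2 R a u v p q r s" using assms by (auto simp: psol_def)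
  have c: "continuous_on (open_strip R) (\<lambda>z. f (fst z + t, snd z))" if "continuous_on (open_strip R) f" for f :: "real \<times> real \<Rightarrow> real"
    by (rule continuous_on_Pair_compose[OF that]) (auto simp: open_strip_def intro!: continuous_intros)
  have c': "continuous_on (strip R) (\<lambda>z. f (fst z + t, snd z))" if "continuous_on (strip R) f" for f :: "real \<times> real \<Rightarrow> real"
    by (rule continuous_on_Pair_compose[OF that]) (auto simp: strip_def intro!: continuous_intros)
  have sh: "((\<lambda>x. f (x + t)) has_real_derivative D) (at x)" if "(f has_real_derivative D) (at (x + t))" for f D x
    using that DERIV_shift by blast
  note s1 = sol2_sol1[OF sol]
  have "sol2 R a (\<lambda>z. u (fst z + t, snd z)) (\<lambda>z. v (fst z + t, snd z)) (\<lambda>z. p (fst z + t, snd z))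
      (\<lambda>z. q (fst z + t, snd z)) (\<lambda>z. r (fst z + t, snd z)) (\<lambda>z. s (fst z + t, snd z))"
    unfolding sol2_def sol1_def fst_conv snd_conv
  proof (intro conjI allI impI c sol1_cont[OF s1 order_refl] sol2_cont[OF sol order_refl])
    fix x y :: real assume y: "\<bar>y\<bar> < R"
    note D = sol1_derivs[OF s1 y, of "x + t"] sol2_derivs[OF sol y, of "x + t"]
    show "((\<lambda>x. u (x + t, y)) has_real_derivative p (x + t, y)) (at x)"
      "((\<lambda>y. u (x + t, y)) has_real_derivative q (x + t, y)) (at y)"
      "((\<lambda>x. v (x + t, y)) has_real_derivative - 2 * sg a (v (x + t, y)) y * q (x + t, y)) (at x)"
      "((\<lambda>y. v (x + t, y)) has_real_derivative p (x + t, y)) (at y)"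
      "((\<lambda>x. p (x + t, y)) has_real_derivative s (x + t, y)) (at x)"
      "((\<lambda>y. p (x + t, y)) has_real_derivative r (x + t, y)) (at y)"
      "((\<lambda>x. q (x + t, y)) has_real_derivative r (x + t, y)) (at x)"
      "((\<lambda>y. - 2 * sg a (v (x + t, y)) y * q (x + t, y)) has_real_derivative s (x + t, y)) (at y)"
      by (rule D sh[OF D(1)] sh[OF D(3)] sh[OF D(5)] sh[OF D(7)])+
  qed
  moreover have "u (x + P + t, y) = u (x + t, y) \<and> v (x + P + t, y) = v (x + t, y)" if "\<bar>y\<bar> \<le> R" for x y
  proof -
    have "x + P + t = (x + t) + P" by simp
    then show ?thesis using assms that unfolding psol_def by metis
  qed
  ultimately show ?thesis using assms c' by (auto simp: psol_def)
qed

lemma psol_order: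
  assumes s1: "psol R P a u1 v1" and s2: "psol R P a u2 v2" and a: "a \<noteq> 0" and P: "P > 0" and R: "R > 0"
    and lt: "\<And>x. v1 (x, R) < v2 (x, R) \<and> v1 (x, -R) < v2 (x, -R)" and y: "\<bar>y\<bar> < R"
  shows "v1 (x, y) \<le> v2 (x, y)"
proof -
  obtain p1 q1 r1 t1 where S1: "sol2 R a u1 v1 p1 q1 r1 t1" using s1 by (auto simp: psol_def)
  obtain p2 q2 r2 t2 where S2: "sol2 R a u2 v2 p2 q2 r2 t2" using s2 by (auto simp: psol_def)
  have c: "continuous_on (strip R) (\<lambda>z. v1 z - v2 z)" using s1 s2 by (auto simp: psol_def intro!: continuous_intros)
  define R1 where "R1 = (\<bar>y\<bar> + R) / 2"
  have R1: "0 < R1" "R1 < R" "\<bar>y\<bar> < R1" using y R by (auto simp: R1_def)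
  obtain R' where R': "R1 < R'" "R' < R" "\<And>x. \<bar>x\<bar> \<le> P \<Longrightarrow> v1 (x, R') - v2 (x, R') \<le> 0 \<and> v1 (x, -R') - v2 (x, -R') \<le> 0"
    using near_edge[OF c R1(1,2), of P 0] lt P by auto
  have per: "v1 (x + P, y) = v1 (x, y)" "v2 (x + P, y) = v2 (x, y)" "u1 (x + P, y) = u1 (x, y)" "u2 (x + P, y) = u2 (x, y)"
    if "\<bar>y\<bar> < R" for x y using s1 s2 that by (auto simp: psol_def)
  have bd: "v1 (x, R') \<le> v2 (x, R') \<and> v1 (x, -R') \<le> v2 (x, -R')" for x
  proof -
    obtain n :: int where n: "x + of_int n * P \<in> {0..P}" using period_reduction[OF P] by blast
    then have ab: "\<bar>x + of_int n * P\<bar> \<le> P" by auto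
    have "\<bar>R'\<bar> < R" "\<bar>-R'\<bar> < R" using R' R1 by auto
    then have "v1 (x + of_int n * P, R') = v1 (x, R')" "v2 (x + of_int n * P, R') = v2 (x, R')"
      "v1 (x + of_int n * P, -R') = v1 (x, -R')" "v2 (x + of_int n * P, -R') = v2 (x, -R')"
      using per by (auto intro!: periodic_int_multiple[of "\<lambda>x. v1 (x, R')" P] periodic_int_multiple[of "\<lambda>x. v2 (x, R')" P]
          periodic_int_multiple[of "\<lambda>x. v1 (x, -R')" P] periodic_int_multiple[of "\<lambda>x. v2 (x, -R')" P])
    then show ?thesis using R'(3)[OF ab] by simp
  qed
  show ?thesis
    by (rule order_principle[OF S1 S2 a P, of R']) (use R' R1 per bd in auto)
qed

section \<open>Boundary data in the Hoelder class\<close>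

lemma C3a_deriv_diff:
  assumes f: "C3a \<alpha> f" and g: "C3a \<alpha> g" and k: "k \<le> 3"
  shows "(deriv ^^ k) (\<lambda>x. f x - g x) = (\<lambda>x. (deriv ^^ k) f x - (deriv ^^ k) g x)"
  using k
proof (induction k)
  case (Suc k)
  then have k: "k < 3" by simp
  have "deriv (\<lambda>x. (deriv ^^ k) f x - (deriv ^^ k) g x) x = (deriv ^^ Suc k) f x - (deriv ^^ Suc k) g x" for x
    by (rule DERIV_imp_deriv, rule DERIV_diff) (use f g k in \<open>auto simp: C3a_def\<close>)
  note D = this
  have "(deriv ^^ Suc k) (\<lambda>x. f x - g x) = deriv (\<lambda>x. (deriv ^^ k) f x - (deriv ^^ k) g x)" using Suc by simp
  also have "\<dots> = (\<lambda>x. (deriv ^^ Suc k) f x - (deriv ^^ Suc k) g x)" by (rule ext) (rule D)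
  finally show ?case .
qed simp

text \<open>The suprema in \<open>c3a_norm\<close> are meaningful only for sets bounded above, so
  boundedness is verified for each of them. It also shows that every other summand is nonnegative
  and may be dropped.\<close>

lemma C3a_sup_bound:
  assumes f: "C3a \<alpha> f" and g: "C3a \<alpha> g"
  shows "\<bar>f x - g x\<bar> \<le> c3a_norm \<alpha> (\<lambda>x. f x - g x)"
proof -
  define h where "h = (\<lambda>x. f x - g x)"
  have bd: "bdd_above (range (\<lambda>x. \<bar>(deriv ^^ k) h x\<bar>))" if k: "k \<le> 3" for k
  proof -
    obtain A where A: "\<And>x. \<bar>(deriv ^^ k) f x\<bar> \<le> A" using f k unfolding C3a_def bounded_iff by force
    obtain B where B: "\<And>x. \<bar>(deriv ^^ k) g x\<bar> \<le> B" using g k unfolding C3a_def bounded_iff by force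
    have "\<bar>(deriv ^^ k) h x\<bar> \<le> A + B" for x
      using A[of x] B[of x] unfolding h_def C3a_deriv_diff[OF f g k] by linarith
    then show ?thesis by (auto intro!: bdd_aboveI2)
  qed
  have nn: "0 \<le> (SUP x. \<bar>(deriv ^^ k) h x\<bar>)" if "k \<le> 3" for k
    by (rule order_trans[OF _ cSUP_upper[OF _ bd[OF that], of 0]]) auto
  define H where "H xy = \<bar>(deriv ^^ 3) h (fst xy) - (deriv ^^ 3) h (snd xy)\<bar> / \<bar>fst xy - snd xy\<bar> powr \<alpha>" for xy :: "real \<times> real"
  obtain A where A: "\<And>x y. \<bar>(deriv ^^ 3) f x - (deriv ^^ 3) f y\<bar> \<le> A * \<bar>x - y\<bar> powr \<alpha>" using f by (auto simp: C3a_def)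
  obtain B where B: "\<And>x y. \<bar>(deriv ^^ 3) g x - (deriv ^^ 3) g y\<bar> \<le> B * \<bar>x - y\<bar> powr \<alpha>" using g by (auto simp: C3a_def)
  have bH: "bdd_above (H ` {xy. fst xy \<noteq> snd xy})"
  proof (rule bdd_aboveI2[where M = "A + B"])
    fix xy :: "real \<times> real" assume "xy \<in> {xy. fst xy \<noteq> snd xy}"
    then have pos: "0 < \<bar>fst xy - snd xy\<bar> powr \<alpha>" by simp
    have e: "(deriv ^^ 3) h = (\<lambda>x. (deriv ^^ 3) f x - (deriv ^^ 3) g x)" unfolding h_def by (rule C3a_deriv_diff[OF f g]) simp
    have "\<bar>(deriv ^^ 3) h (fst xy) - (deriv ^^ 3) h (snd xy)\<bar> \<le> (A + B) * \<bar>fst xy - snd xy\<bar> powr \<alpha>"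
      using A[of "fst xy" "snd xy"] B[of "fst xy" "snd xy"] unfolding e distrib_right by linarith
    then show "H xy \<le> A + B" unfolding H_def using pos by (simp add: pos_divide_le_eq)
  qed
  have "0 \<le> H (0, 1)" by (simp add: H_def)
  also have "\<dots> \<le> (SUP xy \<in> {xy. fst xy \<noteq> snd xy}. H xy)" by (rule cSUP_upper[OF _ bH]) simp
  finally have nH: "0 \<le> (SUP xy \<in> {xy. fst xy \<noteq> snd xy}. H xy)" .
  have "\<bar>h x\<bar> \<le> (SUP x. \<bar>(deriv ^^ 0) h x\<bar>)" using cSUP_upper[OF UNIV_I bd[of 0], of x] by simp
  also have "\<dots> \<le> (\<Sum>k\<le>3. (SUP x. \<bar>(deriv ^^ k) h x\<bar>))"
    by (rule member_le_sum[of 0 "{..3::nat}" "\<lambda>k. SUP x. \<bar>(deriv ^^ k) h x\<bar>"]) (use nn in auto)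
  also have "\<dots> \<le> c3a_norm \<alpha> h" unfolding c3a_norm_def using nH by (simp add: H_def)
  finally show ?thesis by (simp add: h_def)
qed

lemma C3a_lipschitz:
  assumes "C3a \<alpha> f" shows "\<exists>K. \<forall>x y. \<bar>f x - f y\<bar> \<le> K * \<bar>x - y\<bar>"
proof -
  have d: "(f has_real_derivative (deriv ^^ 1) f x) (at x)" for x
    using assms unfolding C3a_def by (metis One_nat_def funpow_0 zero_less_numeral)
  obtain K where K: "\<And>x. \<bar>(deriv ^^ 1) f x\<bar> \<le> K"
    using assms unfolding C3a_def bounded_iff by (metis one_le_numeral rangeI real_norm_def)
  have "norm (f x - f y) \<le> K * norm (x - y)" for x y
    by (rule field_differentiable_bound[of UNIV f "(deriv ^^ 1) f"]) (use d K in auto)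
  then show ?thesis by auto
qed

section \<open>The family of solutions\<close>

lemma sg_lipschitz_a: "\<bar>sg a v y - sg a' v y\<bar> \<le> \<bar>a - a'\<bar>"
proof -
  have "\<bar>norm (sqrt (v\<^sup>2 + y\<^sup>2), a) - norm (sqrt (v\<^sup>2 + y\<^sup>2), a')\<bar>
      \<le> norm ((sqrt (v\<^sup>2 + y\<^sup>2), a) - (sqrt (v\<^sup>2 + y\<^sup>2), a'))"
    by (rule norm_triangle_ineq3)
  then show ?thesis by (simp add: norm_Pair sg_def)
qed

lemma Ck_strip_continuous: "Ck_strip R k f \<Longrightarrow> length ds \<le> k \<Longrightarrow> continuous_on (strip R) (pdS R ds f)"
  by (simp add: Ck_strip_def)

locale sl_family =
  fixes R P \<alpha> :: real
    and \<phi>p \<phi>m :: "real \<Rightarrow> real \<Rightarrow> real \<Rightarrow> real"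
    and u v :: "real \<Rightarrow> real \<Rightarrow> real \<times> real \<Rightarrow> real"
  assumes R_pos: "R > 0" and P_pos: "P > 0"
    and reg: "\<And>a b. C3a \<alpha> (\<phi>p a b) \<and> C3a \<alpha> (\<phi>m a b)"
    and cont_p: "\<And>a b e. e > 0 \<Longrightarrow> \<exists>d>0. \<forall>a' b'. dist (a', b') (a, b) < d \<longrightarrow>
                   c3a_norm \<alpha> (\<lambda>x. \<phi>p a' b' x - \<phi>p a b x) < e"
    and cont_m: "\<And>a b e. e > 0 \<Longrightarrow> \<exists>d>0. \<forall>a' b'. dist (a', b') (a, b) < d \<longrightarrow>
                   c3a_norm \<alpha> (\<lambda>x. \<phi>m a' b' x - \<phi>m a b x) < e"
    and per: "\<And>a b x. \<phi>p a b (x + P) = \<phi>p a b x \<and> \<phi>m a b (x + P) = \<phi>m a b x"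
    and mono: "\<And>a b b' x. b < b' \<Longrightarrow> \<phi>p a b x < \<phi>p a b' x \<and> \<phi>m a b x < \<phi>m a b' x"
    and lim_p: "\<And>a x. filterlim (\<lambda>b. \<phi>p a b x) at_top at_top \<and>
                        filterlim (\<lambda>b. \<phi>p a b x) at_bot at_bot"
    and lim_m: "\<And>a x. filterlim (\<lambda>b. \<phi>m a b x) at_top at_top \<and>
                        filterlim (\<lambda>b. \<phi>m a b x) at_bot at_bot"
    and sol: "\<And>a b. assoc_sol R P \<alpha> a (\<phi>p a b) (\<phi>m a b) (u a b) (v a b)"
begin

lemma periodic_uv: "\<bar>y\<bar> \<le> R \<Longrightarrow> u a b (x + P, y) = u a b (x, y) \<and> v a b (x + P, y) = v a b (x, y)"
proof -
  assume "\<bar>y\<bar> \<le> R"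
  then have "(x, y) \<in> strip R" by (simp add: strip_def)
  then show ?thesis using sol[of a b] unfolding assoc_sol_def by fastforce
qed

lemma u_origin: "u a b (0, 0) = 0"
  using sol[of a b] by (simp add: assoc_sol_def)

lemma v_edge: "v a b (x, R) = \<phi>p a b x" "v a b (x, -R) = \<phi>m a b x"
  using sol[of a b] by (simp_all add: assoc_sol_def)

lemma regular:
  assumes "a \<noteq> 0"
  shows "Ck_strip R 2 (u a b)" "Ck_strip R 2 (v a b)" "dagger_on_strip R a (u a b) (v a b)"
proof -
  have "Ck_strip R 3 (u a b)" "Ck_strip R 3 (v a b)" "dagger_on_strip R a (u a b) (v a b)"
    using sol[of a b] assms by (auto simp: assoc_sol_def Cka_strip_def)
  then show "Ck_strip R 2 (u a b)" "Ck_strip R 2 (v a b)" "dagger_on_strip R a (u a b) (v a b)"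
    by (auto simp: Ck_strip_def)
qed

lemma continuous_strip: "continuous_on (strip R) (u a b)" "continuous_on (strip R) (v a b)"
proof -
  have C0: "continuous_on (strip R) f" if "Ck_strip R 2 f" for f
  proof -
    have "continuous_on (strip R) (pdS R [] f)" by (rule Ck_strip_continuous[OF that]) simp
    then show ?thesis by simp
  qed
  show "continuous_on (strip R) (u a b)" "continuous_on (strip R) (v a b)"
    using sol[of a b] regular[of a b] C0 by (cases "a = 0"; auto simp: assoc_sol_def singular_sol_def)+
qed

lemma continuous_open_strip: "continuous_on (open_strip R) (u a b)" "continuous_on (open_strip R) (v a b)"
  by (rule continuous_on_subset[OF continuous_strip(1)] continuous_on_subset[OF continuous_strip(2)];
      auto simp: strip_def open_strip_def)+

lemma psol_uv:
  assumes "a \<noteq> 0" shows "psol R P a (u a b) (v a b)"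
  using dagger_imp_sol2[OF regular[OF assms, of b]] continuous_strip periodic_uv
  unfolding psol_def by blast

lemma phi_continuous: "continuous_on UNIV (\<phi>p a b)" "continuous_on UNIV (\<phi>m a b)"
proof -
  have "continuous_on UNIV f" if "C3a \<alpha> f" for f
  proof -
    have "(f has_real_derivative (deriv ^^ Suc 0) f x) (at x)" for x
      using that unfolding C3a_def by (metis funpow_0 zero_less_numeral)
    then show ?thesis by (meson DERIV_isCont continuous_at_imp_continuous_on)
  qed
  then show "continuous_on UNIV (\<phi>p a b)" "continuous_on UNIV (\<phi>m a b)" using reg by blast+
qed

lemma phi_close:
  assumes e: "e > 0"
  shows "\<exists>d>0. \<forall>a' b'. \<bar>a' - a\<bar> < d \<longrightarrow> \<bar>b' - b\<bar> < d \<longrightarrow>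
    (\<forall>x. \<bar>\<phi>p a' b' x - \<phi>p a b x\<bar> < e \<and> \<bar>\<phi>m a' b' x - \<phi>m a b x\<bar> < e)"
proof -
  obtain d1 where d1: "d1 > 0" "\<And>a' b'. dist (a', b') (a, b) < d1 \<Longrightarrow> c3a_norm \<alpha> (\<lambda>x. \<phi>p a' b' x - \<phi>p a b x) < e"
    using cont_p[OF e, of a b] by blast
  obtain d2 where d2: "d2 > 0" "\<And>a' b'. dist (a', b') (a, b) < d2 \<Longrightarrow> c3a_norm \<alpha> (\<lambda>x. \<phi>m a' b' x - \<phi>m a b x) < e"
    using cont_m[OF e, of a b] by blast
  show ?thesis
  proof (intro exI[of _ "min d1 d2 / 2"] conjI allI impI)
    fix a' b' x assume "\<bar>a' - a\<bar> < min d1 d2 / 2" "\<bar>b' - b\<bar> < min d1 d2 / 2"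
    then have "dist (a', b') (a, b) < min d1 d2"
      using sqrt_sum_squares_le_sum_abs[of "a' - a" "b' - b"] by (simp add: dist_Pair_Pair dist_real_def)
    then have "c3a_norm \<alpha> (\<lambda>x. \<phi>p a' b' x - \<phi>p a b x) < e" "c3a_norm \<alpha> (\<lambda>x. \<phi>m a' b' x - \<phi>m a b x) < e"
      using d1 d2 by auto
    then show "\<bar>\<phi>p a' b' x - \<phi>p a b x\<bar> < e" "\<bar>\<phi>m a' b' x - \<phi>m a b x\<bar> < e"
      using C3a_sup_bound[of \<alpha> "\<phi>p a' b'" "\<phi>p a b" x] C3a_sup_bound[of \<alpha> "\<phi>m a' b'" "\<phi>m a b" x] reg
      by (meson le_less_trans)+
  qed (use d1 d2 in simp)
qed

lemma v_bounded: "\<exists>M>0. \<forall>x y. \<bar>y\<bar> \<le> R \<longrightarrow> \<bar>v a b (x, y)\<bar> \<le> M"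
proof -
  have "continuous_on ({0..P} \<times> {-R..R}) (v a b)"
    by (rule continuous_on_subset[OF continuous_strip(2)]) (auto simp: strip_def)
  then have "bounded (v a b ` ({0..P} \<times> {-R..R}))"
    by (intro compact_imp_bounded compact_continuous_image) (auto simp: compact_Times)
  then obtain M where M: "M > 0" "\<And>z. z \<in> {0..P} \<times> {-R..R} \<Longrightarrow> \<bar>v a b z\<bar> \<le> M" by (auto simp: bounded_pos)
  have "\<bar>v a b (x, y)\<bar> \<le> M" if y: "\<bar>y\<bar> \<le> R" for x y
  proof -
    obtain n :: int where n: "x + of_int n * P \<in> {0..P}" using period_reduction[OF P_pos] by blast
    have "v a b (x + of_int n * P, y) = v a b (x, y)"
      by (rule periodic_int_multiple[of "\<lambda>x. v a b (x, y)"]) (use periodic_uv[OF y] in auto)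
    moreover have "\<bar>v a b (x + of_int n * P, y)\<bar> \<le> M" by (rule M(2)) (use n y in auto)
    ultimately show ?thesis by simp
  qed
  then show ?thesis using M by blast
qed

lemma v_between:
  assumes a: "a \<noteq> 0" and y: "\<bar>y\<bar> < R"
  shows "(\<And>x. \<phi>p a b x < c \<and> \<phi>m a b x < c) \<Longrightarrow> v a b (x, y) \<le> c"
    and "(\<And>x. c < \<phi>p a b x \<and> c < \<phi>m a b x) \<Longrightarrow> c \<le> v a b (x, y)"
  using psol_order[OF psol_uv[OF a] psol_const a P_pos R_pos _ y, of b c]
    psol_order[OF psol_const psol_uv[OF a] a P_pos R_pos _ y, of c b] by (simp_all add: v_edge)

text \<open>The approximating parameter avoids 0 but the limit parameter \<open>a0\<close> does not:
  estimates are available only along regular solutions, while the limit may be singular.\<close>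

lemma convergence_nonzero:
  assumes y0: "\<bar>y0\<bar> < R" and \<eta>: "\<eta> > 0"
  shows "\<exists>d>0. \<forall>a b x y. a \<noteq> 0 \<longrightarrow> \<bar>a - a0\<bar> < d \<longrightarrow> \<bar>b - b0\<bar> < d \<longrightarrow> \<bar>x - x0\<bar> < d \<longrightarrow> \<bar>y - y0\<bar> < d \<longrightarrow>
    \<bar>v a b (x, y) - v a0 b0 (x0, y0)\<bar> < \<eta> \<and> \<bar>u a b (x, y) - u a0 b0 (x0, y0)\<bar> < \<eta>"
proof -
  obtain M0 where M0: "M0 > 0" "\<And>x y. \<bar>y\<bar> \<le> R \<Longrightarrow> \<bar>v a0 b0 (x, y)\<bar> \<le> M0" using v_bounded by blast
  have M00: "0 \<le> M0 + 1" using M0(1) by simp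
  define A where "A = \<bar>a0\<bar> + 1"
  obtain L \<epsilon> R1 d0 where \<epsilon>: "0 < \<epsilon>" and R1: "0 < R1" "R1 < R" and d0: "0 < d0" and
    LC: "\<And>a u1 v1 p q r s b U V pU qU R' x y.
    a \<noteq> 0 \<Longrightarrow> \<bar>a\<bar> \<le> A \<Longrightarrow> sol2 R a u1 v1 p q r s \<Longrightarrow> sol1 R b U V pU qU \<Longrightarrow>
    (\<forall>x y. \<bar>y\<bar> < R \<longrightarrow> u1 (x + P, y) = u1 (x, y) \<and> v1 (x + P, y) = v1 (x, y)) \<Longrightarrow>
    (\<forall>x y. \<bar>y\<bar> < R \<longrightarrow> \<bar>v1 (x, y)\<bar> \<le> M0 + 1 \<and> \<bar>V (x, y)\<bar> \<le> M0 + 1) \<Longrightarrow> u1 (0, 0) = 0 \<Longrightarrow>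
    R1 < R' \<Longrightarrow> R' < R \<Longrightarrow>
    (\<forall>x. \<bar>x\<bar> \<le> L \<longrightarrow> \<bar>v1 (x, R') - V (x, R')\<bar> \<le> \<epsilon> \<and> \<bar>v1 (x, -R') - V (x, -R')\<bar> \<le> \<epsilon>) \<Longrightarrow>
    (\<forall>x y. \<bar>x\<bar> \<le> L \<longrightarrow> \<bar>y\<bar> \<le> R' \<longrightarrow> \<bar>qU (x, y) * (1 - sg b (V (x, y)) y / sg a (V (x, y)) y)\<bar> \<le> \<epsilon>) \<Longrightarrow>
    (\<forall>x y. \<bar>x\<bar> \<le> L \<longrightarrow> \<bar>y\<bar> < R \<longrightarrow> \<bar>U (x, y) - u a0 b0 (x, y)\<bar> \<le> \<epsilon> \<and> \<bar>V (x, y) - v a0 b0 (x, y)\<bar> \<le> \<epsilon>) \<Longrightarrow>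
    \<bar>x - x0\<bar> \<le> d0 \<Longrightarrow> \<bar>y - y0\<bar> \<le> d0 \<Longrightarrow>
    \<bar>v1 (x, y) - v a0 b0 (x0, y0)\<bar> < \<eta> \<and> \<bar>u1 (x, y) - u a0 b0 (x0, y0)\<bar> < \<eta>"
    using local_convergence[OF R_pos P_pos M00 y0 \<eta> continuous_open_strip(1)[of a0 b0] continuous_open_strip(2)[of a0 b0]
        u_origin, where A = A and ?x0.0 = x0] by blast
  \<comment> \<open>On the edges the deviation of the data and that of the mediating solution add
    up, each below half of \<open>\<epsilon>\<close>. The bound by 1 keeps \<open>v\<close> and
    \<open>V\<close> within \<open>M0 + 1\<close>.\<close>
  define \<epsilon>' where "\<epsilon>' = min (\<epsilon> / 2) 1"
  have \<epsilon>': "0 < \<epsilon>'" "\<epsilon>' \<le> \<epsilon> / 2" "\<epsilon>' \<le> 1" using \<epsilon> by (auto simp: \<epsilon>'_def)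
  obtain d1 where d1: "d1 > 0" and \<phi>c: "\<And>a b x. \<bar>a - a0\<bar> < d1 \<Longrightarrow> \<bar>b - b0\<bar> < d1 \<Longrightarrow>
      \<bar>\<phi>p a b x - \<phi>p a0 b0 x\<bar> < \<epsilon>' \<and> \<bar>\<phi>m a b x - \<phi>m a0 b0 x\<bar> < \<epsilon>'" using phi_close[OF \<epsilon>'(1)] by meson
  have step: "\<bar>v a b (x, y) - v a0 b0 (x0, y0)\<bar> < \<eta> \<and> \<bar>u a b (x, y) - u a0 b0 (x0, y0)\<bar> < \<eta>"
    if a: "a \<noteq> 0" "\<bar>a\<bar> \<le> A" and ab: "\<bar>a - a0\<bar> < d1" "\<bar>b - b0\<bar> < d1" and SU: "sol1 R b' U V pU qU"
      and cV: "continuous_on (strip R) V"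
      and cl: "\<And>x y. \<bar>y\<bar> \<le> R \<Longrightarrow> \<bar>U (x, y) - u a0 b0 (x, y)\<bar> \<le> \<epsilon>' \<and> \<bar>V (x, y) - v a0 b0 (x, y)\<bar> \<le> \<epsilon>'"
      and err: "\<And>x y. \<bar>x\<bar> \<le> L \<Longrightarrow> \<bar>y\<bar> < R \<Longrightarrow> \<bar>qU (x, y) * (1 - sg b' (V (x, y)) y / sg a (V (x, y)) y)\<bar> \<le> \<epsilon>"
      and xy: "\<bar>x - x0\<bar> \<le> d0" "\<bar>y - y0\<bar> \<le> d0" for a b b' U V pU qU x y
  proof -
    obtain p q r s where S: "sol2 R a (u a b) (v a b) p q r s" using psol_uv[OF a(1), of b] by (auto simp: psol_def)
    have \<phi>0: "\<bar>\<phi>p a0 b0 x\<bar> \<le> M0" "\<bar>\<phi>m a0 b0 x\<bar> \<le> M0" for x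
      using M0(2)[of R x] M0(2)[of "-R" x] R_pos by (simp_all add: v_edge)
    have \<phi>M: "\<phi>p a b x < M0 + 1" "\<phi>m a b x < M0 + 1" "- (M0 + 1) < \<phi>p a b x" "- (M0 + 1) < \<phi>m a b x" for x
      using \<phi>c[OF ab, of x] \<phi>0[of x] \<epsilon>'(3) by linarith+
    have vM: "\<bar>v a b (x, y)\<bar> \<le> M0 + 1" if "\<bar>y\<bar> < R" for x y
      using v_between(1)[OF a(1) that, of b "M0 + 1" x] v_between(2)[OF a(1) that, of "- (M0 + 1)" b x] \<phi>M by auto
    have VM: "\<bar>V (x, y)\<bar> \<le> M0 + 1" if "\<bar>y\<bar> < R" for x y
      using cl[of y x] M0(2)[of y x] that \<epsilon>'(3) by linarith
    have cf: "continuous_on (strip R) (\<lambda>z. \<bar>v a b z - V z\<bar>)" by (intro continuous_intros continuous_strip cV)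
    have edge: "\<bar>v a b (x, R) - V (x, R)\<bar> < \<epsilon> \<and> \<bar>v a b (x, -R) - V (x, -R)\<bar> < \<epsilon>" for x
      using \<phi>c[OF ab, of x] cl[of R x] cl[of "-R" x] \<epsilon>'(2) R_pos unfolding v_edge by auto
    obtain R' where R': "R1 < R'" "R' < R"
      "\<And>x. \<bar>x\<bar> \<le> max L 0 \<Longrightarrow> \<bar>v a b (x, R') - V (x, R')\<bar> \<le> \<epsilon> \<and> \<bar>v a b (x, -R') - V (x, -R')\<bar> \<le> \<epsilon>"
      using near_edge[OF cf R1, of "max L 0" \<epsilon>] edge by auto
    have f1: "\<forall>x y. \<bar>y\<bar> < R \<longrightarrow> u a b (x + P, y) = u a b (x, y) \<and> v a b (x + P, y) = v a b (x, y)"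
      using periodic_uv less_imp_le by blast
    have f2: "\<forall>x y. \<bar>y\<bar> < R \<longrightarrow> \<bar>v a b (x, y)\<bar> \<le> M0 + 1 \<and> \<bar>V (x, y)\<bar> \<le> M0 + 1" using vM VM by blast
    have f3: "\<forall>x. \<bar>x\<bar> \<le> L \<longrightarrow> \<bar>v a b (x, R') - V (x, R')\<bar> \<le> \<epsilon> \<and> \<bar>v a b (x, -R') - V (x, -R')\<bar> \<le> \<epsilon>"
      using R'(3) by (meson max.coboundedI1)
    have f4: "\<forall>x y. \<bar>x\<bar> \<le> L \<longrightarrow> \<bar>y\<bar> \<le> R' \<longrightarrow> \<bar>qU (x, y) * (1 - sg b' (V (x, y)) y / sg a (V (x, y)) y)\<bar> \<le> \<epsilon>"
      using err R'(2) by (meson le_less_trans)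
    have \<epsilon>\<epsilon>: "\<epsilon>' \<le> \<epsilon>" using \<epsilon> \<epsilon>' by linarith
    have f5: "\<forall>x y. \<bar>x\<bar> \<le> L \<longrightarrow> \<bar>y\<bar> < R \<longrightarrow> \<bar>U (x, y) - u a0 b0 (x, y)\<bar> \<le> \<epsilon> \<and> \<bar>V (x, y) - v a0 b0 (x, y)\<bar> \<le> \<epsilon>"
      using cl \<epsilon>\<epsilon> by (meson less_imp_le order_trans)
    show ?thesis by (rule LC[OF a S SU f1 f2 u_origin R'(1,2) f3 f4 f5 xy])
  qed
  show ?thesis
  proof (cases "a0 = 0")
    \<comment> \<open>The limit is regular and mediates itself, with coefficient parameter
      \<open>a0\<close>. The defect from \<open>a \<noteq> a0\<close> is small because
      \<open>sg\<close> is Lipschitz in \<open>a\<close> and at least \<open>|a0| / 2\<close> for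
      nearby \<open>a\<close>.\<close>
    case False
    define q where "q = pyS R (u a0 b0)"
    obtain r s where S0: "sol2 R a0 (u a0 b0) (v a0 b0) (px (u a0 b0)) q r s"
      using dagger_imp_sol2[OF regular[OF False, of b0]] unfolding q_def by blast
    have "continuous_on (strip R) (pdS R [True] (u a0 b0))" by (rule Ck_strip_continuous[OF regular(1)[OF False]]) simp
    then have "continuous_on (strip R) q" by (simp add: q_def)
    then have "continuous_on ({-L..L} \<times> {-R..R}) q" by (rule continuous_on_subset) (auto simp: strip_def)
    then have "bounded (q ` ({-L..L} \<times> {-R..R}))"
      by (intro compact_imp_bounded compact_continuous_image) (auto simp: compact_Times)
    then obtain K where K: "K > 0" "\<And>z. z \<in> {-L..L} \<times> {-R..R} \<Longrightarrow> \<bar>q z\<bar> \<le> K" by (auto simp: bounded_pos)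
    define d where "d = min (min d0 d1) (min (\<bar>a0\<bar> / 2) (min 1 (\<epsilon> * \<bar>a0\<bar> / (2 * K))))"
    have "0 < \<epsilon> * \<bar>a0\<bar> / (2 * K)" using \<epsilon> K False by simp
    then have d: "0 < d" "d \<le> d0" "d \<le> d1" "d \<le> \<bar>a0\<bar> / 2" "d \<le> 1" "d \<le> \<epsilon> * \<bar>a0\<bar> / (2 * K)"
      unfolding d_def using d0 d1 False by (auto simp: min_le_iff_disj)
    show ?thesis
    proof (intro exI[of _ d] conjI d(1) allI impI)
      fix a b x y assume a: "a \<noteq> 0" "\<bar>a - a0\<bar> < d" "\<bar>b - b0\<bar> < d" and xy: "\<bar>x - x0\<bar> < d" "\<bar>y - y0\<bar> < d"
      have err: "\<bar>q (x, y) * (1 - sg a0 (v a0 b0 (x, y)) y / sg a (v a0 b0 (x, y)) y)\<bar> \<le> \<epsilon>"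
        if "\<bar>x\<bar> \<le> L" "\<bar>y\<bar> < R" for x y
      proof -
        define t where "t = v a0 b0 (x, y)"
        have sp: "\<bar>a0\<bar> / 2 \<le> sg a t y" using sg_ge_abs_a[of a t y] a(2) d(4) by linarith
        have a0p: "0 < \<bar>a0\<bar>" using False by simp
        then have sp0: "0 < sg a t y" using sp by linarith
        have "1 - sg a0 t y / sg a t y = (sg a t y - sg a0 t y) / sg a t y" using sp0 by (simp add: field_simps)
        then have "\<bar>1 - sg a0 t y / sg a t y\<bar> = \<bar>sg a t y - sg a0 t y\<bar> / sg a t y" using sp0 by simp
        also have "\<dots> \<le> d / (\<bar>a0\<bar> / 2)"
          using sg_lipschitz_a[of a t y a0] a(2) sp a0p d(1) by (intro frac_le) auto
        finally have 1: "\<bar>1 - sg a0 t y / sg a t y\<bar> \<le> d / (\<bar>a0\<bar> / 2)" .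
        have "\<bar>q (x, y)\<bar> \<le> K" by (rule K(2)) (use that in auto)
        then have "\<bar>q (x, y) * (1 - sg a0 t y / sg a t y)\<bar> \<le> K * (d / (\<bar>a0\<bar> / 2))"
          unfolding abs_mult using 1 K(1) by (intro mult_mono) auto
        also have "\<dots> \<le> \<epsilon>" using d(6) K(1) a0p by (simp add: field_simps)
        finally show ?thesis by (simp add: t_def)
      qed
      have g: "\<bar>a\<bar> \<le> A" "\<bar>a - a0\<bar> < d1" "\<bar>b - b0\<bar> < d1" "\<bar>x - x0\<bar> \<le> d0" "\<bar>y - y0\<bar> \<le> d0"
        unfolding A_def using a xy d by linarith+
      have cl: "\<bar>u a0 b0 (x, y) - u a0 b0 (x, y)\<bar> \<le> \<epsilon>' \<and> \<bar>v a0 b0 (x, y) - v a0 b0 (x, y)\<bar> \<le> \<epsilon>'" for x y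
        using \<epsilon>'(1) by simp
      show "\<bar>v a b (x, y) - v a0 b0 (x0, y0)\<bar> < \<eta>" "\<bar>u a b (x, y) - u a0 b0 (x0, y0)\<bar> < \<eta>"
        using step[OF a(1) g(1-3) sol2_sol1[OF S0] continuous_strip(2) cl err g(4,5)] by blast+
    qed
  next
    \<comment> \<open>Mediator is the regular approximation with parameter \<open>|a|\<close>, for
      which the defect vanishes because \<open>sg\<close> depends on \<open>a\<close> only through
      its square. The absolute value is taken because approximations exist for positive parameters
      only.\<close>
    case True
    have "singular_sol R (u a0 b0) (v a0 b0)" using sol[of a0 b0] True by (simp add: assoc_sol_def)
    then obtain U V where UV: "\<And>b. b > 0 \<Longrightarrow> Ck_strip R 2 (U b) \<and> Ck_strip R 2 (V b) \<and> dagger_on_strip R b (U b) (V b)"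
      and lU: "uniform_limit (strip R) U (u a0 b0) (at_right 0)" and lV: "uniform_limit (strip R) V (v a0 b0) (at_right 0)"
      unfolding singular_sol_def by blast
    have "\<forall>\<^sub>F b in at_right 0. (\<forall>z\<in>strip R. dist (U b z) (u a0 b0 z) < \<epsilon>') \<and> (\<forall>z\<in>strip R. dist (V b z) (v a0 b0 z) < \<epsilon>')"
      using uniform_limitD[OF lU \<epsilon>'(1)] uniform_limitD[OF lV \<epsilon>'(1)] by eventually_elim auto
    then obtain d2 where d2: "d2 > 0" "\<And>b z. 0 < b \<Longrightarrow> b < d2 \<Longrightarrow> z \<in> strip R \<Longrightarrow> \<bar>U b z - u a0 b0 z\<bar> < \<epsilon>' \<and> \<bar>V b z - v a0 b0 z\<bar> < \<epsilon>'"
      unfolding eventually_at_right_field dist_real_def by (metis greaterThan_iff)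
    define d where "d = min (min d0 d1) (min d2 1)"
    have d: "0 < d" "d \<le> d0" "d \<le> d1" "d \<le> d2" "d \<le> 1" using d0 d1 d2 by (auto simp: d_def)
    show ?thesis
    proof (intro exI[of _ d] conjI d(1) allI impI)
      fix a b x y assume a: "a \<noteq> 0" "\<bar>a - a0\<bar> < d" "\<bar>b - b0\<bar> < d" and xy: "\<bar>x - x0\<bar> < d" "\<bar>y - y0\<bar> < d"
      have ap: "0 < \<bar>a\<bar>" "\<bar>a\<bar> < d2" using a True d by auto
      obtain pU qU where SU: "sol1 R \<bar>a\<bar> (U \<bar>a\<bar>) (V \<bar>a\<bar>) pU qU"
        using dagger_imp_sol2[of R "U \<bar>a\<bar>" "V \<bar>a\<bar>" "\<bar>a\<bar>"] UV[OF ap(1)] sol2_sol1 by blast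
      have "continuous_on (strip R) (pdS R [] (V \<bar>a\<bar>))" using UV[OF ap(1)] by (intro Ck_strip_continuous[of R 2]) auto
      then have cV: "continuous_on (strip R) (V \<bar>a\<bar>)" by simp
      have cl: "\<bar>U \<bar>a\<bar> (x, y) - u a0 b0 (x, y)\<bar> \<le> \<epsilon>' \<and> \<bar>V \<bar>a\<bar> (x, y) - v a0 b0 (x, y)\<bar> \<le> \<epsilon>'" if "\<bar>y\<bar> \<le> R" for x y
        using d2(2)[OF ap, of "(x, y)"] that by (auto simp: strip_def)
      have "sg \<bar>a\<bar> t y = sg a t y" for t y by (simp add: sg_def)
      then have err: "\<bar>qU (x, y) * (1 - sg \<bar>a\<bar> (V \<bar>a\<bar> (x, y)) y / sg a (V \<bar>a\<bar> (x, y)) y)\<bar> \<le> \<epsilon>" for x y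
        using sg_pos[OF a(1), of "V \<bar>a\<bar> (x, y)" y] \<epsilon> by simp
      have g: "\<bar>a\<bar> \<le> A" "\<bar>a - a0\<bar> < d1" "\<bar>b - b0\<bar> < d1" "\<bar>x - x0\<bar> \<le> d0" "\<bar>y - y0\<bar> \<le> d0"
        unfolding A_def using a xy d by linarith+
      show "\<bar>v a b (x, y) - v a0 b0 (x0, y0)\<bar> < \<eta>" "\<bar>u a b (x, y) - u a0 b0 (x0, y0)\<bar> < \<eta>"
        using step[OF a(1) g(1-3) SU cV cl err g(4,5)] by blast+
    qed
  qed
qed

text \<open>A solution with \<open>a = 0\<close> is itself a limit of solutions with the same
  \<open>b\<close> and a small nonzero parameter. It is replaced by one of these, the tolerance
  being split in two.\<close>

lemma convergence:
  assumes y0: "\<bar>y0\<bar> < R" and \<eta>: "\<eta> > 0"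
  shows "\<exists>d>0. \<forall>a b x y. \<bar>a - a0\<bar> < d \<longrightarrow> \<bar>b - b0\<bar> < d \<longrightarrow> \<bar>x - x0\<bar> < d \<longrightarrow> \<bar>y - y0\<bar> < d \<longrightarrow>
    \<bar>v a b (x, y) - v a0 b0 (x0, y0)\<bar> < \<eta> \<and> \<bar>u a b (x, y) - u a0 b0 (x0, y0)\<bar> < \<eta>"
proof -
  have \<eta>2: "0 < \<eta> / 2" using \<eta> by simp
  obtain d where d: "d > 0" and C: "\<And>a b x y. a \<noteq> 0 \<Longrightarrow> \<bar>a - a0\<bar> < d \<Longrightarrow> \<bar>b - b0\<bar> < d \<Longrightarrow> \<bar>x - x0\<bar> < d \<Longrightarrow> \<bar>y - y0\<bar> < d \<Longrightarrow>
    \<bar>v a b (x, y) - v a0 b0 (x0, y0)\<bar> < \<eta> / 2 \<and> \<bar>u a b (x, y) - u a0 b0 (x0, y0)\<bar> < \<eta> / 2"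
    using convergence_nonzero[OF y0 \<eta>2] by blast
  define d' where "d' = min d (R - \<bar>y0\<bar>)"
  have d': "0 < d'" "d' \<le> d" "d' \<le> R - \<bar>y0\<bar>" using d y0 by (auto simp: d'_def)
  show ?thesis
  proof (intro exI[of _ d'] conjI d'(1) allI impI)
    fix a b x y assume a: "\<bar>a - a0\<bar> < d'" "\<bar>b - b0\<bar> < d'" and xy: "\<bar>x - x0\<bar> < d'" "\<bar>y - y0\<bar> < d'"
    have yR: "\<bar>y\<bar> < R" using xy d' by linarith
    obtain e where e: "e > 0" and E: "\<And>a'. a' \<noteq> 0 \<Longrightarrow> \<bar>a' - a\<bar> < e \<Longrightarrow>
        \<bar>v a' b (x, y) - v a b (x, y)\<bar> < \<eta> / 2 \<and> \<bar>u a' b (x, y) - u a b (x, y)\<bar> < \<eta> / 2"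
      using convergence_nonzero[OF yR \<eta>2, of a b x] by auto
    define s where "s = min e (d' - \<bar>a - a0\<bar>) / 2"
    have s: "0 < s" "s < e" "\<bar>a - a0\<bar> + s < d'" using e a by (auto simp: s_def min_def field_simps)
    define a' where "a' = (if a = 0 then s else a)"
    have a': "a' \<noteq> 0" "\<bar>a' - a\<bar> < e" "\<bar>a' - a0\<bar> < d" using s e a d' by (auto simp: a'_def)
    have bxy: "\<bar>b - b0\<bar> < d" "\<bar>x - x0\<bar> < d" "\<bar>y - y0\<bar> < d" using a xy d' by auto
    show "\<bar>v a b (x, y) - v a0 b0 (x0, y0)\<bar> < \<eta>" "\<bar>u a b (x, y) - u a0 b0 (x0, y0)\<bar> < \<eta>"
      using C[OF a'(1,3) bxy] E[OF a'(1,2)] by linarith+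
  qed
qed

end

section \<open>Compactness for periodic data and limits in a\<close>

lemma periodic_gap:
  fixes f g :: "real \<Rightarrow> real"
  assumes P: "P > 0" and cf: "continuous_on UNIV f" and cg: "continuous_on UNIV g"
    and pf: "\<And>x. f (x + P) = f x" and pg: "\<And>x. g (x + P) = g x" and lt: "\<And>x. f x < g x"
  shows "\<exists>e>0. \<forall>x. f x + e \<le> g x"
proof -
  have "continuous_on {0..P} (\<lambda>x. g x - f x)"
    by (intro continuous_intros continuous_on_subset[OF cf] continuous_on_subset[OF cg]) auto
  then obtain xm where xm: "xm \<in> {0..P}" "\<And>x. x \<in> {0..P} \<Longrightarrow> g xm - f xm \<le> g x - f x"
    using continuous_attains_inf[of "{0..P}" "\<lambda>x. g x - f x"] P by auto
  have "f x + (g xm - f xm) \<le> g x" for x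
  proof -
    obtain n :: int where n: "x + of_int n * P \<in> {0..P}" using period_reduction[OF P] by blast
    show ?thesis using xm(2)[OF n] periodic_int_multiple[of f P, OF pf] periodic_int_multiple[of g P, OF pg] by simp
  qed
  then show ?thesis using lt[of xm] by (intro exI[of _ "g xm - f xm"]) auto
qed

text \<open>A Dini argument: near each point of a period one value of \<open>b\<close> already
  works, finitely many such neighbourhoods cover the period, and monotonicity passes to every
  \<open>b\<close> above the largest of these values.\<close>

lemma uniformly_large:
  fixes f :: "real \<Rightarrow> real \<Rightarrow> real"
  assumes P: "P > 0" and c: "\<And>b. continuous_on UNIV (f b)" and p: "\<And>b x. f b (x + P) = f b x"
    and mono: "\<And>b b' x. b < b' \<Longrightarrow> f b x < f b' x" and lim: "\<And>x. filterlim (\<lambda>b. f b x) at_top at_top"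
  shows "\<exists>b0. \<forall>b\<ge>b0. \<forall>x. c < f b x"
proof -
  have "\<exists>b. c < f b x" for x
  proof -
    have "\<forall>\<^sub>F b in at_top. c < f b x" using lim[of x] unfolding filterlim_at_top_dense by blast
    then show ?thesis by (auto simp: eventually_at_top_linorder)
  qed
  then obtain B where B: "\<And>x. c < f (B x) x" by metis
  define U where "U x = {x'. c < f (B x) x'}" for x
  have "open (U x)" for x unfolding U_def using c by (auto intro!: open_Collect_less continuous_intros)
  note U_open = this
  have cover: "{0..P} \<subseteq> (\<Union>x\<in>{0..P}. U x)" using B by (auto simp: U_def)
  obtain D where D: "finite D" "{0..P} \<subseteq> (\<Union>x\<in>D. U x)"
    by (rule compactE_image[OF compact_Icc U_open cover]) blast
  have "D \<noteq> {}" using D(2) P by auto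
  define b0 where "b0 = Max (B ` D)"
  have "c < f b x" if b: "b0 \<le> b" for b x
  proof -
    obtain n :: int where n: "x + of_int n * P \<in> {0..P}" using period_reduction[OF P] by blast
    then obtain z where z: "z \<in> D" "c < f (B z) (x + of_int n * P)" using D(2) by (auto simp: U_def)
    have "B z \<le> b" using b D(1) z(1) by (auto simp: b0_def intro: order_trans[OF Max_ge])
    then have "f (B z) x \<le> f b x" using mono[of "B z" b x] by (cases "B z = b") auto
    then show ?thesis using z(2) periodic_int_multiple[of "f (B z)" P, OF p] by simp
  qed
  then show ?thesis by blast
qed

text \<open>The device by which inequalities reach the singular solution: they are proved for small
  positive \<open>a\<close> and extended by continuity in \<open>a\<close>.\<close>

lemma le_at_zero:
  fixes F G :: "real \<Rightarrow> real"
  assumes "continuous_on UNIV F" "continuous_on UNIV G" "d > 0" "\<And>a. 0 < a \<Longrightarrow> a < d \<Longrightarrow> F a \<le> G a"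
  shows "F 0 \<le> G 0"
proof -
  have "(F \<longlongrightarrow> F 0) (at_right 0)" "(G \<longlongrightarrow> G 0) (at_right 0)"
    using assms(1,2) by (auto simp: continuous_on_def intro: tendsto_within_subset)
  moreover have "\<forall>\<^sub>F a in at_right 0. F a \<le> G a"
    unfolding eventually_at_right_field using assms(3,4) by blast
  ultimately show ?thesis by (intro tendsto_le[of "at_right (0::real)"]) auto
qed

context sl_family begin

lemma continuous_on_uv:
  fixes A B X Y :: "'z::topological_space \<Rightarrow> real"
  assumes c: "continuous_on S A" "continuous_on S B" "continuous_on S X" "continuous_on S Y"
    and Y: "\<And>z. z \<in> S \<Longrightarrow> \<bar>Y z\<bar> < R"
  shows "continuous_on S (\<lambda>z. v (A z) (B z) (X z, Y z))" "continuous_on S (\<lambda>z. u (A z) (B z) (X z, Y z))"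
proof -
  have "((\<lambda>z. v (A z) (B z) (X z, Y z)) \<longlongrightarrow> v (A z0) (B z0) (X z0, Y z0)) (at z0 within S) \<and>
        ((\<lambda>z. u (A z) (B z) (X z, Y z)) \<longlongrightarrow> u (A z0) (B z0) (X z0, Y z0)) (at z0 within S)" if z0: "z0 \<in> S" for z0
  proof -
    have ev: "\<forall>\<^sub>F z in at z0 within S. \<bar>v (A z) (B z) (X z, Y z) - v (A z0) (B z0) (X z0, Y z0)\<bar> < e \<and>
        \<bar>u (A z) (B z) (X z, Y z) - u (A z0) (B z0) (X z0, Y z0)\<bar> < e" if e: "e > 0" for e
    proof -
      obtain d where d: "d > 0" and D: "\<And>a b x y. \<bar>a - A z0\<bar> < d \<Longrightarrow> \<bar>b - B z0\<bar> < d \<Longrightarrow> \<bar>x - X z0\<bar> < d \<Longrightarrow> \<bar>y - Y z0\<bar> < d \<Longrightarrow>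
        \<bar>v a b (x, y) - v (A z0) (B z0) (X z0, Y z0)\<bar> < e \<and> \<bar>u a b (x, y) - u (A z0) (B z0) (X z0, Y z0)\<bar> < e"
        using convergence[OF Y[OF z0] e] by blast
      have t: "(A \<longlongrightarrow> A z0) (at z0 within S)" "(B \<longlongrightarrow> B z0) (at z0 within S)"
        "(X \<longlongrightarrow> X z0) (at z0 within S)" "(Y \<longlongrightarrow> Y z0) (at z0 within S)"
        using c z0 by (auto simp: continuous_on_def)
      show ?thesis
        using tendstoD[OF t(1) d] tendstoD[OF t(2) d] tendstoD[OF t(3) d] tendstoD[OF t(4) d]
        by eventually_elim (use D in \<open>simp add: dist_real_def\<close>)
    qed
    show ?thesis
    proof (intro conjI tendstoI)
      fix e :: real assume e: "0 < e"
      show "\<forall>\<^sub>F z in at z0 within S. dist (v (A z) (B z) (X z, Y z)) (v (A z0) (B z0) (X z0, Y z0)) < e"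
        using ev[OF e] by eventually_elim (simp add: dist_real_def)
      show "\<forall>\<^sub>F z in at z0 within S. dist (u (A z) (B z) (X z, Y z)) (u (A z0) (B z0) (X z0, Y z0)) < e"
        using ev[OF e] by eventually_elim (simp add: dist_real_def)
    qed
  qed
  then show "continuous_on S (\<lambda>z. v (A z) (B z) (X z, Y z))" "continuous_on S (\<lambda>z. u (A z) (B z) (X z, Y z))"
    by (auto simp: continuous_on_def)
qed

section \<open>Order of solutions and strict monotonicity in b\<close>

lemma order_translated:
  assumes lt: "\<And>x. \<phi>p a b x < \<phi>p a b' (x + t) \<and> \<phi>m a b x < \<phi>m a b' (x + t)" and y: "\<bar>y\<bar> < R"
  shows "v a b (x, y) \<le> v a b' (x + t, y)"
proof -
  have nz: "v a b (x, y) \<le> v a b' (x + t, y)"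
    if "a \<noteq> 0" "\<And>x. \<phi>p a b x < \<phi>p a b' (x + t) \<and> \<phi>m a b x < \<phi>m a b' (x + t)" for a
    using psol_order[OF psol_uv[OF that(1), of b] psol_translate[OF psol_uv[OF that(1), of b'], of t] that(1) P_pos R_pos _ y, of x]
      that(2) by (simp add: v_edge)
  show ?thesis
  proof (cases "a = 0")
    case True
    have sh: "continuous_on UNIV (\<lambda>x. f (x + t))" if "continuous_on UNIV f" for f :: "real \<Rightarrow> real"
      by (rule continuous_on_compose2[OF that]) (auto intro!: continuous_intros)
    have pt: "f (x + P + t) = f (x + t)" if "\<And>x. f (x + P) = f x" for f :: "real \<Rightarrow> real" and x
      using that[of "x + t"] by (simp add: algebra_simps)
    \<comment> \<open>Strictness at \<open>a = 0\<close> need not persist uniformly in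
      \<open>x\<close> by itself. Periodicity turns it into a positive gap, which survives changing
      both data by less than \<open>e\<close> when \<open>a\<close> moves off 0.\<close>
    obtain e1 where e1: "e1 > 0" "\<And>x. \<phi>p 0 b x + e1 \<le> \<phi>p 0 b' (x + t)"
      using periodic_gap[OF P_pos phi_continuous(1)[of 0 b] sh[OF phi_continuous(1)[of 0 b']]] per lt True pt by auto
    obtain e2 where e2: "e2 > 0" "\<And>x. \<phi>m 0 b x + e2 \<le> \<phi>m 0 b' (x + t)"
      using periodic_gap[OF P_pos phi_continuous(2)[of 0 b] sh[OF phi_continuous(2)[of 0 b']]] per lt True pt by auto
    define e where "e = min e1 e2 / 2"
    have e: "e > 0" "2 * e \<le> e1" "2 * e \<le> e2" using e1 e2 by (auto simp: e_def)
    obtain d1 where d1: "d1 > 0" "\<And>a' x. \<bar>a'\<bar> < d1 \<Longrightarrow> \<bar>\<phi>p a' b x - \<phi>p 0 b x\<bar> < e \<and> \<bar>\<phi>m a' b x - \<phi>m 0 b x\<bar> < e"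
      using phi_close[OF e(1), of 0 b] by auto
    obtain d2 where d2: "d2 > 0" "\<And>a' x. \<bar>a'\<bar> < d2 \<Longrightarrow> \<bar>\<phi>p a' b' x - \<phi>p 0 b' x\<bar> < e \<and> \<bar>\<phi>m a' b' x - \<phi>m 0 b' x\<bar> < e"
      using phi_close[OF e(1), of 0 b'] by auto
    have "(\<lambda>a. v a b (x, y)) 0 \<le> (\<lambda>a. v a b' (x + t, y)) 0"
    proof (rule le_at_zero[where d = "min d1 d2"])
      show "continuous_on UNIV (\<lambda>a. v a b (x, y))" "continuous_on UNIV (\<lambda>a. v a b' (x + t, y))"
        by (rule continuous_on_uv(1); use y in \<open>auto intro!: continuous_intros\<close>)+
      fix a assume a: "0 < a" "a < min d1 d2"
      show "v a b (x, y) \<le> v a b' (x + t, y)"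
      proof (rule nz)
        fix x
        have "\<bar>a\<bar> < d1" "\<bar>a\<bar> < d2" using a by auto
        then show "\<phi>p a b x < \<phi>p a b' (x + t) \<and> \<phi>m a b x < \<phi>m a b' (x + t)"
          using d1(2)[of a x] d2(2)[of a "x + t"] e1(2)[of x] e2(2)[of x] e by (auto simp: abs_less_iff)
      qed (use a in simp)
    qed (use d1 d2 in simp)
    then show ?thesis using True by simp
  qed (use nz lt in auto)
qed

lemma v_mono: "b < b' \<Longrightarrow> \<bar>y\<bar> < R \<Longrightarrow> v a b (x, y) \<le> v a b' (x, y)"
  using order_translated[of a b b' 0 y x] mono by simp

text \<open>The gap between the two data exceeds the change caused by a short translation, since the
  data are Lipschitz.\<close>

lemma small_translation:
  assumes "b < b'"
  shows "\<exists>t0>0. \<forall>t x. \<bar>t\<bar> \<le> t0 \<longrightarrow> \<phi>p a b x < \<phi>p a b' (x + t) \<and> \<phi>m a b x < \<phi>m a b' (x + t)"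
proof -
  obtain e1 where e1: "e1 > 0" "\<And>x. \<phi>p a b x + e1 \<le> \<phi>p a b' x"
    using periodic_gap[OF P_pos phi_continuous(1)[of a b] phi_continuous(1)[of a b']] per mono[OF assms] by blast
  obtain e2 where e2: "e2 > 0" "\<And>x. \<phi>m a b x + e2 \<le> \<phi>m a b' x"
    using periodic_gap[OF P_pos phi_continuous(2)[of a b] phi_continuous(2)[of a b']] per mono[OF assms] by blast
  obtain K1 where K1: "\<And>x y. \<bar>\<phi>p a b' x - \<phi>p a b' y\<bar> \<le> K1 * \<bar>x - y\<bar>" using C3a_lipschitz reg by blast
  obtain K2 where K2: "\<And>x y. \<bar>\<phi>m a b' x - \<phi>m a b' y\<bar> \<le> K2 * \<bar>x - y\<bar>" using C3a_lipschitz reg by blast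
  define K where "K = \<bar>K1\<bar> + \<bar>K2\<bar> + 1"
  define t0 where "t0 = min e1 e2 / (2 * K)"
  have K: "K > 0" "K1 \<le> K" "K2 \<le> K" by (auto simp: K_def)
  show ?thesis
  proof (intro exI[of _ t0] conjI allI impI)
    show "0 < t0" using e1 e2 K by (simp add: t0_def)
    fix t x assume t: "\<bar>t\<bar> \<le> t0"
    have "K * \<bar>t\<bar> \<le> K * t0" using t K by (intro mult_left_mono) auto
    also have "\<dots> = min e1 e2 / 2" using K by (simp add: t0_def)
    finally have Kt: "K * \<bar>t\<bar> \<le> min e1 e2 / 2" .
    have "K1 * \<bar>t\<bar> \<le> K * \<bar>t\<bar>" "K2 * \<bar>t\<bar> \<le> K * \<bar>t\<bar>" using K by (auto intro: mult_right_mono)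
    then have k: "\<bar>\<phi>p a b' (x + t) - \<phi>p a b' x\<bar> \<le> min e1 e2 / 2" "\<bar>\<phi>m a b' (x + t) - \<phi>m a b' x\<bar> \<le> min e1 e2 / 2"
      using K1[of "x + t" x] K2[of "x + t" x] Kt by auto
    have m: "min e1 e2 / 2 < e1" "min e1 e2 / 2 < e2" using e1 e2 by (auto simp: min_def)
    show "\<phi>p a b x < \<phi>p a b' (x + t)" using k(1) m(1) e1(2)[of x] by linarith
    show "\<phi>m a b x < \<phi>m a b' (x + t)" using k(2) m(2) e2(2)[of x] by linarith
  qed
qed

lemma v_strict_mono:
  assumes b: "b1 < b2" and y0: "\<bar>y0\<bar> < R"
  shows "v a b1 (x0, y0) < v a b2 (x0, y0)"
proof (rule ccontr)
  assume "\<not> ?thesis"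
  then have eq: "v a b1 (x0, y0) = v a b2 (x0, y0)" using v_mono[OF b y0, of a x0] by simp
  \<comment> \<open>Two intermediate parameters, strictly between \<open>b1\<close> and
    \<open>b2\<close>, leave room on both sides for translating in \<open>x\<close>.\<close>
  define c1 where "c1 = b1 + (b2 - b1) / 3"
  define c2 where "c2 = b1 + 2 * (b2 - b1) / 3"
  have c: "b1 < c1" "c1 < c2" "c2 < b2" "b1 < c2" "c1 < b2" using b by (auto simp: c1_def c2_def field_simps)
  obtain s1 where s1: "s1 > 0" "\<And>t x. \<bar>t\<bar> \<le> s1 \<Longrightarrow> \<phi>p a b1 x < \<phi>p a c1 (x + t) \<and> \<phi>m a b1 x < \<phi>m a c1 (x + t)" using small_translation[OF c(1), of a] by blast
  obtain s2 where s2: "s2 > 0" "\<And>t x. \<bar>t\<bar> \<le> s2 \<Longrightarrow> \<phi>p a b1 x < \<phi>p a c2 (x + t) \<and> \<phi>m a b1 x < \<phi>m a c2 (x + t)" using small_translation[OF c(4), of a] by blast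
  obtain s3 where s3: "s3 > 0" "\<And>t x. \<bar>t\<bar> \<le> s3 \<Longrightarrow> \<phi>p a c1 x < \<phi>p a b2 (x + t) \<and> \<phi>m a c1 x < \<phi>m a b2 (x + t)" using small_translation[OF c(5), of a] by blast
  obtain s4 where s4: "s4 > 0" "\<And>t x. \<bar>t\<bar> \<le> s4 \<Longrightarrow> \<phi>p a c2 x < \<phi>p a b2 (x + t) \<and> \<phi>m a c2 x < \<phi>m a b2 (x + t)" using small_translation[OF c(3), of a] by blast
  define t where "t = min (min s1 s2) (min s3 s4)"
  have t: "t > 0" "t \<le> s1" "t \<le> s2" "t \<le> s3" "t \<le> s4" using s1 s2 s3 s4 by (auto simp: t_def)
  \<comment> \<open>Squeezing: for \<open>c\<close> equal to \<open>c1\<close> or \<open>c2\<close>,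
    the value at \<open>x\<close> is at least that of \<open>b1\<close> at \<open>x0\<close> and at
    most that of \<open>b2\<close> at \<open>x0\<close>, by comparison with translates by
    \<open>x - x0\<close>. These two bounds coincide.\<close>
  have seg: "v a c1 (x, y0) = v a c2 (x, y0)" if "x \<in> {x0-t..x0+t}" for x
  proof -
    have ab: "\<bar>x - x0\<bar> \<le> t" "\<bar>x0 - x\<bar> \<le> t" using that by auto
    have "v a b1 (x0, y0) \<le> v a c1 (x0 + (x - x0), y0)"
      by (rule order_translated[OF _ y0]) (use s1(2)[of "x - x0"] ab t in auto)
    moreover have "v a b1 (x0, y0) \<le> v a c2 (x0 + (x - x0), y0)"
      by (rule order_translated[OF _ y0]) (use s2(2)[of "x - x0"] ab t in auto)
    moreover have "v a c1 (x, y0) \<le> v a b2 (x + (x0 - x), y0)"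
      by (rule order_translated[OF _ y0]) (use s3(2)[of "x0 - x"] ab t in auto)
    moreover have "v a c2 (x, y0) \<le> v a b2 (x + (x0 - x), y0)"
      by (rule order_translated[OF _ y0]) (use s4(2)[of "x0 - x"] ab t in auto)
    ultimately show ?thesis using eq by simp
  qed
  note B = bump_facts[OF t(1), where ?x0.0 = x0]
  \<comment> \<open>The parameter \<open>a\<close> stays an argument: for \<open>a = 0\<close> the
    two integral statements follow from those for positive \<open>a\<close> by joint continuity in
    \<open>a\<close> and \<open>y\<close>.\<close>
  define M where "M a y = integral {x0-t..x0+t} (\<lambda>x. (v a c2 (x, y) - v a c1 (x, y)) * bump x0 t x)" for a y
  define M1 where "M1 a y = - integral {x0-t..x0+t} (\<lambda>x. (u a c2 (x, y) - u a c1 (x, y)) * bump_deriv x0 t x)" for a y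
  define c0 where "c0 = (pi / t)\<^sup>2 / 2"
  have c0: "0 < c0" using t by (simp add: c0_def)
  have jM: "continuous_on (UNIV \<times> {-R<..<R}) (\<lambda>z. M (fst z) (snd z))"
  proof -
    have "continuous_on ((UNIV \<times> {-R<..<R}) \<times> cbox (x0-t) (x0+t)) (\<lambda>(z, x). (v (fst z) c2 (x, snd z) - v (fst z) c1 (x, snd z)) * bump x0 t x)"
      unfolding case_prod_unfold
      by (intro continuous_on_mult continuous_on_diff continuous_on_uv(1) continuous_on_compose2[OF B(9)[of UNIV]])
        (auto intro!: continuous_intros simp: abs_less_iff)
    from integral_continuous_on_param[OF this] show ?thesis by (simp add: M_def)
  qed
  have jM1: "continuous_on (UNIV \<times> {-R<..<R}) (\<lambda>z. M1 (fst z) (snd z))"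
  proof -
    have "continuous_on ((UNIV \<times> {-R<..<R}) \<times> cbox (x0-t) (x0+t)) (\<lambda>(z, x). (u (fst z) c2 (x, snd z) - u (fst z) c1 (x, snd z)) * bump_deriv x0 t x)"
      unfolding case_prod_unfold
      by (intro continuous_on_mult continuous_on_diff continuous_on_uv(2) continuous_on_compose2[OF B(10)[of UNIV]])
        (auto intro!: continuous_intros simp: abs_less_iff)
    from continuous_on_minus[OF integral_continuous_on_param[OF this]] show ?thesis by (simp add: M1_def)
  qed
  have ca: "continuous_on UNIV (\<lambda>a. f a y)" if "continuous_on (UNIV \<times> {-R<..<R}) (\<lambda>z. f (fst z) (snd z))" "\<bar>y\<bar> < R" for f :: "real \<Rightarrow> real \<Rightarrow> real" and y
  proof -
    have "continuous_on UNIV (\<lambda>a. (\<lambda>z. f (fst z) (snd z)) (a, y))"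
      by (rule continuous_on_Pair_compose[OF that(1)]) (use that(2) in \<open>auto intro!: continuous_intros\<close>)
    then show ?thesis by simp
  qed
  have cy: "continuous_on {-R<..<R} (f a)" if "continuous_on (UNIV \<times> {-R<..<R}) (\<lambda>z. f (fst z) (snd z))" for f :: "real \<Rightarrow> real \<Rightarrow> real" and a
  proof -
    have "continuous_on {-R<..<R} (\<lambda>y. (\<lambda>z. f (fst z) (snd z)) (a, y))"
      by (rule continuous_on_Pair_compose[OF that(1)]) (auto intro!: continuous_intros)
    then show ?thesis by simp
  qed
  have ci: "continuous_on UNIV (\<lambda>a. integral {y1..y2} (\<lambda>s. g s * f a s))"
    if "continuous_on (UNIV \<times> {-R<..<R}) (\<lambda>z. f (fst z) (snd z))" "-R < y1" "y2 < R" "continuous_on {y1..y2} g"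
    for f :: "real \<Rightarrow> real \<Rightarrow> real" and g y1 y2
  proof -
    have "continuous_on (UNIV \<times> {y1..y2}) (\<lambda>z. f (fst z) (snd z))"
      by (rule continuous_on_subset[OF that(1)]) (use that(2,3) in auto)
    moreover have "continuous_on (UNIV \<times> {y1..y2}) (\<lambda>z. g (snd z))"
      by (rule continuous_on_compose2[OF that(4)]) (auto intro!: continuous_intros)
    ultimately have "continuous_on (UNIV \<times> {y1..y2}) (\<lambda>z. g (snd z) * f (fst z) (snd z))"
      by (intro continuous_intros)
    from continuous_on_integral_snd[OF this] show ?thesis by simp
  qed
  have nonzero: "M a y2 - M a y1 = integral {y1..y2} (M1 a)"
      "0 \<notin> {y1..y2} \<Longrightarrow> M1 a y2 - M1 a y1 \<le> integral {y1..y2} (\<lambda>s. c0 / \<bar>s\<bar> * M a s)"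
    if a: "a \<noteq> 0" and y: "-R < y1" "y1 \<le> y2" "y2 < R" for a y1 y2
  proof -
    obtain p q r s where S1: "sol2 R a (u a c1) (v a c1) p q r s" using psol_uv[OF a, of c1] by (auto simp: psol_def)
    obtain p' q' r' s' where S2: "sol2 R a (u a c2) (v a c2) p' q' r' s'" using psol_uv[OF a, of c2] by (auto simp: psol_def)
    have le: "v a c1 (x, y) \<le> v a c2 (x, y)" if "\<bar>y\<bar> < R" for x y by (rule v_mono[OF c(2) that])
    note G = difference_average_growth[OF sol2_sol1[OF S1] sol2_sol1[OF S2] a t(1) le y, of x0]
    show "M a y2 - M a y1 = integral {y1..y2} (M1 a)" using G(1) by (simp add: M_def[abs_def] M1_def[abs_def])
    show "M1 a y2 - M1 a y1 \<le> integral {y1..y2} (\<lambda>s. c0 / \<bar>s\<bar> * M a s)" if "0 \<notin> {y1..y2}"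
      using G(2)[OF _ that] by (simp add: M_def[abs_def] M1_def[abs_def] c0_def)
  qed
  have ftc: "M a y2 - M a y1 = integral {y1..y2} (M1 a)" if y: "-R < y1" "y1 \<le> y2" "y2 < R" for y1 y2
  proof (cases "a = 0")
    case True
    have ab: "\<bar>y1\<bar> < R" "\<bar>y2\<bar> < R" using y by auto
    have cF: "continuous_on UNIV (\<lambda>a. M a y2 - M a y1)" by (intro continuous_intros ca[OF jM] ab)
    have cG: "continuous_on UNIV (\<lambda>a. integral {y1..y2} (M1 a))" using ci[OF jM1 y(1,3), of "\<lambda>_. 1"] by simp
    have "(\<lambda>a. M a y2 - M a y1) 0 \<le> (\<lambda>a. integral {y1..y2} (M1 a)) 0"
      by (rule le_at_zero[OF cF cG, of 1]) (use nonzero(1)[OF _ y] in auto)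
    moreover have "(\<lambda>a. integral {y1..y2} (M1 a)) 0 \<le> (\<lambda>a. M a y2 - M a y1) 0"
      by (rule le_at_zero[OF cG cF, of 1]) (use nonzero(1)[OF _ y] in auto)
    ultimately show ?thesis using True by simp
  qed (use nonzero(1)[OF _ y] in auto)
  have growth: "M1 a y2 - M1 a y1 \<le> integral {y1..y2} (\<lambda>s. c0 / \<bar>s\<bar> * M a s)"
    if y: "-R < y1" "y1 \<le> y2" "y2 < R" and nz: "0 \<notin> {y1..y2}" for y1 y2
  proof (cases "a = 0")
    case True
    have ab: "\<bar>y1\<bar> < R" "\<bar>y2\<bar> < R" using y by auto
    have cF: "continuous_on UNIV (\<lambda>a. M1 a y2 - M1 a y1)" by (intro continuous_intros ca[OF jM1] ab)
    have cg: "continuous_on {y1..y2} (\<lambda>s. c0 / \<bar>s\<bar>)" using nz by (intro continuous_intros) auto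
    have cG: "continuous_on UNIV (\<lambda>a. integral {y1..y2} (\<lambda>s. c0 / \<bar>s\<bar> * M a s))" by (rule ci[OF jM y(1,3) cg])
    have "(\<lambda>a. M1 a y2 - M1 a y1) 0 \<le> (\<lambda>a. integral {y1..y2} (\<lambda>s. c0 / \<bar>s\<bar> * M a s)) 0"
      by (rule le_at_zero[OF cF cG, of 1]) (use nonzero(2)[OF _ y nz] in auto)
    then show ?thesis using True by simp
  qed (use nonzero(2)[OF _ y nz] in auto)
  have nn: "0 \<le> M a y" if y: "\<bar>y\<bar> < R" for y
    unfolding M_def
  proof (rule Henstock_Kurzweil_Integration.integral_nonneg)
    have cl: "continuous_on {x0-t..x0+t} (\<lambda>x. v a c (x, y))" for c
      by (rule continuous_on_uv(1)) (use y in \<open>auto intro!: continuous_intros\<close>)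
    show "(\<lambda>x. (v a c2 (x, y) - v a c1 (x, y)) * bump x0 t x) integrable_on {x0-t..x0+t}"
      by (intro integrable_continuous_real continuous_intros cl B)
    show "0 \<le> (v a c2 (x, y) - v a c1 (x, y)) * bump x0 t x" for x
      using v_mono[OF c(2) y, of a x] B(3)[of x] by simp
  qed
  have My0: "M a y0 = 0"
  proof -
    have "M a y0 = integral {x0-t..x0+t} (\<lambda>x. 0)" unfolding M_def by (rule integral_cong) (simp add: seg)
    then show ?thesis by simp
  qed
  have Mz: "M a y = 0" if "\<bar>y\<bar> < R" for y
    by (rule degenerate_gronwall[OF cy[OF jM] cy[OF jM1] nn ftc growth c0 y0 My0 that])
  \<comment> \<open>The average vanishes only in the open strip so far. Continuity up to the edge
    carries this to \<open>y = R\<close>, where the average is that of a strictly positive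
    difference of data.\<close>
  have cMc: "continuous_on {-R..R} (M a)"
  proof -
    have cs: "continuous_on ({x0-t..x0+t} \<times> {-R..R}) (v a c)" for c
      by (rule continuous_on_subset[OF continuous_strip(2)]) (auto simp: strip_def)
    have "continuous_on ({x0-t..x0+t} \<times> {-R..R}) (\<lambda>z. (v a c2 z - v a c1 z) * bump x0 t (fst z))"
      by (intro continuous_on_mult continuous_on_diff cs continuous_on_compose2[OF B(9)[of UNIV]]) (auto intro!: continuous_intros)
    from continuous_on_integral_fst[OF this] show ?thesis by (simp add: M_def[abs_def])
  qed
  have "M a R = 0"
  proof -
    have cl: "closure {-R<..<R} = {-R..R}" using R_pos by (simp add: closure_greaterThanLessThan)
    have "continuous_on (closure {-R<..<R}) (M a)" using cMc cl by simp
    moreover have "M a y = 0" if "y \<in> {-R<..<R}" for y using Mz[of y] that by auto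
    moreover have "R \<in> closure {-R<..<R}" using cl R_pos by simp
    ultimately show ?thesis by (rule continuous_constant_on_closure)
  qed
  then have z: "integral {x0-t..x0+t} (\<lambda>x. (\<phi>p a c2 x - \<phi>p a c1 x) * bump x0 t x) = 0" by (simp add: M_def v_edge)
  have cp: "continuous_on {x0-t..x0+t} (\<lambda>x. (\<phi>p a c2 x - \<phi>p a c1 x) * bump x0 t x)"
    by (intro continuous_intros B continuous_on_subset[OF phi_continuous(1)]) auto
  have np: "0 \<le> (\<phi>p a c2 x - \<phi>p a c1 x) * bump x0 t x" for x
    using mono[OF c(2), of a x] B(3)[of x] by simp
  have "(\<phi>p a c2 x0 - \<phi>p a c1 x0) * bump x0 t x0 = 0"
    using integral_eq_0_iff[OF cp _ np] z t by simp
  then show False using B(12) mono[OF c(2), of a x0] by simp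
qed

text \<open>The margin 1 leaves room to move \<open>a\<close> off 0: at nearby nonzero
  \<open>a\<close> the data still satisfy the strict inequality that the comparison with constants
  requires.\<close>

lemma v_between_all:
  assumes y: "\<bar>y\<bar> < R"
  shows "(\<And>x. c + 1 \<le> \<phi>p a b x \<and> c + 1 \<le> \<phi>m a b x) \<Longrightarrow> c \<le> v a b (x, y)"
    and "(\<And>x. \<phi>p a b x \<le> c - 1 \<and> \<phi>m a b x \<le> c - 1) \<Longrightarrow> v a b (x, y) \<le> c"
proof -
  have cv: "continuous_on UNIV (\<lambda>a. v a b (x, y))"
    by (rule continuous_on_uv(1)) (use y in \<open>auto intro!: continuous_intros\<close>)
  obtain d where d: "d > 0" "\<And>a' x. \<bar>a'\<bar> < d \<Longrightarrow> \<bar>\<phi>p a' b x - \<phi>p 0 b x\<bar> < 1 \<and> \<bar>\<phi>m a' b x - \<phi>m 0 b x\<bar> < 1"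
    using phi_close[of 1 0 b] by auto
  show "c \<le> v a b (x, y)" if H: "\<And>x. c + 1 \<le> \<phi>p a b x \<and> c + 1 \<le> \<phi>m a b x"
  proof (cases "a = 0")
    case True
    have "(\<lambda>_. c) 0 \<le> (\<lambda>a. v a b (x, y)) 0"
    proof (rule le_at_zero[OF continuous_on_const cv d(1)])
      fix a' assume a': "0 < a'" "a' < d"
      show "c \<le> v a' b (x, y)"
      proof (rule v_between(2)[OF _ y])
        fix x show "c < \<phi>p a' b x \<and> c < \<phi>m a' b x" using d(2)[of a' x] H[of x] a' True by auto
      qed (use a' in simp)
    qed
    then show ?thesis using True by simp
  next
    case False
    show ?thesis
    proof (rule v_between(2)[OF False y])
      fix x show "c < \<phi>p a b x \<and> c < \<phi>m a b x" using H[of x] by auto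
    qed
  qed
  show "v a b (x, y) \<le> c" if H: "\<And>x. \<phi>p a b x \<le> c - 1 \<and> \<phi>m a b x \<le> c - 1"
  proof (cases "a = 0")
    case True
    have "(\<lambda>a. v a b (x, y)) 0 \<le> (\<lambda>_. c) 0"
    proof (rule le_at_zero[OF cv continuous_on_const d(1)])
      fix a' assume a': "0 < a'" "a' < d"
      show "v a' b (x, y) \<le> c"
      proof (rule v_between(1)[OF _ y])
        fix x show "\<phi>p a' b x < c \<and> \<phi>m a' b x < c" using d(2)[of a' x] H[of x] a' True by auto
      qed (use a' in simp)
    qed
    then show ?thesis using True by simp
  next
    case False
    show ?thesis
    proof (rule v_between(1)[OF False y])
      fix x show "\<phi>p a b x < c \<and> \<phi>m a b x < c" using H[of x] by auto
    qed
  qed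
qed

lemma v_attains:
  assumes y: "\<bar>y\<bar> < R" shows "\<exists>b. v a b (x, y) = t"
proof -
  have "\<exists>b0. \<forall>b\<ge>b0. \<forall>x. t + 1 < \<phi>p a b x"
    by (rule uniformly_large[OF P_pos]) (use per mono lim_p phi_continuous in auto)
  then obtain B1 where B1: "\<And>b x. B1 \<le> b \<Longrightarrow> t + 1 < \<phi>p a b x" by blast
  have "\<exists>b0. \<forall>b\<ge>b0. \<forall>x. t + 1 < \<phi>m a b x"
    by (rule uniformly_large[OF P_pos]) (use per mono lim_m phi_continuous in auto)
  then obtain B2 where B2: "\<And>b x. B2 \<le> b \<Longrightarrow> t + 1 < \<phi>m a b x" by blast
  \<comment> \<open>Reflecting both \<open>b\<close> and the values reduces the limit at minus
    infinity to \<open>uniformly_large\<close>.\<close>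
  have flip: "filterlim (\<lambda>b. - f (- b)) at_top at_top" if "filterlim f at_bot at_bot" for f :: "real \<Rightarrow> real"
    using filterlim_compose[OF filterlim_uminus_at_top_at_bot filterlim_compose[OF that filterlim_uminus_at_bot_at_top]] .
  have "\<exists>b0. \<forall>b\<ge>b0. \<forall>x. - t + 1 < - \<phi>p a (- b) x"
    by (rule uniformly_large[OF P_pos]) (use per mono lim_p flip[of "\<lambda>b. \<phi>p a b x" for x] in
        \<open>auto intro!: continuous_on_minus phi_continuous\<close>)
  then obtain B3 where B3: "\<And>b x. B3 \<le> b \<Longrightarrow> - t + 1 < - \<phi>p a (- b) x" by blast
  have "\<exists>b0. \<forall>b\<ge>b0. \<forall>x. - t + 1 < - \<phi>m a (- b) x"
    by (rule uniformly_large[OF P_pos]) (use per mono lim_m flip[of "\<lambda>b. \<phi>m a b x" for x] in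
        \<open>auto intro!: continuous_on_minus phi_continuous\<close>)
  then obtain B4 where B4: "\<And>b x. B4 \<le> b \<Longrightarrow> - t + 1 < - \<phi>m a (- b) x" by blast
  define bh where "bh = max B1 B2"
  define bl where "bl = - max B3 B4"
  have hi: "t \<le> v a bh (x, y)"
    by (rule v_between_all(1)[OF y]) (use B1[of bh] B2[of bh] in \<open>auto simp: bh_def less_imp_le\<close>)
  have "\<phi>p a bl x' \<le> t - 1 \<and> \<phi>m a bl x' \<le> t - 1" for x'
    using B3[of "max B3 B4" x'] B4[of "max B3 B4" x'] by (simp add: bl_def)
  then have lo: "v a bl (x, y) \<le> t" by (rule v_between_all(2)[OF y])
  have c: "continuous_on UNIV (\<lambda>b. v a b (x, y))"
    by (rule continuous_on_uv(1)) (use y in \<open>auto intro!: continuous_intros\<close>)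
  show ?thesis
  proof (cases "bl \<le> bh")
    case True
    then show ?thesis
      using IVT'[of "\<lambda>b. v a b (x, y)" bl t bh, OF lo hi True] continuous_on_subset[OF c] by blast
  next
    case False
    then have "v a bh (x, y) < v a bl (x, y)" by (intro v_strict_mono y) auto
    then show ?thesis using hi lo by linarith
  qed
qed

end

section \<open>The fibration\<close>

text \<open>The two conditions force the squared moduli to be \<open>D + a\<close> and
  \<open>D - a\<close>, with product \<open>D^2 - a^2 = |w|^2\<close>. One takes the first number
  real and positive; this fails only if \<open>D + a = 0\<close>, when \<open>w = 0\<close> and
  \<open>a \<le> 0\<close>. The lemma yields points in every fibre, hence surjectivity.\<close>

lemma exists_moment_product:
  fixes a :: real and w :: complex
  shows "\<exists>z1 z2. (cmod z1)\<^sup>2 - (cmod z2)\<^sup>2 = 2 * a \<and> z1 * z2 = w"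
proof -
  define D where "D = sqrt (a\<^sup>2 + (cmod w)\<^sup>2)"
  have D2: "D\<^sup>2 = a\<^sup>2 + (cmod w)\<^sup>2" by (simp add: D_def)
  have Da: "\<bar>a\<bar> \<le> D" unfolding D_def by (rule real_le_rsqrt) simp
  show ?thesis
  proof (cases "a + D = 0")
    case True
    then have "D = - a" by simp
    then have "D\<^sup>2 = a\<^sup>2" by simp
    then have w: "w = 0" using D2 by simp
    have "a \<le> 0" using True Da by linarith
    then have "(sqrt (- 2 * a))\<^sup>2 = - 2 * a" by simp
    then show ?thesis using w by (intro exI[of _ 0] exI[of _ "complex_of_real (sqrt (- 2 * a))"]) simp
  next
    case False
    then have s: "0 < a + D" using Da by linarith
    define \<rho> where "\<rho> = sqrt (a + D)"
    have \<rho>: "0 < \<rho>" "\<rho>\<^sup>2 = a + D" using s by (auto simp: \<rho>_def)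
    have "(cmod w)\<^sup>2 = (D - a) * (a + D)" using D2 by (simp add: algebra_simps power2_eq_square)
    then have "(cmod w)\<^sup>2 / \<rho>\<^sup>2 = D - a" using s \<rho> by simp
    then have "(cmod (of_real \<rho>))\<^sup>2 - (cmod (w / of_real \<rho>))\<^sup>2 = 2 * a"
      using \<rho> by (simp add: norm_divide power_divide)
    moreover have "of_real \<rho> * (w / of_real \<rho>) = w" using \<rho> by simp
    ultimately show ?thesis by blast
  qed
qed

context sl_family begin

definition level :: "real \<Rightarrow> real \<Rightarrow> real \<Rightarrow> real \<Rightarrow> real" where
  "level a x y t = (THE b. v a b (x, y) = t)"

lemma v_injective: "\<bar>y\<bar> < R \<Longrightarrow> v a b (x, y) = v a b' (x, y) \<Longrightarrow> b = b'"
  using v_strict_mono[of b b' y a x] v_strict_mono[of b' b y a x] by (cases b b' rule: linorder_cases) auto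

lemma level_v: "\<bar>y\<bar> < R \<Longrightarrow> level a x y (v a b (x, y)) = b"
  unfolding level_def by (rule the_equality) (auto dest: v_injective)

lemma v_level: "\<bar>y\<bar> < R \<Longrightarrow> v a (level a x y t) (x, y) = t"
  using v_attains[of y a x t] level_v by metis

lemma level_periodic: "\<bar>y\<bar> < R \<Longrightarrow> level a (x + of_int n * P) y t = level a x y t"
  unfolding level_def using periodic_int_multiple[of "\<lambda>x. v a b (x, y)" P for b] periodic_uv[of y] by simp

text \<open>The implicit function theorem for a strictly increasing function: at
  \<open>b - e\<close> and \<open>b + e\<close> the value of \<open>v\<close> lies strictly on
  either side of the target, this persists nearby by joint continuity, and monotonicity traps the
  solution in between.\<close>

lemma continuous_on_level:
  fixes A X Y T :: "'z::topological_space \<Rightarrow> real"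
  assumes c: "continuous_on S A" "continuous_on S X" "continuous_on S Y" "continuous_on S T"
    and Y: "\<And>z. z \<in> S \<Longrightarrow> \<bar>Y z\<bar> < R"
  shows "continuous_on S (\<lambda>z. level (A z) (X z) (Y z) (T z))"
  unfolding continuous_on_def
proof (intro ballI tendstoI)
  fix z0 and e :: real assume z0: "z0 \<in> S" and e: "0 < e"
  define b where "b = level (A z0) (X z0) (Y z0) (T z0)"
  have vb: "v (A z0) b (X z0, Y z0) = T z0" unfolding b_def by (rule v_level[OF Y[OF z0]])
  have cb: "continuous_on S (\<lambda>z. v (A z) b' (X z, Y z) - T z)" for b'
    by (intro continuous_intros continuous_on_uv(1) c Y)
  have t: "((\<lambda>z. v (A z) b' (X z, Y z) - T z) \<longlongrightarrow> v (A z0) b' (X z0, Y z0) - T z0) (at z0 within S)" for b'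
    using cb[of b'] z0 unfolding continuous_on_def by blast
  have "v (A z0) (b - e) (X z0, Y z0) - T z0 < 0" "0 < v (A z0) (b + e) (X z0, Y z0) - T z0"
    using v_strict_mono[of "b - e" b "Y z0" "A z0" "X z0"] v_strict_mono[of b "b + e" "Y z0" "A z0" "X z0"] e Y[OF z0] vb by auto
  then have "\<forall>\<^sub>F z in at z0 within S. v (A z) (b - e) (X z, Y z) - T z < 0"
    "\<forall>\<^sub>F z in at z0 within S. 0 < v (A z) (b + e) (X z, Y z) - T z"
    using order_tendstoD[OF t] by blast+
  moreover have "\<forall>\<^sub>F z in at z0 within S. z \<in> S" by (simp add: eventually_at_filter)
  ultimately show "\<forall>\<^sub>F z in at z0 within S. dist (level (A z) (X z) (Y z) (T z)) (level (A z0) (X z0) (Y z0) (T z0)) < e"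
  proof eventually_elim
    case (elim z)
    define b' where "b' = level (A z) (X z) (Y z) (T z)"
    have vb': "v (A z) b' (X z, Y z) = T z" unfolding b'_def by (rule v_level[OF Y[OF elim(3)]])
    have "b - e < b'"
    proof (rule ccontr)
      assume "\<not> b - e < b'"
      then have "b' = b - e \<or> b' < b - e" by linarith
      then show False using v_strict_mono[of b' "b - e" "Y z" "A z" "X z"] Y[OF elim(3)] elim(1) vb' by auto
    qed
    moreover have "b' < b + e"
    proof (rule ccontr)
      assume "\<not> b' < b + e"
      then have "b' = b + e \<or> b + e < b'" by linarith
      then show False using v_strict_mono[of "b + e" b' "Y z" "A z" "X z"] Y[OF elim(3)] elim(2) vb' by auto
    qed
    ultimately show ?case by (simp add: dist_real_def b_def[symmetric] b'_def[symmetric] abs_less_iff)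
  qed
qed

section \<open>The map and its fibres\<close>

definition mom :: "complex \<times> complex \<times> complex \<Rightarrow> real" where
  "mom z = ((cmod (fst z))\<^sup>2 - (cmod (fst (snd z)))\<^sup>2) / 2"

definition lev :: "complex \<times> complex \<times> complex \<Rightarrow> real" where
  "lev z = level (mom z) (Re (snd (snd z))) (Im (fst z * fst (snd z))) (Re (fst z * fst (snd z)))"

definition fib :: "complex \<times> complex \<times> complex \<Rightarrow> real \<times> real \<times> real" where
  "fib z = (mom z, lev z, Im (snd (snd z)) - u (mom z) (lev z) (Re (snd (snd z)), Im (fst z * fst (snd z))))"

lemma continuous_on_fib: "continuous_on (V_lift R) fib"
proof -
  have Y: "\<bar>Im (fst z * fst (snd z))\<bar> < R" if "z \<in> V_lift R" for z
    using that by (auto simp: V_lift_def case_prod_unfold)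
  have cm: "continuous_on (V_lift R) mom" unfolding mom_def by (intro continuous_intros) auto
  have cl: "continuous_on (V_lift R) lev"
    unfolding lev_def by (intro continuous_on_level cm Y continuous_intros)
  show ?thesis
    unfolding fib_def by (intro continuous_on_Pair continuous_on_diff continuous_on_uv(2) cm cl Y continuous_intros)
qed

lemma fib_shift:
  assumes "z \<in> V_lift R" shows "fib (Zshift P n z) = fib z"
proof -
  have Y: "\<bar>Im (fst z * fst (snd z))\<bar> < R" using assms by (auto simp: V_lift_def case_prod_unfold)
  have [simp]: "fst (Zshift P n z) = fst z" "fst (snd (Zshift P n z)) = fst (snd z)"
    "Re (snd (snd (Zshift P n z))) = Re (snd (snd z)) + of_int n * P" "Im (snd (snd (Zshift P n z))) = Im (snd (snd z))"
    by (simp_all add: Zshift_def)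
  have m: "mom (Zshift P n z) = mom z" by (simp add: mom_def)
  have l: "lev (Zshift P n z) = lev z" unfolding lev_def m using level_periodic[OF Y] by simp
  have "u a b (x + of_int n * P, Im (fst z * fst (snd z))) = u a b (x, Im (fst z * fst (snd z)))" for a b x
    by (rule periodic_int_multiple[of "\<lambda>x. u a b (x, Im (fst z * fst (snd z)))"]) (use periodic_uv Y in auto)
  then show ?thesis unfolding fib_def m l by simp
qed

lemma fiber_eq: "{z \<in> V_lift R. fib z = (a, b, c)} = N_lift R (u a b) (v a b) a c"
proof (intro equalityI subsetI)
  fix z assume "z \<in> {z \<in> V_lift R. fib z = (a, b, c)}"
  then have zV: "z \<in> V_lift R" and f: "fib z = (a, b, c)" by auto
  obtain z1 z2 z3 where z: "z = (z1, z2, z3)" by (cases z)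
  have Y: "\<bar>Im (z1 * z2)\<bar> < R" using zV by (simp add: z V_lift_def)
  have ab: "mom z = a" "lev z = b" "Im z3 - u a b (Re z3, Im (z1 * z2)) = c" using f by (auto simp: fib_def z)
  have "v a b (Re z3, Im (z1 * z2)) = Re (z1 * z2)"
    using v_level[OF Y, of a "Re z3" "Re (z1 * z2)"] ab by (simp add: lev_def z)
  moreover have "(cmod z1)\<^sup>2 - (cmod z2)\<^sup>2 = 2 * a" using ab(1) by (simp add: mom_def z)
  ultimately show "z \<in> N_lift R (u a b) (v a b) a c"
    unfolding N_lift_def z using Y ab(3)
    by (auto simp: abs_less_iff complex_eq_iff intro!: exI[of _ "Re z3"] exI[of _ "Im (z1 * z2)"])
next
  fix z assume zN: "z \<in> N_lift R (u a b) (v a b) a c"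
  obtain z1 z2 z3 where z: "z = (z1, z2, z3)" by (cases z)
  obtain x y where m: "(cmod z1)\<^sup>2 - (cmod z2)\<^sup>2 = 2 * a" and y: "-R < y" "y < R"
    and p: "z1 * z2 = complex_of_real (v a b (x, y)) + \<i> * complex_of_real y"
    and z3: "z3 = complex_of_real x + \<i> * complex_of_real (u a b (x, y)) + \<i> * complex_of_real c"
    using zN unfolding N_lift_def z by blast
  have re: "Re (z1 * z2) = v a b (x, y)" "Im (z1 * z2) = y" "Re z3 = x" "Im z3 = u a b (x, y) + c"
    unfolding p z3 by simp_all
  have yR: "\<bar>y\<bar> < R" using y by (simp add: abs_less_iff)
  have ma: "mom (z1, z2, z3) = a" using m by (simp add: mom_def)
  have lb: "lev (z1, z2, z3) = b" unfolding lev_def ma fst_conv snd_conv re by (rule level_v[OF yR])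
  have "fib z = (a, b, c)" unfolding z fib_def ma lb fst_conv snd_conv re by simp
  moreover have "z \<in> V_lift R" unfolding V_lift_def z using re(2) yR by simp
  ultimately show "z \<in> {z \<in> V_lift R. fib z = (a, b, c)}" by simp
qed

lemma fiber_nonempty: "N_lift R (u a b) (v a b) a c \<noteq> {}"
proof -
  obtain z1 z2 where z: "(cmod z1)\<^sup>2 - (cmod z2)\<^sup>2 = 2 * a" "z1 * z2 = complex_of_real (v a b (0, 0)) + \<i> * complex_of_real 0"
    using exists_moment_product by blast
  then have "(z1, z2, complex_of_real 0 + \<i> * complex_of_real (u a b (0, 0)) + \<i> * complex_of_real c) \<in> N_lift R (u a b) (v a b) a c"
    unfolding N_lift_def using R_pos by force
  then show ?thesis by blast
qed

end

theorem theorem7p5: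
  fixes R P \<alpha> :: real
    and \<phi>p \<phi>m :: "real \<Rightarrow> real \<Rightarrow> real \<Rightarrow> real"
    and u v :: "real \<Rightarrow> real \<Rightarrow> real \<times> real \<Rightarrow> real"
  assumes R_pos: "R > 0" and P_pos: "P > 0"
    and alpha: "0 < \<alpha>" "\<alpha> < 1"
    and reg: "\<And>a b. C3a \<alpha> (\<phi>p a b) \<and> C3a \<alpha> (\<phi>m a b)"
    and cont_p: "\<And>a b e. e > 0 \<Longrightarrow> \<exists>d>0. \<forall>a' b'. dist (a', b') (a, b) < d \<longrightarrow>
                   c3a_norm \<alpha> (\<lambda>x. \<phi>p a' b' x - \<phi>p a b x) < e"
    and cont_m: "\<And>a b e. e > 0 \<Longrightarrow> \<exists>d>0. \<forall>a' b'. dist (a', b') (a, b) < d \<longrightarrow>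
                   c3a_norm \<alpha> (\<lambda>x. \<phi>m a' b' x - \<phi>m a b x) < e"
    and per: "\<And>a b x. \<phi>p a b (x + P) = \<phi>p a b x \<and> \<phi>m a b (x + P) = \<phi>m a b x"
    and int_eq: "\<And>a b. integral {0..P} (\<phi>p a b) = integral {0..P} (\<phi>m a b)"
    and mono: "\<And>a b b' x. b < b' \<Longrightarrow> \<phi>p a b x < \<phi>p a b' x \<and> \<phi>m a b x < \<phi>m a b' x"
    and lim_p: "\<And>a x. filterlim (\<lambda>b. \<phi>p a b x) at_top at_top \<and>
                        filterlim (\<lambda>b. \<phi>p a b x) at_bot at_bot"
    and lim_m: "\<And>a x. filterlim (\<lambda>b. \<phi>m a b x) at_top at_top \<and>
                        filterlim (\<lambda>b. \<phi>m a b x) at_bot at_bot"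
    and sol: "\<And>a b. assoc_sol R P \<alpha> a (\<phi>p a b) (\<phi>m a b) (u a b) (v a b)"
  shows "(\<forall>a b c a' b' c'.
            N_lift R (u a b) (v a b) a c \<noteq> N_lift R (u a' b') (v a' b') a' c' \<longrightarrow>
            N_lift R (u a b) (v a b) a c \<inter> N_lift R (u a' b') (v a' b') a' c' = {}) \<and>
         (\<exists>F :: complex \<times> complex \<times> complex \<Rightarrow> real \<times> real \<times> real.
            continuous_on (V_lift R) F \<and>
            (\<forall>z\<in>V_lift R. \<forall>n. F (Zshift P n z) = F z) \<and>
            F ` V_lift R = UNIV \<and>
            (\<forall>a b c. {z \<in> V_lift R. F z = (a, b, c)} = N_lift R (u a b) (v a b) a c))"
proof -
  interpret sl_family R P \<alpha> \<phi>p \<phi>m u v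
    by unfold_locales (fact R_pos P_pos reg cont_p cont_m per mono lim_p lim_m sol)+
  \<comment> \<open>Fibres of one map: a common point forces the same value
    \<open>(a, b, c)\<close>, hence the same set.\<close>
  have disjoint: "N_lift R (u a b) (v a b) a c \<inter> N_lift R (u a' b') (v a' b') a' c' = {}"
    if "N_lift R (u a b) (v a b) a c \<noteq> N_lift R (u a' b') (v a' b') a' c'" for a b c a' b' c'
    using that unfolding fiber_eq[symmetric] by auto
  have "(a, b, c) \<in> fib ` V_lift R" for a b c
    using fiber_nonempty[of a b c] unfolding fiber_eq[symmetric] by (auto simp: image_iff intro: sym)
  then have surj: "fib ` V_lift R = UNIV" by auto
  show ?thesis
    using disjoint continuous_on_fib fib_shift surj fiber_eq by blast
qed

end
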